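(* Let $k,\theta,\sigma>0$, $r\in\mathbb R$, $\rho\in[-1,1]$, $h>0$, and let $X_t\in\mathbb R$, $V_t\ge 0$ be given. Consider the Heston model $$dX_t=\left(r-\tfrac{V_t}{2}\right)dt+\sqrt{V_t}\left(\rho\,dW_t+\sqrt{1-\rho^2}\,dW_t^{\perp}\right),\qquad dV_t=k(\theta-V_t)\,dt+\sigma\sqrt{V_t}\,dW_t,$$ with $W,W^\perp$ independent Brownian motions, split into the two systems $$\text{(1)}\quad dX^{(1)}_t=\left(r-\tfrac{V^{(1)}_t}{2}\right)dt+\sqrt{1-\rho^2}\sqrt{V^{(1)}_t}\,dW^\perp_t,\qquad dV^{(1)}_t=k(\theta-V_t^{(1)})\,dt,$$ $$\text{(2)}\quad dX^{(2)}_t=\rho\sqrt{V^{(2)}_t}\,dW_t,\qquad dV^{(2)}_t=\sigma\sqrt{V^{(2)}_t}\,dW_t .$$ Let $(X^{\mathrm{split}}_{t+h},V^{\mathrm{split}}_{t+h})$ be the result of one step of the second-order (Strang) operator splitting scheme started from $(X_t,V_t)$: evolve by system (1) for time $h/2$, then by system (2) for time $h$, then by system (1) for time $h/2$. Then, in distribution given $(X_t,V_t)$, $$X^{\mathrm{split}}_{t+h}=X_t+rh-\tfrac12 I^{\mathrm{split},h}_t+\tfrac{\rho}{\sigma}\left(\hat V^{(2)}_{t+h}-\tilde V^{(1)}_{t+h/2}\right)+N\!\left(0,(1-\rho^2)I_t^{\mathrm{split},h}\right),$$ $$V^{\mathrm{split}}_{t+h}=e^{-kh/2}\left(\hat V^{(2)}_{t+h}-\theta\right)+\theta,$$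 where $\tilde V^{(1)}_{t+h/2}=e^{-kh/2}(V_t-\theta)+\theta$, $\hat V^{(2)}_{t+h}\sim CIR(0,0,\sigma,h,\tilde V^{(1)}_{t+h/2})$, and $$I_t^{\mathrm{split},h}=\theta h+\frac{V_t+\hat V^{(2)}_{t+h}-2\theta}{k}\left(1-e^{-kh/2}\right).$$
   Context: $CIR(\alpha,\beta,\sigma,h,v)$ denotes (the law of) the value at time $h$ of the solution of $dV_t=(\alpha-\beta V_t)\,dt+\sigma\sqrt{V_t}\,dW_t$, $V_0=v\ge0$. $N(0,s)$ denotes a normal random variable with mean $0$ and variance $s$; when $s$ is random it is, conditionally on $\hat V^{(2)}_{t+h}$, normal with that variance. In the splitting scheme the three successive evolutions use mutually independent Brownian increments, the output of each evolution being the initial state for the next one. *)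

theory Defs
  imports "HOL-Probability.Probability"
begin

text \<open>The time index of a filtration has type \<^typ>\<open>real\<close>; only nonnegative times are ever used.\<close>

definition filtered_prob_space :: "'a measure \<Rightarrow> (real \<Rightarrow> 'a measure) \<Rightarrow> bool" where
  "filtered_prob_space M F \<longleftrightarrow>
     prob_space M \<and> filtration (space M) F \<and> (\<forall>t. subalgebra M (F t))"

text \<open>
  Standard Brownian motion relative to the filtration \<open>F\<close>, with values in a Euclidean space: the
  coordinates of an increment are independent centred normal variables of variance \<open>t - s\<close>, and the
  increment is independent of \<open>F s\<close>.
\<close>

definition brownian_motion ::
    "'a measure \<Rightarrow> (real \<Rightarrow> 'a measure) \<Rightarrow> (real \<Rightarrow> 'a \<Rightarrow> 'm::euclidean_space) \<Rightarrow> bool" where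
  "brownian_motion M F B \<longleftrightarrow>
     filtered_prob_space M F \<and>
     (\<forall>t\<ge>0. B t \<in> borel_measurable (F t)) \<and>
     (\<forall>\<omega>\<in>space M. continuous_on {0..} (\<lambda>t. B t \<omega>)) \<and>
     (AE \<omega> in M. B 0 \<omega> = 0) \<and>
     (\<forall>s t. 0 \<le> s \<and> s < t \<longrightarrow>
        prob_space.indep_set M (sets (F s))
          (sets (vimage_algebra (space M) (\<lambda>\<omega>. B t \<omega> - B s \<omega>) borel)) \<and>
        distributed M lborel (\<lambda>\<omega>. B t \<omega> - B s \<omega>)
          (\<lambda>x. ennreal (\<Prod>i\<in>Basis. normal_density 0 (sqrt (t - s)) (x \<bullet> i))))"

text \<open>
  A bounded elementary integrand on \<open>[0, T]\<close> is given by a partition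
  \<open>0 = \<tau> 0 \<le> \<dots> \<le> \<tau> N = T\<close> and bounded weights \<open>\<xi> i\<close>, where \<open>\<xi> i\<close> is \<open>F (\<tau> i)\<close>-measurable.
\<close>

definition elementary_integrand ::
    "'a measure \<Rightarrow> (real \<Rightarrow> 'a measure) \<Rightarrow> real \<Rightarrow> nat \<Rightarrow> (nat \<Rightarrow> real) \<Rightarrow> (nat \<Rightarrow> 'a \<Rightarrow> real) \<Rightarrow> bool" where
  "elementary_integrand M F T N \<tau> \<xi> \<longleftrightarrow>
     \<tau> 0 = 0 \<and> \<tau> N = T \<and> (\<forall>i<N. \<tau> i \<le> \<tau> (Suc i)) \<and>
     (\<forall>i<N. \<xi> i \<in> borel_measurable (F (\<tau> i)) \<and> (\<exists>C. \<forall>\<omega>\<in>space M. \<bar>\<xi> i \<omega>\<bar> \<le> C))"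

definition elementary_process ::
    "nat \<Rightarrow> (nat \<Rightarrow> real) \<Rightarrow> (nat \<Rightarrow> 'a \<Rightarrow> real) \<Rightarrow> real \<Rightarrow> 'a \<Rightarrow> real" where
  "elementary_process N \<tau> \<xi> s \<omega> = (\<Sum>i<N. \<xi> i \<omega> * indicator {\<tau> i<..\<tau> (Suc i)} s)"

definition elementary_integral ::
    "(real \<Rightarrow> 'a \<Rightarrow> real) \<Rightarrow> nat \<Rightarrow> (nat \<Rightarrow> real) \<Rightarrow> (nat \<Rightarrow> 'a \<Rightarrow> real) \<Rightarrow> 'a \<Rightarrow> real" where
  "elementary_integral W N \<tau> \<xi> \<omega> = (\<Sum>i<N. \<xi> i \<omega> * (W (\<tau> (Suc i)) \<omega> - W (\<tau> i) \<omega>))"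

text \<open>
  \<open>J\<close> is (a version of) \<open>\<integral>\<^sub>0\<^sup>T H dW\<close>: there are elementary integrands \<open>H\<^sub>n\<close> such that
  \<open>\<integral>\<^sub>0\<^sup>T (H\<^sub>n - H)\<^sup>2 ds\<close> tends to \<open>0\<close> and \<open>\<integral>\<^sub>0\<^sup>T H\<^sub>n dW\<close> tends to \<open>J\<close>, both in probability.
  The integrand is required to be progressively measurable.
\<close>

definition has_ito_integral ::
    "'a measure \<Rightarrow> (real \<Rightarrow> 'a measure) \<Rightarrow> (real \<Rightarrow> 'a \<Rightarrow> real) \<Rightarrow> (real \<Rightarrow> 'a \<Rightarrow> real) \<Rightarrow> real
      \<Rightarrow> ('a \<Rightarrow> real) \<Rightarrow> bool" where
  "has_ito_integral M F W H T J \<longleftrightarrow>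
     J \<in> borel_measurable M \<and>
     (\<forall>u\<in>{0..T}. (\<lambda>(s, \<omega>). H s \<omega>) \<in> borel_measurable (restrict_space borel {0..u} \<Otimes>\<^sub>M F u)) \<and>
     (\<exists>N \<tau> \<xi>. (\<forall>n. elementary_integrand M F T (N n) (\<tau> n) (\<xi> n)) \<and>
        (\<forall>\<epsilon>>0. (\<lambda>n. measure M {\<omega> \<in> space M. ennreal \<epsilon> <
            (\<integral>\<^sup>+ s\<in>{0..T}. ennreal ((elementary_process (N n) (\<tau> n) (\<xi> n) s \<omega> - H s \<omega>)\<^sup>2) \<partial>lborel)})
          \<longlonglongrightarrow> 0) \<and>
        (\<forall>\<epsilon>>0. (\<lambda>n. measure M {\<omega> \<in> space M.
            \<epsilon> < \<bar>elementary_integral W (N n) (\<tau> n) (\<xi> n) \<omega> - J \<omega>\<bar>}) \<longlonglongrightarrow> 0))"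

text \<open>
  \<open>X\<close> is a continuous adapted solution on \<open>[0, T]\<close>, with values in \<open>D\<close>, of
  \<open>dX\<^sub>t = b(X\<^sub>t) dt + a(X\<^sub>t) dB\<^sub>t\<close>, where \<open>a x\<close> is the linear map taking increments of the driving
  Brownian motion to increments of the state. The stochastic integral is taken coordinatewise.
\<close>

definition sde_solution ::
    "'a measure \<Rightarrow> (real \<Rightarrow> 'a measure) \<Rightarrow> (real \<Rightarrow> 'a \<Rightarrow> 'm::euclidean_space) \<Rightarrow> 'x::euclidean_space set
      \<Rightarrow> ('x \<Rightarrow> 'x) \<Rightarrow> ('x \<Rightarrow> 'm \<Rightarrow> 'x) \<Rightarrow> real \<Rightarrow> (real \<Rightarrow> 'a \<Rightarrow> 'x) \<Rightarrow> bool" where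
  "sde_solution M F B D b a T X \<longleftrightarrow>
     brownian_motion M F B \<and>
     (\<forall>t\<in>{0..T}. X t \<in> borel_measurable (F t)) \<and>
     (\<forall>\<omega>\<in>space M. continuous_on {0..T} (\<lambda>t. X t \<omega>) \<and> (\<forall>t\<in>{0..T}. X t \<omega> \<in> D)) \<and>
     (\<forall>t\<in>{0..T}. \<exists>J.
        (\<forall>i\<in>Basis. \<forall>j\<in>Basis.
           has_ito_integral M F (\<lambda>s \<omega>. B s \<omega> \<bullet> j) (\<lambda>s \<omega>. a (X s \<omega>) j \<bullet> i) t (J i j)) \<and>
        (AE \<omega> in M. set_integrable lborel {0..t} (\<lambda>s. b (X s \<omega>)) \<and>
           X t \<omega> = X 0 \<omega> + (LINT s:{0..t}|lborel. b (X s \<omega>))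
                     + (\<Sum>i\<in>Basis. \<Sum>j\<in>Basis. J i j \<omega> *\<^sub>R i)))"

text \<open>
  One step of the Strang splitting of an equation into the systems \<open>(b1, a1)\<close> and \<open>(b2, a2)\<close>,
  started from the point \<open>x\<close>: the first system for time \<open>h/2\<close>, the second for time \<open>h\<close>, the first
  again for time \<open>h/2\<close>; \<open>Y\<close> is the final state. Each stage \<open>i\<close> has its own clock starting at \<open>0\<close>, its
  own filtration \<open>Fi\<close> and its own \<open>Fi\<close>-Brownian motion \<open>Bi\<close>. The initial \<open>\<sigma>\<close>-algebra of a stage
  contains everything known at the end of the preceding one, so the increments used in the three
  stages are mutually independent.
\<close>

definition strang_step ::
    "'a measure \<Rightarrow> 'x::euclidean_space set \<Rightarrow> ('x \<Rightarrow> 'x) \<Rightarrow> ('x \<Rightarrow> 'm::euclidean_space \<Rightarrow> 'x)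
      \<Rightarrow> ('x \<Rightarrow> 'x) \<Rightarrow> ('x \<Rightarrow> 'm \<Rightarrow> 'x) \<Rightarrow> real \<Rightarrow> 'x \<Rightarrow> ('a \<Rightarrow> 'x) \<Rightarrow> bool" where
  "strang_step M D b1 a1 b2 a2 h x Y \<longleftrightarrow>
     (\<exists>F1 B1 S1 F2 B2 S2 F3 B3 S3.
        sde_solution M F1 B1 D b1 a1 (h/2) S1 \<and> (AE \<omega> in M. S1 0 \<omega> = x) \<and>
        sets (F1 (h/2)) \<subseteq> sets (F2 0) \<and>
        sde_solution M F2 B2 D b2 a2 h S2 \<and> (AE \<omega> in M. S2 0 \<omega> = S1 (h/2) \<omega>) \<and>
        sets (F2 h) \<subseteq> sets (F3 0) \<and>
        sde_solution M F3 B3 D b1 a1 (h/2) S3 \<and> (AE \<omega> in M. S3 0 \<omega> = S2 h \<omega>) \<and>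
        (\<forall>\<omega>\<in>space M. Y \<omega> = S3 (h/2) \<omega>))"

text \<open>The state is \<open>(X, V)\<close> and the driving Brownian motion is \<open>(W, W\<^sup>\<bottom>)\<close>.\<close>

definition heston_domain :: "(real \<times> real) set" where
  "heston_domain = UNIV \<times> {0..}"

definition heston_drift :: "real \<Rightarrow> real \<Rightarrow> real \<Rightarrow> real \<times> real \<Rightarrow> real \<times> real" where
  "heston_drift r k \<theta> = (\<lambda>(x, v). (r - v / 2, k * (\<theta> - v)))"

definition heston_diffusion :: "real \<Rightarrow> real \<Rightarrow> real \<times> real \<Rightarrow> real \<times> real \<Rightarrow> real \<times> real" where
  "heston_diffusion \<rho> \<sigma> =
     (\<lambda>(x, v) (w, w'). (sqrt v * (\<rho> * w + sqrt (1 - \<rho>\<^sup>2) * w'), \<sigma> * sqrt v * w))"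

definition system1_drift :: "real \<Rightarrow> real \<Rightarrow> real \<Rightarrow> real \<times> real \<Rightarrow> real \<times> real" where
  "system1_drift r k \<theta> = (\<lambda>(x, v). (r - v / 2, k * (\<theta> - v)))"

definition system1_diffusion :: "real \<Rightarrow> real \<times> real \<Rightarrow> real \<times> real \<Rightarrow> real \<times> real" where
  "system1_diffusion \<rho> = (\<lambda>(x, v) (w, w'). (sqrt (1 - \<rho>\<^sup>2) * sqrt v * w', 0))"

definition system2_drift :: "real \<times> real \<Rightarrow> real \<times> real" where
  "system2_drift = (\<lambda>(x, v). (0, 0))"

definition system2_diffusion :: "real \<Rightarrow> real \<Rightarrow> real \<times> real \<Rightarrow> real \<times> real \<Rightarrow> real \<times> real" where
  "system2_diffusion \<rho> \<sigma> = (\<lambda>(x, v) (w, w'). (\<rho> * sqrt v * w, \<sigma> * sqrt v * w))"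

lemma heston_split:
  "heston_drift r k \<theta> z = system1_drift r k \<theta> z + system2_drift z"
  "heston_diffusion \<rho> \<sigma> z w = system1_diffusion \<rho> z w + system2_diffusion \<rho> \<sigma> z w"
  by (auto simp: heston_drift_def heston_diffusion_def system1_drift_def system1_diffusion_def
      system2_drift_def system2_diffusion_def algebra_simps zero_prod_def split: prod.splits)

text \<open>
  \<open>Y \<sim> CIR(\<alpha>, \<beta>, \<sigma>, h, v)\<close>: the variable \<open>Y\<close> on \<open>M\<close> has the law of the value at time \<open>h\<close> of a
  nonnegative solution of \<open>dV\<^sub>t = (\<alpha> - \<beta> V\<^sub>t) dt + \<sigma> \<surd>V\<^sub>t dW\<^sub>t\<close>, \<open>V\<^sub>0 = v\<close>.
\<close>

definition is_CIR ::
    "'a measure \<Rightarrow> real \<Rightarrow> real \<Rightarrow> real \<Rightarrow> real \<Rightarrow> real \<Rightarrow> ('a \<Rightarrow> real) \<Rightarrow> bool" where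
  "is_CIR M \<alpha> \<beta> \<sigma> h v Y \<longleftrightarrow>
     Y \<in> borel_measurable M \<and>
     (\<exists>F (W :: real \<Rightarrow> 'a \<Rightarrow> real) V.
        sde_solution M F W {0..} (\<lambda>y. \<alpha> - \<beta> * y) (\<lambda>y w. \<sigma> * sqrt y * w) h V \<and>
        (AE \<omega> in M. V 0 \<omega> = v) \<and> distr M borel Y = distr M borel (V h))"

text \<open>
  The law \<open>N(0, s)\<close> as a function of the \<^emph>\<open>variance\<close> (\<^const>\<open>normal_density\<close> takes the standard
  deviation); it is the point mass at \<open>0\<close> when \<open>s = 0\<close>, which occurs for \<open>\<rho> = \<plusminus>1\<close>.
\<close>

definition centred_normal :: "real \<Rightarrow> real measure" where
  "centred_normal s =
     (if s > 0 then density lborel (normal_density 0 (sqrt s))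
      else return borel 0)"

end

theory Submission
  imports Defs
begin

text \<open>
  In system (1) the variance is a deterministic function of its initial value, so the stochastic
  integral in \<open>X\<close> is centred normal given the initial \<open>\<sigma>\<close>-algebra; its conditional characteristic
  function is obtained from the exponential martingales of elementary integrands by approximation.
  In system (2) \<open>dX = (\<rho>/\<sigma>) dV\<close>, so by uniqueness of the stochastic integral \<open>X\<close> moves by
  \<open>(\<rho>/\<sigma>) (V\<^sub>h - V\<^sub>0)\<close>. For \<open>dV = \<sigma> \<surd>V dW\<close> let \<open>\<psi>\<close> solve \<open>\<psi>' = \<sigma>\<^sup>2 \<psi>\<^sup>2 / 2\<close>, \<open>\<psi>(h) = \<mu>\<close>; then
  \<open>exp (- \<psi>(s) V\<^sub>s)\<close> is a martingale, whence \<open>E (G exp (- \<mu> V\<^sub>h)) = E (G exp (- \<psi>(0) V\<^sub>0))\<close> for bounded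
  \<open>G\<close> known at time \<open>0\<close>. When \<open>V\<^sub>0\<close> is constant, this determines the law of \<open>V\<^sub>h\<close>, whatever the solution
  that realises it, and shows that \<open>V\<^sub>h\<close> is independent of the first stage of the step. The two normal
  contributions of system (1) then add up in \<open>E (1\<^sub>A(V) exp (\<i> u X))\<close>, which determines the joint law.
\<close>

section \<open>Exponential martingales of elementary integrands\<close>

text \<open>The integral is only a limit in probability of elementary integrals, so square
  integrability of the integrand cannot be assumed and its quadratic variation may be unbounded. All
  exponential identities therefore come from one discrete fact (a kernel of mean 1 in a fresh
  increment leaves expectations unchanged), applied to weights truncated so that second moments stay
  bounded. The square root is not Lipschitz at 0, so uniqueness in law for the second system is read
  off an explicit transform instead. Real exponents suit the variance, since nonnegativity bounds
  the exponential; the log-price has no sign and needs imaginary ones. Knowing the law of the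
  variance after the second stage is not enough: it enters the final log-price together with the
  noise of the first stage, so their independence must be shown. It holds because the first stage
  moves the variance deterministically, so that the second stage starts from a constant. The mixed
  transform, an indicator in one variable and a character in the other, reduces equality of planar
  laws to uniqueness of one-dimensional laws conditioned on an event.\<close>

lemma expectation_exp_normal:
  assumes "s > 0"
  shows "integrable (density lborel (normal_density 0 s)) (\<lambda>w. exp (x * w - x\<^sup>2 * s\<^sup>2 / 2))"
    and "(\<integral>w. exp (x * w - x\<^sup>2 * s\<^sup>2 / 2) \<partial>density lborel (normal_density 0 s)) = 1"
proof -
  \<comment> \<open>Exponential tilting: completing the square shows that the factor merely shifts
    the mean, so both claims are facts about another normal density.\<close>
  have eq: "normal_density 0 s w * exp (x * w - x\<^sup>2 * s\<^sup>2 / 2) = normal_density (x * s\<^sup>2) s w" for w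
  proof -
    have "- w\<^sup>2 / (2 * s\<^sup>2) + (x * w - x\<^sup>2 * s\<^sup>2 / 2) = - (w - x * s\<^sup>2)\<^sup>2 / (2 * s\<^sup>2)"
      using assms by (simp add: divide_simps) (simp add: power2_eq_square algebra_simps)
    then show ?thesis
      unfolding normal_density_def by (simp add: exp_add[symmetric])
  qed
  show "integrable (density lborel (normal_density 0 s)) (\<lambda>w. exp (x * w - x\<^sup>2 * s\<^sup>2 / 2))"
    by (subst integrable_density) (auto simp: eq assms)
  show "(\<integral>w. exp (x * w - x\<^sup>2 * s\<^sup>2 / 2) \<partial>density lborel (normal_density 0 s)) = 1"
    by (subst integral_density) (auto simp: eq assms)
qed

text \<open>Scaling reduces every positive variance to the standard normal law, whose characteristic
  function is known.\<close>

lemma density_normal_eq_distr: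
  assumes "s > 0"
  shows "density lborel (normal_density 0 s) = distr std_normal_distribution borel (\<lambda>w. s * w)"
proof -
  interpret S: prob_space std_normal_distribution
    by (rule prob_space_normal_density) simp
  have "distributed std_normal_distribution lborel (\<lambda>x. x) (normal_density 0 1)"
    by (auto simp: distributed_def distr_id2 intro!: distr_id2)
  from S.normal_density_affine[OF this, of s 0] assms show ?thesis
    by (simp add: distributed_def distr_cong[OF refl sets_lborel refl])
qed

text \<open>The preceding identity at an imaginary argument, so the compensator changes sign. The
  modulus of the integrand is constant in \<open>w\<close>, which makes integrability
  immediate.\<close>

lemma expectation_iexp_normal:
  assumes "s > 0"
  shows "integrable (density lborel (normal_density 0 s)) (\<lambda>w. exp (\<i> * of_real x * of_real w + of_real (x\<^sup>2 * s\<^sup>2 / 2)))"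
    and "(\<integral>w. exp (\<i> * of_real x * of_real w + of_real (x\<^sup>2 * s\<^sup>2 / 2)) \<partial>density lborel (normal_density 0 s)) = 1"
proof -
  interpret S: prob_space "density lborel (normal_density 0 s)"
    by (rule prob_space_normal_density) (use assms in simp)
  show "integrable (density lborel (normal_density 0 s)) (\<lambda>w. exp (\<i> * of_real x * of_real w + of_real (x\<^sup>2 * s\<^sup>2 / 2)))"
    by (rule S.integrable_const_bound[where B = "exp (x\<^sup>2 * s\<^sup>2 / 2)"])
       (auto simp: norm_exp_eq_Re)
  have "(\<integral>w. exp (\<i> * of_real x * of_real w) \<partial>density lborel (normal_density 0 s))
      = (\<integral>w. exp (\<i> * of_real (x * s) * of_real w) \<partial>std_normal_distribution)"
    unfolding density_normal_eq_distr[OF assms]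
    by (subst integral_distr) (auto simp: mult_ac)
  also have "\<dots> = char std_normal_distribution (x * s)"
    unfolding char_def by (simp add: mult_ac)
  also have "\<dots> = exp (- (of_real ((x * s)\<^sup>2 / 2)))"
    unfolding char_std_normal_distribution
    by (simp add: exp_of_real[symmetric])
  finally have *: "(\<integral>w. exp (\<i> * of_real x * of_real w) \<partial>density lborel (normal_density 0 s))
      = exp (- (of_real ((x * s)\<^sup>2 / 2)))" .
  have "(\<integral>w. exp (\<i> * of_real x * of_real w + of_real (x\<^sup>2 * s\<^sup>2 / 2)) \<partial>density lborel (normal_density 0 s))
    = exp (of_real (x\<^sup>2 * s\<^sup>2 / 2)) * (\<integral>w. exp (\<i> * of_real x * of_real w) \<partial>density lborel (normal_density 0 s))"
    by (subst integral_mult_right_zero[symmetric]) (simp add: exp_add mult_ac)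
  also have "\<dots> = 1"
    unfolding * exp_add[symmetric] by (simp add: power_mult_distrib)
  finally show "(\<integral>w. exp (\<i> * of_real x * of_real w + of_real (x\<^sup>2 * s\<^sup>2 / 2)) \<partial>density lborel (normal_density 0 s)) = 1" .
qed

section \<open>Increments of a scalar Brownian motion\<close>

locale brownian =
  fixes M :: "'a measure" and F :: "real \<Rightarrow> 'a measure" and W :: "real \<Rightarrow> 'a \<Rightarrow> real"
  assumes bm: "brownian_motion M F W"

sublocale brownian \<subseteq> prob_space M
  using bm unfolding brownian_motion_def filtered_prob_space_def by blast

context brownian
begin

lemma subalg: "subalgebra M (F t)"
  using bm unfolding brownian_motion_def filtered_prob_space_def by blast

lemma space_F [simp]: "space (F t) = space M"
  using subalg by (simp add: subalgebra_def)

lemma sets_F_mono: "s \<le> t \<Longrightarrow> sets (F s) \<subseteq> sets (F t)"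
  using bm unfolding brownian_motion_def filtered_prob_space_def filtration_def by blast

lemma F_imp_M: "f \<in> measurable (F t) N \<Longrightarrow> f \<in> measurable M N"
  by (rule measurable_from_subalg[OF subalg])

lemma F_mono: "f \<in> measurable (F s) N \<Longrightarrow> s \<le> t \<Longrightarrow> f \<in> measurable (F t) N"
  by (rule measurable_from_subalg[of "F t" "F s"]) (simp_all add: subalgebra_def sets_F_mono)

lemma W_F: "0 \<le> s \<Longrightarrow> s \<le> t \<Longrightarrow> W s \<in> borel_measurable (F t)"
  using bm F_mono[of "W s" s borel t] unfolding brownian_motion_def by blast

lemma increment_distr:
  assumes "0 \<le> s" "s < t"
  shows "distr M borel (\<lambda>\<omega>. W t \<omega> - W s \<omega>) = density lborel (normal_density 0 (sqrt (t - s)))"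
proof -
  have "distr M lborel (\<lambda>\<omega>. W t \<omega> - W s \<omega>) = density lborel (normal_density 0 (sqrt (t - s)))"
    using bm assms unfolding brownian_motion_def distributed_def by auto
  then show ?thesis
    using distr_cong[OF refl sets_lborel, of M "\<lambda>\<omega>. W t \<omega> - W s \<omega>" "\<lambda>\<omega>. W t \<omega> - W s \<omega>"] by simp
qed

text \<open>Restates independence of \<sigma>-algebras as a product law, the form to which Fubini's
  theorem applies.\<close>

lemma increment_indep:
  assumes "0 \<le> s" "s < t" and Y: "Y \<in> measurable (F s) N"
  shows "distr M (N \<Otimes>\<^sub>M borel) (\<lambda>\<omega>. (Y \<omega>, W t \<omega> - W s \<omega>))
    = distr M N Y \<Otimes>\<^sub>M density lborel (normal_density 0 (sqrt (t - s)))"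
proof -
  note [measurable] = Y[THEN F_imp_M]
  define D where "D = (\<lambda>\<omega>. W t \<omega> - W s \<omega>)"
  have D[measurable]: "D \<in> borel_measurable M"
    using W_F[THEN F_imp_M, of s s] W_F[THEN F_imp_M, of t t] assms by (auto simp: D_def)
  have ind: "indep_set (sets (F s)) (sets (vimage_algebra (space M) D borel))"
    using bm assms unfolding brownian_motion_def D_def by blast
  interpret P: prob_space "distr M N Y" by (rule prob_space_distr) measurable
  interpret Q: prob_space "distr M borel D" by (rule prob_space_distr) measurable
  have "distr M N Y \<Otimes>\<^sub>M distr M borel D = distr M (N \<Otimes>\<^sub>M borel) (\<lambda>\<omega>. (Y \<omega>, D \<omega>))"
  proof (rule pair_measure_eqI)
    show "sigma_finite_measure (distr M N Y)" "sigma_finite_measure (distr M borel D)"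
      by unfold_locales
    show "sets (distr M N Y \<Otimes>\<^sub>M distr M borel D) = sets (distr M (N \<Otimes>\<^sub>M borel) (\<lambda>\<omega>. (Y \<omega>, D \<omega>)))"
      by (simp cong: sets_pair_measure_cong)
    fix A B assume "A \<in> sets (distr M N Y)" "B \<in> sets (distr M borel D)"
    then have AB[measurable]: "A \<in> sets N" "B \<in> sets borel" by simp_all
    have "prob ((Y -` A \<inter> space M) \<inter> (D -` B \<inter> space M)) = prob (Y -` A \<inter> space M) * prob (D -` B \<inter> space M)"
      using indep_setD[OF ind] measurable_sets[OF Y AB(1)] in_vimage_algebra[OF AB(2), of D "space M"]
      by simp
    moreover have "(Y -` A \<inter> space M) \<inter> (D -` B \<inter> space M) = (\<lambda>\<omega>. (Y \<omega>, D \<omega>)) -` (A \<times> B) \<inter> space M"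
      by auto
    ultimately show "emeasure (distr M N Y) A * emeasure (distr M borel D) B
        = emeasure (distr M (N \<Otimes>\<^sub>M borel) (\<lambda>\<omega>. (Y \<omega>, D \<omega>))) (A \<times> B)"
      by (simp add: emeasure_distr emeasure_eq_measure ennreal_mult')
  qed
  then show ?thesis using increment_distr[OF assms(1,2)] by (simp add: D_def)
qed

text \<open>Fubini: with the past frozen, the kernel integrates to 1 over the fresh increment. The
  bound \<open>bd\<close> on its L1 norm, uniform over the values taken by \<open>\<xi>\<close>,
  gives integrability of the product. The value type is general so that real and imaginary
  exponentials share one proof.\<close>

lemma expectation_mult_increment:
  fixes G :: "'a \<Rightarrow> 'b::{real_normed_field,banach,second_countable_topology}"
    and \<kappa> :: "real \<Rightarrow> real \<Rightarrow> 'b"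
  assumes st: "0 \<le> s" "s < t"
    and G: "G \<in> borel_measurable (F s)" and Gi: "integrable M G"
    and \<xi>: "\<xi> \<in> borel_measurable (F s)"
    and \<kappa>[measurable]: "(\<lambda>(x, w). \<kappa> x w) \<in> borel_measurable (borel \<Otimes>\<^sub>M borel)"
    and int: "\<And>x. integrable (density lborel (normal_density 0 (sqrt (t - s)))) (\<kappa> x)"
    and one: "\<And>x. (\<integral>w. \<kappa> x w \<partial>density lborel (normal_density 0 (sqrt (t - s)))) = 1"
    and bd: "\<And>\<omega>. \<omega> \<in> space M \<Longrightarrow>
      (\<integral>w. norm (\<kappa> (\<xi> \<omega>) w) \<partial>density lborel (normal_density 0 (sqrt (t - s)))) \<le> C"
  shows "integrable M (\<lambda>\<omega>. G \<omega> * \<kappa> (\<xi> \<omega>) (W t \<omega> - W s \<omega>))"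
    and "expectation (\<lambda>\<omega>. G \<omega> * \<kappa> (\<xi> \<omega>) (W t \<omega> - W s \<omega>)) = expectation G"
proof -
  note [measurable] = G[THEN F_imp_M] \<xi>[THEN F_imp_M]
  define D where "D = (\<lambda>\<omega>. W t \<omega> - W s \<omega>)"
  have D[measurable]: "D \<in> borel_measurable M"
    using W_F[THEN F_imp_M, of s s] W_F[THEN F_imp_M, of t t] st by (auto simp: D_def)
  \<comment> \<open>The factor and the weight are bundled into one variable because the increment
    must be independent of both jointly.\<close>
  define Y where "Y = (\<lambda>\<omega>. (G \<omega>, \<xi> \<omega>))"
  have Y: "Y \<in> measurable (F s) (borel \<Otimes>\<^sub>M borel)"
    unfolding Y_def using G \<xi> by measurable
  note YM[measurable] = Y[THEN F_imp_M]
  let ?N = "density lborel (normal_density 0 (sqrt (t - s)))"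
  let ?P = "distr M (borel \<Otimes>\<^sub>M borel) Y"
  define f where "f = (\<lambda>((g :: 'b, x), w). g * \<kappa> x w)"
  have f_eq: "f ((g, x), w) = g * \<kappa> x w" for g x w by (simp add: f_def)
  have joint: "distr M ((borel \<Otimes>\<^sub>M borel) \<Otimes>\<^sub>M borel) (\<lambda>\<omega>. (Y \<omega>, D \<omega>)) = ?P \<Otimes>\<^sub>M ?N"
    using increment_indep[OF st Y] by (simp add: D_def)
  interpret P: prob_space ?P by (rule prob_space_distr) measurable
  interpret N: prob_space ?N by (rule prob_space_normal_density) (use st in simp)
  interpret PN: pair_prob_space ?P ?N ..
  have setsN[measurable_cong]: "sets ?N = sets borel" by simp
  have f[measurable]: "f \<in> borel_measurable ((borel \<Otimes>\<^sub>M borel) \<Otimes>\<^sub>M borel)"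
  proof -
    have "(\<lambda>p. \<kappa> (snd (fst p)) (snd p)) \<in> borel_measurable ((borel \<Otimes>\<^sub>M borel) \<Otimes>\<^sub>M borel)"
      using measurable_compose[OF _ \<kappa>, of "\<lambda>p. (snd (fst p), snd p)" "(borel \<Otimes>\<^sub>M borel) \<Otimes>\<^sub>M borel"]
      by auto
    then show ?thesis unfolding f_def split_beta by measurable
  qed
  have f': "f \<in> borel_measurable (?P \<Otimes>\<^sub>M ?N)"
    using f by (simp cong: measurable_cong_sets sets_pair_measure_cong)
  have fN: "(\<lambda>y. \<integral>w. norm (f (y, w)) \<partial>?N) \<in> borel_measurable (borel \<Otimes>\<^sub>M borel)"
  proof (rule N.borel_measurable_lebesgue_integral)
    have "(\<lambda>p. norm (f p)) \<in> borel_measurable ((borel \<Otimes>\<^sub>M borel) \<Otimes>\<^sub>M borel)" using f by simp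
    then show "(\<lambda>(y, w). norm (f (y, w))) \<in> borel_measurable ((borel \<Otimes>\<^sub>M borel) \<Otimes>\<^sub>M ?N)"
      by (simp add: split_beta cong: measurable_cong_sets sets_pair_measure_cong)
  qed
  have fint: "integrable (?P \<Otimes>\<^sub>M ?N) f"
  proof (rule PN.Fubini_integrable[OF f'])
    show "AE y in ?P. integrable ?N (\<lambda>w. f (y, w))"
      using int by (auto simp: f_def split_beta)
    show "integrable ?P (\<lambda>y. \<integral>w. norm (f (y, w)) \<partial>?N)"
    proof (subst integrable_distr_eq[OF YM])
      show "(\<lambda>y. \<integral>w. norm (f (y, w)) \<partial>?N) \<in> borel_measurable (borel \<Otimes>\<^sub>M borel)"
        by (rule fN)
      show "integrable M (\<lambda>\<omega>. \<integral>w. norm (f (Y \<omega>, w)) \<partial>?N)"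
      proof (rule Bochner_Integration.integrable_bound)
        show "integrable M (\<lambda>\<omega>. norm (G \<omega>) * C)" using Gi by auto
        show "(\<lambda>\<omega>. \<integral>w. norm (f (Y \<omega>, w)) \<partial>?N) \<in> borel_measurable M"
          by (rule measurable_compose[OF YM fN])
        show "AE \<omega> in M. norm (\<integral>w. norm (f (Y \<omega>, w)) \<partial>?N) \<le> norm (norm (G \<omega>) * C)"
        proof (rule AE_I2)
          fix \<omega> assume "\<omega> \<in> space M"
          have "0 \<le> (\<integral>w. norm (\<kappa> (\<xi> \<omega>) w) \<partial>?N)" by simp
          then show "norm (\<integral>w. norm (f (Y \<omega>, w)) \<partial>?N) \<le> norm (norm (G \<omega>) * C)"
            using bd[OF \<open>\<omega> \<in> space M\<close>]
            by (auto simp: Y_def f_eq norm_mult abs_mult intro!: mult_left_mono)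
        qed
      qed
    qed
  qed
  have YD[measurable]: "(\<lambda>\<omega>. (Y \<omega>, D \<omega>)) \<in> measurable M ((borel \<Otimes>\<^sub>M borel) \<Otimes>\<^sub>M borel)"
    by measurable
  have "integrable (distr M ((borel \<Otimes>\<^sub>M borel) \<Otimes>\<^sub>M borel) (\<lambda>\<omega>. (Y \<omega>, D \<omega>))) f"
    using fint joint by simp
  then show "integrable M (\<lambda>\<omega>. G \<omega> * \<kappa> (\<xi> \<omega>) (W t \<omega> - W s \<omega>))"
    by (subst (asm) integrable_distr_eq[OF YD f]) (simp add: Y_def D_def f_eq)
  have "expectation (\<lambda>\<omega>. G \<omega> * \<kappa> (\<xi> \<omega>) (W t \<omega> - W s \<omega>))
      = integral\<^sup>L (distr M ((borel \<Otimes>\<^sub>M borel) \<Otimes>\<^sub>M borel) (\<lambda>\<omega>. (Y \<omega>, D \<omega>))) f"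
    by (subst integral_distr[OF YD f]) (simp add: Y_def D_def f_eq)
  also have "\<dots> = (\<integral>y. (\<integral>w. f (y, w) \<partial>?N) \<partial>?P)"
    unfolding joint using PN.integral_fst'[OF fint] by simp
  also have "\<dots> = (\<integral>y. fst y \<partial>?P)"
    by (intro Bochner_Integration.integral_cong) (auto simp: f_def split_beta one)
  also have "\<dots> = expectation G"
    by (subst integral_distr[OF YM]) (auto simp: Y_def)
  finally show "expectation (\<lambda>\<omega>. G \<omega> * \<kappa> (\<xi> \<omega>) (W t \<omega> - W s \<omega>)) = expectation G" .
qed

end

section \<open>Partitions, refinements and elementary processes\<close>

definition elementary_quad :: "nat \<Rightarrow> (nat \<Rightarrow> real) \<Rightarrow> (nat \<Rightarrow> 'a \<Rightarrow> real) \<Rightarrow> 'a \<Rightarrow> real" where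
  "elementary_quad N \<tau> \<xi> \<omega> = (\<Sum>i<N. (\<xi> i \<omega>)\<^sup>2 * (\<tau> (Suc i) - \<tau> i))"

text \<open>
  Since \<open>\<xi> i\<close> is known at time \<open>\<tau> i\<close>, so is the quadratic variation at time \<open>\<tau> (Suc i)\<close>: stopping
  one step before it exceeds \<open>C\<close> keeps the integrand adapted.
\<close>

definition truncate :: "real \<Rightarrow> (nat \<Rightarrow> real) \<Rightarrow> (nat \<Rightarrow> 'a \<Rightarrow> real) \<Rightarrow> nat \<Rightarrow> 'a \<Rightarrow> real" where
  "truncate C \<tau> \<xi> i \<omega> = (if elementary_quad (Suc i) \<tau> \<xi> \<omega> \<le> C then \<xi> i \<omega> else 0)"

text \<open>The process is read at the right endpoint because cells are open on the left and closed
  on the right: \<open>p i\<close> itself still belongs to the preceding cell. When \<open>p\<close>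
  contains all points of \<open>\<tau>\<close>, this value is nevertheless known at time
  \<open>p i\<close>.\<close>

definition refine :: "nat \<Rightarrow> (nat \<Rightarrow> real) \<Rightarrow> (nat \<Rightarrow> 'a \<Rightarrow> real) \<Rightarrow> (nat \<Rightarrow> real) \<Rightarrow> nat \<Rightarrow> 'a \<Rightarrow> real" where
  "refine N \<tau> \<xi> p i \<omega> = elementary_process N \<tau> \<xi> (p (Suc i)) \<omega>"

text \<open>Cutting both endpoints of each cell at \<open>u\<close> makes sense for every
  \<open>u\<close>; a cell beyond \<open>u\<close> contributes an increment from \<open>u\<close> to
  \<open>u\<close>, that is, nothing.\<close>

definition elementary_integral_upto ::
    "(real \<Rightarrow> 'a \<Rightarrow> real) \<Rightarrow> nat \<Rightarrow> (nat \<Rightarrow> real) \<Rightarrow> (nat \<Rightarrow> 'a \<Rightarrow> real) \<Rightarrow> real \<Rightarrow> 'a \<Rightarrow> real" where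
  "elementary_integral_upto W N \<tau> \<xi> u \<omega> =
     (\<Sum>i<N. \<xi> i \<omega> * (W (min (\<tau> (Suc i)) u) \<omega> - W (min (\<tau> i) u) \<omega>))"

definition partition_points :: "nat \<Rightarrow> (nat \<Rightarrow> real) \<Rightarrow> bool" where
  "partition_points N p \<longleftrightarrow> (\<forall>i<N. p i \<le> p (Suc i))"

lemma partition_points_mono:
  assumes "partition_points N p" "i \<le> j" "j \<le> N"
  shows "p i \<le> p j"
  using assms(2,3)
proof (induction j rule: dec_induct)
  case (step n)
  then have "p i \<le> p n" "p n \<le> p (Suc n)" using assms(1) by (simp_all add: partition_points_def)
  then show ?case by (rule order_trans)
qed simp

lemma partition_points_less:
  assumes "partition_points N p" "p i < p j" "i \<le> N" "j \<le> N"
  shows "i < j"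
  using partition_points_mono[OF assms(1), of j i] assms(2-4) by linarith

lemma partition_points_exists:
  assumes "partition_points N p" "s \<in> {p 0<..p N}"
  shows "\<exists>i<N. s \<in> {p i<..p (Suc i)}"
  using assms
proof (induction N)
  case (Suc N)
  show ?case
  proof (cases "s \<le> p N")
    case True
    then have "\<exists>i<N. s \<in> {p i<..p (Suc i)}"
      using Suc by (intro Suc.IH) (auto simp: partition_points_def)
    then show ?thesis by (auto intro: less_SucI)
  next
    case False
    then show ?thesis using Suc.prems by (intro exI[of _ N]) auto
  qed
qed simp

lemma elementary_process_eq:
  assumes "partition_points N p" "i < N" "s \<in> {p i<..p (Suc i)}"
  shows "elementary_process N p \<xi> s \<omega> = \<xi> i \<omega>"
proof -
  have "indicator {p j<..p (Suc j)} s = (if j = i then 1 else 0 :: real)" if "j < N" for j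
  proof (cases j i rule: linorder_cases)
    case less
    then have "p (Suc j) \<le> p i" using assms(2) by (intro partition_points_mono[OF assms(1)]) auto
    with less assms(3) show ?thesis by auto
  next
    case greater
    then have "p (Suc i) \<le> p j" using that by (intro partition_points_mono[OF assms(1)]) auto
    with greater assms(3) show ?thesis by auto
  qed (use assms(3) in auto)
  then have "elementary_process N p \<xi> s \<omega> = (\<Sum>j<N. if j = i then \<xi> j \<omega> else 0)"
    unfolding elementary_process_def by (intro sum.cong) auto
  with assms(2) show ?thesis by (simp add: sum.delta')
qed

lemma elementary_process_outside:
  assumes "partition_points N p" "s \<notin> {p 0<..p N}"
  shows "elementary_process N p \<xi> s \<omega> = 0"
  unfolding elementary_process_def
proof (rule sum.neutral, safe)
  fix i assume "i < N"
  then have "p 0 \<le> p i" "p (Suc i) \<le> p N"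
    using partition_points_mono[OF assms(1)] by auto
  with assms(2) show "\<xi> i \<omega> * indicator {p i<..p (Suc i)} s = 0" by auto
qed

text \<open>The cells are disjoint, so at any time at most one term is active and no cross terms
  arise.\<close>

lemma elementary_process_mult:
  assumes "partition_points N p"
  shows "elementary_process N p (\<lambda>i \<omega>. x i \<omega> * y i \<omega>) s \<omega>
    = elementary_process N p x s \<omega> * elementary_process N p y s \<omega>"
proof (cases "s \<in> {p 0<..p N}")
  case True
  then obtain i where "i < N" "s \<in> {p i<..p (Suc i)}"
    using partition_points_exists[OF assms] by blast
  then show ?thesis by (simp add: elementary_process_eq[OF assms])
qed (simp add: elementary_process_outside[OF assms])

lemma elementary_process_power2:
  assumes "partition_points N p"
  shows "(elementary_process N p \<xi> s \<omega>)\<^sup>2 = (\<Sum>i<N. (\<xi> i \<omega>)\<^sup>2 * indicator {p i<..p (Suc i)} s)"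
  unfolding power2_eq_square elementary_process_mult[OF assms, of \<xi> \<xi> s \<omega>, symmetric]
  unfolding elementary_process_def ..

lemma elementary_process_measurable [measurable]:
  "(\<lambda>s. elementary_process N p \<xi> s \<omega>) \<in> borel_measurable borel"
  unfolding elementary_process_def by measurable

text \<open>This identifies \<open>elementary_quad\<close> with the squared L2 norm of the path. It
  converts closeness of integrands, which is how the stochastic integral is defined, into control of
  quadratic variations.\<close>

lemma nn_integral_elementary_process:
  assumes "partition_points N p"
  shows "(\<integral>\<^sup>+ s\<in>{p 0..p N}. ennreal ((elementary_process N p \<xi> s \<omega>)\<^sup>2) \<partial>lborel)
    = ennreal (elementary_quad N p \<xi> \<omega>)"
proof -
  have "(\<integral>\<^sup>+ s\<in>{p 0..p N}. ennreal ((elementary_process N p \<xi> s \<omega>)\<^sup>2) \<partial>lborel)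
    = (\<integral>\<^sup>+ s. ennreal ((elementary_process N p \<xi> s \<omega>)\<^sup>2) \<partial>lborel)"
  proof (rule nn_integral_cong)
    fix s
    show "ennreal ((elementary_process N p \<xi> s \<omega>)\<^sup>2) * indicator {p 0..p N} s
      = ennreal ((elementary_process N p \<xi> s \<omega>)\<^sup>2)"
      using elementary_process_outside[OF assms, of s \<xi> \<omega>] by (cases "s \<in> {p 0..p N}") auto
  qed
  also have "\<dots> = (\<integral>\<^sup>+ s. (\<Sum>i<N. ennreal ((\<xi> i \<omega>)\<^sup>2) * indicator {p i<..p (Suc i)} s) \<partial>lborel)"
    unfolding elementary_process_power2[OF assms]
    by (intro nn_integral_cong, subst sum_ennreal[symmetric]) (auto simp: ennreal_mult'' ennreal_indicator)
  also have "\<dots> = (\<Sum>i<N. ennreal ((\<xi> i \<omega>)\<^sup>2) * ennreal (p (Suc i) - p i))"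
    using assms
    by (subst nn_integral_sum) (auto simp: nn_integral_cmult_indicator partition_points_def intro!: sum.cong)
  also have "\<dots> = ennreal (elementary_quad N p \<xi> \<omega>)"
    unfolding elementary_quad_def using assms
    by (subst sum_ennreal[symmetric]) (auto simp: ennreal_mult' partition_points_def)
  finally show ?thesis .
qed

lemma telescope_indicator:
  fixes g :: "real \<Rightarrow> real"
  assumes p: "partition_points N p" and a: "a \<in> p ` {..N}" and b: "b \<in> p ` {..N}" and "a \<le> b"
  shows "(\<Sum>i<N. indicator {a<..b} (p (Suc i)) * (g (p (Suc i)) - g (p i))) = g b - g a"
proof -
  \<comment> \<open>Clamping to the interval from \<open>a\<close> to \<open>b\<close> kills every
    increment outside it. Since \<open>a\<close> and \<open>b\<close> are partition points, no cell
    straddles either of them, and the indicator acts as the clamping does.\<close>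
  define c where "c x = max a (min b x)" for x
  consider "a = b" | "a < b" using \<open>a \<le> b\<close> by linarith
  then show ?thesis
  proof cases
    assume "a < b"
  have "(\<Sum>i<N. indicator {a<..b} (p (Suc i)) * (g (p (Suc i)) - g (p i)))
      = (\<Sum>i<N. g (c (p (Suc i))) - g (c (p i)))"
  proof (rule sum.cong[OF refl])
    fix i assume "i \<in> {..<N}"
    then have i: "i < N" "p i \<le> p (Suc i)" using p by (auto simp: partition_points_def)
    have le: "q \<le> p i" if q: "q \<in> p ` {..N}" "q < p (Suc i)" for q
    proof -
      from q obtain k where k: "k \<le> N" "q = p k" by auto
      then have "k < Suc i" using partition_points_less[OF p, of k "Suc i"] q i by auto
      then show ?thesis using k i partition_points_mono[OF p, of k i] by auto
    qed
    show "indicator {a<..b} (p (Suc i)) * (g (p (Suc i)) - g (p i)) = g (c (p (Suc i))) - g (c (p i))"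
      using le[OF a] le[OF b] i \<open>a < b\<close>
      by (cases "p (Suc i) \<le> a"; cases "p (Suc i) \<le> b") (simp_all add: c_def indicator_def max_absorb1 max_absorb2 min_absorb1 min_absorb2)
  qed
  also have "\<dots> = g (c (p N)) - g (c (p 0))"
    by (rule sum_lessThan_telescope)
  also have "c (p N) = b"
    using b partition_points_mono[OF p, of _ N] \<open>a \<le> b\<close> by (force simp: c_def)
  also have "c (p 0) = a"
    using a partition_points_mono[OF p, of 0] \<open>a \<le> b\<close> by (force simp: c_def)
  finally show ?thesis .
  qed simp
qed

text \<open>No point of the coarse partition lies strictly inside a fine cell, so \<open>s\<close>
  and the right endpoint of its fine cell lie in the same coarse cell.\<close>

lemma elementary_process_refine:
  assumes \<tau>: "partition_points N \<tau>" and p: "partition_points N' p" and sub: "\<tau> ` {..N} \<subseteq> p ` {..N'}"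
  shows "elementary_process N' p (refine N \<tau> \<xi> p) s \<omega> = elementary_process N \<tau> \<xi> s \<omega>"
proof (cases "s \<in> {p 0<..p N'}")
  case True
  then obtain i where i: "i < N'" "s \<in> {p i<..p (Suc i)}"
    using partition_points_exists[OF p] by blast
  have le: "q < s \<longleftrightarrow> q < p (Suc i)" if q: "q \<in> p ` {..N'}" for q
  proof
    assume "q < p (Suc i)"
    from q obtain k where k: "k \<le> N'" "q = p k" by auto
    then have "k < Suc i" using partition_points_less[OF p, of k "Suc i"] \<open>q < p (Suc i)\<close> i by auto
    then show "q < s" using k i partition_points_mono[OF p, of k i] by auto
  qed (use i in auto)
  have le': "q \<in> p ` {..N'} \<Longrightarrow> s \<le> q \<longleftrightarrow> p (Suc i) \<le> q" for q
    using le[of q] by (simp add: linorder_not_less[symmetric])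
  have "elementary_process N \<tau> \<xi> s \<omega> = elementary_process N \<tau> \<xi> (p (Suc i)) \<omega>"
    unfolding elementary_process_def
  proof (rule sum.cong[OF refl])
    fix l assume "l \<in> {..<N}"
    then have "\<tau> l \<in> p ` {..N'}" "\<tau> (Suc l) \<in> p ` {..N'}" using sub by auto
    then show "\<xi> l \<omega> * indicator {\<tau> l<..\<tau> (Suc l)} s = \<xi> l \<omega> * indicator {\<tau> l<..\<tau> (Suc l)} (p (Suc i))"
      using le[of "\<tau> l"] le'[of "\<tau> (Suc l)"] by (auto simp: indicator_def)
  qed
  then show ?thesis by (simp add: elementary_process_eq[OF p i] refine_def)
next
  case False
  have "\<tau> 0 \<in> p ` {..N'}" "\<tau> N \<in> p ` {..N'}" using sub by auto
  then have "p 0 \<le> \<tau> 0" "\<tau> N \<le> p N'"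
    using partition_points_mono[OF p, of 0] partition_points_mono[OF p, of _ N'] by auto
  with False have "s \<notin> {\<tau> 0<..\<tau> N}" by auto
  with False show ?thesis by (simp add: elementary_process_outside[OF p] elementary_process_outside[OF \<tau>])
qed

text \<open>After exchanging the two sums, the fine increments inside each coarse cell, cut at
  \<open>u\<close>, telescope. The cut has to be a fine partition point for this.\<close>

lemma elementary_integral_refine_upto:
  assumes \<tau>: "partition_points N \<tau>" and p: "partition_points N' p" and sub: "\<tau> ` {..N} \<subseteq> p ` {..N'}"
    and u: "u \<in> p ` {..N'}"
  shows "elementary_integral W N' p (\<lambda>i \<omega>. indicator {..u} (p (Suc i)) * refine N \<tau> \<xi> p i \<omega>) \<omega>
    = elementary_integral_upto W N \<tau> \<xi> u \<omega>"
proof -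
  have "elementary_integral W N' p (\<lambda>i \<omega>. indicator {..u} (p (Suc i)) * refine N \<tau> \<xi> p i \<omega>) \<omega>
     = (\<Sum>i<N'. \<Sum>l<N. \<xi> l \<omega> * (indicator {min (\<tau> l) u<..min (\<tau> (Suc l)) u} (p (Suc i)) *
          (W (p (Suc i)) \<omega> - W (p i) \<omega>)))"
    unfolding elementary_integral_def refine_def elementary_process_def sum_distrib_left sum_distrib_right
    by (intro sum.cong) (auto simp: indicator_def)
  also have "\<dots> = (\<Sum>l<N. \<xi> l \<omega> * (\<Sum>i<N'. indicator {min (\<tau> l) u<..min (\<tau> (Suc l)) u} (p (Suc i)) *
          (W (p (Suc i)) \<omega> - W (p i) \<omega>)))"
    by (subst sum.swap) (simp only: sum_distrib_left)
  also have "\<dots> = elementary_integral_upto W N \<tau> \<xi> u \<omega>"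
    unfolding elementary_integral_upto_def
  proof (rule sum.cong[OF refl])
    fix l assume l: "l \<in> {..<N}"
    have "min (\<tau> l) u \<in> p ` {..N'}" "min (\<tau> (Suc l)) u \<in> p ` {..N'}"
      using l sub u by (auto simp: min_def)
    moreover have "min (\<tau> l) u \<le> min (\<tau> (Suc l)) u"
      using \<tau> l by (auto simp: partition_points_def min_def intro: order_trans)
    ultimately show "\<xi> l \<omega> * (\<Sum>i<N'. indicator {min (\<tau> l) u<..min (\<tau> (Suc l)) u} (p (Suc i)) *
          (W (p (Suc i)) \<omega> - W (p i) \<omega>))
      = \<xi> l \<omega> * (W (min (\<tau> (Suc l)) u) \<omega> - W (min (\<tau> l) u) \<omega>)"
      using telescope_indicator[OF p, of "min (\<tau> l) u" "min (\<tau> (Suc l)) u" "\<lambda>s. W s \<omega>"] by simp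
  qed
  finally show ?thesis .
qed

lemma elementary_integral_upto_end:
  assumes "partition_points N \<tau>" "\<tau> N \<le> u"
  shows "elementary_integral_upto W N \<tau> \<xi> u \<omega> = elementary_integral W N \<tau> \<xi> \<omega>"
  unfolding elementary_integral_upto_def elementary_integral_def
proof (rule sum.cong[OF refl])
  fix i assume "i \<in> {..<N}"
  then have "\<tau> i \<le> u" "\<tau> (Suc i) \<le> u"
    using partition_points_mono[OF assms(1), of i N] partition_points_mono[OF assms(1), of "Suc i" N] assms(2)
    by auto
  then show "\<xi> i \<omega> * (W (min (\<tau> (Suc i)) u) \<omega> - W (min (\<tau> i) u) \<omega>)
    = \<xi> i \<omega> * (W (\<tau> (Suc i)) \<omega> - W (\<tau> i) \<omega>)" by simp
qed

text \<open>Associativity of the integral at the elementary level: integrating a product is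
  integrating the first factor against the integral process of the second.\<close>

lemma elementary_integral_refine_mult:
  assumes \<tau>: "partition_points N \<tau>" and p: "partition_points N' p" and sub: "\<tau> ` {..N} \<subseteq> p ` {..N'}"
    and t: "partition_points m t" and sub': "t ` {..m} \<subseteq> p ` {..N'}"
  shows "elementary_integral W N' p (\<lambda>i \<omega>. refine m t w p i \<omega> * refine N \<tau> \<xi> p i \<omega>) \<omega>
    = (\<Sum>j<m. w j \<omega> * (elementary_integral_upto W N \<tau> \<xi> (t (Suc j)) \<omega> - elementary_integral_upto W N \<tau> \<xi> (t j) \<omega>))"
proof -
  have "elementary_integral W N' p (\<lambda>i \<omega>. refine m t w p i \<omega> * refine N \<tau> \<xi> p i \<omega>) \<omega>
    = (\<Sum>i<N'. \<Sum>j<m. w j \<omega> * (indicator {t j<..t (Suc j)} (p (Suc i)) * refine N \<tau> \<xi> p i \<omega> *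
         (W (p (Suc i)) \<omega> - W (p i) \<omega>)))"
    unfolding elementary_integral_def refine_def[of m] elementary_process_def[of m] sum_distrib_right
    by (simp add: mult.assoc)
  also have "\<dots> = (\<Sum>j<m. w j \<omega> * (\<Sum>i<N'. indicator {t j<..t (Suc j)} (p (Suc i)) * refine N \<tau> \<xi> p i \<omega> *
         (W (p (Suc i)) \<omega> - W (p i) \<omega>)))"
    by (subst sum.swap) (simp only: sum_distrib_left)
  also have "\<dots> = (\<Sum>j<m. w j \<omega> * (elementary_integral_upto W N \<tau> \<xi> (t (Suc j)) \<omega> - elementary_integral_upto W N \<tau> \<xi> (t j) \<omega>))"
  proof (intro sum.cong refl arg_cong2[where f="(*)"])
    fix j assume j: "j \<in> {..<m}"
    then have u: "t j \<in> p ` {..N'}" "t (Suc j) \<in> p ` {..N'}" using sub' by auto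
    have "t j \<le> t (Suc j)" using t j by (auto simp: partition_points_def)
    then have ind: "indicator {t j<..t (Suc j)} s = (indicator {..t (Suc j)} s - indicator {..t j} s :: real)" for s
      by (auto simp: indicator_def)
    show "(\<Sum>i<N'. indicator {t j<..t (Suc j)} (p (Suc i)) * refine N \<tau> \<xi> p i \<omega> * (W (p (Suc i)) \<omega> - W (p i) \<omega>))
      = elementary_integral_upto W N \<tau> \<xi> (t (Suc j)) \<omega> - elementary_integral_upto W N \<tau> \<xi> (t j) \<omega>"
      unfolding elementary_integral_refine_upto[OF \<tau> p sub u(1), symmetric]
        elementary_integral_refine_upto[OF \<tau> p sub u(2), symmetric] elementary_integral_def ind
      by (simp add: left_diff_distrib sum_subtractf)
  qed
  finally show ?thesis .
qed

lemma partition_points_of_finite: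
  assumes "finite S" "S \<noteq> {}"
  obtains N p where "partition_points N p" "p ` {..N} = (S :: real set)" "p 0 = Min S" "p N = Max S"
proof -
  define p where "p = (!) (sorted_list_of_set S)"
  define N where "N = card S - 1"
  have len: "length (sorted_list_of_set S) = Suc N"
    using assms by (simp add: N_def card_gt_0_iff)
  have part: "partition_points N p"
    unfolding partition_points_def p_def using len
    by (auto intro!: sorted_nth_mono)
  have im: "p ` {..N} = S"
  proof -
    have "p ` {..N} = set (sorted_list_of_set S)"
      unfolding p_def set_conv_nth len by (auto simp: less_Suc_eq_le)
    then show ?thesis using assms by simp
  qed
  have "p 0 = Min S" "p N = Max S"
    using im partition_points_mono[OF part] assms
    by (auto intro!: Min_eqI[symmetric] Max_eqI[symmetric])
  with part im show ?thesis by (rule that)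
qed

lemma elementary_quad_nonneg:
  "partition_points N p \<Longrightarrow> 0 \<le> elementary_quad N p \<xi> \<omega>"
  unfolding elementary_quad_def partition_points_def by (intro sum_nonneg) auto

lemma elementary_quad_mono:
  assumes "partition_points N p" "i \<le> j" "j \<le> N"
  shows "elementary_quad i p \<xi> \<omega> \<le> elementary_quad j p \<xi> \<omega>"
  unfolding elementary_quad_def using assms
  by (intro sum_mono2) (auto simp: partition_points_def)

lemma elementary_quad_truncate_le:
  assumes "partition_points N p" "0 \<le> C"
  shows "elementary_quad N p (truncate C p \<xi>) \<omega> \<le> C"
proof -
  \<comment> \<open>The comparison with the untruncated sum must be carried along in the induction:
    a weight survives only if the untruncated sum including its own term is at most
    \<open>C\<close>, and that sum dominates the truncated one.\<close>
  have "n \<le> N \<Longrightarrow> elementary_quad n p (truncate C p \<xi>) \<omega> \<le> min C (elementary_quad n p \<xi> \<omega>)" for n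
  proof (induction n)
    case 0
    then show ?case using assms(2) by (simp add: elementary_quad_def)
  next
    case (Suc n)
    have 1: "elementary_quad (Suc n) p (truncate C p \<xi>) \<omega>
      = elementary_quad n p (truncate C p \<xi>) \<omega> + (truncate C p \<xi> n \<omega>)\<^sup>2 * (p (Suc n) - p n)"
      "elementary_quad (Suc n) p \<xi> \<omega> = elementary_quad n p \<xi> \<omega> + (\<xi> n \<omega>)\<^sup>2 * (p (Suc n) - p n)"
      by (simp_all add: elementary_quad_def)
    have "0 \<le> (\<xi> n \<omega>)\<^sup>2 * (p (Suc n) - p n)"
      using Suc assms(1) by (auto simp: partition_points_def)
    then show ?case
      using Suc truncate_def[of C p \<xi> n \<omega>] unfolding 1 by (auto split: if_splits)
  qed
  then show ?thesis by force
qed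

lemma truncate_eq:
  assumes "partition_points N p" "elementary_quad N p \<xi> \<omega> \<le> C" "i < N"
  shows "truncate C p \<xi> i \<omega> = \<xi> i \<omega>"
  using elementary_quad_mono[OF assms(1), of "Suc i" N \<xi> \<omega>] assms by (simp add: truncate_def)

lemma elementary_truncate_eq:
  assumes "partition_points N p" "elementary_quad N p \<xi> \<omega> \<le> C"
  shows "elementary_integral W N p (truncate C p \<xi>) \<omega> = elementary_integral W N p \<xi> \<omega>"
    and "elementary_quad N p (truncate C p \<xi>) \<omega> = elementary_quad N p \<xi> \<omega>"
  unfolding elementary_integral_def elementary_quad_def using truncate_eq[OF assms] by auto

lemma elementary_partition: "elementary_integrand M F T N \<tau> \<xi> \<Longrightarrow> partition_points N \<tau>"
  by (simp add: elementary_integrand_def partition_points_def)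

lemma elementary_range:
  assumes "elementary_integrand M F T N \<tau> \<xi>" "i \<le> N"
  shows "0 \<le> \<tau> i" "\<tau> i \<le> T"
  using partition_points_mono[OF elementary_partition[OF assms(1)], of 0 i]
    partition_points_mono[OF elementary_partition[OF assms(1)], of i N] assms
  by (auto simp: elementary_integrand_def)

section \<open>Adapted weights and their discrete exponential martingales\<close>

context brownian
begin

lemma elementary_integrandD:
  assumes "elementary_integrand M F T N \<tau> \<xi>" "i < N"
  shows "0 \<le> \<tau> i" "\<tau> i \<le> \<tau> (Suc i)" "\<xi> i \<in> borel_measurable (F (\<tau> i))"
    "\<exists>C. \<forall>\<omega>\<in>space M. \<bar>\<xi> i \<omega>\<bar> \<le> C"
  using assms elementary_range[OF assms(1), of i] unfolding elementary_integrand_def by auto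

lemma elementary_increment_measurable:
  assumes "elementary_integrand M F T N \<tau> \<xi>" "i < N" "\<tau> (Suc i) \<le> t"
  shows "(\<lambda>\<omega>. W (\<tau> (Suc i)) \<omega> - W (\<tau> i) \<omega>) \<in> borel_measurable (F t)" "\<xi> i \<in> borel_measurable (F t)"
proof -
  note * = elementary_integrandD[OF assms(1,2)]
  show "(\<lambda>\<omega>. W (\<tau> (Suc i)) \<omega> - W (\<tau> i) \<omega>) \<in> borel_measurable (F t)"
    by (intro borel_measurable_diff W_F) (use * assms(3) in auto)
  show "\<xi> i \<in> borel_measurable (F t)"
    by (rule F_mono[OF *(3)]) (use * assms(3) in auto)
qed

lemma elementary_integral_measurable:
  assumes "elementary_integrand M F T N \<tau> \<xi>"
  shows "elementary_integral W N \<tau> \<xi> \<in> borel_measurable M" "elementary_quad N \<tau> \<xi> \<in> borel_measurable M"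
proof -
  have [measurable]: "\<xi> i \<in> borel_measurable M" "(\<lambda>\<omega>. W (\<tau> (Suc i)) \<omega> - W (\<tau> i) \<omega>) \<in> borel_measurable M"
    if "i < N" for i
    using elementary_increment_measurable[OF assms that order_refl] F_imp_M by blast+
  show "elementary_integral W N \<tau> \<xi> \<in> borel_measurable M"
    unfolding elementary_integral_def by (intro borel_measurable_sum borel_measurable_times) auto
  show "elementary_quad N \<tau> \<xi> \<in> borel_measurable M"
    unfolding elementary_quad_def by (intro borel_measurable_sum borel_measurable_times) auto
qed

text \<open>Iterates the one-step identity over the cells, the partial product playing the part of
  the past. The kernel may depend on the cell length \<open>d\<close>, and \<open>bd\<close> asks
  for a bound only on bounded ranges of \<open>x\<close> because each weight is bounded.\<close>

lemma expectation_mult_prod: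
  fixes G :: "'a \<Rightarrow> 'b::{real_normed_field,banach,second_countable_topology}"
    and \<kappa> :: "real \<Rightarrow> real \<Rightarrow> real \<Rightarrow> 'b"
  assumes el: "elementary_integrand M F T N \<tau> \<xi>"
    and G: "G \<in> borel_measurable (F 0)" and Gi: "integrable M G"
    and \<kappa>: "\<And>d. (\<lambda>(x, w). \<kappa> d x w) \<in> borel_measurable (borel \<Otimes>\<^sub>M borel)"
    and int: "\<And>d x. d > 0 \<Longrightarrow> integrable (density lborel (normal_density 0 (sqrt d))) (\<kappa> d x)"
    and one: "\<And>d x. d > 0 \<Longrightarrow> (\<integral>w. \<kappa> d x w \<partial>density lborel (normal_density 0 (sqrt d))) = 1"
    and zero: "\<And>x. \<kappa> 0 x 0 = 1"
    and bd: "\<And>d c. d > 0 \<Longrightarrow> \<exists>C. \<forall>x. \<bar>x\<bar> \<le> c \<longrightarrow>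
      (\<integral>w. norm (\<kappa> d x w) \<partial>density lborel (normal_density 0 (sqrt d))) \<le> C"
  shows "integrable M (\<lambda>\<omega>. G \<omega> * (\<Prod>i<N. \<kappa> (\<tau> (Suc i) - \<tau> i) (\<xi> i \<omega>) (W (\<tau> (Suc i)) \<omega> - W (\<tau> i) \<omega>)))"
    and "expectation (\<lambda>\<omega>. G \<omega> * (\<Prod>i<N. \<kappa> (\<tau> (Suc i) - \<tau> i) (\<xi> i \<omega>) (W (\<tau> (Suc i)) \<omega> - W (\<tau> i) \<omega>)))
      = expectation G"
proof -
  define Z where "Z n \<omega> = G \<omega> * (\<Prod>i<n. \<kappa> (\<tau> (Suc i) - \<tau> i) (\<xi> i \<omega>) (W (\<tau> (Suc i)) \<omega> - W (\<tau> i) \<omega>))" for n \<omega>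
  have Z_Suc: "Z (Suc n) \<omega> = Z n \<omega> * \<kappa> (\<tau> (Suc n) - \<tau> n) (\<xi> n \<omega>) (W (\<tau> (Suc n)) \<omega> - W (\<tau> n) \<omega>)" for n \<omega>
    by (simp add: Z_def mult.assoc)
  have "n \<le> N \<Longrightarrow> Z n \<in> borel_measurable (F (\<tau> n)) \<and> integrable M (Z n) \<and> expectation (Z n) = expectation G" for n
  proof (induction n)
    case 0
    have "\<tau> 0 = 0" using el by (simp add: elementary_integrand_def)
    then show ?case using G Gi by (simp add: Z_def[abs_def])
  next
    case (Suc n)
    then have n: "n < N" and IH: "Z n \<in> borel_measurable (F (\<tau> n))" "integrable M (Z n)"
      "expectation (Z n) = expectation G" by auto
    note D = elementary_integrandD[OF el n]
    have "(\<lambda>\<omega>. \<kappa> (\<tau> (Suc n) - \<tau> n) (\<xi> n \<omega>) (W (\<tau> (Suc n)) \<omega> - W (\<tau> n) \<omega>)) \<in> borel_measurable (F (\<tau> (Suc n)))"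
      using measurable_compose[OF measurable_Pair[OF elementary_increment_measurable(2)[OF el n order_refl]
          elementary_increment_measurable(1)[OF el n order_refl]] \<kappa>] by simp
    then have 1: "Z (Suc n) \<in> borel_measurable (F (\<tau> (Suc n)))"
      unfolding Z_Suc[abs_def] using F_mono[OF IH(1) D(2)] by (rule borel_measurable_times[rotated])
    show ?case
    \<comment> \<open>A cell of length 0 carries no normal density; its increment vanishes
      identically, and \<open>zero\<close> turns its factor into 1.\<close>
    proof (cases "\<tau> n = \<tau> (Suc n)")
      case True
      then have "Z (Suc n) = Z n" unfolding Z_Suc[abs_def] by (simp add: zero)
      then show ?thesis using IH 1 by simp
    next
      case False
      then have lt: "\<tau> n < \<tau> (Suc n)" using D(2) by simp
      from D(4) obtain c where c: "\<And>\<omega>. \<omega> \<in> space M \<Longrightarrow> \<bar>\<xi> n \<omega>\<bar> \<le> c" by blast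
      from bd[of "\<tau> (Suc n) - \<tau> n" c] lt obtain C where C: "\<And>x. \<bar>x\<bar> \<le> c \<Longrightarrow>
        (\<integral>w. norm (\<kappa> (\<tau> (Suc n) - \<tau> n) x w) \<partial>density lborel (normal_density 0 (sqrt (\<tau> (Suc n) - \<tau> n)))) \<le> C"
        by auto
      from expectation_mult_increment[OF D(1) lt IH(1,2) D(3) \<kappa> int one C[OF c]] lt
      have "integrable M (Z (Suc n))" "expectation (Z (Suc n)) = expectation (Z n)"
        unfolding Z_Suc[abs_def] by simp_all
      with 1 IH(3) show ?thesis by simp
    qed
  qed
  from this[of N]
  show "integrable M (\<lambda>\<omega>. G \<omega> * (\<Prod>i<N. \<kappa> (\<tau> (Suc i) - \<tau> i) (\<xi> i \<omega>) (W (\<tau> (Suc i)) \<omega> - W (\<tau> i) \<omega>)))"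
    "expectation (\<lambda>\<omega>. G \<omega> * (\<Prod>i<N. \<kappa> (\<tau> (Suc i) - \<tau> i) (\<xi> i \<omega>) (W (\<tau> (Suc i)) \<omega> - W (\<tau> i) \<omega>)))
      = expectation G"
    unfolding Z_def[abs_def] by simp_all
qed

text \<open>Testing against every integrable \<open>G\<close> known at time 0 states that the
  conditional expectation given \<open>F 0\<close> is 1, without introducing conditional
  expectations.\<close>

lemma expectation_exp_elementary:
  fixes G :: "'a \<Rightarrow> real"
  assumes el: "elementary_integrand M F T N \<tau> \<xi>"
    and G: "G \<in> borel_measurable (F 0)" and Gi: "integrable M G"
  shows "integrable M (\<lambda>\<omega>. G \<omega> * exp (elementary_integral W N \<tau> \<xi> \<omega> - elementary_quad N \<tau> \<xi> \<omega> / 2))"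
    and "expectation (\<lambda>\<omega>. G \<omega> * exp (elementary_integral W N \<tau> \<xi> \<omega> - elementary_quad N \<tau> \<xi> \<omega> / 2)) = expectation G"
proof -
  define \<kappa> where "\<kappa> d x w = exp (x * w - x\<^sup>2 * d / 2)" for d x w :: real
  have eq: "exp (elementary_integral W N \<tau> \<xi> \<omega> - elementary_quad N \<tau> \<xi> \<omega> / 2)
    = (\<Prod>i<N. \<kappa> (\<tau> (Suc i) - \<tau> i) (\<xi> i \<omega>) (W (\<tau> (Suc i)) \<omega> - W (\<tau> i) \<omega>))" for \<omega>
    unfolding \<kappa>_def elementary_integral_def elementary_quad_def
    by (subst exp_sum[symmetric]) (simp_all add: sum_subtractf sum_divide_distrib)
  have m: "(\<lambda>(x, w). \<kappa> d x w) \<in> borel_measurable (borel \<Otimes>\<^sub>M borel)" for d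
    unfolding \<kappa>_def by measurable
  have i: "integrable (density lborel (normal_density 0 (sqrt d))) (\<kappa> d x)"
    and o: "(\<integral>w. \<kappa> d x w \<partial>density lborel (normal_density 0 (sqrt d))) = 1" if "d > 0" for d x
    unfolding \<kappa>_def using expectation_exp_normal[of "sqrt d" x] that by simp_all
  \<comment> \<open>A positive kernel of integral 1 also has L1 norm 1, so the bound is uniform in
    \<open>x\<close>.\<close>
  have b: "\<exists>C. \<forall>x. \<bar>x\<bar> \<le> c \<longrightarrow>
      (\<integral>w. norm (\<kappa> d x w) \<partial>density lborel (normal_density 0 (sqrt d))) \<le> C" if "d > 0" for d c
    using o[OF that] by (intro exI[of _ 1]) (simp add: \<kappa>_def)
  have z: "\<kappa> 0 x 0 = 1" for x by (simp add: \<kappa>_def)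
  show "integrable M (\<lambda>\<omega>. G \<omega> * exp (elementary_integral W N \<tau> \<xi> \<omega> - elementary_quad N \<tau> \<xi> \<omega> / 2))"
    "expectation (\<lambda>\<omega>. G \<omega> * exp (elementary_integral W N \<tau> \<xi> \<omega> - elementary_quad N \<tau> \<xi> \<omega> / 2)) = expectation G"
    unfolding eq using expectation_mult_prod[OF el G Gi m i o z b] by simp_all
qed

lemma expectation_iexp_elementary:
  fixes G :: "'a \<Rightarrow> complex"
  assumes el: "elementary_integrand M F T N \<tau> \<xi>"
    and G: "G \<in> borel_measurable (F 0)" and Gi: "integrable M G"
  shows "integrable M (\<lambda>\<omega>. G \<omega> * exp (\<i> * of_real (elementary_integral W N \<tau> \<xi> \<omega>) + of_real (elementary_quad N \<tau> \<xi> \<omega> / 2)))"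
    and "expectation (\<lambda>\<omega>. G \<omega> * exp (\<i> * of_real (elementary_integral W N \<tau> \<xi> \<omega>) + of_real (elementary_quad N \<tau> \<xi> \<omega> / 2))) = expectation G"
proof -
  define \<kappa> where "\<kappa> d x w = exp (\<i> * of_real x * of_real w + of_real (x\<^sup>2 * d / 2))" for d x w :: real
  have eq: "exp (\<i> * of_real (elementary_integral W N \<tau> \<xi> \<omega>) + of_real (elementary_quad N \<tau> \<xi> \<omega> / 2))
    = (\<Prod>i<N. \<kappa> (\<tau> (Suc i) - \<tau> i) (\<xi> i \<omega>) (W (\<tau> (Suc i)) \<omega> - W (\<tau> i) \<omega>))" for \<omega>
    unfolding \<kappa>_def elementary_integral_def elementary_quad_def
    by (subst exp_sum[symmetric]) (simp_all add: sum.distrib sum_divide_distrib sum_distrib_left mult.assoc)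
  have m: "(\<lambda>(x, w). \<kappa> d x w) \<in> borel_measurable (borel \<Otimes>\<^sub>M borel)" for d
    unfolding \<kappa>_def by measurable
  have i: "integrable (density lborel (normal_density 0 (sqrt d))) (\<kappa> d x)"
    and o: "(\<integral>w. \<kappa> d x w \<partial>density lborel (normal_density 0 (sqrt d))) = 1" if "d > 0" for d x
    unfolding \<kappa>_def using expectation_iexp_normal[of "sqrt d" x] that by simp_all
  have b: "\<exists>C. \<forall>x. \<bar>x\<bar> \<le> c \<longrightarrow>
      (\<integral>w. norm (\<kappa> d x w) \<partial>density lborel (normal_density 0 (sqrt d))) \<le> C" if "d > 0" for d c
  proof (intro exI allI impI)
    fix x :: real assume "\<bar>x\<bar> \<le> c"
    then have "x\<^sup>2 \<le> c\<^sup>2" by (rule power2_le_iff_abs_le[THEN iffD2, rotated]) (use \<open>\<bar>x\<bar> \<le> c\<close> in auto)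
    interpret S: prob_space "density lborel (normal_density 0 (sqrt d))"
      by (rule prob_space_normal_density) (use that in simp)
    have "norm (\<kappa> d x w) = exp (x\<^sup>2 * d / 2)" for w by (simp add: \<kappa>_def norm_exp_eq_Re)
    then have "(\<integral>w. norm (\<kappa> d x w) \<partial>density lborel (normal_density 0 (sqrt d))) = exp (x\<^sup>2 * d / 2)"
      using S.prob_space by simp
    also have "\<dots> \<le> exp (c\<^sup>2 * d / 2)" using \<open>x\<^sup>2 \<le> c\<^sup>2\<close> that by (simp add: mult_right_mono)
    finally show "(\<integral>w. norm (\<kappa> d x w) \<partial>density lborel (normal_density 0 (sqrt d))) \<le> exp (c\<^sup>2 * d / 2)" .
  qed
  have z: "\<kappa> 0 x 0 = 1" for x by (simp add: \<kappa>_def)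
  show "integrable M (\<lambda>\<omega>. G \<omega> * exp (\<i> * of_real (elementary_integral W N \<tau> \<xi> \<omega>) + of_real (elementary_quad N \<tau> \<xi> \<omega> / 2)))"
    "expectation (\<lambda>\<omega>. G \<omega> * exp (\<i> * of_real (elementary_integral W N \<tau> \<xi> \<omega>) + of_real (elementary_quad N \<tau> \<xi> \<omega> / 2))) = expectation G"
    unfolding eq using expectation_mult_prod[OF el G Gi m i o z b] by simp_all
qed

lemma elementary_integrand_cmult:
  assumes "elementary_integrand M F T N \<tau> \<xi>"
  shows "elementary_integrand M F T N \<tau> (\<lambda>i \<omega>. c * \<xi> i \<omega>)"
    "elementary_integral W N \<tau> (\<lambda>i \<omega>. c * \<xi> i \<omega>) \<omega> = c * elementary_integral W N \<tau> \<xi> \<omega>"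
    "elementary_quad N \<tau> (\<lambda>i \<omega>. c * \<xi> i \<omega>) \<omega> = c\<^sup>2 * elementary_quad N \<tau> \<xi> \<omega>"
proof -
  have "\<exists>C. \<forall>\<omega>\<in>space M. \<bar>c * \<xi> i \<omega>\<bar> \<le> C" if i: "i < N" for i
  proof -
    obtain C where "\<forall>\<omega>\<in>space M. \<bar>\<xi> i \<omega>\<bar> \<le> C" using elementary_integrandD(4)[OF assms i] by auto
    then show ?thesis by (intro exI[of _ "\<bar>c\<bar> * C"]) (auto simp: abs_mult intro: mult_left_mono)
  qed
  then show "elementary_integrand M F T N \<tau> (\<lambda>i \<omega>. c * \<xi> i \<omega>)"
    using assms unfolding elementary_integrand_def by auto
qed (simp_all only: elementary_integral_def elementary_quad_def sum_distrib_left power_mult_distrib mult.assoc)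

lemma elementary_integrand_truncate:
  assumes "elementary_integrand M F T N \<tau> \<xi>"
  shows "elementary_integrand M F T N \<tau> (truncate C \<tau> \<xi>)"
proof -
  have m: "truncate C \<tau> \<xi> i \<in> borel_measurable (F (\<tau> i))" if i: "i < N" for i
  proof -
    have [measurable]: "\<xi> j \<in> borel_measurable (F (\<tau> i))" if "j \<le> i" for j
      using elementary_integrandD(3)[OF assms, of j] i that
        partition_points_mono[OF elementary_partition[OF assms], of j i] by (auto intro: F_mono)
    have [measurable]: "elementary_quad (Suc i) \<tau> \<xi> \<in> borel_measurable (F (\<tau> i))"
      unfolding elementary_quad_def by (intro borel_measurable_sum borel_measurable_times) auto
    have [measurable]: "\<xi> i \<in> borel_measurable (F (\<tau> i))" by simp
    show ?thesis unfolding truncate_def[abs_def] by measurable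
  qed
  have "\<exists>C'. \<forall>\<omega>\<in>space M. \<bar>truncate C \<tau> \<xi> i \<omega>\<bar> \<le> C'" if i: "i < N" for i
  proof -
    obtain C' where "\<forall>\<omega>\<in>space M. \<bar>\<xi> i \<omega>\<bar> \<le> C'" using elementary_integrandD(4)[OF assms i] by auto
    then show ?thesis by (intro exI[of _ "max 0 C'"]) (auto simp: truncate_def)
  qed
  then show ?thesis using assms m unfolding elementary_integrand_def by auto
qed

lemma elementary_integrand_refine:
  assumes el: "elementary_integrand M F T N \<tau> \<xi>" and p: "partition_points N' p"
    and sub: "\<tau> ` {..N} \<subseteq> p ` {..N'}" and ends: "p 0 = 0" "p N' = T'"
  shows "elementary_integrand M F T' N' p (refine N \<tau> \<xi> p)"
proof -
  have "refine N \<tau> \<xi> p i \<in> borel_measurable (F (p i)) \<and> (\<exists>C. \<forall>\<omega>\<in>space M. \<bar>refine N \<tau> \<xi> p i \<omega>\<bar> \<le> C)"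
    if i: "i < N'" for i
  proof
    \<comment> \<open>A coarse cell active at \<open>p (Suc i)\<close> starts strictly before that
      point. Its left end is itself a point of \<open>p\<close>, hence at most \<open>p i\<close>,
      so its weight is known at time \<open>p i\<close>.\<close>
    have "(\<lambda>\<omega>. \<xi> l \<omega> * indicator {\<tau> l<..\<tau> (Suc l)} (p (Suc i))) \<in> borel_measurable (F (p i))" if l: "l < N" for l
    proof (cases "\<tau> l < p (Suc i)")
      case True
      have "\<tau> l \<in> p ` {..N'}" using sub l by auto
      then obtain k where k: "k \<le> N'" "\<tau> l = p k" by auto
      then have "k < Suc i" using partition_points_less[OF p, of k "Suc i"] True i by auto
      then have "\<tau> l \<le> p i" using k i partition_points_mono[OF p, of k i] by auto
      then have "\<xi> l \<in> borel_measurable (F (p i))"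
        using elementary_integrandD(3)[OF el l] by (rule F_mono[rotated])
      then show ?thesis by simp
    next
      case False
      then show ?thesis by simp
    qed
    then show "refine N \<tau> \<xi> p i \<in> borel_measurable (F (p i))"
      unfolding refine_def[abs_def] elementary_process_def[abs_def] by (intro borel_measurable_sum) auto
    have "\<forall>l. \<exists>C. l < N \<longrightarrow> (\<forall>\<omega>\<in>space M. \<bar>\<xi> l \<omega>\<bar> \<le> C)"
      using elementary_integrandD(4)[OF el] by blast
    then obtain C where C: "\<And>l \<omega>. l < N \<Longrightarrow> \<omega> \<in> space M \<Longrightarrow> \<bar>\<xi> l \<omega>\<bar> \<le> C l" by metis
    show "\<exists>C. \<forall>\<omega>\<in>space M. \<bar>refine N \<tau> \<xi> p i \<omega>\<bar> \<le> C"
    proof (intro exI[of _ "\<Sum>l<N. C l"] ballI)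
      fix \<omega> assume \<omega>: "\<omega> \<in> space M"
      have "\<bar>refine N \<tau> \<xi> p i \<omega>\<bar> \<le> (\<Sum>l<N. \<bar>\<xi> l \<omega> * indicator {\<tau> l<..\<tau> (Suc l)} (p (Suc i))\<bar>)"
        unfolding refine_def elementary_process_def by (rule sum_abs)
      also have "\<dots> \<le> (\<Sum>l<N. C l)"
      proof (rule sum_mono)
        fix l assume "l \<in> {..<N}"
        then show "\<bar>\<xi> l \<omega> * indicator {\<tau> l<..\<tau> (Suc l)} (p (Suc i))\<bar> \<le> C l"
          using C[of l, OF _ \<omega>] by (auto simp: indicator_def)
      qed
      finally show "\<bar>refine N \<tau> \<xi> p i \<omega>\<bar> \<le> (\<Sum>l<N. C l)" .
    qed
  qed
  then show ?thesis using p ends unfolding elementary_integrand_def partition_points_def by auto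
qed

lemma elementary_integrand_mult:
  assumes "elementary_integrand M F T N \<tau> x" "elementary_integrand M F T N \<tau> y"
  shows "elementary_integrand M F T N \<tau> (\<lambda>i \<omega>. x i \<omega> * y i \<omega>)"
proof -
  have "(\<lambda>\<omega>. x i \<omega> * y i \<omega>) \<in> borel_measurable (F (\<tau> i)) \<and> (\<exists>C. \<forall>\<omega>\<in>space M. \<bar>x i \<omega> * y i \<omega>\<bar> \<le> C)"
    if i: "i < N" for i
  proof
    show "(\<lambda>\<omega>. x i \<omega> * y i \<omega>) \<in> borel_measurable (F (\<tau> i))"
      using elementary_integrandD(3)[OF assms(1) i] elementary_integrandD(3)[OF assms(2) i] by simp
    obtain C C' where "\<forall>\<omega>\<in>space M. \<bar>x i \<omega>\<bar> \<le> C" "\<forall>\<omega>\<in>space M. \<bar>y i \<omega>\<bar> \<le> C'"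
      using elementary_integrandD(4)[OF assms(1) i] elementary_integrandD(4)[OF assms(2) i] by auto
    then show "\<exists>C. \<forall>\<omega>\<in>space M. \<bar>x i \<omega> * y i \<omega>\<bar> \<le> C"
      by (intro exI[of _ "\<bar>C\<bar> * \<bar>C'\<bar>"]) (force simp: abs_mult intro!: mult_mono)
  qed
  then show ?thesis using assms(1) unfolding elementary_integrand_def by auto
qed

lemma elementary_integrand_diff:
  assumes "elementary_integrand M F T N \<tau> x" "elementary_integrand M F T N \<tau> y"
  shows "elementary_integrand M F T N \<tau> (\<lambda>i \<omega>. x i \<omega> - y i \<omega>)"
proof -
  have "(\<lambda>\<omega>. x i \<omega> - y i \<omega>) \<in> borel_measurable (F (\<tau> i)) \<and> (\<exists>C. \<forall>\<omega>\<in>space M. \<bar>x i \<omega> - y i \<omega>\<bar> \<le> C)"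
    if i: "i < N" for i
  proof
    show "(\<lambda>\<omega>. x i \<omega> - y i \<omega>) \<in> borel_measurable (F (\<tau> i))"
      using elementary_integrandD(3)[OF assms(1) i] elementary_integrandD(3)[OF assms(2) i] by simp
    obtain C C' where "\<forall>\<omega>\<in>space M. \<bar>x i \<omega>\<bar> \<le> C" "\<forall>\<omega>\<in>space M. \<bar>y i \<omega>\<bar> \<le> C'"
      using elementary_integrandD(4)[OF assms(1) i] elementary_integrandD(4)[OF assms(2) i] by auto
    then show "\<exists>C. \<forall>\<omega>\<in>space M. \<bar>x i \<omega> - y i \<omega>\<bar> \<le> C"
      by (intro exI[of _ "C + C'"]) force
  qed
  then show ?thesis using assms(1) unfolding elementary_integrand_def by auto
qed

lemma elementary_integrand_indicator:
  assumes "elementary_integrand M F T N \<tau> x"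
  shows "elementary_integrand M F T N \<tau> (\<lambda>i \<omega>. indicator A (\<tau> (Suc i)) * x i \<omega>)"
proof -
  have "\<exists>C. \<forall>\<omega>\<in>space M. \<bar>indicator A (\<tau> (Suc i)) * x i \<omega>\<bar> \<le> C" if i: "i < N" for i
    using elementary_integrandD(4)[OF assms i] by (auto simp: indicator_def)
  then show ?thesis using assms unfolding elementary_integrand_def by auto
qed

text \<open>Chernoff's inequality for the exponential martingale of \<open>\<plusminus> (\<eta> / \<delta>) \<xi>\<close>.\<close>

lemma elementary_tail_bound:
  assumes el: "elementary_integrand M F T N \<tau> \<xi>" and "\<eta> > 0" "\<delta> > 0"
  shows "prob {\<omega> \<in> space M. \<eta> < \<bar>elementary_integral W N \<tau> \<xi> \<omega>\<bar> \<and> elementary_quad N \<tau> \<xi> \<omega> \<le> \<delta>}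
    \<le> 2 * exp (- \<eta>\<^sup>2 / (2 * \<delta>))"
proof -
  note [measurable] = elementary_integral_measurable[OF el]
  have one_side: "prob {\<omega> \<in> space M. \<eta> < s * elementary_integral W N \<tau> \<xi> \<omega> \<and> elementary_quad N \<tau> \<xi> \<omega> \<le> \<delta>}
    \<le> exp (- \<eta>\<^sup>2 / (2 * \<delta>))" if s: "s = 1 \<or> s = -1" for s :: real
  proof -
    \<comment> \<open>This value maximises \<open>u * \<eta> - u\<^sup>2 * \<delta> / 2\<close>, the
      exponent in Chernoff's bound.\<close>
    define u where "u = \<eta> / \<delta>"
    define Z where "Z \<omega> = exp (s * u * elementary_integral W N \<tau> \<xi> \<omega> - u\<^sup>2 * elementary_quad N \<tau> \<xi> \<omega> / 2)" for \<omega>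
    have s2: "s\<^sup>2 = 1" using s by auto
    have Z_eq: "Z = (\<lambda>\<omega>. 1 * exp (elementary_integral W N \<tau> (\<lambda>i \<omega>. s * u * \<xi> i \<omega>) \<omega>
        - elementary_quad N \<tau> (\<lambda>i \<omega>. s * u * \<xi> i \<omega>) \<omega> / 2))"
      unfolding Z_def[abs_def] elementary_integrand_cmult(2,3)[OF el] power_mult_distrib s2 by (simp only: mult_1)
    note E = expectation_exp_elementary[OF elementary_integrand_cmult(1)[OF el, of "s * u"], of "\<lambda>_. 1"]
    have Z: "integrable M Z" "expectation Z = 1"
      unfolding Z_eq using E prob_space by (simp_all only: borel_measurable_const integrable_const lebesgue_integral_const scaleR_one)
    have [measurable]: "Z \<in> borel_measurable M" using Z by auto
    have "{\<omega> \<in> space M. \<eta> < s * elementary_integral W N \<tau> \<xi> \<omega> \<and> elementary_quad N \<tau> \<xi> \<omega> \<le> \<delta>}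
      \<subseteq> {\<omega> \<in> space M. exp (\<eta>\<^sup>2 / (2 * \<delta>)) \<le> Z \<omega>}"
    proof safe
      fix \<omega> assume *: "\<eta> < s * elementary_integral W N \<tau> \<xi> \<omega>" "elementary_quad N \<tau> \<xi> \<omega> \<le> \<delta>"
      have "u > 0" using assms by (simp add: u_def)
      then have "u * \<eta> \<le> u * (s * elementary_integral W N \<tau> \<xi> \<omega>)" "u\<^sup>2 * elementary_quad N \<tau> \<xi> \<omega> \<le> u\<^sup>2 * \<delta>"
        using * by (auto intro!: mult_left_mono)
      moreover have "u * \<eta> - u\<^sup>2 * \<delta> / 2 = \<eta>\<^sup>2 / (2 * \<delta>)"
        using assms(3) by (simp add: u_def power2_eq_square field_simps)
      moreover have "u * (s * elementary_integral W N \<tau> \<xi> \<omega>) = s * u * elementary_integral W N \<tau> \<xi> \<omega>"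
        by simp
      ultimately have "\<eta>\<^sup>2 / (2 * \<delta>) \<le> s * u * elementary_integral W N \<tau> \<xi> \<omega> - u\<^sup>2 * elementary_quad N \<tau> \<xi> \<omega> / 2"
        by linarith
      then show "exp (\<eta>\<^sup>2 / (2 * \<delta>)) \<le> Z \<omega>" by (simp add: Z_def)
    qed
    then have "prob {\<omega> \<in> space M. \<eta> < s * elementary_integral W N \<tau> \<xi> \<omega> \<and> elementary_quad N \<tau> \<xi> \<omega> \<le> \<delta>}
      \<le> prob {\<omega> \<in> space M. exp (\<eta>\<^sup>2 / (2 * \<delta>)) \<le> Z \<omega>}"
      by (rule finite_measure_mono) measurable
    also have "\<dots> \<le> expectation Z / exp (\<eta>\<^sup>2 / (2 * \<delta>))"
      by (rule integral_Markov_inequality_measure[where A = "{}", OF Z(1)]) (simp_all add: Z_def)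
    also have "\<dots> = exp (- \<eta>\<^sup>2 / (2 * \<delta>))"
      unfolding Z(2) by (simp add: exp_minus field_simps)
    finally show ?thesis .
  qed
  have "{\<omega> \<in> space M. \<eta> < \<bar>elementary_integral W N \<tau> \<xi> \<omega>\<bar> \<and> elementary_quad N \<tau> \<xi> \<omega> \<le> \<delta>}
    \<subseteq> {\<omega> \<in> space M. \<eta> < 1 * elementary_integral W N \<tau> \<xi> \<omega> \<and> elementary_quad N \<tau> \<xi> \<omega> \<le> \<delta>}
    \<union> {\<omega> \<in> space M. \<eta> < -1 * elementary_integral W N \<tau> \<xi> \<omega> \<and> elementary_quad N \<tau> \<xi> \<omega> \<le> \<delta>}" by auto
  then have "prob {\<omega> \<in> space M. \<eta> < \<bar>elementary_integral W N \<tau> \<xi> \<omega>\<bar> \<and> elementary_quad N \<tau> \<xi> \<omega> \<le> \<delta>}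
    \<le> prob ({\<omega> \<in> space M. \<eta> < 1 * elementary_integral W N \<tau> \<xi> \<omega> \<and> elementary_quad N \<tau> \<xi> \<omega> \<le> \<delta>}
    \<union> {\<omega> \<in> space M. \<eta> < -1 * elementary_integral W N \<tau> \<xi> \<omega> \<and> elementary_quad N \<tau> \<xi> \<omega> \<le> \<delta>})"
    by (rule finite_measure_mono) measurable
  also have "\<dots> \<le> prob {\<omega> \<in> space M. \<eta> < 1 * elementary_integral W N \<tau> \<xi> \<omega> \<and> elementary_quad N \<tau> \<xi> \<omega> \<le> \<delta>}
    + prob {\<omega> \<in> space M. \<eta> < -1 * elementary_integral W N \<tau> \<xi> \<omega> \<and> elementary_quad N \<tau> \<xi> \<omega> \<le> \<delta>}"
    by (rule measure_Un_le) measurable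
  also have "\<dots> \<le> 2 * exp (- \<eta>\<^sup>2 / (2 * \<delta>))"
    using one_side[of 1] one_side[of "-1"] by simp
  finally show ?thesis .
qed

end

section \<open>Approximation of stochastic integrals\<close>

text \<open>
  Arbitrary exceptional sets \<open>A\<close> replace the superlevel sets of \<^const>\<open>has_ito_integral\<close>, so that
  measurability of the latter (\<^const>\<open>measure\<close> is \<open>0\<close> on nonmeasurable sets) matters only once.
\<close>

definition ito_approx ::
    "'a measure \<Rightarrow> (real \<Rightarrow> 'a measure) \<Rightarrow> (real \<Rightarrow> 'a \<Rightarrow> real) \<Rightarrow> (real \<Rightarrow> 'a \<Rightarrow> real) \<Rightarrow> real
      \<Rightarrow> ('a \<Rightarrow> real) \<Rightarrow> bool" where
  "ito_approx M F W H T J \<longleftrightarrow> J \<in> borel_measurable M \<and>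
     (\<forall>\<epsilon>>0. \<exists>N \<tau> \<xi> A. elementary_integrand M F T N \<tau> \<xi> \<and> A \<in> sets M \<and> measure M A < \<epsilon> \<and>
        (\<forall>\<omega>\<in>space M - A.
           (\<integral>\<^sup>+ s\<in>{0..T}. ennreal ((elementary_process N \<tau> \<xi> s \<omega> - H s \<omega>)\<^sup>2) \<partial>lborel) \<le> ennreal \<epsilon> \<and>
           \<bar>elementary_integral W N \<tau> \<xi> \<omega> - J \<omega>\<bar> \<le> \<epsilon>))"

lemma ito_approxE:
  assumes "ito_approx M F W H T J" "\<epsilon> > 0"
  obtains N \<tau> \<xi> A where "elementary_integrand M F T N \<tau> \<xi>" "A \<in> sets M" "measure M A < \<epsilon>"
    "\<And>\<omega>. \<omega> \<in> space M - A \<Longrightarrow>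
      (\<integral>\<^sup>+ s\<in>{0..T}. ennreal ((elementary_process N \<tau> \<xi> s \<omega> - H s \<omega>)\<^sup>2) \<partial>lborel) \<le> ennreal \<epsilon>"
    "\<And>\<omega>. \<omega> \<in> space M - A \<Longrightarrow> \<bar>elementary_integral W N \<tau> \<xi> \<omega> - J \<omega>\<bar> \<le> \<epsilon>"
  using assms(1)[unfolded ito_approx_def, THEN conjunct2, rule_format, OF assms(2)]
  by (elim exE conjE) (rule that, assumption+, blast, blast)

text \<open>From \<open>2 * f * g \<le> \<eta> * f\<^sup>2 + g\<^sup>2 / \<eta>\<close>. The choice
  \<open>\<eta> = 1\<close> serves for rough estimates, while letting \<open>\<eta>\<close> tend to
  0 gives convergence of squared norms without square roots.\<close>

lemma set_nn_integral_square_add: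
  fixes f g :: "real \<Rightarrow> real"
  assumes f: "set_borel_measurable borel A f" and g: "set_borel_measurable borel A g" and \<eta>: "\<eta> > 0"
  shows "(\<integral>\<^sup>+ s\<in>A. ennreal ((f s + g s)\<^sup>2) \<partial>lborel)
    \<le> ennreal (1 + \<eta>) * (\<integral>\<^sup>+ s\<in>A. ennreal ((f s)\<^sup>2) \<partial>lborel) + ennreal (1 + 1 / \<eta>) * (\<integral>\<^sup>+ s\<in>A. ennreal ((g s)\<^sup>2) \<partial>lborel)"
proof -
  define f' where "f' = (\<lambda>s. indicator A s *\<^sub>R f s)"
  define g' where "g' = (\<lambda>s. indicator A s *\<^sub>R g s)"
  have [measurable]: "f' \<in> borel_measurable borel" "g' \<in> borel_measurable borel"
    using f g by (simp_all add: set_borel_measurable_def f'_def g'_def)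
  have le: "(f' s + g' s)\<^sup>2 \<le> (1 + \<eta>) * (f' s)\<^sup>2 + (1 + 1 / \<eta>) * (g' s)\<^sup>2" for s
  proof -
    have "0 \<le> (\<eta> * f' s - g' s)\<^sup>2 / \<eta>" using \<eta> by simp
    also have "\<dots> = \<eta> * (f' s)\<^sup>2 + (g' s)\<^sup>2 / \<eta> - 2 * f' s * g' s"
      using \<eta> by (simp add: field_simps power2_eq_square)
    finally show ?thesis by (simp add: power2_eq_square algebra_simps)
  qed
  have "(\<integral>\<^sup>+ s\<in>A. ennreal ((f s + g s)\<^sup>2) \<partial>lborel) = (\<integral>\<^sup>+ s. ennreal ((f' s + g' s)\<^sup>2) \<partial>lborel)"
    by (intro nn_integral_cong) (auto simp: f'_def g'_def indicator_def)
  also have "\<dots> \<le> (\<integral>\<^sup>+ s. ennreal (1 + \<eta>) * ennreal ((f' s)\<^sup>2) + ennreal (1 + 1 / \<eta>) * ennreal ((g' s)\<^sup>2) \<partial>lborel)"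
    using \<eta> le by (intro nn_integral_mono) (simp add: ennreal_mult'[symmetric] ennreal_plus[symmetric] del: ennreal_plus)
  also have "\<dots> = ennreal (1 + \<eta>) * (\<integral>\<^sup>+ s. ennreal ((f' s)\<^sup>2) \<partial>lborel) + ennreal (1 + 1 / \<eta>) * (\<integral>\<^sup>+ s. ennreal ((g' s)\<^sup>2) \<partial>lborel)"
    by (simp add: nn_integral_add nn_integral_cmult)
  also have "(\<integral>\<^sup>+ s. ennreal ((f' s)\<^sup>2) \<partial>lborel) = (\<integral>\<^sup>+ s\<in>A. ennreal ((f s)\<^sup>2) \<partial>lborel)"
    by (intro nn_integral_cong) (auto simp: f'_def indicator_def)
  also have "(\<integral>\<^sup>+ s. ennreal ((g' s)\<^sup>2) \<partial>lborel) = (\<integral>\<^sup>+ s\<in>A. ennreal ((g s)\<^sup>2) \<partial>lborel)"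
    by (intro nn_integral_cong) (auto simp: g'_def indicator_def)
  finally show ?thesis .
qed

lemma set_nn_integral_square_cmult:
  fixes f :: "real \<Rightarrow> real"
  assumes "set_borel_measurable borel A f"
  shows "(\<integral>\<^sup>+ s\<in>A. ennreal ((c * f s)\<^sup>2) \<partial>lborel) = ennreal (c\<^sup>2) * (\<integral>\<^sup>+ s\<in>A. ennreal ((f s)\<^sup>2) \<partial>lborel)"
proof -
  have [measurable]: "(\<lambda>s. indicator A s *\<^sub>R f s) \<in> borel_measurable borel"
    using assms by (simp add: set_borel_measurable_def)
  have "(\<integral>\<^sup>+ s\<in>A. ennreal ((c * f s)\<^sup>2) \<partial>lborel) = (\<integral>\<^sup>+ s. ennreal (c\<^sup>2) * ennreal ((indicator A s *\<^sub>R f s)\<^sup>2) \<partial>lborel)"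
    by (intro nn_integral_cong) (auto simp: indicator_def ennreal_mult' power_mult_distrib)
  also have "\<dots> = ennreal (c\<^sup>2) * (\<integral>\<^sup>+ s. ennreal ((indicator A s *\<^sub>R f s)\<^sup>2) \<partial>lborel)"
    by (rule nn_integral_cmult) measurable
  also have "(\<integral>\<^sup>+ s. ennreal ((indicator A s *\<^sub>R f s)\<^sup>2) \<partial>lborel) = (\<integral>\<^sup>+ s\<in>A. ennreal ((f s)\<^sup>2) \<partial>lborel)"
    by (intro nn_integral_cong) (auto simp: indicator_def)
  finally show ?thesis .
qed

lemma set_borel_measurable_elementary:
  assumes "A \<in> sets borel"
  shows "set_borel_measurable borel A (\<lambda>s. elementary_process N \<tau> \<xi> s \<omega>)"
  unfolding set_borel_measurable_def using assms by measurable

lemma set_borel_measurable_continuous_on: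
  fixes f :: "real \<Rightarrow> real"
  assumes "A \<in> sets borel" "continuous_on A f"
  shows "set_borel_measurable borel A f"
  unfolding set_borel_measurable_def by (rule borel_measurable_continuous_on_indicator[OF assms])

lemma set_borel_measurable_diff':
  fixes f g :: "real \<Rightarrow> real"
  assumes "set_borel_measurable borel A f" "set_borel_measurable borel A g"
  shows "set_borel_measurable borel A (\<lambda>s. f s - g s)"
  using borel_measurable_diff[OF assms[unfolded set_borel_measurable_def]]
  by (simp add: set_borel_measurable_def right_diff_distrib)

lemma set_borel_measurable_cmult:
  fixes f :: "real \<Rightarrow> real"
  assumes "set_borel_measurable borel A f"
  shows "set_borel_measurable borel A (\<lambda>s. c * f s)"
  using borel_measurable_times[OF borel_measurable_const[of c] assms[unfolded set_borel_measurable_def]]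
  by (simp add: set_borel_measurable_def mult.left_commute)

lemma elementary_process_indicator:
  assumes p: "partition_points N p" and u: "u \<in> p ` {..N}"
  shows "elementary_process N p (\<lambda>i \<omega>. indicator {..u} (p (Suc i)) * x i \<omega>) s \<omega>
    = indicator {..u} s * elementary_process N p x s \<omega>"
proof (cases "s \<in> {p 0<..p N}")
  case True
  then obtain i where i: "i < N" "s \<in> {p i<..p (Suc i)}"
    using partition_points_exists[OF p] by blast
  have "p (Suc i) \<le> u \<longleftrightarrow> s \<le> u"
  proof
    assume "s \<le> u"
    from u obtain k where k: "k \<le> N" "u = p k" by auto
    then have "i < k" using partition_points_less[OF p, of i k] i \<open>s \<le> u\<close> by auto
    then show "p (Suc i) \<le> u" using k partition_points_mono[OF p, of "Suc i" k] by auto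
  qed (use i in auto)
  then show ?thesis by (simp add: elementary_process_eq[OF p i] indicator_def)
qed (simp add: elementary_process_outside[OF p])

lemma elementary_integral_refine:
  assumes \<tau>: "partition_points N \<tau>" and p: "partition_points N' p" and sub: "\<tau> ` {..N} \<subseteq> p ` {..N'}"
  shows "elementary_integral W N' p (refine N \<tau> \<xi> p) \<omega> = elementary_integral W N \<tau> \<xi> \<omega>"
proof -
  have u: "p N' \<in> p ` {..N'}" by auto
  have "\<tau> N \<le> p N'" using sub partition_points_mono[OF p, of _ N'] by auto
  then have "elementary_integral W N \<tau> \<xi> \<omega>
      = elementary_integral W N' p (\<lambda>i \<omega>. indicator {..p N'} (p (Suc i)) * refine N \<tau> \<xi> p i \<omega>) \<omega>"
    by (simp only: elementary_integral_refine_upto[OF \<tau> p sub u] elementary_integral_upto_end[OF \<tau>])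
  also have "\<dots> = elementary_integral W N' p (refine N \<tau> \<xi> p) \<omega>"
    unfolding elementary_integral_def
    using partition_points_mono[OF p, of _ N'] by (intro sum.cong) auto
  finally show ?thesis by simp
qed

lemma partition_points_cover:
  assumes "finite A" "A \<subseteq> {0..T}" "0 \<le> T"
  obtains n p where "partition_points n p" "A \<subseteq> p ` {..n}" "p 0 = 0" "p n = T"
proof -
  let ?S = "insert 0 (insert T A)"
  have 1: "finite ?S" "?S \<noteq> {}" using assms(1) by simp_all
  obtain n p where p: "partition_points n p" "p ` {..n} = ?S" "p 0 = Min ?S" "p n = Max ?S"
    using partition_points_of_finite[OF 1] by blast
  have "Min ?S = 0" by (rule Min_eqI) (use assms in auto)
  moreover have "Max ?S = T" by (rule Max_eqI) (use assms in auto)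
  ultimately show ?thesis using p by (intro that[of n p]) (simp_all, blast)
qed

lemma small_tail_exists:
  fixes \<eta> :: real
  assumes "\<eta> > 0"
  shows "\<exists>\<delta>>0. 2 * exp (- \<eta>\<^sup>2 / (2 * \<delta>)) < \<eta>"
proof -
  \<comment> \<open>The exponent will equal \<open>- L\<close>. The first entry of the maximum keeps
    \<open>L\<close> positive, and the extra 1 in the second makes the inequality strict.\<close>
  define L where "L = max 1 (1 - ln (\<eta> / 2))"
  have "L > 0" by (simp add: L_def)
  define \<delta> where "\<delta> = \<eta>\<^sup>2 / (2 * L)"
  have "\<delta> > 0" using assms \<open>L > 0\<close> by (simp add: \<delta>_def)
  have "- \<eta>\<^sup>2 / (2 * \<delta>) = - L" using assms \<open>L > 0\<close> by (simp add: \<delta>_def)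
  moreover have "exp (- L) < exp (ln (\<eta> / 2))" by (simp add: L_def max_def)
  ultimately have "2 * exp (- \<eta>\<^sup>2 / (2 * \<delta>)) < \<eta>" using assms by simp
  with \<open>\<delta> > 0\<close> show ?thesis by blast
qed

section \<open>From convergence in probability to uniqueness of the integral\<close>

context brownian
begin

lemma has_ito_integral_imp_approx:
  assumes "has_ito_integral M F W H T J" "0 \<le> T"
  shows "ito_approx M F W H T J"
  unfolding ito_approx_def
proof (intro conjI allI impI)
  show J[measurable]: "J \<in> borel_measurable M" using assms by (simp add: has_ito_integral_def)
  fix \<epsilon> :: real assume \<epsilon>: "\<epsilon> > 0"
  have H: "(\<lambda>(s, \<omega>). H s \<omega>) \<in> borel_measurable (restrict_space borel {0..T} \<Otimes>\<^sub>M F T)"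
    using assms by (auto simp: has_ito_integral_def)
  obtain N \<tau> \<xi> where el: "\<And>n. elementary_integrand M F T (N n) (\<tau> n) (\<xi> n)"
    and c1: "\<And>\<epsilon>. \<epsilon> > 0 \<Longrightarrow> (\<lambda>n. prob {\<omega> \<in> space M. ennreal \<epsilon> <
            (\<integral>\<^sup>+ s\<in>{0..T}. ennreal ((elementary_process (N n) (\<tau> n) (\<xi> n) s \<omega> - H s \<omega>)\<^sup>2) \<partial>lborel)})
          \<longlonglongrightarrow> 0"
    and c2: "\<And>\<epsilon>. \<epsilon> > 0 \<Longrightarrow> (\<lambda>n. prob {\<omega> \<in> space M.
            \<epsilon> < \<bar>elementary_integral W (N n) (\<tau> n) (\<xi> n) \<omega> - J \<omega>\<bar>}) \<longlonglongrightarrow> 0"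
    using assms unfolding has_ito_integral_def by blast
  define A1 where "A1 n = {\<omega> \<in> space M. ennreal \<epsilon> <
            (\<integral>\<^sup>+ s\<in>{0..T}. ennreal ((elementary_process (N n) (\<tau> n) (\<xi> n) s \<omega> - H s \<omega>)\<^sup>2) \<partial>lborel)}" for n
  define A2 where "A2 n = {\<omega> \<in> space M. \<epsilon> < \<bar>elementary_integral W (N n) (\<tau> n) (\<xi> n) \<omega> - J \<omega>\<bar>}" for n
  have "eventually (\<lambda>n. prob (A1 n) < \<epsilon> / 2) sequentially" "eventually (\<lambda>n. prob (A2 n) < \<epsilon> / 2) sequentially"
    using order_tendstoD(2)[OF c1[OF \<epsilon>], of "\<epsilon> / 2"] order_tendstoD(2)[OF c2[OF \<epsilon>], of "\<epsilon> / 2"] \<epsilon>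
    by (simp_all add: A1_def A2_def)
  then have "eventually (\<lambda>n. prob (A1 n) < \<epsilon> / 2 \<and> prob (A2 n) < \<epsilon> / 2) sequentially"
    by (rule eventually_conj)
  then obtain n where n: "prob (A1 n) < \<epsilon> / 2" "prob (A2 n) < \<epsilon> / 2"
    by (auto simp: eventually_sequentially)
  note [measurable] = elementary_integral_measurable(1)[OF el]
  have A2[measurable]: "A2 n \<in> events" unfolding A2_def by measurable
  \<comment> \<open>Here progressive measurability at time \<open>T\<close> enters: it makes the
    inner time integral a measurable function of the path. Otherwise the vanishing of
    \<open>prob (A1 n)\<close> could be an artefact of a nonmeasurable set.\<close>
  have A1: "A1 n \<in> events"
  proof -
    let ?R = "restrict_space lborel {0..T}"
    interpret R: sigma_finite_measure ?R
      by (rule sigma_finite_measure_restrict_space[OF lborel.sigma_finite_measure_axioms]) simp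
    have E: "(\<lambda>(s, \<omega>). elementary_process (N n) (\<tau> n) (\<xi> n) s \<omega>) \<in> borel_measurable (restrict_space borel {0..T} \<Otimes>\<^sub>M F T)"
    proof -
      have 1: "\<xi> n i \<in> borel_measurable (F T)" if "i < N n" for i
        by (rule F_mono[OF elementary_integrandD(3)[OF el that]], rule elementary_range(2)[OF el]) (use that in simp)
      have 2: "(\<lambda>s. indicator {a<..b} s :: real) \<in> borel_measurable (restrict_space borel {0..T})" for a b :: real
        by (rule measurable_restrict_space1) simp
      show ?thesis unfolding elementary_process_def split_beta
        by (intro borel_measurable_sum borel_measurable_times measurable_compose[OF measurable_snd 1]
            measurable_compose[OF measurable_fst 2]) simp
    qed
    have "(\<lambda>(s, \<omega>). ennreal ((elementary_process (N n) (\<tau> n) (\<xi> n) s \<omega> - H s \<omega>)\<^sup>2))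
      \<in> borel_measurable (restrict_space borel {0..T} \<Otimes>\<^sub>M F T)"
      using borel_measurable_power[OF borel_measurable_diff[OF E H], of 2, THEN measurable_compose, OF measurable_ennreal]
      by (simp add: split_beta)
    then have "(\<lambda>(\<omega>, s). ennreal ((elementary_process (N n) (\<tau> n) (\<xi> n) s \<omega> - H s \<omega>)\<^sup>2))
      \<in> borel_measurable (F T \<Otimes>\<^sub>M restrict_space borel {0..T})"
      by (subst measurable_pair_swap_iff) (simp add: split_beta)
    also have "sets (F T \<Otimes>\<^sub>M restrict_space borel {0..T}) = sets (F T \<Otimes>\<^sub>M ?R)"
      by (intro sets_pair_measure_cong refl sets_restrict_space_cong) simp
    then have "borel_measurable (F T \<Otimes>\<^sub>M restrict_space borel {0..T}) = borel_measurable (F T \<Otimes>\<^sub>M ?R)"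
      by (intro measurable_cong_sets refl)
    finally have "(\<lambda>\<omega>. \<integral>\<^sup>+ s. ennreal ((elementary_process (N n) (\<tau> n) (\<xi> n) s \<omega> - H s \<omega>)\<^sup>2) \<partial>?R) \<in> borel_measurable (F T)"
      by (rule R.borel_measurable_nn_integral)
    then have [measurable]: "(\<lambda>\<omega>. \<integral>\<^sup>+ s. ennreal ((elementary_process (N n) (\<tau> n) (\<xi> n) s \<omega> - H s \<omega>)\<^sup>2) \<partial>?R) \<in> borel_measurable M"
      by (rule F_imp_M)
    have "A1 n = {\<omega> \<in> space M. ennreal \<epsilon> < (\<integral>\<^sup>+ s. ennreal ((elementary_process (N n) (\<tau> n) (\<xi> n) s \<omega> - H s \<omega>)\<^sup>2) \<partial>?R)}"
      unfolding A1_def by (subst nn_integral_restrict_space) auto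
    then show ?thesis by simp
  qed
  have "prob (A1 n \<union> A2 n) \<le> prob (A1 n) + prob (A2 n)"
    by (rule measure_Un_le) (use A1 A2 in auto)
  then have "prob (A1 n \<union> A2 n) < \<epsilon>" using n by simp
  then show "\<exists>N \<tau> \<xi> A. elementary_integrand M F T N \<tau> \<xi> \<and> A \<in> sets M \<and> measure M A < \<epsilon> \<and>
        (\<forall>\<omega>\<in>space M - A.
           (\<integral>\<^sup>+ s\<in>{0..T}. ennreal ((elementary_process N \<tau> \<xi> s \<omega> - H s \<omega>)\<^sup>2) \<partial>lborel) \<le> ennreal \<epsilon> \<and>
           \<bar>elementary_integral W N \<tau> \<xi> \<omega> - J \<omega>\<bar> \<le> \<epsilon>)"
    using A1 A2 el by (intro exI[of _ "N n"] exI[of _ "\<tau> n"] exI[of _ "\<xi> n"] exI[of _ "A1 n \<union> A2 n"])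
      (auto simp: A1_def A2_def not_less)
qed

lemma exceptional_sets_AE:
  assumes "\<And>n::nat. B n \<in> events" "\<And>n. prob (B n) \<le> (1/2)^n"
  shows "AE \<omega> in M. eventually (\<lambda>n. \<omega> \<notin> B n) sequentially"
proof -
  have "AE \<omega> in M. eventually (\<lambda>n. \<omega> \<in> space M - B n) sequentially"
  proof (rule borel_cantelli_AE1)
    show "summable (\<lambda>n. prob (B n))"
    proof (rule summable_comparison_test')
      show "summable (\<lambda>n. (1/2::real) ^ n)" by (rule summable_geometric) simp
      show "norm (prob (B n)) \<le> (1/2) ^ n" for n using assms(2)[of n] by simp
    qed
  qed (use assms in \<open>simp_all add: emeasure_eq_measure\<close>)
  then show ?thesis by eventually_elim (auto elim: eventually_mono)
qed

text \<open>Taking \<open>\<eta> = (1/2)^n\<close> makes the probabilities of the exceptional sets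
  summable. By Borel-Cantelli almost every path leaves them eventually.\<close>

lemma AE_zero_of_small_exceptions:
  assumes "\<And>\<eta>::real. \<eta> > 0 \<Longrightarrow> \<exists>B\<in>events. prob B < \<eta> \<and> (\<forall>\<omega>\<in>space M - B. \<bar>f \<omega>\<bar> \<le> \<eta>)"
  shows "AE \<omega> in M. f \<omega> = (0 :: real)"
proof -
  have "\<forall>n::nat. \<exists>B\<in>events. prob B < (1/2)^n \<and> (\<forall>\<omega>\<in>space M - B. \<bar>f \<omega>\<bar> \<le> (1/2)^n)"
    using assms by auto
  then obtain B where B: "\<And>n. B n \<in> events" "\<And>n. prob (B n) < (1/2)^n"
    "\<And>n \<omega>. \<omega> \<in> space M - B n \<Longrightarrow> \<bar>f \<omega>\<bar> \<le> (1/2)^n" by metis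
  have "AE \<omega> in M. eventually (\<lambda>n. \<omega> \<notin> B n) sequentially"
    by (rule exceptional_sets_AE) (use B in \<open>auto intro: less_imp_le\<close>)
  then show ?thesis
  proof (rule AE_mp, intro AE_I2 impI)
    fix \<omega> assume \<omega>: "\<omega> \<in> space M" "eventually (\<lambda>n. \<omega> \<notin> B n) sequentially"
    then have "eventually (\<lambda>n. \<bar>f \<omega>\<bar> \<le> (1/2)^n) sequentially"
      using B(3) by (auto elim: eventually_mono)
    moreover have "(\<lambda>n. (1/2::real)^n) \<longlonglongrightarrow> 0" by (rule LIMSEQ_power_zero) simp
    ultimately have "\<bar>f \<omega>\<bar> \<le> 0" by (intro tendsto_le[OF _ _ tendsto_const]) auto
    then show "f \<omega> = 0" by simp
  qed
qed

text \<open>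
  The difference of two approximations is elementary, so \<open>elementary_tail_bound\<close> applies to it and
  no square integrability of \<open>H\<close> is needed.
\<close>

lemma ito_approx_close:
  assumes u: "0 \<le> u" "u \<le> T"
    and H: "\<And>\<omega>. \<omega> \<in> space M \<Longrightarrow> continuous_on {0..u} (\<lambda>s. H s \<omega>)"
    and ia: "ito_approx M F W (\<lambda>s \<omega>. c * H s \<omega>) u J" and \<eta>: "\<eta> > 0"
  obtains \<epsilon> where "\<epsilon> > 0" "\<And>N \<tau> \<xi> A. elementary_integrand M F T N \<tau> \<xi> \<Longrightarrow>
    (\<And>\<omega>. \<omega> \<in> space M - A \<Longrightarrow>
      (\<integral>\<^sup>+ s\<in>{0..u}. ennreal ((elementary_process N \<tau> \<xi> s \<omega> - H s \<omega>)\<^sup>2) \<partial>lborel) \<le> ennreal \<epsilon>) \<Longrightarrow>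
    \<exists>A'\<in>events. prob A' < \<eta> \<and>
       (\<forall>\<omega>\<in>space M - (A \<union> A'). \<bar>c * elementary_integral_upto W N \<tau> \<xi> u \<omega> - J \<omega>\<bar> \<le> \<eta>)"
proof -
  obtain \<delta> where \<delta>: "\<delta> > 0" "2 * exp (- (\<eta> / 2)\<^sup>2 / (2 * \<delta>)) < \<eta> / 2"
    using small_tail_exists[of "\<eta> / 2"] \<eta> by auto
  \<comment> \<open>The quadratic variation of the difference will be at most
    \<open>2 * (c\<^sup>2 * \<epsilon>) + 2 * (\<delta> / 4)\<close>; this choice keeps it below
    \<open>\<delta>\<close>. Adding 1 to \<open>c\<^sup>2\<close> covers
    \<open>c = 0\<close>.\<close>
  define \<epsilon> where "\<epsilon> = \<delta> / (4 * (c\<^sup>2 + 1))"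
  have c1: "c\<^sup>2 + 1 > 0" by (simp add: add_nonneg_pos)
  then have \<epsilon>: "\<epsilon> > 0" "c\<^sup>2 * \<epsilon> \<le> \<delta> / 4"
    using \<delta>(1) by (simp_all add: \<epsilon>_def divide_simps)
  obtain N' \<tau>' \<xi>' A2 where K': "elementary_integrand M F u N' \<tau>' \<xi>'" "A2 \<in> events" "prob A2 < min (\<eta> / 2) (\<delta> / 4)"
    "\<And>\<omega>. \<omega> \<in> space M - A2 \<Longrightarrow>
      (\<integral>\<^sup>+ s\<in>{0..u}. ennreal ((elementary_process N' \<tau>' \<xi>' s \<omega> - c * H s \<omega>)\<^sup>2) \<partial>lborel) \<le> ennreal (min (\<eta> / 2) (\<delta> / 4))"
    "\<And>\<omega>. \<omega> \<in> space M - A2 \<Longrightarrow> \<bar>elementary_integral W N' \<tau>' \<xi>' \<omega> - J \<omega>\<bar> \<le> min (\<eta> / 2) (\<delta> / 4)"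
    using ito_approxE[OF ia, of "min (\<eta> / 2) (\<delta> / 4)" thesis] \<delta>(1) \<eta> by simp
  show ?thesis
  proof (rule that[of \<epsilon>])
    show "\<epsilon> > 0" by fact
    fix N \<tau> \<xi> A assume el: "elementary_integrand M F T N \<tau> \<xi>"
      and close: "\<And>\<omega>. \<omega> \<in> space M - A \<Longrightarrow>
        (\<integral>\<^sup>+ s\<in>{0..u}. ennreal ((elementary_process N \<tau> \<xi> s \<omega> - H s \<omega>)\<^sup>2) \<partial>lborel) \<le> ennreal \<epsilon>"
    have "finite (\<tau> ` {..N} \<union> \<tau>' ` {..N'} \<union> {u})" by simp
    moreover have "\<tau>' i \<le> T" if "i \<le> N'" for i
      using elementary_range(2)[OF K'(1) that] u(2) by (rule order_trans)
    then have "\<tau> ` {..N} \<union> \<tau>' ` {..N'} \<union> {u} \<subseteq> {0..T}"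
      using elementary_range[OF el] elementary_range(1)[OF K'(1)] u by auto
    ultimately obtain n p where p: "partition_points n p" "\<tau> ` {..N} \<union> \<tau>' ` {..N'} \<union> {u} \<subseteq> p ` {..n}" "p 0 = 0" "p n = T"
      using partition_points_cover[of "\<tau> ` {..N} \<union> \<tau>' ` {..N'} \<union> {u}" T thesis] order_trans[OF u] by simp
    have sub: "\<tau> ` {..N} \<subseteq> p ` {..n}" "\<tau>' ` {..N'} \<subseteq> p ` {..n}" and up: "u \<in> p ` {..n}"
      using p(2) by auto
    note \<tau> = elementary_partition[OF el] and \<tau>' = elementary_partition[OF K'(1)]
    \<comment> \<open>On a common refinement, the scaled approximation stopped at \<open>u\<close>
      minus the approximation of the scaled integrand is a single elementary integrand, to which the
      tail bound applies.\<close>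
    define d where "d = (\<lambda>i \<omega>. c * (indicator {..u} (p (Suc i)) * refine N \<tau> \<xi> p i \<omega>) - refine N' \<tau>' \<xi>' p i \<omega>)"
    have d: "elementary_integrand M F T n p d"
      unfolding d_def
      by (intro elementary_integrand_diff elementary_integrand_cmult elementary_integrand_indicator
          elementary_integrand_refine[OF el p(1) sub(1) p(3,4)] elementary_integrand_refine[OF K'(1) p(1) sub(2) p(3,4)])
    have Id: "elementary_integral W n p d \<omega> = c * elementary_integral_upto W N \<tau> \<xi> u \<omega> - elementary_integral W N' \<tau>' \<xi>' \<omega>" for \<omega>
      unfolding elementary_integral_refine[OF \<tau>' p(1) sub(2), symmetric] elementary_integral_refine_upto[OF \<tau> p(1) sub(1) up, symmetric]
      by (simp only: d_def elementary_integral_def left_diff_distrib sum_subtractf sum_distrib_left mult.assoc)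
    have Pd: "elementary_process n p d s \<omega> = c * (indicator {..u} s * elementary_process N \<tau> \<xi> s \<omega>) - elementary_process N' \<tau>' \<xi>' s \<omega>" for s \<omega>
      unfolding elementary_process_refine[OF \<tau> p(1) sub(1), symmetric] elementary_process_refine[OF \<tau>' p(1) sub(2), symmetric]
        elementary_process_indicator[OF p(1) up, symmetric]
      by (simp only: d_def elementary_process_def left_diff_distrib sum_subtractf sum_distrib_left mult.assoc)
    have Q: "elementary_quad n p d \<omega> \<le> \<delta>" if \<omega>: "\<omega> \<in> space M - (A \<union> A2)" for \<omega>
    proof -
      have Hm: "set_borel_measurable borel {0..u} (\<lambda>s. H s \<omega>)"
        using \<omega> by (intro set_borel_measurable_continuous_on H) auto
      note Em = set_borel_measurable_elementary[of "{0..u}"]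
      have "ennreal (elementary_quad n p d \<omega>) = (\<integral>\<^sup>+ s\<in>{0..T}. ennreal ((elementary_process n p d s \<omega>)\<^sup>2) \<partial>lborel)"
        using nn_integral_elementary_process[OF p(1), of d \<omega>] by (simp add: p)
      also have "\<dots> = (\<integral>\<^sup>+ s\<in>{0..u}. ennreal ((c * (elementary_process N \<tau> \<xi> s \<omega> - H s \<omega>) + (-1) * (elementary_process N' \<tau>' \<xi>' s \<omega> - c * H s \<omega>))\<^sup>2) \<partial>lborel)"
      proof (rule nn_integral_cong)
        fix s :: real
        have "elementary_process N' \<tau>' \<xi>' s \<omega> = 0" if "s > u"
          using K'(1) that by (intro elementary_process_outside[OF \<tau>']) (auto simp: elementary_integrand_def)
        then show "ennreal ((elementary_process n p d s \<omega>)\<^sup>2) * indicator {0..T} s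
          = ennreal ((c * (elementary_process N \<tau> \<xi> s \<omega> - H s \<omega>) + (-1) * (elementary_process N' \<tau>' \<xi>' s \<omega> - c * H s \<omega>))\<^sup>2) * indicator {0..u} s"
          using u unfolding Pd by (auto simp: indicator_def algebra_simps)
      qed
      also have "\<dots> \<le> ennreal (1 + 1) * (\<integral>\<^sup>+ s\<in>{0..u}. ennreal ((c * (elementary_process N \<tau> \<xi> s \<omega> - H s \<omega>))\<^sup>2) \<partial>lborel)
        + ennreal (1 + 1 / 1) * (\<integral>\<^sup>+ s\<in>{0..u}. ennreal (((-1) * (elementary_process N' \<tau>' \<xi>' s \<omega> - c * H s \<omega>))\<^sup>2) \<partial>lborel)"
        by (intro set_nn_integral_square_add set_borel_measurable_cmult set_borel_measurable_diff' Em Hm) auto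
      also have "\<dots> = 2 * (ennreal (c\<^sup>2) * (\<integral>\<^sup>+ s\<in>{0..u}. ennreal ((elementary_process N \<tau> \<xi> s \<omega> - H s \<omega>)\<^sup>2) \<partial>lborel))
        + 2 * (\<integral>\<^sup>+ s\<in>{0..u}. ennreal ((elementary_process N' \<tau>' \<xi>' s \<omega> - c * H s \<omega>)\<^sup>2) \<partial>lborel)"
        by (subst (1 2) set_nn_integral_square_cmult)
           (auto intro!: set_borel_measurable_cmult set_borel_measurable_diff' Em Hm)
      also have "\<dots> \<le> 2 * (ennreal (c\<^sup>2) * ennreal \<epsilon>) + 2 * ennreal (\<delta> / 4)"
      proof (intro add_mono mult_left_mono)
        show "(\<integral>\<^sup>+ s\<in>{0..u}. ennreal ((elementary_process N' \<tau>' \<xi>' s \<omega> - c * H s \<omega>)\<^sup>2) \<partial>lborel) \<le> ennreal (\<delta> / 4)"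
          using K'(4)[of \<omega>] \<omega> by (auto intro: order_trans[OF _ ennreal_leI])
      qed (use close \<omega> in auto)
      also have "\<dots> = ennreal (2 * (c\<^sup>2 * \<epsilon>) + 2 * (\<delta> / 4))"
      proof -
        have two: "(2 :: ennreal) = ennreal 2" by simp
        show ?thesis
          using \<epsilon>(1) \<delta>(1) unfolding two
          by (simp add: ennreal_mult[symmetric] ennreal_plus[symmetric] del: ennreal_plus ennreal_numeral)
      qed
      also have "\<dots> \<le> ennreal \<delta>" using \<epsilon> by (intro ennreal_leI) simp
      finally show ?thesis using \<delta>(1) by (simp add: ennreal_le_iff)
    qed
    define A3 where "A3 = {\<omega> \<in> space M. \<eta> / 2 < \<bar>elementary_integral W n p d \<omega>\<bar> \<and> elementary_quad n p d \<omega> \<le> \<delta>}"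
    have A3: "A3 \<in> events" unfolding A3_def using elementary_integral_measurable[OF d] by measurable
    have "prob A3 < \<eta> / 2"
      using elementary_tail_bound[OF d, of "\<eta> / 2" \<delta>] \<eta> \<delta> by (simp add: A3_def)
    moreover have "prob (A2 \<union> A3) \<le> prob A2 + prob A3"
      by (rule measure_Un_le) (use A3 K' in auto)
    ultimately have "prob (A2 \<union> A3) < \<eta>" using K'(3) by auto
    moreover have "\<bar>c * elementary_integral_upto W N \<tau> \<xi> u \<omega> - J \<omega>\<bar> \<le> \<eta>" if \<omega>: "\<omega> \<in> space M - (A \<union> (A2 \<union> A3))" for \<omega>
    proof -
      have "\<bar>elementary_integral W n p d \<omega>\<bar> \<le> \<eta> / 2" using \<omega> Q[of \<omega>] by (auto simp: A3_def not_less)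
      moreover have "\<bar>elementary_integral W N' \<tau>' \<xi>' \<omega> - J \<omega>\<bar> \<le> \<eta> / 2" using K'(5)[of \<omega>] \<omega> by auto
      ultimately show ?thesis unfolding Id by linarith
    qed
    ultimately show "\<exists>A'\<in>events. prob A' < \<eta> \<and>
       (\<forall>\<omega>\<in>space M - (A \<union> A'). \<bar>c * elementary_integral_upto W N \<tau> \<xi> u \<omega> - J \<omega>\<bar> \<le> \<eta>)"
      using A3 K'(2) by (intro bexI[of _ "A2 \<union> A3"]) auto
  qed
qed

text \<open>One elementary approximation of \<open>H\<close> serves both integrals: scaled by
  \<open>c\<close> it is near \<open>c * J\<close> by its choice and near \<open>J'\<close> by
  \<open>ito_approx_close\<close>. The factor \<open>c\<close> is built in because the second system
  needs it with \<open>\<rho> / \<sigma>\<close>.\<close>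

lemma ito_approx_cmult_unique:
  assumes T: "0 \<le> T"
    and H: "\<And>\<omega>. \<omega> \<in> space M \<Longrightarrow> continuous_on {0..T} (\<lambda>s. H s \<omega>)"
    and ia: "ito_approx M F W H T J" and ia': "ito_approx M F W (\<lambda>s \<omega>. c * H s \<omega>) T J'"
  shows "AE \<omega> in M. J' \<omega> = c * J \<omega>"
proof -
  have "AE \<omega> in M. J' \<omega> - c * J \<omega> = 0"
  proof (rule AE_zero_of_small_exceptions)
    fix \<eta> :: real assume \<eta>: "\<eta> > 0"
    have \<eta>2: "\<eta> / 2 > 0" using \<eta> by simp
    show "\<exists>B\<in>events. prob B < \<eta> \<and> (\<forall>\<omega>\<in>space M - B. \<bar>J' \<omega> - c * J \<omega>\<bar> \<le> \<eta>)"
    proof (rule ito_approx_close[OF T order_refl H ia' \<eta>2])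
    fix \<epsilon> :: real assume \<epsilon>: "\<epsilon> > 0" and close: "\<And>N \<tau> \<xi> A. elementary_integrand M F T N \<tau> \<xi> \<Longrightarrow>
      (\<And>\<omega>. \<omega> \<in> space M - A \<Longrightarrow> (\<integral>\<^sup>+ s\<in>{0..T}. ennreal ((elementary_process N \<tau> \<xi> s \<omega> - H s \<omega>)\<^sup>2) \<partial>lborel) \<le> ennreal \<epsilon>) \<Longrightarrow>
      \<exists>A'\<in>events. prob A' < \<eta> / 2 \<and>
       (\<forall>\<omega>\<in>space M - (A \<union> A'). \<bar>c * elementary_integral_upto W N \<tau> \<xi> T \<omega> - J' \<omega>\<bar> \<le> \<eta> / 2)"
    \<comment> \<open>Three demands on one accuracy: at most \<open>\<epsilon>\<close> for closeness
      of the integrands, at most \<open>\<eta> / 2\<close> for the exceptional probability, and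
      \<open>\<bar>c\<bar> * e \<le> \<eta> / 2\<close> for the scaled value.\<close>
    define e where "e = min \<epsilon> (\<eta> / (2 * (\<bar>c\<bar> + 1)))"
    have e: "e > 0" "e \<le> \<epsilon>" "e \<le> \<eta> / 2" "\<bar>c\<bar> * e \<le> \<eta> / 2"
    proof -
      show "e > 0" "e \<le> \<epsilon>" using \<epsilon> \<eta> by (auto simp: e_def)
      have "e \<le> \<eta> / (2 * (\<bar>c\<bar> + 1))" by (simp add: e_def)
      then have "e * (\<bar>c\<bar> + 1) \<le> \<eta> / (2 * (\<bar>c\<bar> + 1)) * (\<bar>c\<bar> + 1)"
        by (intro mult_right_mono) auto
      also have "\<dots> = \<eta> / 2"
      proof -
        have "\<eta> / (2 * d) * d = \<eta> / 2" if "d \<noteq> 0" for d :: real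
          using that by simp
        from this[of "\<bar>c\<bar> + 1"] show ?thesis by linarith

      qed
      finally have "e * \<bar>c\<bar> + e \<le> \<eta> / 2" by (simp only: distrib_left mult_1_right)
      moreover have "0 \<le> e * \<bar>c\<bar>" using \<open>e > 0\<close> by simp
      ultimately have "e \<le> \<eta> / 2" "e * \<bar>c\<bar> \<le> \<eta> / 2"
        using \<open>e > 0\<close> by linarith+
      then show "e \<le> \<eta> / 2" "\<bar>c\<bar> * e \<le> \<eta> / 2"
        by (simp_all only: mult.commute[of "\<bar>c\<bar>" e])
    qed
    obtain N \<tau> \<xi> A where K: "elementary_integrand M F T N \<tau> \<xi>" "A \<in> events" "prob A < e"
      "\<And>\<omega>. \<omega> \<in> space M - A \<Longrightarrow>
        (\<integral>\<^sup>+ s\<in>{0..T}. ennreal ((elementary_process N \<tau> \<xi> s \<omega> - H s \<omega>)\<^sup>2) \<partial>lborel) \<le> ennreal e"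
      "\<And>\<omega>. \<omega> \<in> space M - A \<Longrightarrow> \<bar>elementary_integral W N \<tau> \<xi> \<omega> - J \<omega>\<bar> \<le> e"
      using ito_approxE[OF ia e(1)] by blast
    have "(\<integral>\<^sup>+ s\<in>{0..T}. ennreal ((elementary_process N \<tau> \<xi> s \<omega> - H s \<omega>)\<^sup>2) \<partial>lborel) \<le> ennreal \<epsilon>"
      if "\<omega> \<in> space M - A" for \<omega>
      using K(4)[OF that] ennreal_leI[OF e(2)] by (rule order_trans)
    from close[OF K(1) this] obtain A' where A'0: "A' \<in> events"
      "prob A' < \<eta> / 2 \<and> (\<forall>\<omega>\<in>space M - (A \<union> A'). \<bar>c * elementary_integral_upto W N \<tau> \<xi> T \<omega> - J' \<omega>\<bar> \<le> \<eta> / 2)"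
      by (rule bexE)
    note A' = A'0(1) A'0(2)[THEN conjunct1] A'0(2)[THEN conjunct2, rule_format]
    have up: "elementary_integral_upto W N \<tau> \<xi> T \<omega> = elementary_integral W N \<tau> \<xi> \<omega>" for \<omega>
      using K(1) by (intro elementary_integral_upto_end elementary_partition[OF K(1)]) (simp add: elementary_integrand_def)
    have "prob (A \<union> A') \<le> prob A + prob A'"
      by (rule measure_Un_le) (use A' K in auto)
    then have "prob (A \<union> A') < \<eta>" using A'(2) K(3) e(3) by simp
    moreover have "\<bar>J' \<omega> - c * J \<omega>\<bar> \<le> \<eta>" if \<omega>: "\<omega> \<in> space M - (A \<union> A')" for \<omega>
    proof -
      have "\<bar>c * elementary_integral W N \<tau> \<xi> \<omega> - c * J \<omega>\<bar> = \<bar>c\<bar> * \<bar>elementary_integral W N \<tau> \<xi> \<omega> - J \<omega>\<bar>"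
        by (simp add: abs_mult right_diff_distrib[symmetric])
      also have "\<dots> \<le> \<bar>c\<bar> * e" using K(5)[of \<omega>] \<omega> by (intro mult_left_mono) auto
      finally show ?thesis using A'(3)[OF \<omega>] e(4) unfolding up by linarith
    qed
    ultimately show "\<exists>B\<in>events. prob B < \<eta> \<and> (\<forall>\<omega>\<in>space M - B. \<bar>J' \<omega> - c * J \<omega>\<bar> \<le> \<eta>)"
      using A'(1) K(2) by (intro bexI[of _ "A \<union> A'"]) auto
    qed
  qed
  then show ?thesis by eventually_elim simp
qed

text \<open>Since \<open>2 * 0 = 0\<close>, the variable \<open>J\<close> is an integral both of the
  zero integrand and of its double. Uniqueness with \<open>c = 2\<close> then gives
  \<open>J = 2 * J\<close> almost everywhere.\<close>

lemma ito_approx_zero: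
  assumes T: "0 \<le> T" and ia: "ito_approx M F W (\<lambda>s \<omega>. 0) T J"
  shows "AE \<omega> in M. J \<omega> = 0"
  using ito_approx_cmult_unique[OF T, of "\<lambda>s \<omega>. 0" J 2 J] ia by simp

end

text \<open>In the application \<open>q\<close> is the squared norm of the integrand,
  \<open>Q n\<close> that of its approximation, and \<open>e n\<close> bounds that of their
  difference.\<close>

lemma tendsto_of_square_comparison:
  fixes Q e :: "nat \<Rightarrow> real"
  assumes q: "0 \<le> q" and Q: "\<And>n. 0 \<le> Q n" and e: "e \<longlonglongrightarrow> 0"
    and up: "\<And>\<eta>. \<eta> > 0 \<Longrightarrow> eventually (\<lambda>n. Q n \<le> (1 + \<eta>) * q + (1 + 1 / \<eta>) * e n) sequentially"
    and low: "\<And>\<eta>. \<eta> > 0 \<Longrightarrow> eventually (\<lambda>n. q \<le> (1 + \<eta>) * Q n + (1 + 1 / \<eta>) * e n) sequentially"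
  shows "Q \<longlonglongrightarrow> q"
proof (rule LIMSEQ_I)
  fix r :: real assume r: "r > 0"
  define s where "s = min r 1"
  have s: "s > 0" "s \<le> r" "s \<le> 1" using r by (auto simp: s_def)
  \<comment> \<open>This makes \<open>\<eta> * (q + 1) = s / 4\<close>. Because
    \<open>s \<le> 1\<close>, the upper estimate yields \<open>Q n \<le> q + 1\<close>, so the same
    constant also controls \<open>\<eta> * Q n\<close> in the lower one.\<close>
  define \<eta> where "\<eta> = s / (4 * (q + 1))"
  have q1: "q + 1 > 0" using q by simp
  then have \<eta>: "\<eta> > 0" using s by (simp add: \<eta>_def)
  have \<eta>q: "\<eta> * (q + 1) = s / 4"
  proof -
    have "s / (4 * d) * d = s / 4" if "d > 0" for d :: real using that by simp
    from this[OF q1] show ?thesis by (simp only: \<eta>_def)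
  qed
  have "(\<lambda>n. (1 + 1 / \<eta>) * e n) \<longlonglongrightarrow> (1 + 1 / \<eta>) * 0" by (intro tendsto_mult tendsto_const e)
  then have "eventually (\<lambda>n. (1 + 1 / \<eta>) * e n < s / 4) sequentially"
    by (rule order_tendstoD) (use s in simp)
  with up[OF \<eta>] low[OF \<eta>]
  have "eventually (\<lambda>n. norm (Q n - q) < r) sequentially"
  proof eventually_elim
    case (elim n)
    have "\<eta> * q \<le> s / 4" using \<eta>q \<eta> by (simp only: distrib_left mult_1_right)
    then have 1: "Q n \<le> q + s / 2"
      using elim by (simp only: distrib_right mult_1)
    have "\<eta> * Q n \<le> \<eta> * (q + 1)" using 1 s \<eta> by (intro mult_left_mono) auto
    then have "q \<le> Q n + s / 2"
      using elim \<eta>q by (simp only: distrib_right mult_1)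
    with 1 s show ?case by (simp add: abs_less_iff)
  qed
  then show "\<exists>no. \<forall>n\<ge>no. norm (Q n - q) < r" by (simp add: eventually_sequentially)
qed

section \<open>Limits under bounded second moments\<close>

context prob_space
begin

text \<open>Bounded second moments give uniform integrability, which upgrades almost sure
  convergence to convergence in L1.\<close>

lemma L2_bounded_tendsto_zero:
  fixes D :: "nat \<Rightarrow> 'a \<Rightarrow> real"
  assumes D[measurable]: "\<And>n. D n \<in> borel_measurable M"
    and int: "\<And>n. integrable M (\<lambda>\<omega>. (D n \<omega>)\<^sup>2)" and le: "\<And>n. expectation (\<lambda>\<omega>. (D n \<omega>)\<^sup>2) \<le> c"
    and lim: "AE \<omega> in M. (\<lambda>n. D n \<omega>) \<longlonglongrightarrow> 0"
  shows "integrable M (D n)" "(\<lambda>n. expectation (\<lambda>\<omega>. \<bar>D n \<omega>\<bar>)) \<longlonglongrightarrow> 0"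
proof -
  show int1: "integrable M (D n)" for n
    by (rule square_integrable_imp_integrable[OF D int])
  have "0 \<le> expectation (\<lambda>\<omega>. (D 0 \<omega>)\<^sup>2)" by simp
  then have c: "0 \<le> c" using le[of 0] by linarith
  show "(\<lambda>n. expectation (\<lambda>\<omega>. \<bar>D n \<omega>\<bar>)) \<longlonglongrightarrow> 0"
  proof (rule LIMSEQ_I)
    fix r :: real assume r: "r > 0"
    \<comment> \<open>Truncation level: the part of \<open>\<bar>D n\<bar>\<close> above
      \<open>b\<close> is at most \<open>(D n)\<^sup>2 / b\<close>, whose mean is at most
      \<open>c / b \<le> r / 2\<close>, uniformly in \<open>n\<close>.\<close>
    define b where "b = 2 * (c + 1) / r"
    have b: "b > 0" using c r by (simp add: b_def)
    have "(\<lambda>n. expectation (\<lambda>\<omega>. min \<bar>D n \<omega>\<bar> b)) \<longlonglongrightarrow> expectation (\<lambda>\<omega>. 0)"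
    proof (rule integral_dominated_convergence[where w = "\<lambda>_. b"])
      show "AE \<omega> in M. (\<lambda>n. min \<bar>D n \<omega>\<bar> b) \<longlonglongrightarrow> 0"
        using lim
      proof eventually_elim
        case (elim \<omega>)
        have "(\<lambda>n. min \<bar>D n \<omega>\<bar> b) \<longlonglongrightarrow> min \<bar>0\<bar> b"
          by (intro tendsto_min tendsto_rabs elim tendsto_const)
        then show ?case using b by simp
      qed
      show "AE \<omega> in M. norm (min \<bar>D n \<omega>\<bar> b) \<le> b" for n using b by auto
    qed auto
    then have "eventually (\<lambda>n. expectation (\<lambda>\<omega>. min \<bar>D n \<omega>\<bar> b) < r / 2) sequentially"
      using r by (intro order_tendstoD(2)[of _ 0]) auto
    then have "eventually (\<lambda>n. norm (expectation (\<lambda>\<omega>. \<bar>D n \<omega>\<bar>) - 0) < r) sequentially"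
    proof eventually_elim
      case (elim n)
      have mi: "integrable M (\<lambda>\<omega>. min \<bar>D n \<omega>\<bar> b)"
        using b by (intro integrable_const_bound[where B = b]) auto
      have "expectation (\<lambda>\<omega>. \<bar>D n \<omega>\<bar>) \<le> expectation (\<lambda>\<omega>. min \<bar>D n \<omega>\<bar> b + (D n \<omega>)\<^sup>2 / b)"
      proof (rule integral_mono)
        show "integrable M (\<lambda>\<omega>. \<bar>D n \<omega>\<bar>)" using int1 by simp
        show "integrable M (\<lambda>\<omega>. min \<bar>D n \<omega>\<bar> b + (D n \<omega>)\<^sup>2 / b)" using mi int by simp
        fix \<omega>
        show "\<bar>D n \<omega>\<bar> \<le> min \<bar>D n \<omega>\<bar> b + (D n \<omega>)\<^sup>2 / b"
        proof (cases "\<bar>D n \<omega>\<bar> \<le> b")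
          case False
          then have "b * \<bar>D n \<omega>\<bar> \<le> \<bar>D n \<omega>\<bar> * \<bar>D n \<omega>\<bar>" by (intro mult_right_mono) auto
          then have "\<bar>D n \<omega>\<bar> \<le> (D n \<omega>)\<^sup>2 / b" using b by (simp add: pos_le_divide_eq power2_eq_square mult.commute)
          then show ?thesis using False b by simp
        qed (use b in simp)
      qed
      also have "\<dots> = expectation (\<lambda>\<omega>. min \<bar>D n \<omega>\<bar> b) + expectation (\<lambda>\<omega>. (D n \<omega>)\<^sup>2) / b"
        using mi int by simp
      also have "expectation (\<lambda>\<omega>. (D n \<omega>)\<^sup>2) / b \<le> c / b"
        using le b by (intro divide_right_mono) auto
      also have "c / b \<le> r / 2"
      proof -
        have "c * r \<le> (c + 1) * r" using r by (intro mult_right_mono) auto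
        then show ?thesis using c r by (simp add: b_def divide_simps)
      qed
      finally have "expectation (\<lambda>\<omega>. \<bar>D n \<omega>\<bar>) < r" using elim by linarith
      then show ?case by simp
    qed
    then show "\<exists>no. \<forall>n\<ge>no. norm (expectation (\<lambda>\<omega>. \<bar>D n \<omega>\<bar>) - 0) < r" by (simp add: eventually_sequentially)
  qed
qed

text \<open>Fatou's lemma for squares.\<close>

lemma expectation_square_le_of_AE_limit:
  fixes X :: "nat \<Rightarrow> 'a \<Rightarrow> real"
  assumes [measurable]: "\<And>n. X n \<in> borel_measurable M" "Y \<in> borel_measurable M"
    and int: "\<And>n. integrable M (\<lambda>\<omega>. (X n \<omega>)\<^sup>2)" and le: "\<And>n. expectation (\<lambda>\<omega>. (X n \<omega>)\<^sup>2) \<le> c"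
    and lim: "AE \<omega> in M. (\<lambda>n. X n \<omega>) \<longlonglongrightarrow> Y \<omega>"
  shows "integrable M (\<lambda>\<omega>. (Y \<omega>)\<^sup>2)" "expectation (\<lambda>\<omega>. (Y \<omega>)\<^sup>2) \<le> c"
proof -
  have "0 \<le> expectation (\<lambda>\<omega>. (X 0 \<omega>)\<^sup>2)" by simp
  then have c: "0 \<le> c" using le[of 0] by linarith
  have "(\<integral>\<^sup>+\<omega>. ennreal ((Y \<omega>)\<^sup>2) \<partial>M) = (\<integral>\<^sup>+\<omega>. liminf (\<lambda>n. ennreal ((X n \<omega>)\<^sup>2)) \<partial>M)"
  proof (rule nn_integral_cong_AE)
    show "AE \<omega> in M. ennreal ((Y \<omega>)\<^sup>2) = liminf (\<lambda>n. ennreal ((X n \<omega>)\<^sup>2))"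
      using lim
    proof eventually_elim
      case (elim \<omega>)
      then have "(\<lambda>n. ennreal ((X n \<omega>)\<^sup>2)) \<longlonglongrightarrow> ennreal ((Y \<omega>)\<^sup>2)"
        by (intro tendsto_ennrealI tendsto_power)
      then show ?case by (metis lim_imp_Liminf trivial_limit_sequentially)
    qed
  qed
  also have "\<dots> \<le> liminf (\<lambda>n. \<integral>\<^sup>+\<omega>. ennreal ((X n \<omega>)\<^sup>2) \<partial>M)"
    by (rule nn_integral_liminf) measurable
  also have "\<dots> \<le> ennreal c"
  proof (rule Liminf_le)
    show "eventually (\<lambda>n. (\<integral>\<^sup>+\<omega>. ennreal ((X n \<omega>)\<^sup>2) \<partial>M) \<le> ennreal c) sequentially"
      using int le by (intro always_eventually allI) (simp add: nn_integral_eq_integral ennreal_leI)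
  qed simp
  finally have *: "(\<integral>\<^sup>+\<omega>. ennreal ((Y \<omega>)\<^sup>2) \<partial>M) \<le> ennreal c" .
  then have "(\<integral>\<^sup>+\<omega>. ennreal ((Y \<omega>)\<^sup>2) \<partial>M) < \<infinity>" by (simp add: order_le_less_trans)
  then show i: "integrable M (\<lambda>\<omega>. (Y \<omega>)\<^sup>2)"
    by (intro integrableI_bounded) auto
  show "expectation (\<lambda>\<omega>. (Y \<omega>)\<^sup>2) \<le> c"
    using * c by (subst (asm) nn_integral_eq_integral[OF i]) auto
qed

end

section \<open>Exponential identities for stochastic integrals\<close>

context brownian
begin

text \<open>Accuracy \<open>(1/2)^n\<close> at stage \<open>n\<close> and Borel-Cantelli give almost
  sure convergence along one sequence. The quadratic variations converge with the integrals because
  the integrands converge in L2 on almost every path.\<close>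

lemma ito_approx_sequence:
  assumes ia: "ito_approx M F W H T J"
    and H: "\<And>\<omega>. \<omega> \<in> space M \<Longrightarrow> set_borel_measurable borel {0..T} (\<lambda>s. H s \<omega>)"
    and q: "AE \<omega> in M. 0 \<le> q \<omega> \<and> (\<integral>\<^sup>+ s\<in>{0..T}. ennreal ((H s \<omega>)\<^sup>2) \<partial>lborel) = ennreal (q \<omega>)"
  obtains N \<tau> \<xi> where "\<forall>n::nat. elementary_integrand M F T (N n) (\<tau> n) (\<xi> n)"
    "AE \<omega> in M. (\<lambda>n. elementary_integral W (N n) (\<tau> n) (\<xi> n) \<omega>) \<longlonglongrightarrow> J \<omega>"
    "AE \<omega> in M. (\<lambda>n. elementary_quad (N n) (\<tau> n) (\<xi> n) \<omega>) \<longlonglongrightarrow> q \<omega>"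
proof -
  define good where "good n N \<tau> \<xi> A \<longleftrightarrow> elementary_integrand M F T N \<tau> \<xi> \<and> A \<in> events \<and> prob A < (1/2)^n \<and>
     (\<forall>\<omega>\<in>space M - A.
           (\<integral>\<^sup>+ s\<in>{0..T}. ennreal ((elementary_process N \<tau> \<xi> s \<omega> - H s \<omega>)\<^sup>2) \<partial>lborel) \<le> ennreal ((1/2)^n) \<and>
           \<bar>elementary_integral W N \<tau> \<xi> \<omega> - J \<omega>\<bar> \<le> (1/2)^n)" for n :: nat and N \<tau> \<xi> A
  have "\<exists>N \<tau> \<xi> A. good n N \<tau> \<xi> A" for n
    unfolding good_def by (rule ia[unfolded ito_approx_def, THEN conjunct2, rule_format]) simp
  then have "\<forall>n. \<exists>x. good n (fst x) (fst (snd x)) (fst (snd (snd x))) (snd (snd (snd x)))" by simp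
  from choice[OF this] obtain x
    where x: "\<forall>n. good n (fst (x n)) (fst (snd (x n))) (fst (snd (snd (x n)))) (snd (snd (snd (x n))))"
    by (rule exE)
  define N where "N n = fst (x n)" for n
  define \<tau> where "\<tau> n = fst (snd (x n))" for n
  define \<xi> where "\<xi> n = fst (snd (snd (x n)))" for n
  define A where "A n = snd (snd (snd (x n)))" for n
  have g: "good n (N n) (\<tau> n) (\<xi> n) (A n)" for n using x by (simp add: N_def \<tau>_def \<xi>_def A_def)
  have el: "elementary_integrand M F T (N n) (\<tau> n) (\<xi> n)" and Ae: "A n \<in> events" and pA: "prob (A n) < (1/2)^n"
    and d1: "\<And>\<omega>. \<omega> \<in> space M - A n \<Longrightarrow> (\<integral>\<^sup>+ s\<in>{0..T}. ennreal ((elementary_process (N n) (\<tau> n) (\<xi> n) s \<omega> - H s \<omega>)\<^sup>2) \<partial>lborel) \<le> ennreal ((1/2)^n)"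
    and d2: "\<And>\<omega>. \<omega> \<in> space M - A n \<Longrightarrow> \<bar>elementary_integral W (N n) (\<tau> n) (\<xi> n) \<omega> - J \<omega>\<bar> \<le> (1/2)^n" for n
    using g[of n] unfolding good_def by simp_all
  have ev: "AE \<omega> in M. \<omega> \<in> space M \<and> eventually (\<lambda>n. \<omega> \<notin> A n) sequentially"
    using exceptional_sets_AE[of A, OF Ae less_imp_le[OF pA]] AE_space by eventually_elim simp
  have half: "(\<lambda>n. (1/2::real)^n) \<longlonglongrightarrow> 0" by (rule LIMSEQ_power_zero) simp
  show ?thesis
  proof (rule that[OF allI[OF el]])
    show "AE \<omega> in M. (\<lambda>n. elementary_integral W (N n) (\<tau> n) (\<xi> n) \<omega>) \<longlonglongrightarrow> J \<omega>"
      using ev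
    proof eventually_elim
      case (elim \<omega>)
      then have "eventually (\<lambda>n. norm (elementary_integral W (N n) (\<tau> n) (\<xi> n) \<omega> - J \<omega>) \<le> (1/2)^n) sequentially"
        using d2[of \<omega>] by (auto elim!: eventually_mono)
      then have "(\<lambda>n. elementary_integral W (N n) (\<tau> n) (\<xi> n) \<omega> - J \<omega>) \<longlonglongrightarrow> 0"
        by (rule Lim_null_comparison) (rule half)
      then show ?case by (simp add: LIM_zero_iff)
    qed
    show "AE \<omega> in M. (\<lambda>n. elementary_quad (N n) (\<tau> n) (\<xi> n) \<omega>) \<longlonglongrightarrow> q \<omega>"
      using ev q
    proof eventually_elim
      case (elim \<omega>)
      then have \<omega>: "\<omega> \<in> space M" and q0: "0 \<le> q \<omega>"
        and qe: "(\<integral>\<^sup>+ s\<in>{0..T}. ennreal ((H s \<omega>)\<^sup>2) \<partial>lborel) = ennreal (q \<omega>)" by simp_all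
      let ?K = "\<lambda>n s. elementary_process (N n) (\<tau> n) (\<xi> n) s \<omega>"
      let ?Q = "\<lambda>n. elementary_quad (N n) (\<tau> n) (\<xi> n) \<omega>"
      have part: "partition_points (N n) (\<tau> n)" for n by (rule elementary_partition[OF el])
      have Q0: "0 \<le> ?Q n" for n by (rule elementary_quad_nonneg[OF part])
      have Qe: "(\<integral>\<^sup>+ s\<in>{0..T}. ennreal ((?K n s)\<^sup>2) \<partial>lborel) = ennreal (?Q n)" for n
        using nn_integral_elementary_process[OF part[of n], of "\<xi> n" \<omega>] el[of n]
        by (simp add: elementary_integrand_def)
      note Hm = H[OF \<omega>]
      have Km: "set_borel_measurable borel {0..T} (?K n)" for n by (rule set_borel_measurable_elementary) simp
      have KH: "set_borel_measurable borel {0..T} (\<lambda>s. ?K n s - H s \<omega>)" for n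
        by (rule set_borel_measurable_diff'[OF Km Hm])
      have toreal: "a \<le> (1 + \<eta>) * b + (1 + 1 / \<eta>) * (1/2)^n"
        if "ennreal a \<le> ennreal (1 + \<eta>) * ennreal b + ennreal (1 + 1 / \<eta>) * ennreal ((1/2)^n)" "\<eta> > 0" "0 \<le> b"
        for a b \<eta> :: real and n :: nat
      proof -
        have "ennreal (1 + \<eta>) * ennreal b + ennreal (1 + 1 / \<eta>) * ennreal ((1/2)^n)
          = ennreal ((1 + \<eta>) * b + (1 + 1 / \<eta>) * (1/2)^n)"
          using that(2,3) by (subst ennreal_plus) (simp_all add: ennreal_mult del: ennreal_plus)
        with that show ?thesis
          by (simp only:) (subst (asm) ennreal_le_iff, simp_all)
      qed
      show ?case
      proof (rule tendsto_of_square_comparison[OF q0 Q0 half])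
        fix \<eta> :: real assume \<eta>: "\<eta> > 0"
        show "eventually (\<lambda>n. ?Q n \<le> (1 + \<eta>) * q \<omega> + (1 + 1 / \<eta>) * (1/2)^n) sequentially"
          using elim(1)[THEN conjunct2]
        proof eventually_elim
          case (elim n)
          have "ennreal (?Q n) = (\<integral>\<^sup>+ s\<in>{0..T}. ennreal ((H s \<omega> + (?K n s - H s \<omega>))\<^sup>2) \<partial>lborel)"
            unfolding Qe[symmetric] by simp
          also have "\<dots> \<le> ennreal (1 + \<eta>) * ennreal (q \<omega>) + ennreal (1 + 1 / \<eta>) * (\<integral>\<^sup>+ s\<in>{0..T}. ennreal ((?K n s - H s \<omega>)\<^sup>2) \<partial>lborel)"
            unfolding qe[symmetric] by (rule set_nn_integral_square_add[OF Hm KH \<eta>])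
          also have "\<dots> \<le> ennreal (1 + \<eta>) * ennreal (q \<omega>) + ennreal (1 + 1 / \<eta>) * ennreal ((1/2)^n)"
            using d1[of \<omega> n] \<omega> elim by (intro add_mono mult_left_mono order_refl) auto
          finally show ?case by (rule toreal[OF _ \<eta> q0])
        qed
        show "eventually (\<lambda>n. q \<omega> \<le> (1 + \<eta>) * ?Q n + (1 + 1 / \<eta>) * (1/2)^n) sequentially"
          using elim(1)[THEN conjunct2]
        proof eventually_elim
          case (elim n)
          have "ennreal (q \<omega>) = (\<integral>\<^sup>+ s\<in>{0..T}. ennreal ((?K n s + (-1) * (?K n s - H s \<omega>))\<^sup>2) \<partial>lborel)"
            unfolding qe[symmetric] by simp
          also have "\<dots> \<le> ennreal (1 + \<eta>) * ennreal (?Q n) + ennreal (1 + 1 / \<eta>) * (\<integral>\<^sup>+ s\<in>{0..T}. ennreal (((-1) * (?K n s - H s \<omega>))\<^sup>2) \<partial>lborel)"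
            unfolding Qe[symmetric] by (rule set_nn_integral_square_add[OF Km set_borel_measurable_cmult[OF KH] \<eta>])
          also have "(\<integral>\<^sup>+ s\<in>{0..T}. ennreal (((-1) * (?K n s - H s \<omega>))\<^sup>2) \<partial>lborel) = (\<integral>\<^sup>+ s\<in>{0..T}. ennreal ((?K n s - H s \<omega>)\<^sup>2) \<partial>lborel)"
            by (subst set_nn_integral_square_cmult[OF KH]) simp
          also have "ennreal (1 + \<eta>) * ennreal (?Q n) + ennreal (1 + 1 / \<eta>) * \<dots>
            \<le> ennreal (1 + \<eta>) * ennreal (?Q n) + ennreal (1 + 1 / \<eta>) * ennreal ((1/2)^n)"
            using d1[of \<omega> n] \<omega> elim by (intro add_mono mult_left_mono order_refl) auto
          finally show ?case by (rule toreal[OF _ \<eta> Q0])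
        qed
      qed
    qed
  qed
qed

text \<open>Associativity of the integral for an elementary outer factor. The difficulty is that one
  approximation of \<open>H\<close> on the whole interval must give good integrals at all times
  \<open>t j\<close> simultaneously. This lemma turns weighted increments of a solution into an
  integral against the Brownian motion.\<close>

lemma ito_approx_weighted:
  assumes T: "0 \<le> T" and w: "elementary_integrand M F T m t w"
    and H: "\<And>\<omega>. \<omega> \<in> space M \<Longrightarrow> continuous_on {0..T} (\<lambda>s. H s \<omega>)"
    and ia: "\<And>u. u \<in> {0..T} \<Longrightarrow> ito_approx M F W H u (J u)"
  shows "ito_approx M F W (\<lambda>s \<omega>. elementary_process m t w s \<omega> * H s \<omega>) T
    (\<lambda>\<omega>. \<Sum>j<m. w j \<omega> * (J (t (Suc j)) \<omega> - J (t j) \<omega>))"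
  unfolding ito_approx_def
proof (intro conjI allI impI)
  note tr = elementary_range[OF w]
  have Jm: "J u \<in> borel_measurable M" if "u \<in> {0..T}" for u
    using ia[OF that] by (simp add: ito_approx_def)
  have wm: "w j \<in> borel_measurable M" if "j < m" for j
    by (rule F_imp_M[OF elementary_integrandD(3)[OF w that]])
  show "(\<lambda>\<omega>. \<Sum>j<m. w j \<omega> * (J (t (Suc j)) \<omega> - J (t j) \<omega>)) \<in> borel_measurable M"
    by (intro borel_measurable_sum borel_measurable_times borel_measurable_diff wm Jm) (use tr in auto)
  fix \<epsilon> :: real assume \<epsilon>: "\<epsilon> > 0"
  have "\<forall>j. \<exists>C. j < m \<longrightarrow> (\<forall>\<omega>\<in>space M. \<bar>w j \<omega>\<bar> \<le> C)"
    using elementary_integrandD(4)[OF w] by simp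
  from choice[OF this] obtain C0 where C0: "\<forall>j. j < m \<longrightarrow> (\<forall>\<omega>\<in>space M. \<bar>w j \<omega>\<bar> \<le> C0 j)" by (rule exE)
  define C where "C = 1 + (\<Sum>j<m. \<bar>C0 j\<bar>)"
  have C: "1 \<le> C" by (simp add: C_def sum_nonneg)
  have wC: "\<bar>w j \<omega>\<bar> \<le> C" if "j < m" "\<omega> \<in> space M" for j \<omega>
  proof -
    have "\<bar>C0 j\<bar> \<le> (\<Sum>j<m. \<bar>C0 j\<bar>)" using that by (intro member_le_sum) auto
    moreover have "\<bar>w j \<omega>\<bar> \<le> C0 j" using C0 that by simp
    ultimately show ?thesis unfolding C_def by linarith
  qed
  \<comment> \<open>The budget covers \<open>m + 1\<close> exceptional sets of probability at most
    \<open>\<eta>\<close> each, and \<open>m\<close> weighted increments with error at most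
    \<open>2 * \<eta>\<close> times a weight bounded by \<open>C\<close>. Having
    \<open>C \<ge> 1\<close> lets one constant serve both purposes.\<close>
  define \<eta> where "\<eta> = \<epsilon> / (4 * (real m + 1) * C)"
  have \<eta>: "\<eta> > 0" using \<epsilon> C by (simp add: \<eta>_def)
  have \<eta>1: "(real m + 1) * C * \<eta> = \<epsilon> / 4"
  proof -
    have "a * b * (\<epsilon> / (4 * a * b)) = \<epsilon> / 4" if "a > 0" "b > 0" for a b :: real using that by simp
    from this[of "real m + 1" C] C show ?thesis by (simp only: \<eta>_def)
  qed
  have \<eta>2: "(real m + 1) * \<eta> \<le> \<epsilon> / 4"
  proof -
    have "1 * ((real m + 1) * \<eta>) \<le> C * ((real m + 1) * \<eta>)" using C \<eta> by (intro mult_right_mono) auto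
    also have "\<dots> = \<epsilon> / 4" using \<eta>1 by (simp only: mult.assoc mult.left_commute)
    finally show ?thesis by simp
  qed
  \<comment> \<open>Packaging the conclusion of \<open>ito_approx_close\<close> as a predicate
    allows a sufficient accuracy to be chosen for each of the finitely many times; their minimum
    serves all of them.\<close>
  define P where "P j e \<longleftrightarrow> (\<forall>N \<tau> \<xi> A. elementary_integrand M F T N \<tau> \<xi> \<longrightarrow>
      (\<forall>\<omega>\<in>space M - A. (\<integral>\<^sup>+ s\<in>{0..t j}. ennreal ((elementary_process N \<tau> \<xi> s \<omega> - H s \<omega>)\<^sup>2) \<partial>lborel) \<le> ennreal e) \<longrightarrow>
      (\<exists>A'\<in>events. prob A' < \<eta> \<and>
       (\<forall>\<omega>\<in>space M - (A \<union> A'). \<bar>elementary_integral_upto W N \<tau> \<xi> (t j) \<omega> - J (t j) \<omega>\<bar> \<le> \<eta>)))" for j e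
  have "\<exists>e>0. P j e" if j: "j \<le> m" for j
  proof -
    have Hj: "continuous_on {0..t j} (\<lambda>s. H s \<omega>)" if "\<omega> \<in> space M" for \<omega>
      by (rule continuous_on_subset[OF H[OF that]]) (use tr[OF j] in auto)
    have iaj: "ito_approx M F W (\<lambda>s \<omega>. 1 * H s \<omega>) (t j) (J (t j))" using ia[of "t j"] tr[OF j] by simp
    show ?thesis
    proof (rule ito_approx_close[OF tr[OF j] Hj iaj \<eta>])
      fix e :: real
      assume "0 < e" and c: "\<And>N \<tau> \<xi> A. elementary_integrand M F T N \<tau> \<xi> \<Longrightarrow>
        (\<And>\<omega>. \<omega> \<in> space M - A \<Longrightarrow>
          (\<integral>\<^sup>+ s\<in>{0..t j}. ennreal ((elementary_process N \<tau> \<xi> s \<omega> - H s \<omega>)\<^sup>2) \<partial>lborel) \<le> ennreal e) \<Longrightarrow>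
        \<exists>A'\<in>events. prob A' < \<eta> \<and>
         (\<forall>\<omega>\<in>space M - (A \<union> A'). \<bar>1 * elementary_integral_upto W N \<tau> \<xi> (t j) \<omega> - J (t j) \<omega>\<bar> \<le> \<eta>)"
      have "P j e" unfolding P_def
      proof (intro allI impI)
        fix N \<tau> \<xi> A assume a: "elementary_integrand M F T N \<tau> \<xi>"
          and b: "\<forall>\<omega>\<in>space M - A. (\<integral>\<^sup>+ s\<in>{0..t j}. ennreal ((elementary_process N \<tau> \<xi> s \<omega> - H s \<omega>)\<^sup>2) \<partial>lborel) \<le> ennreal e"
        show "\<exists>A'\<in>events. prob A' < \<eta> \<and>
         (\<forall>\<omega>\<in>space M - (A \<union> A'). \<bar>elementary_integral_upto W N \<tau> \<xi> (t j) \<omega> - J (t j) \<omega>\<bar> \<le> \<eta>)"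
          using c[OF a b[rule_format]] unfolding mult_1 .
      qed
      with \<open>0 < e\<close> show "\<exists>e>0. P j e" by (intro exI[of _ e] conjI)
    qed
  qed
  then have "\<forall>j. \<exists>e. j \<le> m \<longrightarrow> e > 0 \<and> P j e" by simp
  from choice[OF this] obtain e where e: "\<forall>j. j \<le> m \<longrightarrow> e j > 0 \<and> P j (e j)" by (rule exE)
  \<comment> \<open>The additional entry accounts for the weights, which enlarge the squared error
    by a factor of up to \<open>C\<^sup>2\<close>.\<close>
  define e0 where "e0 = Min (insert (\<epsilon> / (2 * C\<^sup>2)) (e ` {..m}))"
  have e0_in: "e0 \<in> insert (\<epsilon> / (2 * C\<^sup>2)) (e ` {..m})" unfolding e0_def by (rule Min_in) auto
  have e0: "e0 > 0" using e0_in e \<epsilon> C by auto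
  have e0_le: "e0 \<le> e j" if "j \<le> m" for j unfolding e0_def by (rule Min_le) (use that in auto)
  have "e0 \<le> \<epsilon> / (2 * C\<^sup>2)" unfolding e0_def by (rule Min_le) auto
  then have e0C: "C\<^sup>2 * e0 \<le> \<epsilon> / 2" using C by (simp add: pos_le_divide_eq mult_ac)
  have "1 \<le> C\<^sup>2" using C by (simp add: power2_eq_square) (metis mult_mono' mult_1 zero_le_one)
  then have "1 * e0 \<le> C\<^sup>2 * e0" using e0 by (intro mult_right_mono) auto
  with e0C have e0\<epsilon>: "e0 \<le> \<epsilon> / 2" by simp
  have Tin: "T \<in> {0..T}" using T by simp
  obtain N \<tau> \<xi> A where K: "elementary_integrand M F T N \<tau> \<xi>" "A \<in> events" "prob A < e0"
    "\<And>\<omega>. \<omega> \<in> space M - A \<Longrightarrow>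
        (\<integral>\<^sup>+ s\<in>{0..T}. ennreal ((elementary_process N \<tau> \<xi> s \<omega> - H s \<omega>)\<^sup>2) \<partial>lborel) \<le> ennreal e0"
    using ito_approxE[OF ia[OF Tin] e0, of thesis] by simp
  have "\<exists>A'. A' \<in> events \<and> prob A' < \<eta> \<and>
       (\<forall>\<omega>\<in>space M - (A \<union> A'). \<bar>elementary_integral_upto W N \<tau> \<xi> (t j) \<omega> - J (t j) \<omega>\<bar> \<le> \<eta>)" if j: "j \<le> m" for j
  proof -
    have "(\<integral>\<^sup>+ s\<in>{0..t j}. ennreal ((elementary_process N \<tau> \<xi> s \<omega> - H s \<omega>)\<^sup>2) \<partial>lborel) \<le> ennreal (e j)"
      if \<omega>: "\<omega> \<in> space M - A" for \<omega>
    proof -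
      have "(\<integral>\<^sup>+ s\<in>{0..t j}. ennreal ((elementary_process N \<tau> \<xi> s \<omega> - H s \<omega>)\<^sup>2) \<partial>lborel)
        \<le> (\<integral>\<^sup>+ s\<in>{0..T}. ennreal ((elementary_process N \<tau> \<xi> s \<omega> - H s \<omega>)\<^sup>2) \<partial>lborel)"
        using tr[OF j] by (intro nn_integral_mono) (auto simp: indicator_def)
      also note K(4)[OF \<omega>]
      also have "ennreal e0 \<le> ennreal (e j)" by (rule ennreal_leI[OF e0_le[OF j]])
      finally show ?thesis .
    qed
    then show ?thesis
      using e[rule_format, OF j, THEN conjunct2, unfolded P_def, rule_format, OF K(1), of A] by (simp add: Bex_def)
  qed
  then have "\<forall>j. \<exists>A'. j \<le> m \<longrightarrow> A' \<in> events \<and> prob A' < \<eta> \<and>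
       (\<forall>\<omega>\<in>space M - (A \<union> A'). \<bar>elementary_integral_upto W N \<tau> \<xi> (t j) \<omega> - J (t j) \<omega>\<bar> \<le> \<eta>)" by simp
  from choice[OF this] obtain A' where A'0: "\<forall>j. j \<le> m \<longrightarrow> A' j \<in> events \<and> prob (A' j) < \<eta> \<and>
       (\<forall>\<omega>\<in>space M - (A \<union> A' j). \<bar>elementary_integral_upto W N \<tau> \<xi> (t j) \<omega> - J (t j) \<omega>\<bar> \<le> \<eta>)" by (rule exE)
  have A': "A' j \<in> events" "prob (A' j) \<le> \<eta>" if "j \<le> m" for j using A'0 that by (auto intro: less_imp_le)
  have A'c: "\<bar>elementary_integral_upto W N \<tau> \<xi> (t j) \<omega> - J (t j) \<omega>\<bar> \<le> \<eta>"
    if "j \<le> m" "\<omega> \<in> space M" "\<omega> \<notin> A" "\<omega> \<notin> A' j" for j \<omega> using A'0 that by simp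
  define B where "B = A \<union> (\<Union>j\<in>{..m}. A' j)"
  have B: "B \<in> events" unfolding B_def using K(2) A'(1) by (intro sets.Un sets.finite_UN) auto
  have "prob B \<le> prob A + prob (\<Union>j\<in>{..m}. A' j)"
    unfolding B_def using K(2) A'(1) by (intro measure_Un_le sets.finite_UN) auto
  also have "prob (\<Union>j\<in>{..m}. A' j) \<le> (\<Sum>j\<in>{..m}. prob (A' j))"
    by (rule measure_UNION_le) (use A'(1) in auto)
  also have "\<dots> \<le> (\<Sum>j\<in>{..m}. \<eta>)" by (intro sum_mono A'(2)) auto
  also have "\<dots> = (real m + 1) * \<eta>" by simp
  finally have pB: "prob B < \<epsilon>" using K(3) e0\<epsilon> \<eta>2 \<epsilon> by linarith
  have cov: "finite (\<tau> ` {..N} \<union> t ` {..m})" "\<tau> ` {..N} \<union> t ` {..m} \<subseteq> {0..T}"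
    using tr elementary_range[OF K(1)] by auto
  obtain n p where p: "partition_points n p" "\<tau> ` {..N} \<union> t ` {..m} \<subseteq> p ` {..n}" "p 0 = 0" "p n = T"
    using partition_points_cover[OF cov T] by blast
  have sub: "\<tau> ` {..N} \<subseteq> p ` {..n}" "t ` {..m} \<subseteq> p ` {..n}" using p(2) by auto
  note part = elementary_partition[OF K(1)] elementary_partition[OF w]
  define b where "b = (\<lambda>i \<omega>. refine m t w p i \<omega> * refine N \<tau> \<xi> p i \<omega>)"
  have b: "elementary_integrand M F T n p b"
    unfolding b_def
    by (intro elementary_integrand_mult elementary_integrand_refine[OF w p(1) sub(2) p(3,4)]
        elementary_integrand_refine[OF K(1) p(1) sub(1) p(3,4)])
  have Ib: "elementary_integral W n p b \<omega> = (\<Sum>j<m. w j \<omega> * (elementary_integral_upto W N \<tau> \<xi> (t (Suc j)) \<omega> - elementary_integral_upto W N \<tau> \<xi> (t j) \<omega>))" for \<omega>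
    unfolding b_def by (rule elementary_integral_refine_mult[OF part(1) p(1) sub(1) part(2) sub(2)])
  have Pb: "elementary_process n p b s \<omega> = elementary_process m t w s \<omega> * elementary_process N \<tau> \<xi> s \<omega>" for s \<omega>
    unfolding b_def elementary_process_mult[OF p(1)] elementary_process_refine[OF part(1) p(1) sub(1)]
      elementary_process_refine[OF part(2) p(1) sub(2)] ..
  have "(\<integral>\<^sup>+ s\<in>{0..T}. ennreal ((elementary_process n p b s \<omega> - elementary_process m t w s \<omega> * H s \<omega>)\<^sup>2) \<partial>lborel) \<le> ennreal \<epsilon> \<and>
           \<bar>elementary_integral W n p b \<omega> - (\<Sum>j<m. w j \<omega> * (J (t (Suc j)) \<omega> - J (t j) \<omega>))\<bar> \<le> \<epsilon>"
    if \<omega>: "\<omega> \<in> space M - B" for \<omega>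
  proof
    have \<omega>': "\<omega> \<in> space M" "\<omega> \<in> space M - A" using \<omega> by (auto simp: B_def)
    have KH: "set_borel_measurable borel {0..T} (\<lambda>s. elementary_process N \<tau> \<xi> s \<omega> - H s \<omega>)"
      by (intro set_borel_measurable_diff' set_borel_measurable_elementary set_borel_measurable_continuous_on H \<omega>'(1)) auto
    have "\<bar>elementary_process m t w s \<omega>\<bar> \<le> C" for s
    proof (cases "s \<in> {t 0<..t m}")
      case True
      then obtain i where "i < m" "s \<in> {t i<..t (Suc i)}"
        using partition_points_exists[OF part(2)] by blast
      then show ?thesis using wC[OF _ \<omega>'(1)] by (simp add: elementary_process_eq[OF part(2)])
    qed (use C in \<open>simp add: elementary_process_outside[OF part(2)]\<close>)
    then have wle: "(elementary_process m t w s \<omega> * x)\<^sup>2 \<le> (C * x)\<^sup>2" for s x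
      unfolding power_mult_distrib using C
      by (intro mult_right_mono) (auto intro!: power2_le_iff_abs_le[THEN iffD2])
    have "(\<integral>\<^sup>+ s\<in>{0..T}. ennreal ((elementary_process n p b s \<omega> - elementary_process m t w s \<omega> * H s \<omega>)\<^sup>2) \<partial>lborel)
      \<le> (\<integral>\<^sup>+ s\<in>{0..T}. ennreal ((C * (elementary_process N \<tau> \<xi> s \<omega> - H s \<omega>))\<^sup>2) \<partial>lborel)"
      unfolding Pb right_diff_distrib[symmetric]
      by (intro nn_integral_mono mult_right_mono ennreal_leI wle) simp
    also have "\<dots> = ennreal (C\<^sup>2) * (\<integral>\<^sup>+ s\<in>{0..T}. ennreal ((elementary_process N \<tau> \<xi> s \<omega> - H s \<omega>)\<^sup>2) \<partial>lborel)"
      by (rule set_nn_integral_square_cmult[OF KH])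
    also have "\<dots> \<le> ennreal (C\<^sup>2) * ennreal e0" by (intro mult_left_mono K(4) \<omega>') simp
    also have "\<dots> = ennreal (C\<^sup>2 * e0)" using e0 by (simp add: ennreal_mult)
    also have "\<dots> \<le> ennreal \<epsilon>" using e0C \<epsilon> by (intro ennreal_leI) simp
    finally show "(\<integral>\<^sup>+ s\<in>{0..T}. ennreal ((elementary_process n p b s \<omega> - elementary_process m t w s \<omega> * H s \<omega>)\<^sup>2) \<partial>lborel) \<le> ennreal \<epsilon>" .
    let ?U = "\<lambda>j. elementary_integral_upto W N \<tau> \<xi> (t j) \<omega>"
    have cl: "\<bar>?U j - J (t j) \<omega>\<bar> \<le> \<eta>" if "j \<le> m" for j
      by (rule A'c[OF that]) (use \<omega> that in \<open>auto simp: B_def\<close>)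
    have "\<bar>elementary_integral W n p b \<omega> - (\<Sum>j<m. w j \<omega> * (J (t (Suc j)) \<omega> - J (t j) \<omega>))\<bar>
      = \<bar>\<Sum>j<m. w j \<omega> * ((?U (Suc j) - ?U j) - (J (t (Suc j)) \<omega> - J (t j) \<omega>))\<bar>"
      unfolding Ib by (simp only: right_diff_distrib sum_subtractf)
    also have "\<dots> \<le> (\<Sum>j<m. \<bar>w j \<omega> * ((?U (Suc j) - ?U j) - (J (t (Suc j)) \<omega> - J (t j) \<omega>))\<bar>)"
      by (rule sum_abs)
    also have "\<dots> \<le> (\<Sum>j<m. C * (2 * \<eta>))"
    proof (rule sum_mono)
      fix j assume j: "j \<in> {..<m}"
      have "\<bar>(?U (Suc j) - ?U j) - (J (t (Suc j)) \<omega> - J (t j) \<omega>)\<bar> \<le> 2 * \<eta>"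
        using cl[of j] cl[of "Suc j"] j by auto
      then show "\<bar>w j \<omega> * ((?U (Suc j) - ?U j) - (J (t (Suc j)) \<omega> - J (t j) \<omega>))\<bar> \<le> C * (2 * \<eta>)"
        unfolding abs_mult using wC[of j \<omega>] j \<omega>' C by (intro mult_mono) auto
    qed
    also have "\<dots> = 2 * (real m * C * \<eta>)" by simp
    also have "\<dots> \<le> 2 * ((real m + 1) * C * \<eta>)" using C \<eta> by (intro mult_left_mono mult_right_mono) auto
    also have "\<dots> \<le> \<epsilon>" unfolding \<eta>1 using \<epsilon> by simp
    finally show "\<bar>elementary_integral W n p b \<omega> - (\<Sum>j<m. w j \<omega> * (J (t (Suc j)) \<omega> - J (t j) \<omega>))\<bar> \<le> \<epsilon>" .
  qed
  then show "\<exists>N \<tau> \<xi> A. elementary_integrand M F T N \<tau> \<xi> \<and> A \<in> events \<and> prob A < \<epsilon> \<and>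
        (\<forall>\<omega>\<in>space M - A.
           (\<integral>\<^sup>+ s\<in>{0..T}. ennreal ((elementary_process N \<tau> \<xi> s \<omega> - elementary_process m t w s \<omega> * H s \<omega>)\<^sup>2) \<partial>lborel) \<le> ennreal \<epsilon> \<and>
           \<bar>elementary_integral W N \<tau> \<xi> \<omega> - (\<Sum>j<m. w j \<omega> * (J (t (Suc j)) \<omega> - J (t j) \<omega>))\<bar> \<le> \<epsilon>)"
    using b B pB by (intro exI[of _ n] exI[of _ p] exI[of _ b] exI[of _ B] conjI ballI) simp_all
qed

text \<open>
  The truncation \<open>q \<omega> < C\<close> takes the place of Novikov's condition; it costs an error governed by the
  probability that \<open>q\<close> reaches \<open>C\<close>.
\<close>

lemma expectation_exp_truncated:
  fixes G :: "'a \<Rightarrow> real"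
  assumes ia: "ito_approx M F W H T J"
    and H: "\<And>\<omega>. \<omega> \<in> space M \<Longrightarrow> set_borel_measurable borel {0..T} (\<lambda>s. H s \<omega>)"
    and q: "AE \<omega> in M. 0 \<le> q \<omega> \<and> (\<integral>\<^sup>+ s\<in>{0..T}. ennreal ((H s \<omega>)\<^sup>2) \<partial>lborel) = ennreal (q \<omega>)"
    and qm[measurable]: "q \<in> borel_measurable M"
    and G: "G \<in> borel_measurable (F 0)" "\<And>\<omega>. \<omega> \<in> space M \<Longrightarrow> \<bar>G \<omega>\<bar> \<le> 1" and C: "C > 0"
  defines "Z \<equiv> \<lambda>\<omega>. exp (J \<omega> - q \<omega> / 2) * indicator {..<C} (q \<omega>)"
  shows "integrable M (\<lambda>\<omega>. (Z \<omega>)\<^sup>2)" "expectation (\<lambda>\<omega>. (Z \<omega>)\<^sup>2) \<le> exp C"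
    "\<And>a. a > 0 \<Longrightarrow> \<bar>expectation G - expectation (\<lambda>\<omega>. G \<omega> * Z \<omega>)\<bar> \<le> a * exp C + prob {\<omega>\<in>space M. C \<le> q \<omega>} / a"
proof -
  have Jm[measurable]: "J \<in> borel_measurable M" using ia by (simp add: ito_approx_def)
  have Gm[measurable]: "G \<in> borel_measurable M" by (rule F_imp_M[OF G(1)])
  have Zm[measurable]: "Z \<in> borel_measurable M" unfolding Z_def by measurable
  obtain N \<tau> \<xi> where el0: "\<forall>n::nat. elementary_integrand M F T (N n) (\<tau> n) (\<xi> n)"
    and Ic: "AE \<omega> in M. (\<lambda>n. elementary_integral W (N n) (\<tau> n) (\<xi> n) \<omega>) \<longlonglongrightarrow> J \<omega>"
    and Qc: "AE \<omega> in M. (\<lambda>n. elementary_quad (N n) (\<tau> n) (\<xi> n) \<omega>) \<longlonglongrightarrow> q \<omega>"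
    by (rule ito_approx_sequence[OF ia H q])
  note el = el0[rule_format]
  have part: "partition_points (N n) (\<tau> n)" for n by (rule elementary_partition[OF el])
  define \<xi>' where "\<xi>' n = truncate C (\<tau> n) (\<xi> n)" for n
  have el': "elementary_integrand M F T (N n) (\<tau> n) (\<xi>' n)" for n
    unfolding \<xi>'_def by (rule elementary_integrand_truncate[OF el])
  define I where "I n = elementary_integral W (N n) (\<tau> n) (\<xi>' n)" for n
  define Q where "Q n = elementary_quad (N n) (\<tau> n) (\<xi>' n)" for n
  have [measurable]: "I n \<in> borel_measurable M" "Q n \<in> borel_measurable M" for n
    unfolding I_def Q_def by (rule elementary_integral_measurable[OF el'])+
  have QC: "Q n \<omega> \<le> C" for n \<omega>
    unfolding Q_def \<xi>'_def using C by (intro elementary_quad_truncate_le part) simp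
  define Y where "Y n \<omega> = exp (I n \<omega> - Q n \<omega> / 2)" for n \<omega>
  have Ym[measurable]: "Y n \<in> borel_measurable M" for n unfolding Y_def by measurable
  have Gi: "integrable M G" by (rule integrable_const_bound[where B = 1]) (use G(2) in auto)
  have GY: "integrable M (\<lambda>\<omega>. G \<omega> * Y n \<omega>)" "expectation (\<lambda>\<omega>. G \<omega> * Y n \<omega>) = expectation G" for n
    using expectation_exp_elementary[OF el' G(1) Gi] by (simp_all add: Y_def I_def Q_def)
  have Y2: "integrable M (\<lambda>\<omega>. (Y n \<omega>)\<^sup>2)" "expectation (\<lambda>\<omega>. (Y n \<omega>)\<^sup>2) \<le> exp C" for n
  proof -
    \<comment> \<open>The exponential martingale of the doubled weights:
      \<open>(Y n)\<^sup>2\<close> equals \<open>exp (Q n) * E\<close>, and truncation keeps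
      \<open>Q n\<close> below \<open>C\<close>. This is the uniform second moment that the passage
      to the limit needs.\<close>
    define E where "E \<omega> = exp (2 * I n \<omega> - 2\<^sup>2 * Q n \<omega> / 2)" for \<omega>
    have E0: "E = (\<lambda>\<omega>. 1 * exp (elementary_integral W (N n) (\<tau> n) (\<lambda>i \<omega>. 2 * \<xi>' n i \<omega>) \<omega>
        - elementary_quad (N n) (\<tau> n) (\<lambda>i \<omega>. 2 * \<xi>' n i \<omega>) \<omega> / 2))"
      unfolding E_def[abs_def] elementary_integrand_cmult(2,3)[OF el'] I_def Q_def by (simp only: mult_1)
    have E: "integrable M E" "expectation E = 1"
      unfolding E0 using expectation_exp_elementary[OF elementary_integrand_cmult(1)[OF el', of n 2], of "\<lambda>_. 1"] prob_space
      by (simp_all only: borel_measurable_const integrable_const lebesgue_integral_const scaleR_one)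
    have le: "(Y n \<omega>)\<^sup>2 \<le> exp C * E \<omega>" for \<omega>
    proof -
      have "(Y n \<omega>)\<^sup>2 = exp (Q n \<omega>) * E \<omega>"
        unfolding Y_def E_def power2_eq_square mult_exp_exp by (simp add: field_simps)
      also have "\<dots> \<le> exp C * E \<omega>" using QC by (intro mult_right_mono) (auto simp: E_def)
      finally show ?thesis .
    qed
    show i: "integrable M (\<lambda>\<omega>. (Y n \<omega>)\<^sup>2)"
    proof (rule Bochner_Integration.integrable_bound)
      show "integrable M (\<lambda>\<omega>. exp C * E \<omega>)" using E by simp
      show "AE \<omega> in M. norm ((Y n \<omega>)\<^sup>2) \<le> norm (exp C * E \<omega>)"
        using le by (auto simp: E_def)
    qed measurable
    have "expectation (\<lambda>\<omega>. (Y n \<omega>)\<^sup>2) \<le> expectation (\<lambda>\<omega>. exp C * E \<omega>)"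
      by (intro integral_mono i le) (use E in simp)
    then show "expectation (\<lambda>\<omega>. (Y n \<omega>)\<^sup>2) \<le> exp C" using E by simp
  qed
  \<comment> \<open>Only where \<open>q < C\<close> is the truncation eventually inactive, so that
    the limit of \<open>Y n\<close> is known; the remaining paths are cut out and estimated
    separately.\<close>
  define X where "X n \<omega> = Y n \<omega> * indicator {..<C} (q \<omega>)" for n \<omega>
  have Xm[measurable]: "X n \<in> borel_measurable M" for n unfolding X_def by measurable
  have X2: "integrable M (\<lambda>\<omega>. (X n \<omega>)\<^sup>2)" "expectation (\<lambda>\<omega>. (X n \<omega>)\<^sup>2) \<le> exp C" for n
  proof -
    have le: "(X n \<omega>)\<^sup>2 \<le> (Y n \<omega>)\<^sup>2" for \<omega> by (simp add: X_def indicator_def)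
    show i: "integrable M (\<lambda>\<omega>. (X n \<omega>)\<^sup>2)"
      by (rule Bochner_Integration.integrable_bound[OF Y2(1)[of n]]) (use le in auto)
    have "expectation (\<lambda>\<omega>. (X n \<omega>)\<^sup>2) \<le> expectation (\<lambda>\<omega>. (Y n \<omega>)\<^sup>2)"
      by (intro integral_mono i le Y2(1))
    then show "expectation (\<lambda>\<omega>. (X n \<omega>)\<^sup>2) \<le> exp C" using Y2(2)[of n] by simp
  qed
  have XZ: "AE \<omega> in M. (\<lambda>n. X n \<omega>) \<longlonglongrightarrow> Z \<omega>"
    using Ic Qc
  proof eventually_elim
    case (elim \<omega>)
    show ?case
    proof (cases "q \<omega> < C")
      case True
      then have "eventually (\<lambda>n. elementary_quad (N n) (\<tau> n) (\<xi> n) \<omega> < C) sequentially"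
        using elim(2) by (rule order_tendstoD(2)[rotated])
      then have ev: "eventually (\<lambda>n. exp (elementary_integral W (N n) (\<tau> n) (\<xi> n) \<omega> - elementary_quad (N n) (\<tau> n) (\<xi> n) \<omega> / 2) = X n \<omega>) sequentially"
      proof eventually_elim
        case (elim n)
        then show ?case
          using True by (simp add: X_def Y_def I_def Q_def \<xi>'_def elementary_truncate_eq[OF part less_imp_le[OF elim]])
      qed
      have "(\<lambda>n. exp (elementary_integral W (N n) (\<tau> n) (\<xi> n) \<omega> - elementary_quad (N n) (\<tau> n) (\<xi> n) \<omega> / 2)) \<longlonglongrightarrow> exp (J \<omega> - q \<omega> / 2)"
        by (intro tendsto_exp tendsto_diff tendsto_divide tendsto_const elim) simp
      then have "(\<lambda>n. X n \<omega>) \<longlonglongrightarrow> exp (J \<omega> - q \<omega> / 2)"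
        by (rule Lim_transform_eventually[OF _ ev])
      then show ?thesis using True by (simp add: Z_def)
    qed (simp add: X_def Z_def)
  qed
  show Z2: "integrable M (\<lambda>\<omega>. (Z \<omega>)\<^sup>2)" "expectation (\<lambda>\<omega>. (Z \<omega>)\<^sup>2) \<le> exp C"
    by (rule expectation_square_le_of_AE_limit[OF Xm Zm X2 XZ])+
  have Zi: "integrable M Z" by (rule square_integrable_imp_integrable[OF Zm Z2(1)])
  have Xi: "integrable M (X n)" for n by (rule square_integrable_imp_integrable[OF Xm X2(1)])
  fix a :: real assume a: "a > 0"
  define D where "D n \<omega> = X n \<omega> - Z \<omega>" for n \<omega>
  have Dm[measurable]: "D n \<in> borel_measurable M" for n unfolding D_def by measurable
  have Dle: "(D n \<omega>)\<^sup>2 \<le> 2 * (X n \<omega>)\<^sup>2 + 2 * (Z \<omega>)\<^sup>2" for n \<omega>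
  proof -
    have "0 \<le> (X n \<omega> + Z \<omega>)\<^sup>2" by simp
    then show ?thesis by (simp add: D_def power2_eq_square algebra_simps)
  qed
  have D2: "integrable M (\<lambda>\<omega>. (D n \<omega>)\<^sup>2)" "expectation (\<lambda>\<omega>. (D n \<omega>)\<^sup>2) \<le> 4 * exp C" for n
  proof -
    have i2: "integrable M (\<lambda>\<omega>. 2 * (X n \<omega>)\<^sup>2 + 2 * (Z \<omega>)\<^sup>2)" using X2(1) Z2(1) by simp
    show i: "integrable M (\<lambda>\<omega>. (D n \<omega>)\<^sup>2)"
      by (rule Bochner_Integration.integrable_bound[OF i2]) (use Dle in auto)
    have "expectation (\<lambda>\<omega>. (D n \<omega>)\<^sup>2) \<le> expectation (\<lambda>\<omega>. 2 * (X n \<omega>)\<^sup>2 + 2 * (Z \<omega>)\<^sup>2)"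
      by (intro integral_mono i i2 Dle)
    also have "\<dots> = 2 * expectation (\<lambda>\<omega>. (X n \<omega>)\<^sup>2) + 2 * expectation (\<lambda>\<omega>. (Z \<omega>)\<^sup>2)"
      using X2(1) Z2(1) by simp
    also have "\<dots> \<le> 4 * exp C" using X2(2)[of n] Z2(2) by simp
    finally show "expectation (\<lambda>\<omega>. (D n \<omega>)\<^sup>2) \<le> 4 * exp C" .
  qed
  have D0: "AE \<omega> in M. (\<lambda>n. D n \<omega>) \<longlonglongrightarrow> 0"
    using XZ by eventually_elim (simp add: D_def LIM_zero)
  have lim0: "(\<lambda>n. expectation (\<lambda>\<omega>. \<bar>D n \<omega>\<bar>)) \<longlonglongrightarrow> 0"
    by (rule L2_bounded_tendsto_zero(2)[OF Dm D2 D0])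
  have ind: "integrable M (indicator {\<omega>\<in>space M. C \<le> q \<omega>} :: 'a \<Rightarrow> real)"
    by (rule integrable_const_bound[where B = 1]) (auto simp: indicator_def)
  have bound: "\<bar>expectation G - expectation (\<lambda>\<omega>. G \<omega> * Z \<omega>)\<bar>
    \<le> expectation (\<lambda>\<omega>. \<bar>D n \<omega>\<bar>) + (a * exp C + prob {\<omega>\<in>space M. C \<le> q \<omega>} / a)" for n
  proof -
    have GZi: "integrable M (\<lambda>\<omega>. G \<omega> * Z \<omega>)"
      by (rule Bochner_Integration.integrable_bound[OF Zi]) (use G(2) in \<open>auto simp: abs_mult intro!: mult_left_le_one_le\<close>)
    have "\<bar>expectation G - expectation (\<lambda>\<omega>. G \<omega> * Z \<omega>)\<bar> = \<bar>expectation (\<lambda>\<omega>. G \<omega> * Y n \<omega> - G \<omega> * Z \<omega>)\<bar>"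
      using GY[of n] GZi by simp
    also have "\<dots> \<le> expectation (\<lambda>\<omega>. \<bar>G \<omega> * Y n \<omega> - G \<omega> * Z \<omega>\<bar>)"
      by (rule integral_abs_bound)
    also have "\<dots> \<le> expectation (\<lambda>\<omega>. \<bar>D n \<omega>\<bar> + (a * (Y n \<omega>)\<^sup>2 + indicator {\<omega>\<in>space M. C \<le> q \<omega>} \<omega> / a))"
    proof (rule integral_mono)
      show "integrable M (\<lambda>\<omega>. \<bar>G \<omega> * Y n \<omega> - G \<omega> * Z \<omega>\<bar>)" using GY(1)[of n] GZi by simp
      have "integrable M (D n)" by (rule L2_bounded_tendsto_zero(1)[OF Dm D2 D0])
      then show "integrable M (\<lambda>\<omega>. \<bar>D n \<omega>\<bar> + (a * (Y n \<omega>)\<^sup>2 + indicator {\<omega>\<in>space M. C \<le> q \<omega>} \<omega> / a))"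
        using Y2(1)[of n] ind
        by (intro Bochner_Integration.integrable_add integrable_abs integrable_mult_right integrable_divide)
      fix \<omega> assume \<omega>: "\<omega> \<in> space M"
      have Y0: "0 \<le> Y n \<omega>" by (simp add: Y_def)
      have "\<bar>G \<omega> * Y n \<omega> - G \<omega> * Z \<omega>\<bar> \<le> \<bar>Y n \<omega> - Z \<omega>\<bar>"
        unfolding right_diff_distrib[symmetric] abs_mult using G(2)[OF \<omega>] by (intro mult_left_le_one_le) auto
      also have "\<dots> \<le> \<bar>D n \<omega>\<bar> + (a * (Y n \<omega>)\<^sup>2 + indicator {\<omega>\<in>space M. C \<le> q \<omega>} \<omega> / a)"
      proof (cases "q \<omega> < C")
        case True
        then show ?thesis using a by (simp add: D_def X_def)
      next
        case False
        \<comment> \<open>Where \<open>q\<close> reaches \<open>C\<close> the limit \<open>Z\<close>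
          is 0 and \<open>Y n\<close> has to be paid for in full. The inequality between arithmetic
          and geometric means trades it for a small multiple of its second moment plus
          \<open>1 / a\<close> on that event; the caller chooses \<open>a\<close>.\<close>
        have "0 \<le> (a * Y n \<omega> - 1)\<^sup>2 / a" using a by simp
        also have "\<dots> = a * (Y n \<omega>)\<^sup>2 + 1 / a - 2 * Y n \<omega>"
          using a by (simp add: power2_eq_square field_simps)
        finally have "Y n \<omega> \<le> a * (Y n \<omega>)\<^sup>2 + 1 / a" using Y0 by linarith
        then show ?thesis using False \<omega> Y0 by (simp add: D_def X_def Z_def)
      qed
      finally show "\<bar>G \<omega> * Y n \<omega> - G \<omega> * Z \<omega>\<bar> \<le> \<bar>D n \<omega>\<bar> + (a * (Y n \<omega>)\<^sup>2 + indicator {\<omega>\<in>space M. C \<le> q \<omega>} \<omega> / a)" .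
    qed
    also have "\<dots> = expectation (\<lambda>\<omega>. \<bar>D n \<omega>\<bar>) + (a * expectation (\<lambda>\<omega>. (Y n \<omega>)\<^sup>2) + prob {\<omega>\<in>space M. C \<le> q \<omega>} / a)"
    proof -
      have "integrable M (D n)" by (rule L2_bounded_tendsto_zero(1)[OF Dm D2 D0])
      then show ?thesis using Y2(1)[of n] ind by simp
    qed
    also have "a * expectation (\<lambda>\<omega>. (Y n \<omega>)\<^sup>2) \<le> a * exp C" using Y2(2)[of n] a by (intro mult_left_mono) auto
    finally show ?thesis by simp
  qed
  have "(\<lambda>n. expectation (\<lambda>\<omega>. \<bar>D n \<omega>\<bar>) + (a * exp C + prob {\<omega>\<in>space M. C \<le> q \<omega>} / a))
    \<longlonglongrightarrow> 0 + (a * exp C + prob {\<omega>\<in>space M. C \<le> q \<omega>} / a)"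
    by (intro tendsto_add lim0 tendsto_const)
  then show "\<bar>expectation G - expectation (\<lambda>\<omega>. G \<omega> * Z \<omega>)\<bar> \<le> a * exp C + prob {\<omega>\<in>space M. C \<le> q \<omega>} / a"
    using bound by (intro tendsto_lowerbound[of _ _ sequentially]) auto
qed

text \<open>Since \<open>q\<close> is known at time 0, the integral is conditionally normal with
  variance \<open>q\<close>. In contrast to the real exponential, truncation causes no error here:
  it can be made part of the test variable, and dominated convergence removes it at the end.\<close>

lemma expectation_iexp_ito:
  fixes G :: "'a \<Rightarrow> complex"
  assumes ia: "ito_approx M F W H T J"
    and H: "\<And>\<omega>. \<omega> \<in> space M \<Longrightarrow> set_borel_measurable borel {0..T} (\<lambda>s. H s \<omega>)"
    and q: "AE \<omega> in M. 0 \<le> q \<omega> \<and> (\<integral>\<^sup>+ s\<in>{0..T}. ennreal ((H s \<omega>)\<^sup>2) \<partial>lborel) = ennreal (q \<omega>)"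
    and qm: "q \<in> borel_measurable (F 0)"
    and G: "G \<in> borel_measurable (F 0)" "\<And>\<omega>. \<omega> \<in> space M \<Longrightarrow> norm (G \<omega>) \<le> 1"
  shows "expectation (\<lambda>\<omega>. G \<omega> * exp (\<i> * of_real (u * J \<omega>))) = expectation (\<lambda>\<omega>. G \<omega> * of_real (exp (- (u\<^sup>2 * q \<omega> / 2))))"
proof -
  have [measurable]: "J \<in> borel_measurable M" using ia by (simp add: ito_approx_def)
  note [measurable] = F_imp_M[OF G(1)] F_imp_M[OF qm]
  obtain N \<tau> \<xi> where el0: "\<forall>n::nat. elementary_integrand M F T (N n) (\<tau> n) (\<xi> n)"
    and Ic: "AE \<omega> in M. (\<lambda>n. elementary_integral W (N n) (\<tau> n) (\<xi> n) \<omega>) \<longlonglongrightarrow> J \<omega>"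
    and Qc: "AE \<omega> in M. (\<lambda>n. elementary_quad (N n) (\<tau> n) (\<xi> n) \<omega>) \<longlonglongrightarrow> q \<omega>"
    by (rule ito_approx_sequence[OF ia H q])
  note el = el0[rule_format]
  have part: "partition_points (N n) (\<tau> n)" for n by (rule elementary_partition[OF el])
  have q0: "AE \<omega> in M. 0 \<le> q \<omega>" using q by eventually_elim simp
  have trunc: "expectation (\<lambda>\<omega>. G \<omega> * exp (\<i> * of_real (u * J \<omega>)) * indicator {0..<C} (q \<omega>))
    = expectation (\<lambda>\<omega>. G \<omega> * of_real (exp (- (u\<^sup>2 * q \<omega> / 2))) * indicator {0..<C} (q \<omega>))" if C: "C > 0" for C :: real
  proof -
    define \<xi>' where "\<xi>' n = (\<lambda>i \<omega>. u * truncate C (\<tau> n) (\<xi> n) i \<omega>)" for n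
    have el'': "elementary_integrand M F T (N n) (\<tau> n) (truncate C (\<tau> n) (\<xi> n))" for n
      by (rule elementary_integrand_truncate[OF el])
    have el': "elementary_integrand M F T (N n) (\<tau> n) (\<xi>' n)" for n
      unfolding \<xi>'_def by (rule elementary_integrand_cmult(1)[OF el''])
    define I where "I n = elementary_integral W (N n) (\<tau> n) (\<xi>' n)" for n
    define Q where "Q n = elementary_quad (N n) (\<tau> n) (\<xi>' n)" for n
    have [measurable]: "I n \<in> borel_measurable M" "Q n \<in> borel_measurable M" for n
      unfolding I_def Q_def by (rule elementary_integral_measurable[OF el'])+
    have Ieq: "I n \<omega> = u * elementary_integral W (N n) (\<tau> n) (truncate C (\<tau> n) (\<xi> n)) \<omega>"
      and Qeq: "Q n \<omega> = u\<^sup>2 * elementary_quad (N n) (\<tau> n) (truncate C (\<tau> n) (\<xi> n)) \<omega>" for n \<omega>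
      unfolding I_def Q_def \<xi>'_def by (rule elementary_integrand_cmult(2,3)[OF el''])+
    have QC: "Q n \<omega> \<le> u\<^sup>2 * C" for n \<omega>
      unfolding Qeq using C by (intro mult_left_mono elementary_quad_truncate_le part) auto
    \<comment> \<open>The compensator and the truncation are absorbed into the test variable, which
      stays known at time 0; in the limit of \<open>X n\<close> the compensator cancels. The lower
      end 0 of the indicator keeps the compensator at most 1 on every path, while \<open>q\<close>
      is nonnegative only almost everywhere.\<close>
    define G' where "G' \<omega> = G \<omega> * of_real (exp (- (u\<^sup>2 * q \<omega> / 2))) * indicator {0..<C} (q \<omega>)" for \<omega>
    have "(\<lambda>\<omega>. G \<omega> * of_real (exp (- (u\<^sup>2 * q \<omega> / 2))) * indicator {0..<C} (q \<omega>)) \<in> borel_measurable (F 0)"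
      using G(1) qm by measurable
    then have G'm: "G' \<in> borel_measurable (F 0)" by (simp add: G'_def[abs_def])
    note [measurable] = F_imp_M[OF G'm]
    have G'b: "norm (G' \<omega>) \<le> 1" if "\<omega> \<in> space M" for \<omega>
      using G(2)[OF that] by (auto simp: G'_def norm_mult indicator_def intro!: mult_le_one)
    have G'i: "integrable M G'" by (rule integrable_const_bound[where B = 1]) (use G'b in auto)
    define X where "X n \<omega> = G' \<omega> * exp (\<i> * of_real (I n \<omega>) + of_real (Q n \<omega> / 2))" for n \<omega>
    have Xm[measurable]: "X n \<in> borel_measurable M" for n unfolding X_def by measurable
    have EX: "expectation (X n) = expectation G'" for n
      unfolding X_def[abs_def] I_def Q_def by (rule expectation_iexp_elementary(2)[OF el' G'm G'i])
    have "(\<lambda>n. expectation (X n)) \<longlonglongrightarrow> expectation (\<lambda>\<omega>. G \<omega> * exp (\<i> * of_real (u * J \<omega>)) * indicator {0..<C} (q \<omega>))"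
    proof (rule integral_dominated_convergence[where w = "\<lambda>_. exp (u\<^sup>2 * C / 2)"])
      show "AE \<omega> in M. norm (X n \<omega>) \<le> exp (u\<^sup>2 * C / 2)" for n
      proof (rule AE_I2)
        fix \<omega> assume \<omega>: "\<omega> \<in> space M"
        have "norm (X n \<omega>) = norm (G' \<omega>) * exp (Q n \<omega> / 2)" by (simp add: X_def norm_mult)
        also have "\<dots> \<le> 1 * exp (u\<^sup>2 * C / 2)" using G'b[OF \<omega>] QC by (intro mult_mono) auto
        finally show "norm (X n \<omega>) \<le> exp (u\<^sup>2 * C / 2)" by simp
      qed
      show "AE \<omega> in M. (\<lambda>n. X n \<omega>) \<longlonglongrightarrow> G \<omega> * exp (\<i> * of_real (u * J \<omega>)) * indicator {0..<C} (q \<omega>)"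
        using Ic Qc
      proof eventually_elim
        case (elim \<omega>)
        show ?case
        proof (cases "q \<omega> \<in> {0..<C}")
          case True
          then have "eventually (\<lambda>n. elementary_quad (N n) (\<tau> n) (\<xi> n) \<omega> < C) sequentially"
            using elim(2) by (intro order_tendstoD(2)) auto
          then have ev: "eventually (\<lambda>n. G' \<omega> * exp (\<i> * of_real (u * elementary_integral W (N n) (\<tau> n) (\<xi> n) \<omega>)
             + of_real (u\<^sup>2 * elementary_quad (N n) (\<tau> n) (\<xi> n) \<omega> / 2)) = X n \<omega>) sequentially"
          proof eventually_elim
            case (elim n)
            then show ?case
              by (simp add: X_def Ieq Qeq elementary_truncate_eq[OF part less_imp_le[OF elim]])
          qed
          have "(\<lambda>n. G' \<omega> * exp (\<i> * of_real (u * elementary_integral W (N n) (\<tau> n) (\<xi> n) \<omega>)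
             + of_real (u\<^sup>2 * elementary_quad (N n) (\<tau> n) (\<xi> n) \<omega> / 2)))
            \<longlonglongrightarrow> G' \<omega> * exp (\<i> * of_real (u * J \<omega>) + of_real (u\<^sup>2 * q \<omega> / 2))"
            by (intro tendsto_exp tendsto_add tendsto_mult tendsto_of_real tendsto_divide tendsto_const elim) simp
          then have "(\<lambda>n. X n \<omega>) \<longlonglongrightarrow> G' \<omega> * exp (\<i> * of_real (u * J \<omega>) + of_real (u\<^sup>2 * q \<omega> / 2))"
            by (rule Lim_transform_eventually[OF _ ev])
          also have "G' \<omega> * exp (\<i> * of_real (u * J \<omega>) + of_real (u\<^sup>2 * q \<omega> / 2))
            = G \<omega> * exp (\<i> * of_real (u * J \<omega>)) * (of_real (exp (- (u\<^sup>2 * q \<omega> / 2))) * of_real (exp (u\<^sup>2 * q \<omega> / 2)))"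
            using True unfolding G'_def exp_add exp_of_real by simp
          also have "\<dots> = G \<omega> * exp (\<i> * of_real (u * J \<omega>))"
            unfolding of_real_mult[symmetric] mult_exp_exp by simp
          finally show ?thesis using True by simp
        qed (simp add: X_def G'_def)
      qed
    qed auto
    then have "expectation (\<lambda>\<omega>. G \<omega> * exp (\<i> * of_real (u * J \<omega>)) * indicator {0..<C} (q \<omega>)) = expectation G'"
      unfolding EX by (simp add: LIMSEQ_const_iff)
    then show ?thesis by (simp add: G'_def[abs_def])
  qed
  have ind: "AE \<omega> in M. (\<lambda>n. indicator {0..<real (Suc n)} (q \<omega>) :: complex) \<longlonglongrightarrow> 1"
    using q0
  proof eventually_elim
    case (elim \<omega>)
    obtain n0 :: nat where "q \<omega> < real n0" using reals_Archimedean2 by blast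
    then have "eventually (\<lambda>n. (1::complex) = indicator {0..<real (Suc n)} (q \<omega>)) sequentially"
      using elim by (auto simp: eventually_sequentially intro!: exI[of _ n0])
    then show ?case by (rule Lim_transform_eventually[OF tendsto_const])
  qed
  have lim1: "(\<lambda>n. expectation (\<lambda>\<omega>. G \<omega> * exp (\<i> * of_real (u * J \<omega>)) * indicator {0..<real (Suc n)} (q \<omega>)))
    \<longlonglongrightarrow> expectation (\<lambda>\<omega>. G \<omega> * exp (\<i> * of_real (u * J \<omega>)))"
  proof (rule integral_dominated_convergence[where w = "\<lambda>_. 1"])
    show "AE \<omega> in M. (\<lambda>n. G \<omega> * exp (\<i> * of_real (u * J \<omega>)) * indicator {0..<real (Suc n)} (q \<omega>)) \<longlonglongrightarrow> G \<omega> * exp (\<i> * of_real (u * J \<omega>))"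
      using ind
    proof eventually_elim
      case (elim \<omega>)
      from tendsto_mult[OF tendsto_const elim] show ?case by simp
    qed
    show "AE \<omega> in M. norm (G \<omega> * exp (\<i> * of_real (u * J \<omega>)) * indicator {0..<real (Suc n)} (q \<omega>)) \<le> 1" for n
      using G(2) by (intro AE_I2) (auto simp: norm_mult indicator_def)
  qed auto
  have lim2: "(\<lambda>n. expectation (\<lambda>\<omega>. G \<omega> * of_real (exp (- (u\<^sup>2 * q \<omega> / 2))) * indicator {0..<real (Suc n)} (q \<omega>)))
    \<longlonglongrightarrow> expectation (\<lambda>\<omega>. G \<omega> * of_real (exp (- (u\<^sup>2 * q \<omega> / 2))))"
  proof (rule integral_dominated_convergence[where w = "\<lambda>_. 1"])
    show "AE \<omega> in M. (\<lambda>n. G \<omega> * of_real (exp (- (u\<^sup>2 * q \<omega> / 2))) * indicator {0..<real (Suc n)} (q \<omega>)) \<longlonglongrightarrow> G \<omega> * of_real (exp (- (u\<^sup>2 * q \<omega> / 2)))"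
      using ind
    proof eventually_elim
      case (elim \<omega>)
      from tendsto_mult[OF tendsto_const elim] show ?case by simp
    qed
    show "AE \<omega> in M. norm (G \<omega> * of_real (exp (- (u\<^sup>2 * q \<omega> / 2))) * indicator {0..<real (Suc n)} (q \<omega>)) \<le> 1" for n
      using G(2) by (intro AE_I2) (auto simp: norm_mult indicator_def intro!: mult_le_one)
  qed auto
  show ?thesis
    using lim1 lim2 unfolding trunc[OF of_nat_0_less_iff[THEN iffD2, OF zero_less_Suc]]
    by (rule LIMSEQ_unique)
qed

end

section \<open>The Laplace transform of the driftless square-root diffusion\<close>

text \<open>The solution of \<open>\<psi>' = \<sigma>\<^sup>2 \<psi>\<^sup>2 / 2\<close>, \<open>\<psi> h = \<mu>\<close>.\<close>

definition riccati :: "real \<Rightarrow> real \<Rightarrow> real \<Rightarrow> real \<Rightarrow> real" where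
  "riccati \<sigma> \<mu> h s = \<mu> / (1 + \<sigma>\<^sup>2 * \<mu> * (h - s) / 2)"

lemma riccati_bounds:
  assumes "\<mu> > 0" "s \<le> h"
  shows "0 < riccati \<sigma> \<mu> h s" "riccati \<sigma> \<mu> h s \<le> \<mu>"
proof -
  have d: "1 \<le> 1 + \<sigma>\<^sup>2 * \<mu> * (h - s) / 2" using assms by simp
  then have d': "0 < 1 + \<sigma>\<^sup>2 * \<mu> * (h - s) / 2" by linarith
  then show "0 < riccati \<sigma> \<mu> h s" unfolding riccati_def by (rule divide_pos_pos[OF assms(1)])
  have "\<mu> / (1 + \<sigma>\<^sup>2 * \<mu> * (h - s) / 2) \<le> \<mu> / 1" using d d' assms by (intro divide_left_mono) simp_all
  then show "riccati \<sigma> \<mu> h s \<le> \<mu>" by (simp add: riccati_def)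
qed

text \<open>The reciprocal of the Riccati solution is affine in time with slope
  \<open>- \<sigma>\<^sup>2 / 2\<close>. The equation thus holds exactly for differences, with the
  square replaced by the product of the endpoint values, and no remainder term has to be
  estimated.\<close>

lemma riccati_diff:
  assumes "\<mu> > 0" "s \<le> u" "u \<le> h"
  shows "riccati \<sigma> \<mu> h u - riccati \<sigma> \<mu> h s = \<sigma>\<^sup>2 / 2 * riccati \<sigma> \<mu> h s * riccati \<sigma> \<mu> h u * (u - s)"
proof -
  define a where "a = 1 + \<sigma>\<^sup>2 * \<mu> * (h - s) / 2"
  define b where "b = 1 + \<sigma>\<^sup>2 * \<mu> * (h - u) / 2"
  have "0 \<le> \<sigma>\<^sup>2 * \<mu> * (h - s)" "0 \<le> \<sigma>\<^sup>2 * \<mu> * (h - u)" using assms by auto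
  then have ab: "a > 0" "b > 0" by (auto simp: a_def b_def)
  have "\<mu> / b - \<mu> / a = \<mu> * (a - b) / (a * b)" using ab by (simp add: field_simps)
  also have "a - b = \<sigma>\<^sup>2 * \<mu> * (u - s) / 2" by (simp add: a_def b_def field_simps)
  finally have "\<mu> / b - \<mu> / a = \<sigma>\<^sup>2 / 2 * (\<mu> / a) * (\<mu> / b) * (u - s)"
    using ab by (simp add: mult_ac)
  then show ?thesis by (simp only: riccati_def a_def b_def)
qed

lemma set_integral_close:
  fixes f :: "real \<Rightarrow> real"
  assumes f: "continuous_on {a..b} f" and "a \<le> b" and close: "\<And>s. s \<in> {a..b} \<Longrightarrow> \<bar>f s - c\<bar> \<le> \<epsilon>"
  shows "\<bar>(LINT s:{a<..b}|lborel. f s) - c * (b - a)\<bar> \<le> \<epsilon> * (b - a)"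
proof -
  have i: "set_integrable lborel {a<..b} f"
    by (rule set_integrable_subset[OF borel_integrable_atLeastAtMost'[OF f]]) auto
  have ic: "set_integrable lborel {a<..b} (\<lambda>_. d)" for d :: real
    by (rule set_integrable_subset[OF borel_integrable_atLeastAtMost'[of a b "\<lambda>_. d"]]) auto
  have ev: "(LINT s:{a<..b}|lborel. d) = d * (b - a)" for d :: real
    using \<open>a \<le> b\<close> by (simp add: set_lebesgue_integral_def)
  have le: "f s \<le> c + \<epsilon>" "c - \<epsilon> \<le> f s" if "s \<in> {a<..b}" for s
  proof -
    have "s \<in> {a..b}" using that by simp
    from close[OF this] show "f s \<le> c + \<epsilon>" "c - \<epsilon> \<le> f s" by linarith+
  qed
  have "(LINT s:{a<..b}|lborel. f s) \<le> (LINT s:{a<..b}|lborel. c + \<epsilon>)"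
    by (rule set_integral_mono[OF i ic le(1)])
  moreover have "(LINT s:{a<..b}|lborel. c - \<epsilon>) \<le> (LINT s:{a<..b}|lborel. f s)"
    by (rule set_integral_mono[OF ic i le(2)])
  ultimately show ?thesis unfolding ev by (simp add: abs_le_iff algebra_simps)
qed

section \<open>Uniform grids and the discretised product rule\<close>

definition grid :: "real \<Rightarrow> nat \<Rightarrow> nat \<Rightarrow> real" where
  "grid h m j = real j * h / real m"

lemma grid_simps [simp]: "grid h m 0 = 0" "m > 0 \<Longrightarrow> grid h m m = h"
  by (simp_all add: grid_def)

lemma grid_step: "grid h m (Suc j) - grid h m j = h / real m"
  by (simp add: grid_def diff_divide_distrib[symmetric] algebra_simps)

lemma grid_range:
  assumes "0 \<le> h" "j \<le> m" "m > 0"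
  shows "grid h m j \<in> {0..h}"
proof -
  have "real j * h \<le> real m * h" using assms by (intro mult_right_mono) auto
  then show ?thesis using assms by (simp add: grid_def divide_simps mult.commute)
qed

lemma grid_mono:
  assumes "0 \<le> h"
  shows "grid h m j \<le> grid h m (Suc j)"
proof -
  have "0 \<le> h / real m" using assms by simp
  then show ?thesis using grid_step[of h m j] by linarith
qed

lemma uniform_grid_oscillation:
  fixes f :: "real \<Rightarrow> real"
  assumes f: "continuous_on {0..h} f" and h: "0 \<le> h" and \<epsilon>: "\<epsilon> > 0"
  shows "eventually (\<lambda>m. m > 0 \<and> (\<forall>j<m. \<forall>s\<in>{grid h m j..grid h m (Suc j)}. \<forall>u\<in>{grid h m j..grid h m (Suc j)}.
    \<bar>f s - f u\<bar> \<le> \<epsilon>)) sequentially"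
proof -
  have "uniformly_continuous_on {0..h} f" using f by (intro compact_uniformly_continuous) auto
  then obtain d where d: "d > 0" "\<And>x y. x \<in> {0..h} \<Longrightarrow> y \<in> {0..h} \<Longrightarrow> dist x y < d \<Longrightarrow> dist (f x) (f y) < \<epsilon>"
    using \<epsilon> unfolding uniformly_continuous_on_def by metis
  have "(\<lambda>m. h / real m) \<longlonglongrightarrow> 0" by (rule lim_const_over_n)
  then have "eventually (\<lambda>m. h / real m < d) sequentially" by (rule order_tendstoD(2)) (rule d(1))
  moreover have "eventually (\<lambda>m::nat. m > 0) sequentially" by (rule eventually_gt_at_top)
  ultimately show ?thesis
  proof eventually_elim
    case (elim m)
    show ?case
    proof (intro conjI allI impI ballI)
      show "m > 0" by fact
      fix j s u assume j: "j < m" and s: "s \<in> {grid h m j..grid h m (Suc j)}" and u: "u \<in> {grid h m j..grid h m (Suc j)}"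
      have "grid h m j \<in> {0..h}" "grid h m (Suc j) \<in> {0..h}" using j elim h by (auto intro!: grid_range simp del: atLeastAtMost_iff)
      then have "s \<in> {0..h}" "u \<in> {0..h}" using s u by auto
      moreover have "dist s u < d" using s u grid_step[of h m j] elim by (auto simp: dist_real_def)
      ultimately have "dist (f s) (f u) < \<epsilon>" by (rule d(2))
      then show "\<bar>f s - f u\<bar> \<le> \<epsilon>" by (simp add: dist_real_def)
    qed
  qed
qed

text \<open>
  Discretises \<open>d(\<psi> f) = \<psi> df + \<sigma>\<^sup>2 \<psi>\<^sup>2 / 2 f ds\<close>; the uniformity in \<open>n\<close> is needed because the sum
  will be stopped at a random index.
\<close>

lemma riccati_path_sum:
  fixes f :: "real \<Rightarrow> real" and \<sigma> :: real
  assumes f: "continuous_on {0..h} f" and f0': "\<forall>s\<in>{0..h}. 0 \<le> f s" and h: "h > 0" and \<mu>: "\<mu> > 0" and \<delta>: "\<delta> > 0"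
  defines "\<psi> \<equiv> riccati \<sigma> \<mu> h"
  shows "eventually (\<lambda>m. \<forall>n\<le>m. \<bar>(\<Sum>j<n. - \<psi> (grid h m j) * (f (grid h m (Suc j)) - f (grid h m j))
      - \<sigma>\<^sup>2 / 2 * (\<psi> (grid h m j))\<^sup>2 * (LINT s:{grid h m j<..grid h m (Suc j)}|lborel. f s))
      - (\<psi> 0 * f 0 - \<psi> (grid h m n) * f (grid h m n))\<bar> \<le> \<delta>) sequentially"
proof -
  note f0 = f0'[rule_format]
  have "compact (f ` {0..h})" using f by (intro compact_continuous_image) auto
  then obtain B0 where B0': "\<forall>s\<in>{0..h}. \<bar>f s\<bar> \<le> B0"
    using compact_imp_bounded[of "f ` {0..h}"] unfolding bounded_real by auto
  note B0 = B0'[rule_format]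
  define B where "B = \<bar>B0\<bar>"
  have B: "B \<ge> 0" "f s \<le> B" if "s \<in> {0..h}" for s
    using B0[OF that] unfolding B_def by linarith+
  have "B \<ge> 0" by (simp add: B_def)
  \<comment> \<open>A bound for \<open>\<sigma>\<^sup>2 / 2 * \<psi>\<close>. The accumulated error
    will be at most \<open>(c * c * \<mu> * B * h) * \<Delta> + c * \<mu> * h * \<epsilon>\<close>:
    the first term comes from the change of \<open>\<psi>\<close> within a cell, the second from the
    oscillation of \<open>f\<close>, and each gets half of \<open>\<delta>\<close>.\<close>
  define c where "c = \<sigma>\<^sup>2 / 2 * \<mu>"
  have c: "c \<ge> 0" using \<mu> by (simp add: c_def)
  define \<epsilon> where "\<epsilon> = \<delta> / (2 * (c * \<mu> * h + 1))"
  have pos: "c * \<mu> * h + 1 > 0" using c \<mu> h by (intro add_nonneg_pos mult_nonneg_nonneg) auto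
  have \<epsilon>: "\<epsilon> > 0" using pos \<delta> by (simp add: \<epsilon>_def)
  have "\<epsilon> * (c * \<mu> * h + 1) = \<delta> / 2"
  proof -
    have "\<delta> / (2 * d) * d = \<delta> / 2" if "d > 0" for d :: real using that by simp
    from this[OF pos] show ?thesis by (simp only: \<epsilon>_def)
  qed
  then have \<epsilon>le: "c * \<mu> * h * \<epsilon> \<le> \<delta> / 2" using \<epsilon> by (simp only: distrib_left mult_1_right mult_ac)
  have "(\<lambda>m. (c * c * \<mu> * B * h) * (h / real m)) \<longlonglongrightarrow> (c * c * \<mu> * B * h) * 0"
    by (intro tendsto_mult tendsto_const lim_const_over_n)
  then have "eventually (\<lambda>m. (c * c * \<mu> * B * h) * (h / real m) < \<delta> / 2) sequentially"
    by (rule order_tendstoD(2)) (use \<delta> in simp)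
  with uniform_grid_oscillation[OF f less_imp_le[OF h] \<epsilon>]
  show ?thesis
  proof eventually_elim
    case (elim m)
    then have m: "m > 0" and osc: "\<And>j s u. j < m \<Longrightarrow> s \<in> {grid h m j..grid h m (Suc j)} \<Longrightarrow> u \<in> {grid h m j..grid h m (Suc j)} \<Longrightarrow>
      \<bar>f s - f u\<bar> \<le> \<epsilon>" and small: "(c * c * \<mu> * B * h) * (h / real m) < \<delta> / 2" by blast+
    define \<Delta> where "\<Delta> = h / real m"
    have \<Delta>: "\<Delta> > 0" using h m by (simp add: \<Delta>_def)
    let ?t = "grid h m"
    define T where "T j = - \<psi> (?t j) * (f (?t (Suc j)) - f (?t j))
      - \<sigma>\<^sup>2 / 2 * (\<psi> (?t j))\<^sup>2 * (LINT s:{?t j<..?t (Suc j)}|lborel. f s)" for j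
    have term_bound: "\<bar>T j - (\<psi> (?t j) * f (?t j) - \<psi> (?t (Suc j)) * f (?t (Suc j)))\<bar> \<le> c * (c * \<mu> * \<Delta> * B + \<mu> * \<epsilon>) * \<Delta>" if j: "j < m" for j
    proof -
      have tr: "?t j \<in> {0..h}" "?t (Suc j) \<in> {0..h}" using j m h by (auto intro!: grid_range simp del: atLeastAtMost_iff)
      have le: "?t j \<le> ?t (Suc j)" using grid_mono h by simp
      have step: "?t (Suc j) - ?t j = \<Delta>" unfolding \<Delta>_def by (rule grid_step)
      define a where "a = \<psi> (?t j)"
      define b where "b = \<psi> (?t (Suc j))"
      have a: "0 < a" "a \<le> \<mu>" and b: "0 < b" "b \<le> \<mu>"
        unfolding a_def b_def \<psi>_def using riccati_bounds[OF \<mu>] tr by auto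
      have ba: "b - a = \<sigma>\<^sup>2 / 2 * a * b * \<Delta>"
        unfolding a_def b_def \<psi>_def step[symmetric] by (rule riccati_diff[OF \<mu> le]) (use tr in simp)
      define v where "v = (LINT s:{?t j<..?t (Suc j)}|lborel. f s)"
      define y where "y = f (?t (Suc j))"
      have y: "0 \<le> y" "y \<le> B" unfolding y_def using f0 B(2) tr by auto
      have fj: "continuous_on {?t j..?t (Suc j)} f" by (rule continuous_on_subset[OF f]) (use tr in auto)
      have v: "\<bar>v - y * \<Delta>\<bar> \<le> \<epsilon> * \<Delta>"
        unfolding v_def y_def step[symmetric]
        by (rule set_integral_close[OF fj le]) (use osc[OF j] le in auto)
      \<comment> \<open>The exact error of one cell: the first summand compares
        \<open>\<psi>\<close> at its two ends, the second compares the time integral of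
        \<open>f\<close> with its value at the right end.\<close>
      have eq: "T j - (a * f (?t j) - b * y) = \<sigma>\<^sup>2 / 2 * a * ((b - a) * \<Delta> * y + a * (y * \<Delta> - v))"
      proof -
        have "T j - (a * f (?t j) - b * y) = (b - a) * y - \<sigma>\<^sup>2 / 2 * a\<^sup>2 * v"
          by (simp add: T_def a_def y_def v_def algebra_simps)
        also have "\<dots> = \<sigma>\<^sup>2 / 2 * a * b * \<Delta> * y - \<sigma>\<^sup>2 / 2 * a\<^sup>2 * v" unfolding ba ..
        also have "\<dots> = \<sigma>\<^sup>2 / 2 * a * ((b - a) * \<Delta> * y + a * (y * \<Delta> - v))"
          by (simp add: power2_eq_square algebra_simps)
        finally show ?thesis .
      qed
      have ba0: "0 \<le> b - a" unfolding ba using a b \<Delta> by simp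
      have ble: "b - a \<le> c * \<mu> * \<Delta>"
      proof -
        have "a * b \<le> \<mu> * \<mu>" using a b by (intro mult_mono) auto
        then have "\<sigma>\<^sup>2 / 2 * \<Delta> * (a * b) \<le> \<sigma>\<^sup>2 / 2 * \<Delta> * (\<mu> * \<mu>)" using \<Delta> by (intro mult_left_mono) auto
        then show ?thesis unfolding ba c_def by (simp add: mult_ac)
      qed
      have "\<bar>(b - a) * \<Delta> * y + a * (y * \<Delta> - v)\<bar> \<le> \<bar>(b - a) * \<Delta> * y\<bar> + \<bar>a * (y * \<Delta> - v)\<bar>" by (rule abs_triangle_ineq)
      also have "\<dots> = (b - a) * \<Delta> * y + a * \<bar>v - y * \<Delta>\<bar>"
        using ba0 a y \<Delta> by (simp add: abs_mult abs_minus_commute)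
      also have "\<dots> \<le> c * \<mu> * \<Delta> * \<Delta> * B + \<mu> * (\<epsilon> * \<Delta>)"
        using ba0 ble a y v \<Delta> c \<mu> \<epsilon> by (intro add_mono mult_mono mult_nonneg_nonneg) auto
      finally have in1: "\<bar>(b - a) * \<Delta> * y + a * (y * \<Delta> - v)\<bar> \<le> (c * \<mu> * \<Delta> * B + \<mu> * \<epsilon>) * \<Delta>" by (simp add: algebra_simps)
      have "\<sigma>\<^sup>2 / 2 * a \<le> c" unfolding c_def using a by (intro mult_left_mono) auto
      then have "\<sigma>\<^sup>2 / 2 * a * \<bar>(b - a) * \<Delta> * y + a * (y * \<Delta> - v)\<bar> \<le> c * ((c * \<mu> * \<Delta> * B + \<mu> * \<epsilon>) * \<Delta>)"
        using in1 a c by (intro mult_mono) auto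
      moreover have "\<bar>T j - (a * f (?t j) - b * y)\<bar> = \<sigma>\<^sup>2 / 2 * a * \<bar>(b - a) * \<Delta> * y + a * (y * \<Delta> - v)\<bar>"
        unfolding eq abs_mult using a by simp
      ultimately show ?thesis by (simp only: a_def b_def y_def mult.assoc)
    qed
    show ?case
    proof (intro allI impI)
      fix n assume n: "n \<le> m"
      have tel: "(\<Sum>j<n. \<psi> (?t j) * f (?t j) - \<psi> (?t (Suc j)) * f (?t (Suc j))) = \<psi> 0 * f 0 - \<psi> (?t n) * f (?t n)"
        using sum_lessThan_telescope'[of "\<lambda>j. \<psi> (?t j) * f (?t j)" n] by simp
      have "\<bar>(\<Sum>j<n. T j) - (\<psi> 0 * f 0 - \<psi> (?t n) * f (?t n))\<bar>
        = \<bar>\<Sum>j<n. T j - (\<psi> (?t j) * f (?t j) - \<psi> (?t (Suc j)) * f (?t (Suc j)))\<bar>"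
        unfolding tel[symmetric] sum_subtractf ..
      also have "\<dots> \<le> (\<Sum>j<n. \<bar>T j - (\<psi> (?t j) * f (?t j) - \<psi> (?t (Suc j)) * f (?t (Suc j)))\<bar>)"
        by (rule sum_abs)
      also have "\<dots> \<le> (\<Sum>j<n. c * (c * \<mu> * \<Delta> * B + \<mu> * \<epsilon>) * \<Delta>)"
        by (intro sum_mono term_bound) (use n in auto)
      also have "\<dots> = (real n * \<Delta>) * (c * (c * \<mu> * \<Delta> * B + \<mu> * \<epsilon>))" by simp
      also have "\<dots> \<le> h * (c * (c * \<mu> * \<Delta> * B + \<mu> * \<epsilon>))"
      proof (rule mult_right_mono)
        have "real n * \<Delta> \<le> real m * \<Delta>" using n \<Delta> by (intro mult_right_mono) auto
        also have "\<dots> = h" using m by (simp add: \<Delta>_def)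
        finally show "real n * \<Delta> \<le> h" .
        show "0 \<le> c * (c * \<mu> * \<Delta> * B + \<mu> * \<epsilon>)" using c \<mu> \<Delta> \<open>B \<ge> 0\<close> \<epsilon> by auto
      qed
      also have "\<dots> = (c * c * \<mu> * B * h) * \<Delta> + c * \<mu> * h * \<epsilon>" by (simp add: algebra_simps)
      also have "\<dots> \<le> \<delta>" using small \<epsilon>le unfolding \<Delta>_def by linarith
      finally show "\<bar>(\<Sum>j<n. - \<psi> (?t j) * (f (?t (Suc j)) - f (?t j))
      - \<sigma>\<^sup>2 / 2 * (\<psi> (?t j))\<^sup>2 * (LINT s:{?t j<..?t (Suc j)}|lborel. f s))
      - (\<psi> 0 * f 0 - \<psi> (?t n) * f (?t n))\<bar> \<le> \<delta>" by (simp only: T_def)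
    qed
  qed
qed

section \<open>The stopped exponential martingale of the square-root diffusion\<close>

locale feller_diffusion = brownian M F W for M :: "'a measure" and F W +
  fixes \<sigma> h :: real and V :: "real \<Rightarrow> 'a \<Rightarrow> real"
  assumes h: "h > 0"
    and cont: "\<And>\<omega>. \<omega> \<in> space M \<Longrightarrow> continuous_on {0..h} (\<lambda>s. V s \<omega>)"
    and nonneg: "\<And>\<omega> s. \<omega> \<in> space M \<Longrightarrow> s \<in> {0..h} \<Longrightarrow> 0 \<le> V s \<omega>"
    and adapted: "\<And>s. s \<in> {0..h} \<Longrightarrow> V s \<in> borel_measurable (F s)"
    and joint: "(\<lambda>(s, \<omega>). V s \<omega>) \<in> borel_measurable (restrict_space borel {0..h} \<Otimes>\<^sub>M M)"
    and ito: "\<And>u. u \<in> {0..h} \<Longrightarrow> ito_approx M F W (\<lambda>s \<omega>. \<sigma> * sqrt (V s \<omega>)) u (\<lambda>\<omega>. V u \<omega> - V 0 \<omega>)"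
begin

text \<open>The alternative \<open>j = m\<close> guarantees that the minimum exists, so
  \<open>m\<close> is also the value when the level is never exceeded.\<close>

definition exit_index :: "real \<Rightarrow> nat \<Rightarrow> 'a \<Rightarrow> nat" where
  "exit_index K m \<omega> = (LEAST j. j = m \<or> K < V (grid h m j) \<omega>)"

text \<open>
  Stopping at the first grid point where \<open>V\<close> exceeds \<open>K\<close> bounds the quadratic variation.
\<close>

definition weight :: "real \<Rightarrow> real \<Rightarrow> nat \<Rightarrow> nat \<Rightarrow> 'a \<Rightarrow> real" where
  "weight \<mu> K m j \<omega> = - riccati \<sigma> \<mu> h (grid h m j) * (if \<forall>i\<le>j. V (grid h m i) \<omega> \<le> K then 1 else 0)"

definition cell_integral :: "nat \<Rightarrow> nat \<Rightarrow> 'a \<Rightarrow> real" where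
  "cell_integral m j \<omega> = (LINT s:{grid h m j<..grid h m (Suc j)}|lborel. V s \<omega>)"

text \<open>The initial value, which cancels, is kept so that the summands have the form produced by
  \<open>ito_approx_weighted\<close> from the integrals \<open>V u - V 0\<close> of the locale
  assumption \<open>ito\<close>.\<close>

definition weighted_sum :: "real \<Rightarrow> real \<Rightarrow> nat \<Rightarrow> 'a \<Rightarrow> real" where
  "weighted_sum \<mu> K m \<omega> = (\<Sum>j<m. weight \<mu> K m j \<omega> * ((V (grid h m (Suc j)) \<omega> - V 0 \<omega>) - (V (grid h m j) \<omega> - V 0 \<omega>)))"

text \<open>The time integral of the squared integrand belonging to \<open>weighted_sum\<close>,
  that is, of the weight process times \<open>\<sigma> * sqrt V\<close>.\<close>

definition weighted_quad :: "real \<Rightarrow> real \<Rightarrow> nat \<Rightarrow> 'a \<Rightarrow> real" where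
  "weighted_quad \<mu> K m \<omega> = (\<Sum>j<m. (weight \<mu> K m j \<omega>)\<^sup>2 * \<sigma>\<^sup>2 * cell_integral m j \<omega>)"

lemma exit_index:
  shows "exit_index K m \<omega> \<le> m"
    and "j < m \<Longrightarrow> (\<forall>i\<le>j. V (grid h m i) \<omega> \<le> K) \<longleftrightarrow> j < exit_index K m \<omega>"
    and "(\<And>j. j \<le> m \<Longrightarrow> V (grid h m j) \<omega> \<le> K) \<Longrightarrow> exit_index K m \<omega> = m"
proof -
  let ?P = "\<lambda>j. j = m \<or> K < V (grid h m j) \<omega>"
  show le: "exit_index K m \<omega> \<le> m" unfolding exit_index_def by (rule Least_le) simp
  have P: "?P (exit_index K m \<omega>)" unfolding exit_index_def by (rule LeastI[of ?P m]) simp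
  have notP: "\<not> ?P i" if "i < exit_index K m \<omega>" for i using that unfolding exit_index_def by (rule not_less_Least)
  show "(\<forall>i\<le>j. V (grid h m i) \<omega> \<le> K) \<longleftrightarrow> j < exit_index K m \<omega>" if j: "j < m"
  proof
    assume *: "\<forall>i\<le>j. V (grid h m i) \<omega> \<le> K"
    show "j < exit_index K m \<omega>"
    proof (rule ccontr)
      assume "\<not> j < exit_index K m \<omega>"
      then have "exit_index K m \<omega> \<le> j" by simp
      then show False using P * j by fastforce
    qed
  next
    assume "j < exit_index K m \<omega>"
    then show "\<forall>i\<le>j. V (grid h m i) \<omega> \<le> K"
      using notP by (meson le_less_trans not_le)
  qed
  show "exit_index K m \<omega> = m" if "\<And>j. j \<le> m \<Longrightarrow> V (grid h m j) \<omega> \<le> K"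
    using P that[OF le] by auto
qed

lemma V_measurable: "s \<in> {0..h} \<Longrightarrow> V s \<in> borel_measurable M"
  by (rule F_imp_M[OF adapted])

lemma weight_elementary:
  assumes m: "m > 0" and \<mu>: "\<mu> > 0"
  shows "elementary_integrand M F h m (grid h m) (weight \<mu> K m)"
proof -
  have "weight \<mu> K m j \<in> borel_measurable (F (grid h m j)) \<and> (\<exists>C. \<forall>\<omega>\<in>space M. \<bar>weight \<mu> K m j \<omega>\<bar> \<le> C)"
    if j: "j < m" for j
  proof
    have V: "V (grid h m i) \<in> borel_measurable (F (grid h m j))" if i: "i \<le> j" for i
    proof (rule F_mono[OF adapted])
      show "grid h m i \<in> {0..h}" by (rule grid_range) (use i j m h in auto)
      show "grid h m i \<le> grid h m j" using i h by (auto simp: grid_def intro!: divide_right_mono mult_right_mono)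
    qed
    have "{\<omega> \<in> space (F (grid h m j)). \<forall>i\<in>{..j}. V (grid h m i) \<omega> \<le> K} \<in> sets (F (grid h m j))"
    proof (rule sets.sets_Collect_finite_All')
      fix i assume i: "i \<in> {..j}"
      then have [measurable]: "V (grid h m i) \<in> borel_measurable (F (grid h m j))" by (intro V) simp
      show "{\<omega> \<in> space (F (grid h m j)). V (grid h m i) \<omega> \<le> K} \<in> sets (F (grid h m j))" by measurable
    qed auto
    then have S: "{\<omega> \<in> space (F (grid h m j)). \<forall>i\<le>j. V (grid h m i) \<omega> \<le> K} \<in> sets (F (grid h m j))"
      by (simp only: Ball_def atMost_iff)
    show "weight \<mu> K m j \<in> borel_measurable (F (grid h m j))"
      unfolding weight_def[abs_def]
      by (intro borel_measurable_times borel_measurable_const measurable_If[OF borel_measurable_const borel_measurable_const S])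
    show "\<exists>C. \<forall>\<omega>\<in>space M. \<bar>weight \<mu> K m j \<omega>\<bar> \<le> C"
      by (rule exI[of _ "\<bar>riccati \<sigma> \<mu> h (grid h m j)\<bar>"]) (auto simp: weight_def)
  qed
  then show ?thesis
    using m h grid_mono[of h m] unfolding elementary_integrand_def by auto
qed

lemma cell_integral_measurable:
  assumes "m > 0" "j < m"
  shows "cell_integral m j \<in> borel_measurable M"
proof -
  let ?R = "restrict_space lborel {0..h}"
  let ?A = "{grid h m j<..grid h m (Suc j)}"
  interpret R: sigma_finite_measure ?R
    by (rule sigma_finite_measure_restrict_space[OF lborel.sigma_finite_measure_axioms]) simp
  have sub: "?A \<subseteq> {0..h}"
  proof -
    have "grid h m j \<in> {0..h}" by (rule grid_range) (use assms h in auto)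
    moreover have "grid h m (Suc j) \<in> {0..h}" by (rule grid_range) (use assms h in auto)
    ultimately show ?thesis by auto
  qed
  have 1: "(\<lambda>s. indicator ?A s :: real) \<in> borel_measurable (restrict_space borel {0..h})"
    by (rule measurable_restrict_space1) simp
  have "(\<lambda>(s, \<omega>). indicator ?A s * V s \<omega>) \<in> borel_measurable (restrict_space borel {0..h} \<Otimes>\<^sub>M M)"
    using borel_measurable_times[OF measurable_compose[OF measurable_fst 1] joint] by (simp add: split_beta)
  then have "(\<lambda>(\<omega>, s). indicator ?A s * V s \<omega>) \<in> borel_measurable (M \<Otimes>\<^sub>M restrict_space borel {0..h})"
    by (subst measurable_pair_swap_iff) (simp add: split_beta)
  also have "sets (M \<Otimes>\<^sub>M restrict_space borel {0..h}) = sets (M \<Otimes>\<^sub>M ?R)"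
    by (intro sets_pair_measure_cong refl sets_restrict_space_cong) simp
  then have "borel_measurable (M \<Otimes>\<^sub>M restrict_space borel {0..h}) = borel_measurable (M \<Otimes>\<^sub>M ?R)"
    by (intro measurable_cong_sets refl)
  finally have "(\<lambda>\<omega>. LINT s|?R. indicator ?A s * V s \<omega>) \<in> borel_measurable M"
    by (rule R.borel_measurable_lebesgue_integral)
  also have "(\<lambda>\<omega>. LINT s|?R. indicator ?A s * V s \<omega>) = cell_integral m j"
  proof
    fix \<omega>
    have "(LINT s|?R. indicator ?A s * V s \<omega>) = (LINT s|lborel. indicator {0..h} s *\<^sub>R (indicator ?A s * V s \<omega>))"
      by (rule integral_restrict_space) simp
    also have "\<dots> = cell_integral m j \<omega>"
      unfolding cell_integral_def set_lebesgue_integral_def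
      using sub by (intro Bochner_Integration.integral_cong) (auto simp: indicator_def)
    finally show "(LINT s|?R. indicator ?A s * V s \<omega>) = cell_integral m j \<omega>" .
  qed
  finally show ?thesis .
qed

lemma weighted_quad_measurable:
  assumes "m > 0" "\<mu> > 0"
  shows "weighted_quad \<mu> K m \<in> borel_measurable M"
  unfolding weighted_quad_def[abs_def]
  by (intro borel_measurable_sum borel_measurable_times borel_measurable_power borel_measurable_const
      cell_integral_measurable F_imp_M[OF elementary_integrandD(3)[OF weight_elementary]]) (use assms in auto)

lemma cell_integrable:
  assumes "\<omega> \<in> space M" "m > 0" "j < m"
  shows "set_integrable lborel {grid h m j<..grid h m (Suc j)} (\<lambda>s. V s \<omega>)"
proof -
  have "grid h m j \<in> {0..h}" by (rule grid_range) (use assms h in auto)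
  moreover have "grid h m (Suc j) \<in> {0..h}" by (rule grid_range) (use assms h in auto)
  ultimately show ?thesis
    by (intro set_integrable_subset[OF borel_integrable_atLeastAtMost'[OF cont[OF assms(1)]]]) auto
qed

lemma weighted_quad_eq:
  assumes \<omega>: "\<omega> \<in> space M" and m: "m > 0" and \<mu>: "\<mu> > 0"
  shows "0 \<le> weighted_quad \<mu> K m \<omega> \<and>
    (\<integral>\<^sup>+ s\<in>{0..h}. ennreal ((elementary_process m (grid h m) (weight \<mu> K m) s \<omega> * (\<sigma> * sqrt (V s \<omega>)))\<^sup>2) \<partial>lborel)
      = ennreal (weighted_quad \<mu> K m \<omega>)"
proof -
  let ?A = "\<lambda>j. {grid h m j<..grid h m (Suc j)}"
  let ?w = "\<lambda>j. weight \<mu> K m j \<omega>"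
  note part = elementary_partition[OF weight_elementary[OF m \<mu>, of K]]
  have sub: "?A j \<subseteq> {0..h}" if "j < m" for j
  proof -
    have "grid h m j \<in> {0..h}" by (rule grid_range) (use that m h in auto)
    moreover have "grid h m (Suc j) \<in> {0..h}" by (rule grid_range) (use that m h in auto)
    ultimately show ?thesis by auto
  qed
  define f where "f s = (\<Sum>j<m. (?w j)\<^sup>2 * \<sigma>\<^sup>2 * (indicator (?A j) s *\<^sub>R V s \<omega>))" for s
  have f0: "0 \<le> f s" for s
    unfolding f_def
  proof (rule sum_nonneg)
    fix j assume "j \<in> {..<m}"
    then show "0 \<le> (?w j)\<^sup>2 * \<sigma>\<^sup>2 * (indicator (?A j) s *\<^sub>R V s \<omega>)"
      using sub[of j] nonneg[OF \<omega>, of s] by (cases "s \<in> ?A j") auto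
  qed
  have fi: "integrable lborel f"
    unfolding f_def[abs_def]
    by (intro Bochner_Integration.integrable_sum integrable_mult_right)
       (use cell_integrable[OF \<omega> m] in \<open>simp add: set_integrable_def\<close>)
  have fint: "integral\<^sup>L lborel f = weighted_quad \<mu> K m \<omega>"
  proof -
    have "integral\<^sup>L lborel f = (\<Sum>j<m. LINT s|lborel. (?w j)\<^sup>2 * \<sigma>\<^sup>2 * (indicator (?A j) s *\<^sub>R V s \<omega>))"
      unfolding f_def
      by (intro Bochner_Integration.integral_sum integrable_mult_right)
         (use cell_integrable[OF \<omega> m] in \<open>simp add: set_integrable_def\<close>)
    also have "\<dots> = weighted_quad \<mu> K m \<omega>"
      unfolding weighted_quad_def cell_integral_def set_lebesgue_integral_def
      by (intro sum.cong refl integral_mult_right_zero)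
    finally show ?thesis .
  qed
  have "(\<integral>\<^sup>+ s\<in>{0..h}. ennreal ((elementary_process m (grid h m) (weight \<mu> K m) s \<omega> * (\<sigma> * sqrt (V s \<omega>)))\<^sup>2) \<partial>lborel)
    = (\<integral>\<^sup>+ s. ennreal (f s) \<partial>lborel)"
  proof (rule nn_integral_cong)
    fix s
    show "ennreal ((elementary_process m (grid h m) (weight \<mu> K m) s \<omega> * (\<sigma> * sqrt (V s \<omega>)))\<^sup>2) * indicator {0..h} s = ennreal (f s)"
    proof (cases "s \<in> {0..h}")
      case True
      have "f s = (\<Sum>j<m. (?w j)\<^sup>2 * indicator (?A j) s) * (\<sigma>\<^sup>2 * V s \<omega>)"
        unfolding f_def sum_distrib_right by (intro sum.cong) auto
      also have "\<dots> = (elementary_process m (grid h m) (weight \<mu> K m) s \<omega>)\<^sup>2 * (\<sigma>\<^sup>2 * V s \<omega>)"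
        unfolding elementary_process_power2[OF part] ..
      also have "\<dots> = (elementary_process m (grid h m) (weight \<mu> K m) s \<omega> * (\<sigma> * sqrt (V s \<omega>)))\<^sup>2"
        using nonneg[OF \<omega> True] by (simp add: power_mult_distrib)
      finally show ?thesis using True by simp
    next
      case False
      have "f s = 0" unfolding f_def
      proof (rule sum.neutral, rule ballI)
        fix j assume "j \<in> {..<m}"
        then have "s \<notin> ?A j" using sub[of j] False by blast
        then show "(?w j)\<^sup>2 * \<sigma>\<^sup>2 * (indicator (?A j) s *\<^sub>R V s \<omega>) = 0" by simp
      qed
      then show ?thesis using False by simp
    qed
  qed
  also have "\<dots> = ennreal (integral\<^sup>L lborel f)"
    by (rule nn_integral_eq_integral[OF fi]) (use f0 in simp)
  finally show ?thesis using f0 unfolding fint[symmetric] by (simp add: Bochner_Integration.integral_nonneg)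
qed

lemma weighted_exponent:
  assumes m: "m > 0"
  shows "weighted_sum \<mu> K m \<omega> - weighted_quad \<mu> K m \<omega> / 2 =
    (\<Sum>j<exit_index K m \<omega>. - riccati \<sigma> \<mu> h (grid h m j) * (V (grid h m (Suc j)) \<omega> - V (grid h m j) \<omega>)
      - \<sigma>\<^sup>2 / 2 * (riccati \<sigma> \<mu> h (grid h m j))\<^sup>2 * cell_integral m j \<omega>)" (is "_ = sum ?T {..<?n}")
    and "weighted_quad \<mu> K m \<omega> = (\<Sum>j<exit_index K m \<omega>. (riccati \<sigma> \<mu> h (grid h m j))\<^sup>2 * \<sigma>\<^sup>2 * cell_integral m j \<omega>)"
proof -
  have w: "weight \<mu> K m j \<omega> = (if j < ?n then - riccati \<sigma> \<mu> h (grid h m j) else 0)" if "j < m" for j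
    using exit_index(2)[OF that, of \<omega> K] by (simp add: weight_def)
  have sub: "{..<?n} = {..<m} \<inter> {j. j < ?n}" using exit_index(1)[of K m \<omega>] by auto
  have "weighted_sum \<mu> K m \<omega> - weighted_quad \<mu> K m \<omega> / 2 = (\<Sum>j<m. if j < ?n then ?T j else 0)"
    unfolding weighted_sum_def weighted_quad_def sum_divide_distrib sum_subtractf[symmetric]
    by (intro sum.cong refl) (auto simp: w)
  also have "\<dots> = sum ?T {..<?n}" unfolding sub sum.inter_restrict[OF finite_lessThan] mem_Collect_eq ..
  finally show "weighted_sum \<mu> K m \<omega> - weighted_quad \<mu> K m \<omega> / 2 = sum ?T {..<?n}" .
  have "weighted_quad \<mu> K m \<omega> = (\<Sum>j<m. if j < ?n then (riccati \<sigma> \<mu> h (grid h m j))\<^sup>2 * \<sigma>\<^sup>2 * cell_integral m j \<omega> else 0)"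
    unfolding weighted_quad_def by (intro sum.cong refl) (auto simp: w)
  also have "\<dots> = (\<Sum>j<?n. (riccati \<sigma> \<mu> h (grid h m j))\<^sup>2 * \<sigma>\<^sup>2 * cell_integral m j \<omega>)" unfolding sub sum.inter_restrict[OF finite_lessThan] mem_Collect_eq ..
  finally show "weighted_quad \<mu> K m \<omega> = (\<Sum>j<?n. (riccati \<sigma> \<mu> h (grid h m j))\<^sup>2 * \<sigma>\<^sup>2 * cell_integral m j \<omega>)" .
qed

text \<open>\<open>riccati_path_sum\<close> is uniform in the number of summands and may therefore
  be evaluated at the exit index, which depends on the path and on the grid.\<close>

lemma weighted_exponent_limit:
  assumes \<omega>: "\<omega> \<in> space M" and \<mu>: "\<mu> > 0" and \<delta>: "\<delta> > 0"
  shows "eventually (\<lambda>m. m > 0 \<and> \<bar>weighted_sum \<mu> K m \<omega> - weighted_quad \<mu> K m \<omega> / 2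
    - (riccati \<sigma> \<mu> h 0 * V 0 \<omega> - riccati \<sigma> \<mu> h (grid h m (exit_index K m \<omega>)) * V (grid h m (exit_index K m \<omega>)) \<omega>)\<bar> \<le> \<delta>) sequentially"
proof -
  have nn: "\<forall>s\<in>{0..h}. 0 \<le> V s \<omega>" using nonneg[OF \<omega>] by blast
  show ?thesis
  using riccati_path_sum[OF cont[OF \<omega>] nn h \<mu> \<delta>, of \<sigma>] eventually_gt_at_top[of 0]
proof eventually_elim
  case (elim m)
  have "exit_index K m \<omega> \<le> m" by (rule exit_index)
  from elim(1)[rule_format, OF this] elim(2) show ?case
    unfolding weighted_exponent(1)[OF elim(2)] cell_integral_def by simp
qed
qed

text \<open>The level \<open>K\<close> is checked only at grid points, so the variance can exceed it
  inside the last active cell. On a fine grid the overshoot is at most 1, whence the summand 1 in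
  the bound.\<close>

lemma weighted_quad_bound:
  assumes \<omega>: "\<omega> \<in> space M" and \<mu>: "\<mu> > 0"
  shows "eventually (\<lambda>m. m > 0 \<and> weighted_quad \<mu> K m \<omega> \<le> \<mu>\<^sup>2 * \<sigma>\<^sup>2 * (\<bar>K\<bar> + 1) * h) sequentially"
  using uniform_grid_oscillation[OF cont[OF \<omega>] less_imp_le[OF h], of 1, OF zero_less_one]
proof eventually_elim
  case (elim m)
  then have m: "m > 0" and osc: "\<And>j s u. j < m \<Longrightarrow> s \<in> {grid h m j..grid h m (Suc j)} \<Longrightarrow> u \<in> {grid h m j..grid h m (Suc j)} \<Longrightarrow>
      \<bar>V s \<omega> - V u \<omega>\<bar> \<le> 1" by blast+
  define \<Delta> where "\<Delta> = h / real m"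
  have \<Delta>: "\<Delta> > 0" using h m by (simp add: \<Delta>_def)
  let ?n = "exit_index K m \<omega>"
  have "weighted_quad \<mu> K m \<omega> \<le> (\<Sum>j<?n. \<mu>\<^sup>2 * \<sigma>\<^sup>2 * ((\<bar>K\<bar> + 1) * \<Delta>))"
    unfolding weighted_exponent(2)[OF m]
  proof (rule sum_mono)
    fix j assume "j \<in> {..<?n}"
    then have jn: "j < ?n" by simp
    then have jm: "j < m" using exit_index(1)[of K m \<omega>] by simp
    have VK: "V (grid h m j) \<omega> \<le> K" using exit_index(2)[OF jm, of \<omega> K] jn by simp
    have le: "grid h m j \<le> grid h m (Suc j)" using grid_mono h by simp
    have tr: "grid h m j \<in> {0..h}" "grid h m (Suc j) \<in> {0..h}" using jm m h by (auto intro!: grid_range simp del: atLeastAtMost_iff)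
    have cj: "continuous_on {grid h m j..grid h m (Suc j)} (\<lambda>s. V s \<omega>)"
      by (rule continuous_on_subset[OF cont[OF \<omega>]]) (use tr in auto)
    have "\<bar>cell_integral m j \<omega> - V (grid h m j) \<omega> * \<Delta>\<bar> \<le> 1 * \<Delta>"
      unfolding cell_integral_def \<Delta>_def grid_step[of h m j, symmetric]
      by (rule set_integral_close[OF cj le]) (use osc[OF jm] le in auto)
    moreover have "V (grid h m j) \<omega> * \<Delta> \<le> \<bar>K\<bar> * \<Delta>" using VK \<Delta> by (intro mult_right_mono) auto
    ultimately have cell: "cell_integral m j \<omega> \<le> (\<bar>K\<bar> + 1) * \<Delta>" by (simp only: distrib_right)
    have r: "0 < riccati \<sigma> \<mu> h (grid h m j)" "riccati \<sigma> \<mu> h (grid h m j) \<le> \<mu>"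
      using riccati_bounds[OF \<mu>, of "grid h m j" h \<sigma>] tr by auto
    have "(riccati \<sigma> \<mu> h (grid h m j))\<^sup>2 \<le> \<mu>\<^sup>2" using r by (intro power_mono) auto
    then have "(riccati \<sigma> \<mu> h (grid h m j))\<^sup>2 * \<sigma>\<^sup>2 \<le> \<mu>\<^sup>2 * \<sigma>\<^sup>2" by (intro mult_right_mono) auto
    then have "(riccati \<sigma> \<mu> h (grid h m j))\<^sup>2 * \<sigma>\<^sup>2 * ((\<bar>K\<bar> + 1) * \<Delta>) \<le> \<mu>\<^sup>2 * \<sigma>\<^sup>2 * ((\<bar>K\<bar> + 1) * \<Delta>)"
      by (rule mult_right_mono) (use \<Delta> in simp)
    moreover have "(riccati \<sigma> \<mu> h (grid h m j))\<^sup>2 * \<sigma>\<^sup>2 * cell_integral m j \<omega> \<le> (riccati \<sigma> \<mu> h (grid h m j))\<^sup>2 * \<sigma>\<^sup>2 * ((\<bar>K\<bar> + 1) * \<Delta>)"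
      using cell by (intro mult_left_mono) auto
    ultimately show "(riccati \<sigma> \<mu> h (grid h m j))\<^sup>2 * \<sigma>\<^sup>2 * cell_integral m j \<omega> \<le> \<mu>\<^sup>2 * \<sigma>\<^sup>2 * ((\<bar>K\<bar> + 1) * \<Delta>)" by linarith
  qed
  also have "\<dots> = (real ?n * \<Delta>) * (\<mu>\<^sup>2 * \<sigma>\<^sup>2 * (\<bar>K\<bar> + 1))" by simp
  also have "\<dots> \<le> h * (\<mu>\<^sup>2 * \<sigma>\<^sup>2 * (\<bar>K\<bar> + 1))"
  proof (rule mult_right_mono)
    have "real ?n * \<Delta> \<le> real m * \<Delta>" using exit_index(1)[of K m \<omega>] \<Delta> by (intro mult_right_mono) auto
    also have "\<dots> = h" using m by (simp add: \<Delta>_def)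
    finally show "real ?n * \<Delta> \<le> h" .
  qed auto
  finally show ?case using m by (simp add: mult_ac)
qed

text \<open>Martingale identity for the stopped exponent, with the effect of stopping charged to the
  complement of \<open>\<Omega>\<close>. The level \<open>K\<close> stays fixed while the grid is
  refined, so the quadratic variations have an eventual bound common to all paths.\<close>

lemma laplace_bounded_paths:
  fixes G :: "'a \<Rightarrow> real"
  assumes \<mu>: "\<mu> > 0" and G: "G \<in> borel_measurable (F 0)" "\<And>\<omega>. \<omega> \<in> space M \<Longrightarrow> \<bar>G \<omega>\<bar> \<le> 1" and a: "a > 0"
    and \<Omega>: "\<Omega> \<in> events" "\<And>\<omega> m j. \<omega> \<in> \<Omega> \<Longrightarrow> m > 0 \<Longrightarrow> j \<le> m \<Longrightarrow> V (grid h m j) \<omega> \<le> K"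
  shows "\<bar>expectation (\<lambda>\<omega>. G \<omega> * exp (- riccati \<sigma> \<mu> h 0 * V 0 \<omega>)) - expectation (\<lambda>\<omega>. G \<omega> * exp (- \<mu> * V h \<omega>))\<bar>
    \<le> a + (exp 1 + 1) * prob (space M - \<Omega>)"
proof -
  let ?\<psi>0 = "riccati \<sigma> \<mu> h 0"
  \<comment> \<open>The bound of \<open>weighted_quad_bound\<close> plus 1, so that on every path
    the truncation at \<open>C\<close> is eventually inactive with a strict inequality.\<close>
  define C where "C = \<mu>\<^sup>2 * \<sigma>\<^sup>2 * (\<bar>K\<bar> + 1) * h + 1"
  have C: "C > 0" using h by (simp add: C_def add_nonneg_pos)
  \<comment> \<open>Scaled so that the error term \<open>a' * exp C\<close> of the truncated
    martingale identity is exactly \<open>a\<close>.\<close>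
  define a' where "a' = a / exp C"
  have a': "a' > 0" "a' * exp C = a" using a by (simp_all add: a'_def)
  have V0m: "V 0 \<in> borel_measurable M" and Vhm: "V h \<in> borel_measurable M" using h by (auto intro!: V_measurable)
  note [measurable] = V0m Vhm F_imp_M[OF G(1)] \<Omega>(1)
  have \<psi>0: "0 < ?\<psi>0" using riccati_bounds[OF \<mu>, of 0 h \<sigma>] h by simp
  \<comment> \<open>The initial exponential is known at time 0 and goes into the test variable; it
    later cancels the initial term of the limiting exponent.\<close>
  define G' where "G' \<omega> = G \<omega> * exp (- ?\<psi>0 * V 0 \<omega>)" for \<omega>
  have G'm: "G' \<in> borel_measurable (F 0)"
    unfolding G'_def[abs_def] using G(1) adapted[of 0] h by simp
  have V0: "0 \<le> V 0 \<omega>" if "\<omega> \<in> space M" for \<omega> using nonneg[OF that, of 0] h by simp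
  have Vh: "0 \<le> V h \<omega>" if "\<omega> \<in> space M" for \<omega> using nonneg[OF that, of h] h by simp
  have e0: "exp (- ?\<psi>0 * V 0 \<omega>) \<le> 1" if "\<omega> \<in> space M" for \<omega>
    using V0[OF that] \<psi>0 by simp
  have G'1: "\<bar>G' \<omega>\<bar> \<le> 1" if "\<omega> \<in> space M" for \<omega>
    unfolding G'_def abs_mult using G(2)[OF that] e0[OF that] by (intro mult_le_one) auto
  \<comment> \<open>The index shift guarantees a grid with at least one cell.\<close>
  define q where "q n = weighted_quad \<mu> K (Suc n)" for n
  define S where "S n = weighted_sum \<mu> K (Suc n)" for n
  have qm[measurable]: "q n \<in> borel_measurable M" for n
    unfolding q_def by (rule weighted_quad_measurable[OF zero_less_Suc \<mu>])
  have ia: "ito_approx M F W (\<lambda>s \<omega>. elementary_process (Suc n) (grid h (Suc n)) (weight \<mu> K (Suc n)) s \<omega> * (\<sigma> * sqrt (V s \<omega>))) h (S n)" for n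
    unfolding S_def weighted_sum_def[abs_def]
    by (rule ito_approx_weighted[OF less_imp_le[OF h] weight_elementary[OF zero_less_Suc \<mu>] _ ito])
       (intro continuous_intros cont)
  have Hm: "set_borel_measurable borel {0..h} (\<lambda>s. elementary_process (Suc n) (grid h (Suc n)) (weight \<mu> K (Suc n)) s \<omega> * (\<sigma> * sqrt (V s \<omega>)))"
    if \<omega>: "\<omega> \<in> space M" for n \<omega>
  proof -
    have "set_borel_measurable borel {0..h} (\<lambda>s. \<sigma> * sqrt (V s \<omega>))"
      by (rule set_borel_measurable_continuous_on) (auto intro!: continuous_intros cont[OF \<omega>])
    then have "(\<lambda>s. elementary_process (Suc n) (grid h (Suc n)) (weight \<mu> K (Suc n)) s \<omega> * (indicator {0..h} s *\<^sub>R (\<sigma> * sqrt (V s \<omega>)))) \<in> borel_measurable borel"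
      unfolding set_borel_measurable_def by (intro borel_measurable_times elementary_process_measurable)
    then show ?thesis unfolding set_borel_measurable_def by (simp add: mult.left_commute)
  qed
  have qq: "AE \<omega> in M. 0 \<le> q n \<omega> \<and> (\<integral>\<^sup>+ s\<in>{0..h}. ennreal ((elementary_process (Suc n) (grid h (Suc n)) (weight \<mu> K (Suc n)) s \<omega> * (\<sigma> * sqrt (V s \<omega>)))\<^sup>2) \<partial>lborel) = ennreal (q n \<omega>)" for n
    unfolding q_def by (rule AE_I2) (rule weighted_quad_eq[OF _ zero_less_Suc \<mu>])
  define Z where "Z n \<omega> = exp (S n \<omega> - q n \<omega> / 2) * indicator {..<C} (q n \<omega>)" for n \<omega>
  note tr = expectation_exp_truncated[OF ia Hm qq qm G'm G'1 C, folded Z_def]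
  have Zm[measurable]: "Z n \<in> borel_measurable M" for n
  proof -
    have [measurable]: "S n \<in> borel_measurable M" using ia[of n] by (simp add: ito_approx_def)
    show ?thesis unfolding Z_def[abs_def] by measurable
  qed
  have Z0: "0 \<le> Z n \<omega>" for n \<omega> by (simp add: Z_def)
  define \<zeta> where "\<zeta> \<omega> = exp (- \<mu> * V h \<omega>)" for \<omega>
  have \<zeta>m[measurable]: "\<zeta> \<in> borel_measurable M" unfolding \<zeta>_def[abs_def] by measurable
  have \<zeta>: "0 \<le> \<zeta> \<omega>" "\<omega> \<in> space M \<Longrightarrow> \<zeta> \<omega> \<le> 1" for \<omega> using Vh[of \<omega>] \<mu> by (simp_all add: \<zeta>_def)
  define X where "X n \<omega> = exp (- ?\<psi>0 * V 0 \<omega>) * Z n \<omega>" for n \<omega>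
  have Xm[measurable]: "X n \<in> borel_measurable M" for n unfolding X_def[abs_def] by measurable
  have X0: "0 \<le> X n \<omega>" for n \<omega> using Z0 by (simp add: X_def)
  have XZ: "X n \<omega> \<le> Z n \<omega>" if "\<omega> \<in> space M" for n \<omega>
    unfolding X_def using e0[OF that] Z0 by (intro mult_left_le_one_le) auto
  have Xle2: "(X n \<omega>)\<^sup>2 \<le> (Z n \<omega>)\<^sup>2" if "\<omega> \<in> space M" for n \<omega>
    using XZ[OF that] X0 by (intro power_mono)
  have X2: "integrable M (\<lambda>\<omega>. (X n \<omega>)\<^sup>2)" "expectation (\<lambda>\<omega>. (X n \<omega>)\<^sup>2) \<le> exp C" for n
  proof -
    show i: "integrable M (\<lambda>\<omega>. (X n \<omega>)\<^sup>2)"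
      by (rule Bochner_Integration.integrable_bound[OF tr(1)[of n]]) (auto intro!: AE_I2 Xle2)
    have "expectation (\<lambda>\<omega>. (X n \<omega>)\<^sup>2) \<le> expectation (\<lambda>\<omega>. (Z n \<omega>)\<^sup>2)"
      by (intro integral_mono i tr(1) Xle2)
    then show "expectation (\<lambda>\<omega>. (X n \<omega>)\<^sup>2) \<le> exp C" using tr(2)[of n] by simp
  qed
  have qC: "eventually (\<lambda>n. q n \<omega> < C) sequentially" if \<omega>: "\<omega> \<in> space M" for \<omega>
  proof -
    have "eventually (\<lambda>m. weighted_quad \<mu> K m \<omega> < C) sequentially"
      using weighted_quad_bound[OF \<omega> \<mu>, of K] by eventually_elim (simp add: C_def)
    then show ?thesis unfolding q_def by (rule eventually_compose_filterlim) (rule filterlim_Suc)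
  qed
  have lim: "eventually (\<lambda>n. \<bar>S n \<omega> - q n \<omega> / 2 - (?\<psi>0 * V 0 \<omega> - riccati \<sigma> \<mu> h (grid h (Suc n) (exit_index K (Suc n) \<omega>))
      * V (grid h (Suc n) (exit_index K (Suc n) \<omega>)) \<omega>)\<bar> \<le> \<delta>) sequentially" if \<omega>: "\<omega> \<in> space M" and \<delta>: "\<delta> > 0" for \<omega> \<delta>
  proof -
    have "eventually (\<lambda>m. \<bar>weighted_sum \<mu> K m \<omega> - weighted_quad \<mu> K m \<omega> / 2
      - (?\<psi>0 * V 0 \<omega> - riccati \<sigma> \<mu> h (grid h m (exit_index K m \<omega>)) * V (grid h m (exit_index K m \<omega>)) \<omega>)\<bar> \<le> \<delta>) sequentially"
      using weighted_exponent_limit[OF \<omega> \<mu> \<delta>, of K] by eventually_elim simp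
    then show ?thesis unfolding S_def q_def by (rule eventually_compose_filterlim) (rule filterlim_Suc)
  qed
  have Xe: "eventually (\<lambda>n. X n \<omega> \<le> exp 1) sequentially" if \<omega>: "\<omega> \<in> space M" for \<omega>
    using lim[OF \<omega> zero_less_one]
  proof eventually_elim
    case (elim n)
    let ?s = "grid h (Suc n) (exit_index K (Suc n) \<omega>)"
    have s: "?s \<in> {0..h}" by (rule grid_range) (use h exit_index(1) in auto)
    have "0 \<le> riccati \<sigma> \<mu> h ?s * V ?s \<omega>"
      using riccati_bounds(1)[OF \<mu>, of ?s h \<sigma>] nonneg[OF \<omega> s] s by (intro mult_nonneg_nonneg) auto
    then have *: "- ?\<psi>0 * V 0 \<omega> + (S n \<omega> - q n \<omega> / 2) \<le> 1" using elim by (simp add: abs_le_iff)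
    have "X n \<omega> \<le> exp (- ?\<psi>0 * V 0 \<omega>) * exp (S n \<omega> - q n \<omega> / 2)"
      unfolding X_def Z_def by (intro mult_left_mono) (auto simp: indicator_def)
    also have "\<dots> = exp (- ?\<psi>0 * V 0 \<omega> + (S n \<omega> - q n \<omega> / 2))" by (simp only: exp_add)
    also have "\<dots> \<le> exp 1" using * by (simp only: exp_le_cancel_iff)
    finally show ?case .
  qed
  have \<Omega>sp: "\<omega> \<in> space M" if "\<omega> \<in> \<Omega>" for \<omega> using sets.sets_into_space[OF \<Omega>(1)] that by blast
  have Xlim: "(\<lambda>n. X n \<omega>) \<longlonglongrightarrow> \<zeta> \<omega>" if \<omega>: "\<omega> \<in> \<Omega>" for \<omega>
  proof -
    have ex: "exit_index K (Suc n) \<omega> = Suc n" for n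
      by (rule exit_index(3)) (rule \<Omega>(2)[OF \<omega> zero_less_Suc])
    have rh: "riccati \<sigma> \<mu> h h = \<mu>" by (simp add: riccati_def)
    have "(\<lambda>n. S n \<omega> - q n \<omega> / 2) \<longlonglongrightarrow> ?\<psi>0 * V 0 \<omega> - \<mu> * V h \<omega>"
    proof (rule tendstoI)
      fix e :: real assume "e > 0"
      then have "e / 2 > 0" by simp
      from lim[OF \<Omega>sp[OF \<omega>] this]
      show "eventually (\<lambda>n. dist (S n \<omega> - q n \<omega> / 2) (?\<psi>0 * V 0 \<omega> - \<mu> * V h \<omega>) < e) sequentially"
      proof eventually_elim
        case (elim n)
        then have "dist (S n \<omega> - q n \<omega> / 2) (?\<psi>0 * V 0 \<omega> - \<mu> * V h \<omega>) \<le> e / 2"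
          unfolding ex grid_simps(2)[OF zero_less_Suc] rh dist_real_def .
        then show ?case using \<open>e > 0\<close> by linarith
      qed
    qed
    then have "(\<lambda>n. exp (- ?\<psi>0 * V 0 \<omega>) * exp (S n \<omega> - q n \<omega> / 2)) \<longlonglongrightarrow> exp (- ?\<psi>0 * V 0 \<omega>) * exp (?\<psi>0 * V 0 \<omega> - \<mu> * V h \<omega>)"
      by (intro tendsto_mult tendsto_const tendsto_exp)
    also have "exp (- ?\<psi>0 * V 0 \<omega>) * exp (?\<psi>0 * V 0 \<omega> - \<mu> * V h \<omega>) = \<zeta> \<omega>"
      unfolding \<zeta>_def mult_exp_exp by simp
    finally have l: "(\<lambda>n. exp (- ?\<psi>0 * V 0 \<omega>) * exp (S n \<omega> - q n \<omega> / 2)) \<longlonglongrightarrow> \<zeta> \<omega>" .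
    have "eventually (\<lambda>n. exp (- ?\<psi>0 * V 0 \<omega>) * exp (S n \<omega> - q n \<omega> / 2) = X n \<omega>) sequentially"
      using qC[OF \<Omega>sp[OF \<omega>]] by eventually_elim (simp add: X_def Z_def)
    with l show ?thesis by (rule Lim_transform_eventually)
  qed
  \<comment> \<open>On \<open>\<Omega>\<close> no path is stopped and \<open>X n\<close> tends to \<open>\<zeta>\<close>; elsewhere the stopped exponent is only
    nonpositive in the limit, which bounds \<open>X n\<close> by \<open>exp 1\<close> eventually.\<close>
  define D where "D n \<omega> = (X n \<omega> - \<zeta> \<omega>) * indicator \<Omega> \<omega>" for n \<omega>
  define E where "E n \<omega> = max 0 (X n \<omega> - exp 1)" for n \<omega>
  have Dm[measurable]: "D n \<in> borel_measurable M" and Em[measurable]: "E n \<in> borel_measurable M" for n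
    unfolding D_def[abs_def] E_def[abs_def] by measurable
  have D2: "integrable M (\<lambda>\<omega>. (D n \<omega>)\<^sup>2)" "expectation (\<lambda>\<omega>. (D n \<omega>)\<^sup>2) \<le> exp C + 1" for n
  proof -
    have le: "(D n \<omega>)\<^sup>2 \<le> (X n \<omega>)\<^sup>2 + 1" if "\<omega> \<in> space M" for \<omega>
    proof -
      have "0 \<le> X n \<omega> * \<zeta> \<omega>" using X0 \<zeta> by simp
      moreover have "(\<zeta> \<omega>)\<^sup>2 \<le> 1" using \<zeta>[of \<omega>] that by (simp add: power_le_one)
      moreover have "(X n \<omega> - \<zeta> \<omega>)\<^sup>2 = (X n \<omega>)\<^sup>2 - 2 * (X n \<omega> * \<zeta> \<omega>) + (\<zeta> \<omega>)\<^sup>2"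
        by (simp add: power2_eq_square algebra_simps)
      ultimately have "(X n \<omega> - \<zeta> \<omega>)\<^sup>2 \<le> (X n \<omega>)\<^sup>2 + 1" by linarith
      then show ?thesis by (simp add: D_def indicator_def)
    qed
    have i1: "integrable M (\<lambda>\<omega>. (X n \<omega>)\<^sup>2 + 1)" using X2(1) by simp
    show i: "integrable M (\<lambda>\<omega>. (D n \<omega>)\<^sup>2)"
      by (rule Bochner_Integration.integrable_bound[OF i1]) (auto intro!: AE_I2 order_trans[OF le])
    have "expectation (\<lambda>\<omega>. (D n \<omega>)\<^sup>2) \<le> expectation (\<lambda>\<omega>. (X n \<omega>)\<^sup>2 + 1)"
      by (intro integral_mono i i1 le)
    also have "\<dots> = expectation (\<lambda>\<omega>. (X n \<omega>)\<^sup>2) + 1" using X2(1)[of n] by (simp add: prob_space)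
    finally show "expectation (\<lambda>\<omega>. (D n \<omega>)\<^sup>2) \<le> exp C + 1" using X2(2)[of n] by linarith
  qed
  have E2: "integrable M (\<lambda>\<omega>. (E n \<omega>)\<^sup>2)" "expectation (\<lambda>\<omega>. (E n \<omega>)\<^sup>2) \<le> exp C" for n
  proof -
    have le: "(E n \<omega>)\<^sup>2 \<le> (X n \<omega>)\<^sup>2" for \<omega>
      using X0[of n \<omega>] by (intro power_mono) (auto simp: E_def)
    show i: "integrable M (\<lambda>\<omega>. (E n \<omega>)\<^sup>2)"
      by (rule Bochner_Integration.integrable_bound[OF X2(1)[of n]]) (auto intro!: AE_I2 le)
    have "expectation (\<lambda>\<omega>. (E n \<omega>)\<^sup>2) \<le> expectation (\<lambda>\<omega>. (X n \<omega>)\<^sup>2)"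
      by (intro integral_mono i X2(1) le)
    then show "expectation (\<lambda>\<omega>. (E n \<omega>)\<^sup>2) \<le> exp C" using X2(2)[of n] by linarith
  qed
  have Dl: "AE \<omega> in M. (\<lambda>n. D n \<omega>) \<longlonglongrightarrow> 0"
  proof (rule AE_I2)
    fix \<omega> assume "\<omega> \<in> space M"
    show "(\<lambda>n. D n \<omega>) \<longlonglongrightarrow> 0"
    proof (cases "\<omega> \<in> \<Omega>")
      case True
      then show ?thesis using LIM_zero[OF Xlim[OF True]] by (simp add: D_def)
    qed (simp add: D_def)
  qed
  have El: "AE \<omega> in M. (\<lambda>n. E n \<omega>) \<longlonglongrightarrow> 0"
  proof (rule AE_I2)
    fix \<omega> assume "\<omega> \<in> space M"
    from Xe[OF this] have "eventually (\<lambda>n. 0 = E n \<omega>) sequentially"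
      by eventually_elim (simp add: E_def)
    then show "(\<lambda>n. E n \<omega>) \<longlonglongrightarrow> 0" by (rule Lim_transform_eventually[OF tendsto_const])
  qed
  note DD = L2_bounded_tendsto_zero[OF Dm D2 Dl] and EE = L2_bounded_tendsto_zero[OF Em E2 El]
  have P0: "(\<lambda>n. prob {\<omega>\<in>space M. C \<le> q n \<omega>}) \<longlonglongrightarrow> 0"
  proof -
    have "(\<lambda>n. expectation (\<lambda>\<omega>. indicator {C..} (q n \<omega>) :: real)) \<longlonglongrightarrow> expectation (\<lambda>\<omega>. 0)"
    proof (rule integral_dominated_convergence[where w = "\<lambda>_. 1"])
      show "AE \<omega> in M. (\<lambda>n. indicator {C..} (q n \<omega>) :: real) \<longlonglongrightarrow> 0"
      proof (rule AE_I2)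
        fix \<omega> assume "\<omega> \<in> space M"
        from qC[OF this] have "eventually (\<lambda>n. (0::real) = indicator {C..} (q n \<omega>)) sequentially"
          by eventually_elim simp
        then show "(\<lambda>n. indicator {C..} (q n \<omega>) :: real) \<longlonglongrightarrow> 0" by (rule Lim_transform_eventually[OF tendsto_const])
      qed
    qed (auto simp: indicator_def)
    moreover have "expectation (\<lambda>\<omega>. indicator {C..} (q n \<omega>) :: real) = prob {\<omega>\<in>space M. C \<le> q n \<omega>}" for n
    proof -
      have "expectation (\<lambda>\<omega>. indicator {C..} (q n \<omega>) :: real) = expectation (indicator {\<omega>\<in>space M. C \<le> q n \<omega>})"
        by (intro Bochner_Integration.integral_cong) (auto simp: indicator_def)
      also have "\<dots> = prob ({\<omega>\<in>space M. C \<le> q n \<omega>} \<inter> space M)" by (rule Bochner_Integration.integral_indicator)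
      also have "\<dots> = prob {\<omega>\<in>space M. C \<le> q n \<omega>}" by (rule arg_cong[where f = prob]) auto
      finally show ?thesis .
    qed
    ultimately show ?thesis by simp
  qed
  have Xi: "integrable M (X n)" for n by (rule square_integrable_imp_integrable[OF Xm X2(1)])
  have GXi: "integrable M (\<lambda>\<omega>. G \<omega> * X n \<omega>)" for n
  proof (rule Bochner_Integration.integrable_bound[OF Xi[of n]])
    show "AE \<omega> in M. norm (G \<omega> * X n \<omega>) \<le> norm (X n \<omega>)"
      by (rule AE_I2) (use G(2) in \<open>auto simp: abs_mult intro!: mult_left_le_one_le\<close>)
  qed measurable
  have G\<zeta>i: "integrable M (\<lambda>\<omega>. G \<omega> * \<zeta> \<omega>)"
  proof (rule integrable_const_bound[where B = 1])
    show "AE \<omega> in M. norm (G \<omega> * \<zeta> \<omega>) \<le> 1"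
      by (rule AE_I2) (use G(2) \<zeta> in \<open>auto simp: abs_mult intro!: mult_le_one\<close>)
  qed measurable
  have indi: "integrable M (\<lambda>\<omega>. indicator (space M - \<Omega>) \<omega> :: real)"
    by (rule integrable_const_bound[where B = 1]) (auto simp: indicator_def)
  have bound: "\<bar>expectation G' - expectation (\<lambda>\<omega>. G \<omega> * \<zeta> \<omega>)\<bar>
    \<le> (a + prob {\<omega>\<in>space M. C \<le> q n \<omega>} / a') + (expectation (\<lambda>\<omega>. \<bar>D n \<omega>\<bar>) + expectation (\<lambda>\<omega>. \<bar>E n \<omega>\<bar>) + (exp 1 + 1) * prob (space M - \<Omega>))" for n
  proof -
    have "(\<lambda>\<omega>. G' \<omega> * Z n \<omega>) = (\<lambda>\<omega>. G \<omega> * X n \<omega>)" by (simp add: G'_def X_def mult.assoc)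
    then have 1: "\<bar>expectation G' - expectation (\<lambda>\<omega>. G \<omega> * X n \<omega>)\<bar> \<le> a + prob {\<omega>\<in>space M. C \<le> q n \<omega>} / a'"
      using tr(3)[OF _ _ a'(1), of n] unfolding a'(2) by simp
    have "\<bar>expectation (\<lambda>\<omega>. G \<omega> * X n \<omega>) - expectation (\<lambda>\<omega>. G \<omega> * \<zeta> \<omega>)\<bar> = \<bar>expectation (\<lambda>\<omega>. G \<omega> * X n \<omega> - G \<omega> * \<zeta> \<omega>)\<bar>"
      using GXi[of n] G\<zeta>i by simp
    also have "\<dots> \<le> expectation (\<lambda>\<omega>. \<bar>G \<omega> * X n \<omega> - G \<omega> * \<zeta> \<omega>\<bar>)" by (rule integral_abs_bound)
    also have "\<dots> \<le> expectation (\<lambda>\<omega>. \<bar>D n \<omega>\<bar> + \<bar>E n \<omega>\<bar> + (exp 1 + 1) * indicator (space M - \<Omega>) \<omega>)"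
    proof (rule integral_mono)
      show "integrable M (\<lambda>\<omega>. \<bar>G \<omega> * X n \<omega> - G \<omega> * \<zeta> \<omega>\<bar>)" using GXi[of n] G\<zeta>i by simp
      show "integrable M (\<lambda>\<omega>. \<bar>D n \<omega>\<bar> + \<bar>E n \<omega>\<bar> + (exp 1 + 1) * indicator (space M - \<Omega>) \<omega>)"
        by (intro Bochner_Integration.integrable_add integrable_abs integrable_mult_right DD(1) EE(1) indi)
      fix \<omega> assume \<omega>: "\<omega> \<in> space M"
      have "\<bar>G \<omega> * X n \<omega> - G \<omega> * \<zeta> \<omega>\<bar> \<le> \<bar>X n \<omega> - \<zeta> \<omega>\<bar>"
        unfolding right_diff_distrib[symmetric] abs_mult using G(2)[OF \<omega>] by (intro mult_left_le_one_le) auto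
      also have "\<dots> \<le> \<bar>D n \<omega>\<bar> + \<bar>E n \<omega>\<bar> + (exp 1 + 1) * indicator (space M - \<Omega>) \<omega>"
      proof (cases "\<omega> \<in> \<Omega>")
        case True
        then show ?thesis by (simp add: D_def)
      next
        case False
        \<comment> \<open>This is the source of the constant \<open>exp 1 + 1\<close>: off
          \<open>\<Omega>\<close> the target is at most 1, and \<open>X n\<close> is at most
          \<open>exp 1\<close> up to the excess \<open>E n\<close>.\<close>
        have "\<bar>X n \<omega> - \<zeta> \<omega>\<bar> \<le> X n \<omega> + 1" using X0[of n \<omega>] \<zeta>[of \<omega>] \<omega> by linarith
        also have "\<dots> \<le> \<bar>E n \<omega>\<bar> + (exp 1 + 1)" unfolding E_def by linarith
        finally show ?thesis using False \<omega> by simp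
      qed
      finally show "\<bar>G \<omega> * X n \<omega> - G \<omega> * \<zeta> \<omega>\<bar> \<le> \<bar>D n \<omega>\<bar> + \<bar>E n \<omega>\<bar> + (exp 1 + 1) * indicator (space M - \<Omega>) \<omega>" .
    qed
    also have "\<dots> = expectation (\<lambda>\<omega>. \<bar>D n \<omega>\<bar>) + expectation (\<lambda>\<omega>. \<bar>E n \<omega>\<bar>) + (exp 1 + 1) * prob (space M - \<Omega>)"
    proof -
      have "expectation (\<lambda>\<omega>. indicator (space M - \<Omega>) \<omega>) = prob (space M - \<Omega>)"
        using Bochner_Integration.integral_indicator[of M "space M - \<Omega>"] by (simp add: Int_absorb2)
      then show ?thesis using DD(1)[of n] EE(1)[of n] indi by simp
    qed
    finally show ?thesis using 1 by linarith
  qed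
  have "(\<lambda>n. (a + prob {\<omega>\<in>space M. C \<le> q n \<omega>} / a') + (expectation (\<lambda>\<omega>. \<bar>D n \<omega>\<bar>) + expectation (\<lambda>\<omega>. \<bar>E n \<omega>\<bar>) + (exp 1 + 1) * prob (space M - \<Omega>)))
    \<longlonglongrightarrow> (a + 0 / a') + (0 + 0 + (exp 1 + 1) * prob (space M - \<Omega>))"
    by (intro tendsto_add tendsto_divide tendsto_const P0 DD(2) EE(2)) (use a' in simp)
  then have "\<bar>expectation G' - expectation (\<lambda>\<omega>. G \<omega> * \<zeta> \<omega>)\<bar> \<le> (a + 0 / a') + (0 + 0 + (exp 1 + 1) * prob (space M - \<Omega>))"
    using bound by (intro tendsto_lowerbound[of _ _ sequentially]) auto
  then show ?thesis by (simp add: G'_def[abs_def] \<zeta>_def[abs_def])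
qed

text \<open>Continuous paths are bounded on a compact interval, so the events
  \<open>\<Omega> K\<close> exhaust the space as \<open>K\<close> grows; then \<open>a\<close> tends
  to 0.\<close>

lemma laplace:
  fixes G :: "'a \<Rightarrow> real"
  assumes \<mu>: "\<mu> > 0" and G: "G \<in> borel_measurable (F 0)" "\<And>\<omega>. \<omega> \<in> space M \<Longrightarrow> \<bar>G \<omega>\<bar> \<le> 1"
  shows "expectation (\<lambda>\<omega>. G \<omega> * exp (- \<mu> * V h \<omega>)) = expectation (\<lambda>\<omega>. G \<omega> * exp (- riccati \<sigma> \<mu> h 0 * V 0 \<omega>))"
proof -
  let ?d = "\<bar>expectation (\<lambda>\<omega>. G \<omega> * exp (- riccati \<sigma> \<mu> h 0 * V 0 \<omega>)) - expectation (\<lambda>\<omega>. G \<omega> * exp (- \<mu> * V h \<omega>))\<bar>"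
  define I where "I = (SIGMA m:{0<..}. {..m::nat})"
  \<comment> \<open>One event must serve all grids, since it stays fixed while the grid is refined.
    Only countably many times occur, which keeps it measurable.\<close>
  define \<Omega> where "\<Omega> K = {\<omega> \<in> space M. \<forall>p\<in>I. V (grid h (fst p) (snd p)) \<omega> \<le> real K}" for K
  have gr: "grid h (fst p) (snd p) \<in> {0..h}" if "p \<in> I" for p
    using that h unfolding I_def by (intro grid_range) auto
  have \<Omega>: "\<Omega> K \<in> events" for K
    unfolding \<Omega>_def
  proof (rule sets.sets_Collect_countable_All')
    show "countable I" by (rule countable_subset[OF subset_UNIV]) simp
    fix p assume "p \<in> I"
    then have [measurable]: "V (grid h (fst p) (snd p)) \<in> borel_measurable M" by (intro V_measurable gr)
    show "{\<omega> \<in> space M. V (grid h (fst p) (snd p)) \<omega> \<le> real K} \<in> events" by measurable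
  qed
  have \<Omega>2: "V (grid h m j) \<omega> \<le> real K" if "\<omega> \<in> \<Omega> K" "m > 0" "j \<le> m" for \<omega> m j K
  proof -
    have "(m, j) \<in> I" using that by (simp add: I_def)
    with that(1) show ?thesis unfolding \<Omega>_def by force
  qed
  have b: "?d \<le> a + (exp 1 + 1) * prob (space M - \<Omega> K)" if "a > 0" for a K
    by (rule laplace_bounded_paths[OF \<mu> G that \<Omega> \<Omega>2])
  have P0: "(\<lambda>K. prob (space M - \<Omega> K)) \<longlonglongrightarrow> 0"
  proof -
    have "(\<lambda>K. expectation (\<lambda>\<omega>. indicator (space M - \<Omega> K) \<omega> :: real)) \<longlonglongrightarrow> expectation (\<lambda>\<omega>. 0)"
    proof (rule integral_dominated_convergence[where w = "\<lambda>_. 1"])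
      show "AE \<omega> in M. (\<lambda>K. indicator (space M - \<Omega> K) \<omega> :: real) \<longlonglongrightarrow> 0"
      proof (rule AE_I2)
        fix \<omega> assume \<omega>: "\<omega> \<in> space M"
        have "compact ((\<lambda>s. V s \<omega>) ` {0..h})" using cont[OF \<omega>] by (intro compact_continuous_image) auto
        then obtain B where B: "\<forall>s\<in>{0..h}. \<bar>V s \<omega>\<bar> \<le> B"
          using compact_imp_bounded[of "(\<lambda>s. V s \<omega>) ` {0..h}"] unfolding bounded_real by auto
        obtain K0 :: nat where K0: "B \<le> real K0" using real_arch_simple by blast
        have "eventually (\<lambda>K. (0::real) = indicator (space M - \<Omega> K) \<omega>) sequentially"
          using eventually_ge_at_top[of K0]
        proof eventually_elim
          case (elim K)
          have "V (grid h (fst p) (snd p)) \<omega> \<le> real K" if "p \<in> I" for p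
          proof -
            have "\<bar>V (grid h (fst p) (snd p)) \<omega>\<bar> \<le> B" using B gr[OF that] by blast
            moreover have "real K0 \<le> real K" using elim by simp
            ultimately show ?thesis using K0 by linarith
          qed
          then have "\<omega> \<in> \<Omega> K" using \<omega> by (simp add: \<Omega>_def)
          then show ?case by simp
        qed
        then show "(\<lambda>K. indicator (space M - \<Omega> K) \<omega> :: real) \<longlonglongrightarrow> 0" by (rule Lim_transform_eventually[OF tendsto_const])
      qed
    qed (use \<Omega> in \<open>auto simp: indicator_def\<close>)
    moreover have "expectation (\<lambda>\<omega>. indicator (space M - \<Omega> K) \<omega> :: real) = prob (space M - \<Omega> K)" for K
      using Bochner_Integration.integral_indicator[of M "space M - \<Omega> K"] by (simp add: Int_absorb2)
    ultimately show ?thesis by simp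
  qed
  have "?d \<le> a" if "a > 0" for a
  proof -
    have "(\<lambda>K. a + (exp 1 + 1) * prob (space M - \<Omega> K)) \<longlonglongrightarrow> a + (exp 1 + 1) * 0"
      by (intro tendsto_add tendsto_mult tendsto_const P0)
    then have "?d \<le> a + (exp 1 + 1) * 0"
      using b[OF that] by (intro tendsto_lowerbound[of _ _ sequentially]) auto
    then show ?thesis by simp
  qed
  then have "?d \<le> 0" by (rule field_le_epsilon) simp
  then show ?thesis by linarith
qed

end

text \<open>The moments of the bounded variable \<open>exp (- X)\<close> are values of the Laplace transform of \<open>X\<close>.\<close>

lemma laplace_determines_distr:
  fixes X :: "'a \<Rightarrow> real" and Y :: "'b \<Rightarrow> real"
  assumes M: "prob_space M" and N: "prob_space N"
    and X[measurable]: "X \<in> borel_measurable M" and Y[measurable]: "Y \<in> borel_measurable N"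
    and X0: "AE \<omega> in M. 0 \<le> X \<omega>" and Y0: "AE \<omega> in N. 0 \<le> Y \<omega>"
    and eq: "\<And>\<mu>. \<mu> > 0 \<Longrightarrow> (LINT \<omega>|M. exp (- \<mu> * X \<omega>)) = (LINT \<omega>|N. exp (- \<mu> * Y \<omega>))"
  shows "distr M borel X = distr N borel Y"
proof -
  interpret M: prob_space M by (rule M)
  interpret N: prob_space N by (rule N)
  define P where "P = distr M borel (\<lambda>\<omega>. exp (- X \<omega>))"
  define Q where "Q = distr N borel (\<lambda>\<omega>. exp (- Y \<omega>))"
  interpret P: real_distribution P unfolding P_def by (rule M.real_distribution_distr) measurable
  interpret Q: real_distribution Q unfolding Q_def by (rule N.real_distribution_distr) measurable
  have P01: "AE x in P. 0 \<le> x \<and> x \<le> 1"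
    unfolding P_def using X0 by (subst AE_distr_iff) auto
  have Q01: "AE x in Q. 0 \<le> x \<and> x \<le> 1"
    unfolding Q_def using Y0 by (subst AE_distr_iff) auto
  have nP: "AE x in P. norm (x ^ k) \<le> 1" for k
    using P01 by eventually_elim (simp add: power_le_one)
  have iP: "integrable P (\<lambda>x. x ^ k)" for k
    by (rule P.integrable_const_bound[where B = 1]) (use nP in auto)
  have nQ: "AE x in Q. norm (x ^ k) \<le> 1" for k
    using Q01 by eventually_elim (simp add: power_le_one)
  have iQ: "integrable Q (\<lambda>x. x ^ k)" for k
    by (rule Q.integrable_const_bound[where B = 1]) (use nQ in auto)
  have bP: "P.expectation (\<lambda>x. \<bar>x\<bar> ^ k) \<le> 1" for k
  proof -
    have "P.expectation (\<lambda>x. \<bar>x\<bar> ^ k) \<le> P.expectation (\<lambda>x. 1)"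
      by (rule integral_mono_AE) (use nP[of k] iP[of k] in \<open>simp_all add: power_abs[symmetric]\<close>)
    then show ?thesis using P.prob_space by simp
  qed
  have bQ: "Q.expectation (\<lambda>x. \<bar>x\<bar> ^ k) \<le> 1" for k
  proof -
    have "Q.expectation (\<lambda>x. \<bar>x\<bar> ^ k) \<le> Q.expectation (\<lambda>x. 1)"
      by (rule integral_mono_AE) (use nQ[of k] iQ[of k] in \<open>simp_all add: power_abs[symmetric]\<close>)
    then show ?thesis using Q.prob_space by simp
  qed
  have mom: "P.expectation (\<lambda>x. x ^ k) = Q.expectation (\<lambda>x. x ^ k)" for k
  proof (cases "k = 0")
    case True
    then show ?thesis using P.prob_space Q.prob_space by simp
  next
    case False
    have "P.expectation (\<lambda>x. x ^ k) = (LINT \<omega>|M. exp (- real k * X \<omega>))"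
      unfolding P_def by (subst integral_distr) (auto simp: exp_of_nat_mult[symmetric])
    also have "\<dots> = (LINT \<omega>|N. exp (- real k * Y \<omega>))" using False by (intro eq) simp
    also have "\<dots> = Q.expectation (\<lambda>x. x ^ k)"
      unfolding Q_def by (subst integral_distr) (auto simp: exp_of_nat_mult[symmetric])
    finally show ?thesis .
  qed
  have "char P = char Q"
  proof
    fix t
    have "norm (char P t - char Q t) \<le> 4 * (\<bar>t\<bar> ^ n / fact n)" for n
    proof -
      \<comment> \<open>A Taylor polynomial common to both characteristic functions, because the
        moments agree. All absolute moments are at most 1, so the remainders are dominated by terms
        of the exponential series.\<close>
      define s where "s = (\<Sum>k \<le> n. ((\<i> * t)^k / fact k) * P.expectation (\<lambda>x. x^k))"
      have "norm (char P t - s) \<le> (2*\<bar>t\<bar>^n / fact n) * P.expectation (\<lambda>x. \<bar>x\<bar>^n)"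
        unfolding s_def by (rule P.char_approx1) (rule iP)
      also have "\<dots> \<le> (2*\<bar>t\<bar>^n / fact n) * 1" by (intro mult_left_mono bP) auto
      finally have 1: "norm (char P t - s) \<le> 2 * (\<bar>t\<bar>^n / fact n)" by simp
      have "norm (char Q t - s) \<le> (2*\<bar>t\<bar>^n / fact n) * Q.expectation (\<lambda>x. \<bar>x\<bar>^n)"
        unfolding s_def mom by (rule Q.char_approx1) (rule iQ)
      also have "\<dots> \<le> (2*\<bar>t\<bar>^n / fact n) * 1" by (intro mult_left_mono bQ) auto
      finally have 2: "norm (char Q t - s) \<le> 2 * (\<bar>t\<bar>^n / fact n)" by simp
      have "norm (char P t - char Q t) \<le> norm (char P t - s) + norm (char Q t - s)"
        using norm_triangle_ineq4[of "char P t - s" "char Q t - s"] by simp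
      then show ?thesis using 1 2 by linarith
    qed
    moreover have "(\<lambda>n. 4 * (\<bar>t\<bar> ^ n / fact n)) \<longlonglongrightarrow> 4 * 0"
      by (intro tendsto_mult tendsto_const summable_LIMSEQ_zero) (use summable_exp[of "\<bar>t\<bar>"] in \<open>simp add: divide_inverse mult.commute\<close>)
    ultimately have "norm (char P t - char Q t) \<le> 4 * 0"
      by (intro tendsto_lowerbound[of _ _ sequentially]) auto
    then show "char P t = char Q t" by simp
  qed
  then have PQ: "P = Q" by (rule Levy_uniqueness[OF P.real_distribution_axioms Q.real_distribution_axioms])
  have "distr M borel X = distr P borel (\<lambda>x. - ln x)"
    unfolding P_def by (subst distr_distr) (auto simp: comp_def)
  also have "\<dots> = distr N borel Y"
    unfolding PQ Q_def by (subst distr_distr) (auto simp: comp_def)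
  finally show ?thesis .
qed

section \<open>Coordinates of a planar Brownian motion\<close>

lemma borel_measurable_projections:
  "(fst :: real \<times> real \<Rightarrow> real) \<in> borel_measurable borel" "(snd :: real \<times> real \<Rightarrow> real) \<in> borel_measurable borel"
  by (intro borel_measurable_continuous_onI continuous_intros)+

text \<open>On the plane the density has two factors, so the joint law is a product measure and its
  projections are the factors. The product over \<open>Basis\<close>, trivial on the line, is kept
  to match \<open>brownian_motion\<close> at type \<open>real\<close>.\<close>

lemma distr_marginals_normal:
  fixes D :: "'a \<Rightarrow> real \<times> real"
  assumes D: "distributed M lborel D (\<lambda>x. ennreal (\<Prod>i\<in>Basis. normal_density 0 s (x \<bullet> i)))" and s: "s > 0"
  shows "distributed M lborel (\<lambda>\<omega>. fst (D \<omega>)) (\<lambda>x. ennreal (\<Prod>i\<in>Basis. normal_density 0 s (x \<bullet> i)))"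
    and "distributed M lborel (\<lambda>\<omega>. snd (D \<omega>)) (\<lambda>x. ennreal (\<Prod>i\<in>Basis. normal_density 0 s (x \<bullet> i)))"
proof -
  let ?n = "density lborel (normal_density 0 s)"
  interpret n: prob_space ?n by (rule prob_space_normal_density[OF s])
  interpret nn: pair_prob_space ?n ?n ..
  have Dm[measurable]: "D \<in> borel_measurable M" using D by (auto simp: distributed_def)
  have dens: "(\<lambda>x::real \<times> real. ennreal (\<Prod>i\<in>Basis. normal_density 0 s (x \<bullet> i)))
      = (\<lambda>(x, y). ennreal (normal_density 0 s x) * ennreal (normal_density 0 s y))"
  proof
    fix x :: "real \<times> real"
    have B: "(Basis :: (real \<times> real) set) = {(1, 0), (0, 1)}" by (auto simp: Basis_prod_def)
    show "ennreal (\<Prod>i\<in>Basis. normal_density 0 s (x \<bullet> i)) = (case x of (x, y) \<Rightarrow> ennreal (normal_density 0 s x) * ennreal (normal_density 0 s y))"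
      unfolding B by (cases x) (simp add: ennreal_mult')
  qed
  have "distr M lborel D = density lborel (\<lambda>(x, y). ennreal (normal_density 0 s x) * ennreal (normal_density 0 s y))"
    using D unfolding distributed_def dens by simp
  also have "\<dots> = ?n \<Otimes>\<^sub>M ?n"
    by (subst pair_measure_density) (auto simp: lborel_prod lborel.sigma_finite_measure_axioms n.sigma_finite_measure_axioms)
  finally have DD: "distr M lborel D = ?n \<Otimes>\<^sub>M ?n" .
  have "distr M lborel (\<lambda>\<omega>. fst (D \<omega>)) = distr (distr M lborel D) lborel fst"
    using Dm borel_measurable_projections by (subst distr_distr) (auto simp: comp_def)
  also have "\<dots> = distr (?n \<Otimes>\<^sub>M ?n) ?n fst" unfolding DD by (rule distr_cong) auto
  also have "\<dots> = ?n" by (rule n.distr_pair_fst)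
  finally have 1: "distr M lborel (\<lambda>\<omega>. fst (D \<omega>)) = ?n" .
  have "distr M lborel (\<lambda>\<omega>. snd (D \<omega>)) = distr (distr M lborel D) lborel snd"
    using Dm borel_measurable_projections by (subst distr_distr) (auto simp: comp_def)
  also have "\<dots> = distr (?n \<Otimes>\<^sub>M ?n) ?n snd" unfolding DD by (rule distr_cong) auto
  also have "\<dots> = ?n"
  proof (rule measure_eqI)
    fix A assume A: "A \<in> sets (distr (?n \<Otimes>\<^sub>M ?n) ?n snd)"
    then have "emeasure (distr (?n \<Otimes>\<^sub>M ?n) ?n snd) A = emeasure (?n \<Otimes>\<^sub>M ?n) (space ?n \<times> A)"
      by (auto simp: emeasure_distr space_pair_measure dest: sets.sets_into_space intro!: arg_cong2[where f=emeasure])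
    with A show "emeasure (distr (?n \<Otimes>\<^sub>M ?n) ?n snd) A = emeasure ?n A"
      by (simp add: n.emeasure_pair_measure_Times n.emeasure_space_1[simplified])
  qed simp
  finally have 2: "distr M lborel (\<lambda>\<omega>. snd (D \<omega>)) = ?n" .
  show "distributed M lborel (\<lambda>\<omega>. fst (D \<omega>)) (\<lambda>x. ennreal (\<Prod>i\<in>Basis. normal_density 0 s (x \<bullet> i)))"
    using 1 measurable_compose[OF Dm borel_measurable_projections(1)] by (simp add: distributed_def)
  show "distributed M lborel (\<lambda>\<omega>. snd (D \<omega>)) (\<lambda>x. ennreal (\<Prod>i\<in>Basis. normal_density 0 s (x \<bullet> i)))"
    using 2 measurable_compose[OF Dm borel_measurable_projections(2)] by (simp add: distributed_def)
qed

text \<open>Each coordinate is Brownian relative to the same filtration: the \<sigma>-algebra of its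
  increment is contained in that of the vector increment, so independence of the past is
  inherited.\<close>

lemma brownian_motion_component:
  fixes B :: "real \<Rightarrow> 'a \<Rightarrow> real \<times> real" and \<pi> :: "real \<times> real \<Rightarrow> real"
  assumes B: "brownian_motion M F B" and \<pi>: "\<pi> = fst \<or> \<pi> = snd"
  shows "brownian_motion M F (\<lambda>t \<omega>. \<pi> (B t \<omega>))"
proof -
  have filt: "filtered_prob_space M F"
    and meas: "\<And>t. t \<ge> 0 \<Longrightarrow> B t \<in> borel_measurable (F t)"
    and cont: "\<And>\<omega>. \<omega> \<in> space M \<Longrightarrow> continuous_on {0..} (\<lambda>t. B t \<omega>)"
    and init: "AE \<omega> in M. B 0 \<omega> = 0"
    and incr: "\<And>s t. 0 \<le> s \<and> s < t \<Longrightarrow>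
        prob_space.indep_set M (sets (F s))
          (sets (vimage_algebra (space M) (\<lambda>\<omega>. B t \<omega> - B s \<omega>) borel)) \<and>
        distributed M lborel (\<lambda>\<omega>. B t \<omega> - B s \<omega>)
          (\<lambda>x. ennreal (\<Prod>i\<in>Basis. normal_density 0 (sqrt (t - s)) (x \<bullet> i)))"
    using B unfolding brownian_motion_def by blast+
  interpret prob_space M using filt unfolding filtered_prob_space_def by blast
  have \<pi>m: "\<pi> \<in> borel_measurable borel" using \<pi> borel_measurable_projections by auto
  have \<pi>diff: "\<pi> (x - y) = \<pi> x - \<pi> y" for x y using \<pi> by auto
  show ?thesis
    unfolding brownian_motion_def
  proof (intro conjI allI impI ballI)
    show "filtered_prob_space M F" by (rule filt)
    show "(\<lambda>\<omega>. \<pi> (B t \<omega>)) \<in> borel_measurable (F t)" if "t \<ge> 0" for t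
      by (rule measurable_compose[OF meas[OF that] \<pi>m])
    show "continuous_on {0..} (\<lambda>t. \<pi> (B t \<omega>))" if "\<omega> \<in> space M" for \<omega>
      using \<pi> cont[OF that] by (auto intro: continuous_on_fst continuous_on_snd)
    show "AE \<omega> in M. \<pi> (B 0 \<omega>) = 0"
      using init by eventually_elim (use \<pi> in auto)
    fix s t :: real assume st: "0 \<le> s \<and> s < t"
    let ?D = "\<lambda>\<omega>. B t \<omega> - B s \<omega>"
    have "sets (vimage_algebra (space M) (\<lambda>\<omega>. \<pi> (B t \<omega>) - \<pi> (B s \<omega>)) borel) \<subseteq> sets (vimage_algebra (space M) ?D borel)"
    proof (rule sets_image_in_sets)
      have "?D \<in> measurable (vimage_algebra (space M) ?D borel) borel"
        by (rule measurable_vimage_algebra1) auto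
      from measurable_compose[OF this \<pi>m]
      show "(\<lambda>\<omega>. \<pi> (B t \<omega>) - \<pi> (B s \<omega>)) \<in> borel_measurable (vimage_algebra (space M) ?D borel)"
        by (simp add: \<pi>diff)
    qed simp
    then have sub: "case_bool (sets (F s)) (sets (vimage_algebra (space M) (\<lambda>\<omega>. \<pi> (B t \<omega>) - \<pi> (B s \<omega>)) borel)) i
      \<subseteq> case_bool (sets (F s)) (sets (vimage_algebra (space M) ?D borel)) i" for i
      by (auto split: bool.split)
    show "indep_set (sets (F s)) (sets (vimage_algebra (space M) (\<lambda>\<omega>. \<pi> (B t \<omega>) - \<pi> (B s \<omega>)) borel))"
      unfolding indep_set_def
      by (rule indep_sets_mono_sets[OF incr[OF st, THEN conjunct1, unfolded indep_set_def] sub])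
    have sp: "sqrt (t - s) > 0" using st by simp
    show "distributed M lborel (\<lambda>\<omega>. \<pi> (B t \<omega>) - \<pi> (B s \<omega>)) (\<lambda>x. ennreal (\<Prod>i\<in>Basis. normal_density 0 (sqrt (t - s)) (x \<bullet> i)))"
      using distr_marginals_normal[OF incr[OF st, THEN conjunct2] sp] \<pi>
      by auto
  qed
qed

text \<open>The null set of disagreement joins the exceptional set. This lets
  \<open>V u - V 0\<close> replace the abstract version of the integral supplied by the
  equation.\<close>

lemma (in brownian) ito_approx_cong_AE:
  assumes ia: "ito_approx M F W H T J" and J': "J' \<in> borel_measurable M" and eq: "AE \<omega> in M. J \<omega> = J' \<omega>"
  shows "ito_approx M F W H T J'"
  unfolding ito_approx_def
proof (intro conjI allI impI)
  show "J' \<in> borel_measurable M" by (rule J')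
  have [measurable]: "J \<in> borel_measurable M" "J' \<in> borel_measurable M" using ia J' by (simp_all add: ito_approx_def)
  fix \<epsilon> :: real assume "\<epsilon> > 0"
  with ia[unfolded ito_approx_def, THEN conjunct2, rule_format, OF this]
  obtain N \<tau> \<xi> A where *: "elementary_integrand M F T N \<tau> \<xi>" "A \<in> events" "prob A < \<epsilon>"
    "\<forall>\<omega>\<in>space M - A.
           (\<integral>\<^sup>+ s\<in>{0..T}. ennreal ((elementary_process N \<tau> \<xi> s \<omega> - H s \<omega>)\<^sup>2) \<partial>lborel) \<le> ennreal \<epsilon> \<and>
           \<bar>elementary_integral W N \<tau> \<xi> \<omega> - J \<omega>\<bar> \<le> \<epsilon>" by (elim exE conjE)
  let ?B = "{\<omega>\<in>space M. J \<omega> \<noteq> J' \<omega>}"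
  have B: "?B \<in> events" by measurable
  have "prob ?B = 0" using eq by (intro prob_eq_0[OF B, THEN iffD2]) (auto elim: eventually_mono)
  moreover have "prob (A \<union> ?B) \<le> prob A + prob ?B" by (rule measure_Un_le[OF *(2) B])
  ultimately have "prob (A \<union> ?B) < \<epsilon>" using *(3) by linarith
  moreover have "\<forall>\<omega>\<in>space M - (A \<union> ?B).
           (\<integral>\<^sup>+ s\<in>{0..T}. ennreal ((elementary_process N \<tau> \<xi> s \<omega> - H s \<omega>)\<^sup>2) \<partial>lborel) \<le> ennreal \<epsilon> \<and>
           \<bar>elementary_integral W N \<tau> \<xi> \<omega> - J' \<omega>\<bar> \<le> \<epsilon>"
  proof
    fix \<omega> assume \<omega>: "\<omega> \<in> space M - (A \<union> ?B)"
    then have "J' \<omega> = J \<omega>" "\<omega> \<in> space M - A" by auto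
    then show "(\<integral>\<^sup>+ s\<in>{0..T}. ennreal ((elementary_process N \<tau> \<xi> s \<omega> - H s \<omega>)\<^sup>2) \<partial>lborel) \<le> ennreal \<epsilon> \<and>
           \<bar>elementary_integral W N \<tau> \<xi> \<omega> - J' \<omega>\<bar> \<le> \<epsilon>" using *(4) by simp
  qed
  ultimately show "\<exists>N \<tau> \<xi> A. elementary_integrand M F T N \<tau> \<xi> \<and> A \<in> events \<and> prob A < \<epsilon> \<and>
        (\<forall>\<omega>\<in>space M - A.
           (\<integral>\<^sup>+ s\<in>{0..T}. ennreal ((elementary_process N \<tau> \<xi> s \<omega> - H s \<omega>)\<^sup>2) \<partial>lborel) \<le> ennreal \<epsilon> \<and>
           \<bar>elementary_integral W N \<tau> \<xi> \<omega> - J' \<omega>\<bar> \<le> \<epsilon>)"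
    using *(1,2) B by (intro exI[of _ N] exI[of _ \<tau>] exI[of _ \<xi>] exI[of _ "A \<union> ?B"] conjI sets.Un)
qed

section \<open>The two systems\<close>

text \<open>
  Only rational times are assumed, because a solution of the equation satisfies it outside a null
  set that depends on the time.
\<close>

lemma linear_ode_path:
  fixes f :: "real \<Rightarrow> real"
  assumes T: "T > 0" and k: "k \<noteq> 0" and f: "continuous_on {0..T} f"
    and eq: "\<And>t. t \<in> {0<..<T} \<inter> \<rat> \<Longrightarrow> f t = f 0 + (LINT s:{0..t}|lborel. k * (\<theta> - f s))"
  shows "\<And>t. t \<in> {0..T} \<Longrightarrow> f t = exp (- k * t) * (f 0 - \<theta>) + \<theta>"
    and "(LINT s:{0..T}|lborel. f s) = \<theta> * T + (f 0 - \<theta>) * (1 - exp (- k * T)) / k"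
proof -
  let ?g = "\<lambda>s. k * (\<theta> - f s)"
  \<comment> \<open>The right-hand side of the equation is continuous and differentiable by
    construction; it agrees with \<open>f\<close> at rational times and hence, by continuity,
    everywhere.\<close>
  define Y where "Y t = f 0 + integral {0..t} ?g" for t
  have gc: "continuous_on {0..T} ?g" by (intro continuous_intros f)
  have gi: "?g integrable_on {0..T}" by (rule integrable_continuous_real[OF gc])
  have L: "(LINT s:{0..t}|lborel. ?g s) = integral {0..t} ?g" if "t \<in> {0..T}" for t
  proof -
    have "continuous_on {0..t} ?g" by (rule continuous_on_subset[OF gc]) (use that in auto)
    from set_borel_integral_eq_integral(2)[OF borel_integrable_atLeastAtMost'[OF this]] show ?thesis .
  qed
  have Yc: "continuous_on {0..T} Y"
    unfolding Y_def by (intro continuous_intros indefinite_integral_continuous_1 gi)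
  have fY: "f t = Y t" if t: "t \<in> {0..T}" for t
  proof -
    have cl: "{0..T} \<subseteq> closure ({0<..<T} \<inter> \<rat>)"
    proof -
      have "{0<..<T} \<subseteq> closure ({0<..<T} \<inter> \<rat>)"
        using open_Int_closure_subset[of "{0<..<T}" "\<rat> :: real set"] by (simp add: Rats_closure_real)
      then have "closure {0<..<T} \<subseteq> closure ({0<..<T} \<inter> \<rat>)" by (rule closure_minimal) simp
      then show ?thesis using T by simp
    qed
    have cl': "closure ({0<..<T} \<inter> \<rat>) \<subseteq> {0..T}" by (rule closure_minimal) auto
    have "f t - Y t = 0"
    proof (rule continuous_constant_on_closure[where f = "\<lambda>t. f t - Y t" and x = t])
      show "continuous_on (closure ({0<..<T} \<inter> \<rat>)) (\<lambda>t. f t - Y t)"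
        by (rule continuous_on_subset[OF _ cl']) (intro continuous_intros f Yc)
      show "f s - Y s = 0" if "s \<in> {0<..<T} \<inter> \<rat>" for s
        using eq[OF that] L[of s] that by (simp add: Y_def)
      show "t \<in> closure ({0<..<T} \<inter> \<rat>)" using cl t by blast
    qed
    then show ?thesis by simp
  qed
  have dY: "(Y has_vector_derivative k * (\<theta> - Y t)) (at t within {0..T})" if t: "t \<in> {0..T}" for t
  proof -
    have "((\<lambda>t. integral {0..t} ?g) has_vector_derivative ?g t) (at t within {0..T})"
      by (rule integral_has_vector_derivative[OF gc t])
    then show ?thesis unfolding Y_def[abs_def] fY[OF t, unfolded Y_def, symmetric]
      by (intro derivative_eq_intros) auto
  qed
  \<comment> \<open>Integrating factor: the derivative of \<open>U\<close> vanishes.\<close>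
  define U where "U t = exp (k * t) * (Y t - \<theta>)" for t
  have dU: "(U has_vector_derivative 0) (at t within {0..T})" if t: "t \<in> {0..T}" for t
  proof -
    have "(Y has_real_derivative k * (\<theta> - Y t)) (at t within {0..T})"
      using dY[OF t] by (simp add: has_real_derivative_iff_has_vector_derivative)
    then have "(U has_real_derivative 0) (at t within {0..T})"
      unfolding U_def[abs_def] by (auto intro!: derivative_eq_intros simp: algebra_simps)
    then show ?thesis by (simp add: has_real_derivative_iff_has_vector_derivative)
  qed
  obtain c where c: "\<And>t. t \<in> {0..T} \<Longrightarrow> U t = c"
    using has_vector_derivative_zero_constant[of "{0..T}" U] dU by auto
  show sol: "f t = exp (- k * t) * (f 0 - \<theta>) + \<theta>" if t: "t \<in> {0..T}" for t
  proof -
    have "exp (k * t) * (f t - \<theta>) = f 0 - \<theta>"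
      using c[OF t] c[of 0] T fY[OF t] fY[of 0] by (simp add: U_def)
    then have "exp (- k * t) * (exp (k * t) * (f t - \<theta>)) = exp (- k * t) * (f 0 - \<theta>)" by simp
    then have "(exp (- k * t) * exp (k * t)) * (f t - \<theta>) = exp (- k * t) * (f 0 - \<theta>)" by (simp only: mult.assoc)
    then show ?thesis by (simp add: mult_exp_exp)
  qed
  have Tin: "T \<in> {0..T}" using T by simp
  have fi: "set_integrable lborel {0..T} f" by (rule borel_integrable_atLeastAtMost'[OF f])
  have ci: "set_integrable lborel {0..T} (\<lambda>_. \<theta>)" by (rule borel_integrable_atLeastAtMost') simp
  \<comment> \<open>The time integral is read off the integrated equation at \<open>T\<close>
    instead of integrating the explicit solution.\<close>
  have "f T = f 0 + (LINT s:{0..T}|lborel. ?g s)"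
    unfolding L[OF Tin] using fY[OF Tin] by (simp add: Y_def)
  also have "(LINT s:{0..T}|lborel. ?g s) = k * ((LINT s:{0..T}|lborel. \<theta>) - (LINT s:{0..T}|lborel. f s))"
    by (simp add: set_integral_diff(2)[OF ci fi])
  also have "(LINT s:{0..T}|lborel. \<theta>) = \<theta> * T"
    using T by (simp add: set_lebesgue_integral_def)
  finally have "f T = f 0 + k * (\<theta> * T - (LINT s:{0..T}|lborel. f s))" .
  then have "(LINT s:{0..T}|lborel. f s) = \<theta> * T + (f 0 - f T) / k" using k by (simp add: field_simps)
  also have "f 0 - f T = (f 0 - \<theta>) * (1 - exp (- k * T))" unfolding sol[OF Tin] by (simp add: algebra_simps)
  finally show "(LINT s:{0..T}|lborel. f s) = \<theta> * T + (f 0 - \<theta>) * (1 - exp (- k * T)) / k" .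
qed

text \<open>In the names of the integrals the first index is the state coordinate and the second the
  driving one. Vanishing coefficients still leave integrals here, since each entry of the diffusion
  matrix supplies some version of its own.\<close>

lemma sde_solution_pairD:
  fixes X :: "real \<Rightarrow> 'a \<Rightarrow> real \<times> real" and B :: "real \<Rightarrow> 'a \<Rightarrow> real \<times> real"
  assumes sol: "sde_solution M F B D b a T X"
  shows "brownian M F (\<lambda>t \<omega>. fst (B t \<omega>))" "brownian M F (\<lambda>t \<omega>. snd (B t \<omega>))"
    and "\<And>t. t \<in> {0..T} \<Longrightarrow> (\<lambda>\<omega>. fst (X t \<omega>)) \<in> borel_measurable (F t)"
    and "\<And>t. t \<in> {0..T} \<Longrightarrow> (\<lambda>\<omega>. snd (X t \<omega>)) \<in> borel_measurable (F t)"
    and "\<And>\<omega>. \<omega> \<in> space M \<Longrightarrow> continuous_on {0..T} (\<lambda>t. fst (X t \<omega>))"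
    and "\<And>\<omega>. \<omega> \<in> space M \<Longrightarrow> continuous_on {0..T} (\<lambda>t. snd (X t \<omega>))"
    and "\<And>\<omega> t. \<omega> \<in> space M \<Longrightarrow> t \<in> {0..T} \<Longrightarrow> X t \<omega> \<in> D"
    and "\<And>t. t \<in> {0..T} \<Longrightarrow> \<exists>J11 J12 J21 J22.
      has_ito_integral M F (\<lambda>s \<omega>. fst (B s \<omega>)) (\<lambda>s \<omega>. fst (a (X s \<omega>) (1, 0))) t J11 \<and>
      has_ito_integral M F (\<lambda>s \<omega>. snd (B s \<omega>)) (\<lambda>s \<omega>. fst (a (X s \<omega>) (0, 1))) t J12 \<and>
      has_ito_integral M F (\<lambda>s \<omega>. fst (B s \<omega>)) (\<lambda>s \<omega>. snd (a (X s \<omega>) (1, 0))) t J21 \<and>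
      has_ito_integral M F (\<lambda>s \<omega>. snd (B s \<omega>)) (\<lambda>s \<omega>. snd (a (X s \<omega>) (0, 1))) t J22 \<and>
      (AE \<omega> in M. fst (X t \<omega>) = fst (X 0 \<omega>) + (LINT s:{0..t}|lborel. fst (b (X s \<omega>))) + J11 \<omega> + J12 \<omega> \<and>
        snd (X t \<omega>) = snd (X 0 \<omega>) + (LINT s:{0..t}|lborel. snd (b (X s \<omega>))) + J21 \<omega> + J22 \<omega>)"
proof -
  have bm: "brownian_motion M F B"
    and meas: "\<And>t. t \<in> {0..T} \<Longrightarrow> X t \<in> borel_measurable (F t)"
    and path: "\<And>\<omega>. \<omega> \<in> space M \<Longrightarrow> continuous_on {0..T} (\<lambda>t. X t \<omega>) \<and> (\<forall>t\<in>{0..T}. X t \<omega> \<in> D)"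
    and ev: "\<And>t. t \<in> {0..T} \<Longrightarrow> \<exists>J.
        (\<forall>i\<in>Basis. \<forall>j\<in>Basis.
           has_ito_integral M F (\<lambda>s \<omega>. B s \<omega> \<bullet> j) (\<lambda>s \<omega>. a (X s \<omega>) j \<bullet> i) t (J i j)) \<and>
        (AE \<omega> in M. set_integrable lborel {0..t} (\<lambda>s. b (X s \<omega>)) \<and>
           X t \<omega> = X 0 \<omega> + (LINT s:{0..t}|lborel. b (X s \<omega>))
                     + (\<Sum>i\<in>Basis. \<Sum>j\<in>Basis. J i j \<omega> *\<^sub>R i))"
    using sol unfolding sde_solution_def by blast+
  show "brownian M F (\<lambda>t \<omega>. fst (B t \<omega>))" "brownian M F (\<lambda>t \<omega>. snd (B t \<omega>))"
    using brownian_motion_component[OF bm, of fst] brownian_motion_component[OF bm, of snd] by (simp_all add: brownian_def)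
  show "(\<lambda>\<omega>. fst (X t \<omega>)) \<in> borel_measurable (F t)" "(\<lambda>\<omega>. snd (X t \<omega>)) \<in> borel_measurable (F t)" if "t \<in> {0..T}" for t
    using measurable_compose[OF meas[OF that] borel_measurable_projections(1)]
      measurable_compose[OF meas[OF that] borel_measurable_projections(2)] by simp_all
  show "continuous_on {0..T} (\<lambda>t. fst (X t \<omega>))" "continuous_on {0..T} (\<lambda>t. snd (X t \<omega>))" if "\<omega> \<in> space M" for \<omega>
    using path[OF that] by (auto intro: continuous_on_fst continuous_on_snd)
  show "X t \<omega> \<in> D" if "\<omega> \<in> space M" "t \<in> {0..T}" for \<omega> t
    using path[OF that(1)] that(2) by blast
  have Bas: "(Basis :: (real \<times> real) set) = {(1, 0), (0, 1)}" by (auto simp: Basis_prod_def)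
  fix t assume t: "t \<in> {0..T}"
  from ev[OF t] obtain J where J: "\<forall>i\<in>Basis. \<forall>j\<in>Basis.
           has_ito_integral M F (\<lambda>s \<omega>. B s \<omega> \<bullet> j) (\<lambda>s \<omega>. a (X s \<omega>) j \<bullet> i) t (J i j)"
    and AJ: "AE \<omega> in M. set_integrable lborel {0..t} (\<lambda>s. b (X s \<omega>)) \<and>
           X t \<omega> = X 0 \<omega> + (LINT s:{0..t}|lborel. b (X s \<omega>))
                     + (\<Sum>i\<in>Basis. \<Sum>j\<in>Basis. J i j \<omega> *\<^sub>R i)" by (elim exE conjE)
  have in1: "x \<bullet> (1, 0) = fst x" "x \<bullet> (0, 1) = snd x" for x :: "real \<times> real"
    by (simp_all add: inner_prod_def)
  have "AE \<omega> in M. fst (X t \<omega>) = fst (X 0 \<omega>) + (LINT s:{0..t}|lborel. fst (b (X s \<omega>))) + J (1, 0) (1, 0) \<omega> + J (1, 0) (0, 1) \<omega> \<and>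
        snd (X t \<omega>) = snd (X 0 \<omega>) + (LINT s:{0..t}|lborel. snd (b (X s \<omega>))) + J (0, 1) (1, 0) \<omega> + J (0, 1) (0, 1) \<omega>"
    using AJ
  proof eventually_elim
    case (elim \<omega>)
    then have i: "integrable lborel (\<lambda>s. indicator {0..t} s *\<^sub>R b (X s \<omega>))" by (simp add: set_integrable_def)
    have "fst (LINT s:{0..t}|lborel. b (X s \<omega>)) = (LINT s:{0..t}|lborel. fst (b (X s \<omega>)))"
      "snd (LINT s:{0..t}|lborel. b (X s \<omega>)) = (LINT s:{0..t}|lborel. snd (b (X s \<omega>)))"
      unfolding set_lebesgue_integral_def
      using integral_bounded_linear[OF bounded_linear_fst i] integral_bounded_linear[OF bounded_linear_snd i]
      by (simp_all add: fst_scaleR snd_scaleR)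
    then show ?case using elim[THEN conjunct2] by (simp add: Bas)
  qed
  moreover have "has_ito_integral M F (\<lambda>s \<omega>. fst (B s \<omega>)) (\<lambda>s \<omega>. fst (a (X s \<omega>) (1, 0))) t (J (1, 0) (1, 0))"
    "has_ito_integral M F (\<lambda>s \<omega>. snd (B s \<omega>)) (\<lambda>s \<omega>. fst (a (X s \<omega>) (0, 1))) t (J (1, 0) (0, 1))"
    "has_ito_integral M F (\<lambda>s \<omega>. fst (B s \<omega>)) (\<lambda>s \<omega>. snd (a (X s \<omega>) (1, 0))) t (J (0, 1) (1, 0))"
    "has_ito_integral M F (\<lambda>s \<omega>. snd (B s \<omega>)) (\<lambda>s \<omega>. snd (a (X s \<omega>) (0, 1))) t (J (0, 1) (0, 1))"
    using J[rule_format, of "(1, 0)" "(1, 0)"] J[rule_format, of "(1, 0)" "(0, 1)"]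
      J[rule_format, of "(0, 1)" "(1, 0)"] J[rule_format, of "(0, 1)" "(0, 1)"]
    by (simp_all add: Bas in1)
  ultimately show "\<exists>J11 J12 J21 J22.
      has_ito_integral M F (\<lambda>s \<omega>. fst (B s \<omega>)) (\<lambda>s \<omega>. fst (a (X s \<omega>) (1, 0))) t J11 \<and>
      has_ito_integral M F (\<lambda>s \<omega>. snd (B s \<omega>)) (\<lambda>s \<omega>. fst (a (X s \<omega>) (0, 1))) t J12 \<and>
      has_ito_integral M F (\<lambda>s \<omega>. fst (B s \<omega>)) (\<lambda>s \<omega>. snd (a (X s \<omega>) (1, 0))) t J21 \<and>
      has_ito_integral M F (\<lambda>s \<omega>. snd (B s \<omega>)) (\<lambda>s \<omega>. snd (a (X s \<omega>) (0, 1))) t J22 \<and>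
      (AE \<omega> in M. fst (X t \<omega>) = fst (X 0 \<omega>) + (LINT s:{0..t}|lborel. fst (b (X s \<omega>))) + J11 \<omega> + J12 \<omega> \<and>
        snd (X t \<omega>) = snd (X 0 \<omega>) + (LINT s:{0..t}|lborel. snd (b (X s \<omega>))) + J21 \<omega> + J22 \<omega>)"
    by (intro exI conjI)
qed

text \<open>The drift is written \<open>0 - 0 * y\<close> to agree literally with
  \<open>is_CIR\<close> at \<alpha> = \<beta> = 0.\<close>

lemma feller_diffusion_of_sde:
  fixes W :: "real \<Rightarrow> 'a \<Rightarrow> real"
  assumes sol: "sde_solution M F W {0..} (\<lambda>y. 0 - 0 * y) (\<lambda>y w. \<sigma> * sqrt y * w) h V" and h: "h > 0" and \<sigma>: "\<sigma> > 0"
  shows "feller_diffusion M F W \<sigma> h V"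
proof -
  have bm: "brownian_motion M F W"
    and meas: "\<And>t. t \<in> {0..h} \<Longrightarrow> V t \<in> borel_measurable (F t)"
    and path: "\<And>\<omega>. \<omega> \<in> space M \<Longrightarrow> continuous_on {0..h} (\<lambda>t. V t \<omega>) \<and> (\<forall>t\<in>{0..h}. V t \<omega> \<in> {0..})"
    and ev: "\<And>t. t \<in> {0..h} \<Longrightarrow> \<exists>J.
        (\<forall>i\<in>Basis. \<forall>j\<in>Basis.
           has_ito_integral M F (\<lambda>s \<omega>. W s \<omega> \<bullet> j) (\<lambda>s \<omega>. (\<sigma> * sqrt (V s \<omega>) * j) \<bullet> i) t (J i j)) \<and>
        (AE \<omega> in M. set_integrable lborel {0..t} (\<lambda>s. 0 - 0 * V s \<omega>) \<and>
           V t \<omega> = V 0 \<omega> + (LINT s:{0..t}|lborel. 0 - 0 * V s \<omega>)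
                     + (\<Sum>i\<in>Basis. \<Sum>j\<in>Basis. J i j \<omega> *\<^sub>R i))"
    using sol unfolding sde_solution_def by blast+
  interpret brownian M F W by (rule brownian.intro[OF bm])
  have Vn: "0 \<le> V t \<omega>" if "\<omega> \<in> space M" "t \<in> {0..h}" for \<omega> t
    using path[OF that(1)] that(2) by auto
  have J: "\<exists>J. has_ito_integral M F W (\<lambda>s \<omega>. \<sigma> * sqrt (V s \<omega>)) t J \<and> (AE \<omega> in M. V t \<omega> = V 0 \<omega> + J \<omega>)"
    if t: "t \<in> {0..h}" for t
  proof -
    from ev[OF t] obtain J where J: "\<forall>i\<in>Basis. \<forall>j\<in>Basis.
           has_ito_integral M F (\<lambda>s \<omega>. W s \<omega> \<bullet> j) (\<lambda>s \<omega>. (\<sigma> * sqrt (V s \<omega>) * j) \<bullet> i) t (J i j)"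
      and AJ: "AE \<omega> in M. set_integrable lborel {0..t} (\<lambda>s. 0 - 0 * V s \<omega>) \<and>
           V t \<omega> = V 0 \<omega> + (LINT s:{0..t}|lborel. 0 - 0 * V s \<omega>)
                     + (\<Sum>i\<in>Basis. \<Sum>j\<in>Basis. J i j \<omega> *\<^sub>R i)" by (elim exE conjE)
    have "AE \<omega> in M. V t \<omega> = V 0 \<omega> + J 1 1 \<omega>"
      using AJ by eventually_elim (simp add: set_lebesgue_integral_def)
    moreover have "has_ito_integral M F W (\<lambda>s \<omega>. \<sigma> * sqrt (V s \<omega>)) t (J 1 1)"
      using J by simp
    ultimately show ?thesis by blast
  qed
  show ?thesis
  proof
    show "h > 0" by (rule h)
    show "continuous_on {0..h} (\<lambda>s. V s \<omega>)" if "\<omega> \<in> space M" for \<omega> using path[OF that] by blast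
    show "0 \<le> V s \<omega>" if "\<omega> \<in> space M" "s \<in> {0..h}" for \<omega> s by (rule Vn[OF that])
    show "V s \<in> borel_measurable (F s)" if "s \<in> {0..h}" for s by (rule meas[OF that])
    show "ito_approx M F W (\<lambda>s \<omega>. \<sigma> * sqrt (V s \<omega>)) u (\<lambda>\<omega>. V u \<omega> - V 0 \<omega>)" if u: "u \<in> {0..h}" for u
    proof -
      from J[OF u] obtain J where J: "has_ito_integral M F W (\<lambda>s \<omega>. \<sigma> * sqrt (V s \<omega>)) u J" "AE \<omega> in M. V u \<omega> = V 0 \<omega> + J \<omega>"
        by (elim exE conjE)
      show ?thesis
      proof (rule ito_approx_cong_AE[OF has_ito_integral_imp_approx[OF J(1)]])
        show "0 \<le> u" using u by simp
        show "(\<lambda>\<omega>. V u \<omega> - V 0 \<omega>) \<in> borel_measurable M"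
          using F_imp_M[OF meas[OF u]] F_imp_M[OF meas[of 0]] h by auto
        show "AE \<omega> in M. J \<omega> = V u \<omega> - V 0 \<omega>" using J(2) by eventually_elim simp
      qed
    qed
    have hin: "h \<in> {0..h}" using h by simp
    from J[OF hin] obtain J where J: "has_ito_integral M F W (\<lambda>s \<omega>. \<sigma> * sqrt (V s \<omega>)) h J" by (elim exE conjE)
    then have "(\<lambda>(s, \<omega>). \<sigma> * sqrt (V s \<omega>)) \<in> borel_measurable (restrict_space borel {0..h} \<Otimes>\<^sub>M F h)"
      using hin unfolding has_ito_integral_def by blast
    moreover have "(\<lambda>p. p) \<in> measurable (restrict_space borel {0..h} \<Otimes>\<^sub>M M) (restrict_space borel {0..h} \<Otimes>\<^sub>M F h)"
    proof -
      have "(\<lambda>\<omega>. \<omega>) \<in> measurable M (F h)" by (rule F_imp_M[where t = h], rule measurable_ident_sets[OF refl])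
      then have "(\<lambda>p. (fst p, snd p)) \<in> measurable (restrict_space borel {0..h} \<Otimes>\<^sub>M M) (restrict_space borel {0..h} \<Otimes>\<^sub>M F h)"
        by (intro measurable_Pair measurable_fst measurable_compose[OF measurable_snd])
      then show ?thesis by simp
    qed
    ultimately have "(\<lambda>p. (case p of (s, \<omega>) \<Rightarrow> \<sigma> * sqrt (V s \<omega>))) \<in> borel_measurable (restrict_space borel {0..h} \<Otimes>\<^sub>M M)"
      by (rule measurable_compose[rotated])
    \<comment> \<open>Dividing by \<open>\<sigma>\<close> and squaring recovers the process from the
      progressively measurable integrand, because \<open>V\<close> is nonnegative.\<close>
    then have "(\<lambda>p. ((case p of (s, \<omega>) \<Rightarrow> \<sigma> * sqrt (V s \<omega>)) / \<sigma>)\<^sup>2) \<in> borel_measurable (restrict_space borel {0..h} \<Otimes>\<^sub>M M)"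
      by (intro borel_measurable_power borel_measurable_divide borel_measurable_const)
    then show "(\<lambda>(s, \<omega>). V s \<omega>) \<in> borel_measurable (restrict_space borel {0..h} \<Otimes>\<^sub>M M)"
    proof (rule measurable_cong[THEN iffD1, rotated])
      fix p assume "p \<in> space (restrict_space borel {0..h} \<Otimes>\<^sub>M M)"
      then have "fst p \<in> {0..h}" "snd p \<in> space M" by (auto simp: space_pair_measure space_restrict_space)
      from Vn[OF this(2,1)] show "((case p of (s, \<omega>) \<Rightarrow> \<sigma> * sqrt (V s \<omega>)) / \<sigma>)\<^sup>2 = (case p of (s, \<omega>) \<Rightarrow> V s \<omega>)"
        using \<sigma> by (simp add: split_beta)
    qed
  qed
qed

lemma system2_solution:
  fixes S :: "real \<Rightarrow> 'a \<Rightarrow> real \<times> real"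
  assumes sol: "sde_solution M F B heston_domain system2_drift (system2_diffusion \<rho> \<sigma>) h S" and h: "h > 0" and \<sigma>: "\<sigma> > 0"
  shows "sde_solution M F (\<lambda>t \<omega>. fst (B t \<omega>)) {0..} (\<lambda>y. 0 - 0 * y) (\<lambda>y w. \<sigma> * sqrt y * w) h (\<lambda>t \<omega>. snd (S t \<omega>))"
    and "AE \<omega> in M. fst (S h \<omega>) = fst (S 0 \<omega>) + \<rho> / \<sigma> * (snd (S h \<omega>) - snd (S 0 \<omega>))"
proof -
  note D = sde_solution_pairD[OF sol]
  interpret B1: brownian M F "\<lambda>t \<omega>. fst (B t \<omega>)" by (rule D(1))
  interpret B2: brownian M F "\<lambda>t \<omega>. snd (B t \<omega>)" by (rule D(2))
  have J: "\<exists>J J'. has_ito_integral M F (\<lambda>s \<omega>. fst (B s \<omega>)) (\<lambda>s \<omega>. \<rho> * sqrt (snd (S s \<omega>))) t J \<and>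
      has_ito_integral M F (\<lambda>s \<omega>. fst (B s \<omega>)) (\<lambda>s \<omega>. \<sigma> * sqrt (snd (S s \<omega>))) t J' \<and>
      (AE \<omega> in M. fst (S t \<omega>) = fst (S 0 \<omega>) + J \<omega> \<and> snd (S t \<omega>) = snd (S 0 \<omega>) + J' \<omega>)" if t: "t \<in> {0..h}" for t
  proof -
    obtain J11 J12 J21 J22 where
      1: "has_ito_integral M F (\<lambda>s \<omega>. fst (B s \<omega>)) (\<lambda>s \<omega>. fst (system2_diffusion \<rho> \<sigma> (S s \<omega>) (1, 0))) t J11"
      and 2: "has_ito_integral M F (\<lambda>s \<omega>. snd (B s \<omega>)) (\<lambda>s \<omega>. fst (system2_diffusion \<rho> \<sigma> (S s \<omega>) (0, 1))) t J12"
      and 3: "has_ito_integral M F (\<lambda>s \<omega>. fst (B s \<omega>)) (\<lambda>s \<omega>. snd (system2_diffusion \<rho> \<sigma> (S s \<omega>) (1, 0))) t J21"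
      and 4: "has_ito_integral M F (\<lambda>s \<omega>. snd (B s \<omega>)) (\<lambda>s \<omega>. snd (system2_diffusion \<rho> \<sigma> (S s \<omega>) (0, 1))) t J22"
      and ae: "AE \<omega> in M. fst (S t \<omega>) = fst (S 0 \<omega>) + (LINT s:{0..t}|lborel. fst (system2_drift (S s \<omega>))) + J11 \<omega> + J12 \<omega> \<and>
        snd (S t \<omega>) = snd (S 0 \<omega>) + (LINT s:{0..t}|lborel. snd (system2_drift (S s \<omega>))) + J21 \<omega> + J22 \<omega>"
      using D(8)[OF t] by (elim exE conjE)
    have coef: "fst (system2_diffusion \<rho> \<sigma> z (1, 0)) = \<rho> * sqrt (snd z)" "snd (system2_diffusion \<rho> \<sigma> z (1, 0)) = \<sigma> * sqrt (snd z)"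
      "fst (system2_diffusion \<rho> \<sigma> z (0, 1)) = 0" "snd (system2_diffusion \<rho> \<sigma> z (0, 1)) = 0" "system2_drift z = (0, 0)" for z
      by (simp_all add: system2_diffusion_def system2_drift_def split_beta)
    have t0: "0 \<le> t" using t by simp
    \<comment> \<open>The second driving motion enters with coefficient 0, but its integrals are
      arbitrary versions; they vanish only almost everywhere and by uniqueness.\<close>
    have "AE \<omega> in M. J12 \<omega> = 0"
      by (rule B2.ito_approx_zero[OF t0 B2.has_ito_integral_imp_approx[OF 2[unfolded coef] t0]])
    moreover have "AE \<omega> in M. J22 \<omega> = 0"
      by (rule B2.ito_approx_zero[OF t0 B2.has_ito_integral_imp_approx[OF 4[unfolded coef] t0]])
    ultimately have "AE \<omega> in M. fst (S t \<omega>) = fst (S 0 \<omega>) + J11 \<omega> \<and> snd (S t \<omega>) = snd (S 0 \<omega>) + J21 \<omega>"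
      using ae by eventually_elim (simp add: coef set_lebesgue_integral_def)
    with 1 3 show ?thesis unfolding coef by blast
  qed
  have S2: "0 \<le> snd (S t \<omega>)" if "\<omega> \<in> space M" "t \<in> {0..h}" for \<omega> t
    using D(7)[OF that] by (auto simp: heston_domain_def)
  show "sde_solution M F (\<lambda>t \<omega>. fst (B t \<omega>)) {0..} (\<lambda>y. 0 - 0 * y) (\<lambda>y w. \<sigma> * sqrt y * w) h (\<lambda>t \<omega>. snd (S t \<omega>))"
    unfolding sde_solution_def
  proof (intro conjI ballI)
    show "brownian_motion M F (\<lambda>t \<omega>. fst (B t \<omega>))" by (rule B1.bm)
    show "(\<lambda>\<omega>. snd (S t \<omega>)) \<in> borel_measurable (F t)" if "t \<in> {0..h}" for t by (rule D(4)[OF that])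
    show "continuous_on {0..h} (\<lambda>t. snd (S t \<omega>))" if "\<omega> \<in> space M" for \<omega> by (rule D(6)[OF that])
    show "snd (S t \<omega>) \<in> {0..}" if "\<omega> \<in> space M" "t \<in> {0..h}" for \<omega> t using S2[OF that] by simp
    fix t assume t: "t \<in> {0..h}"
    from J[OF t] obtain J J' where J': "has_ito_integral M F (\<lambda>s \<omega>. fst (B s \<omega>)) (\<lambda>s \<omega>. \<sigma> * sqrt (snd (S s \<omega>))) t J'"
      and ae: "AE \<omega> in M. fst (S t \<omega>) = fst (S 0 \<omega>) + J \<omega> \<and> snd (S t \<omega>) = snd (S 0 \<omega>) + J' \<omega>" by (elim exE conjE)
    show "\<exists>J. (\<forall>i\<in>Basis. \<forall>j\<in>Basis.
           has_ito_integral M F (\<lambda>s \<omega>. fst (B s \<omega>) \<bullet> j) (\<lambda>s \<omega>. (\<sigma> * sqrt (snd (S s \<omega>)) * j) \<bullet> i) t (J i j)) \<and>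
        (AE \<omega> in M. set_integrable lborel {0..t} (\<lambda>s. 0 - 0 * snd (S s \<omega>)) \<and>
           snd (S t \<omega>) = snd (S 0 \<omega>) + (LINT s:{0..t}|lborel. 0 - 0 * snd (S s \<omega>))
                     + (\<Sum>i\<in>Basis. \<Sum>j\<in>Basis. J i j \<omega> *\<^sub>R i))"
    proof (intro exI[of _ "\<lambda>i j. J'"] conjI)
      show "\<forall>i\<in>Basis. \<forall>j\<in>Basis.
           has_ito_integral M F (\<lambda>s \<omega>. fst (B s \<omega>) \<bullet> j) (\<lambda>s \<omega>. (\<sigma> * sqrt (snd (S s \<omega>)) * j) \<bullet> i) t J'"
        using J' by simp
      show "AE \<omega> in M. set_integrable lborel {0..t} (\<lambda>s. 0 - 0 * snd (S s \<omega>)) \<and>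
           snd (S t \<omega>) = snd (S 0 \<omega>) + (LINT s:{0..t}|lborel. 0 - 0 * snd (S s \<omega>))
                     + (\<Sum>(i::real)\<in>Basis. \<Sum>(j::real)\<in>Basis. J' \<omega> *\<^sub>R i)"
        using ae by eventually_elim (simp add: set_lebesgue_integral_def set_integrable_def)
    qed
  qed
  have hin: "h \<in> {0..h}" and h0: "0 \<le> h" using h by simp_all
  from J[OF hin] obtain J J' where J1: "has_ito_integral M F (\<lambda>s \<omega>. fst (B s \<omega>)) (\<lambda>s \<omega>. \<rho> * sqrt (snd (S s \<omega>))) h J"
    and J2: "has_ito_integral M F (\<lambda>s \<omega>. fst (B s \<omega>)) (\<lambda>s \<omega>. \<sigma> * sqrt (snd (S s \<omega>))) h J'"
    and ae: "AE \<omega> in M. fst (S h \<omega>) = fst (S 0 \<omega>) + J \<omega> \<and> snd (S h \<omega>) = snd (S 0 \<omega>) + J' \<omega>" by (elim exE conjE)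
  have "(\<lambda>s \<omega>. \<rho> * sqrt (snd (S s \<omega>))) = (\<lambda>s \<omega>. \<rho> / \<sigma> * (\<sigma> * sqrt (snd (S s \<omega>))))" using \<sigma> by simp
  with J1 have J1': "has_ito_integral M F (\<lambda>s \<omega>. fst (B s \<omega>)) (\<lambda>s \<omega>. \<rho> / \<sigma> * (\<sigma> * sqrt (snd (S s \<omega>)))) h J" by simp
  have "AE \<omega> in M. J \<omega> = \<rho> / \<sigma> * J' \<omega>"
  proof (rule B1.ito_approx_cmult_unique[OF h0 _ B1.has_ito_integral_imp_approx[OF J2 h0] B1.has_ito_integral_imp_approx[OF J1' h0]])
    show "continuous_on {0..h} (\<lambda>s. \<sigma> * sqrt (snd (S s \<omega>)))" if "\<omega> \<in> space M" for \<omega>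
      by (intro continuous_intros D(6)[OF that])
  qed
  with ae show "AE \<omega> in M. fst (S h \<omega>) = fst (S 0 \<omega>) + \<rho> / \<sigma> * (snd (S h \<omega>) - snd (S 0 \<omega>))"
    by eventually_elim simp
qed

text \<open>Here \<open>I\<close> is the variance integrated over the stage, a function of the
  starting value alone; this puts the conditional variance at time 0, as
  \<open>expectation_iexp_ito\<close> demands. Quantifying over all bounded test variables
  \<open>G\<close> describes the law of the log-price conditionally on \<open>F 0\<close>.\<close>

lemma system1_solution:
  fixes S :: "real \<Rightarrow> 'a \<Rightarrow> real \<times> real" and G :: "'a \<Rightarrow> complex"
  assumes sol: "sde_solution M F B heston_domain (system1_drift r k \<theta>) (system1_diffusion \<rho>) T S"
    and T: "T > 0" and k: "k > 0" and \<rho>: "\<rho> \<in> {-1..1}"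
  defines "I \<equiv> \<lambda>y. \<theta> * T + (y - \<theta>) * (1 - exp (- k * T)) / k"
  shows "AE \<omega> in M. snd (S T \<omega>) = exp (- k * T) * (snd (S 0 \<omega>) - \<theta>) + \<theta>"
    and "G \<in> borel_measurable (F 0) \<Longrightarrow> (\<And>\<omega>. \<omega> \<in> space M \<Longrightarrow> norm (G \<omega>) \<le> 1) \<Longrightarrow>
      (LINT \<omega>|M. G \<omega> * exp (\<i> * of_real (u * fst (S T \<omega>)))) =
      (LINT \<omega>|M. G \<omega> * exp (\<i> * of_real (u * (fst (S 0 \<omega>) + r * T - I (snd (S 0 \<omega>)) / 2)))
         * of_real (exp (- (u\<^sup>2 * ((1 - \<rho>\<^sup>2) * I (snd (S 0 \<omega>))) / 2))))"
proof -
  note D = sde_solution_pairD[OF sol]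
  interpret B1: brownian M F "\<lambda>t \<omega>. fst (B t \<omega>)" by (rule D(1))
  interpret B2: brownian M F "\<lambda>t \<omega>. snd (B t \<omega>)" by (rule D(2))
  have \<rho>2: "0 \<le> 1 - \<rho>\<^sup>2" using \<rho> by (simp add: abs_square_le_1 abs_le_iff)
  define H where "H = (\<lambda>s \<omega>. sqrt (1 - \<rho>\<^sup>2) * sqrt (snd (S s \<omega>)))"
  have J: "\<exists>J. has_ito_integral M F (\<lambda>s \<omega>. snd (B s \<omega>)) H t J \<and>
      (AE \<omega> in M. fst (S t \<omega>) = fst (S 0 \<omega>) + (LINT s:{0..t}|lborel. r - snd (S s \<omega>) / 2) + J \<omega> \<and>
        snd (S t \<omega>) = snd (S 0 \<omega>) + (LINT s:{0..t}|lborel. k * (\<theta> - snd (S s \<omega>))))" if t: "t \<in> {0..T}" for t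
  proof -
    obtain J11 J12 J21 J22 where
      1: "has_ito_integral M F (\<lambda>s \<omega>. fst (B s \<omega>)) (\<lambda>s \<omega>. fst (system1_diffusion \<rho> (S s \<omega>) (1, 0))) t J11"
      and 2: "has_ito_integral M F (\<lambda>s \<omega>. snd (B s \<omega>)) (\<lambda>s \<omega>. fst (system1_diffusion \<rho> (S s \<omega>) (0, 1))) t J12"
      and 3: "has_ito_integral M F (\<lambda>s \<omega>. fst (B s \<omega>)) (\<lambda>s \<omega>. snd (system1_diffusion \<rho> (S s \<omega>) (1, 0))) t J21"
      and 4: "has_ito_integral M F (\<lambda>s \<omega>. snd (B s \<omega>)) (\<lambda>s \<omega>. snd (system1_diffusion \<rho> (S s \<omega>) (0, 1))) t J22"
      and ae: "AE \<omega> in M. fst (S t \<omega>) = fst (S 0 \<omega>) + (LINT s:{0..t}|lborel. fst (system1_drift r k \<theta> (S s \<omega>))) + J11 \<omega> + J12 \<omega> \<and>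
        snd (S t \<omega>) = snd (S 0 \<omega>) + (LINT s:{0..t}|lborel. snd (system1_drift r k \<theta> (S s \<omega>))) + J21 \<omega> + J22 \<omega>"
      using D(8)[OF t] by (elim exE conjE)
    have coef: "fst (system1_diffusion \<rho> z (1, 0)) = 0" "snd (system1_diffusion \<rho> z (1, 0)) = 0"
      "fst (system1_diffusion \<rho> z (0, 1)) = sqrt (1 - \<rho>\<^sup>2) * sqrt (snd z)" "snd (system1_diffusion \<rho> z (0, 1)) = 0"
      "system1_drift r k \<theta> z = (r - snd z / 2, k * (\<theta> - snd z))" for z
      by (simp_all add: system1_diffusion_def system1_drift_def split_beta)
    have t0: "0 \<le> t" using t by simp
    have "AE \<omega> in M. J11 \<omega> = 0"
      by (rule B1.ito_approx_zero[OF t0 B1.has_ito_integral_imp_approx[OF 1[unfolded coef] t0]])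
    moreover have "AE \<omega> in M. J21 \<omega> = 0"
      by (rule B1.ito_approx_zero[OF t0 B1.has_ito_integral_imp_approx[OF 3[unfolded coef] t0]])
    moreover have "AE \<omega> in M. J22 \<omega> = 0"
      by (rule B2.ito_approx_zero[OF t0 B2.has_ito_integral_imp_approx[OF 4[unfolded coef] t0]])
    ultimately have "AE \<omega> in M. fst (S t \<omega>) = fst (S 0 \<omega>) + (LINT s:{0..t}|lborel. r - snd (S s \<omega>) / 2) + J12 \<omega> \<and>
        snd (S t \<omega>) = snd (S 0 \<omega>) + (LINT s:{0..t}|lborel. k * (\<theta> - snd (S s \<omega>)))"
      using ae by eventually_elim (simp add: coef)
    with 2 show ?thesis unfolding coef H_def by blast
  qed
  have S2: "0 \<le> snd (S t \<omega>)" if "\<omega> \<in> space M" "t \<in> {0..T}" for \<omega> t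
    using D(7)[OF that] by (auto simp: heston_domain_def)
  have "AE \<omega> in M. \<forall>t\<in>{0<..<T} \<inter> \<rat>. snd (S t \<omega>) = snd (S 0 \<omega>) + (LINT s:{0..t}|lborel. k * (\<theta> - snd (S s \<omega>)))"
  proof (rule AE_ball_countable')
    show "countable ({0<..<T} \<inter> \<rat>)" using countable_rat by (rule countable_Int2)
    fix t assume "t \<in> {0<..<T} \<inter> \<rat>"
    then have "t \<in> {0..T}" by auto
    from J[OF this] show "AE \<omega> in M. snd (S t \<omega>) = snd (S 0 \<omega>) + (LINT s:{0..t}|lborel. k * (\<theta> - snd (S s \<omega>)))"
      by (elim exE conjE) (auto elim: eventually_mono)
  qed
  then have path: "AE \<omega> in M. \<omega> \<in> space M \<and> (\<forall>t\<in>{0..T}. snd (S t \<omega>) = exp (- k * t) * (snd (S 0 \<omega>) - \<theta>) + \<theta>) \<and>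
     (LINT s:{0..T}|lborel. snd (S s \<omega>)) = I (snd (S 0 \<omega>))"
    using AE_space
  proof eventually_elim
    case (elim \<omega>)
    have k0: "k \<noteq> 0" using k by simp
    have e: "snd (S t \<omega>) = snd (S 0 \<omega>) + (LINT s:{0..t}|lborel. k * (\<theta> - snd (S s \<omega>)))"
      if "t \<in> {0<..<T} \<inter> \<rat>" for t using elim(1) that by blast
    have "\<forall>t\<in>{0..T}. snd (S t \<omega>) = exp (- k * t) * (snd (S 0 \<omega>) - \<theta>) + \<theta>"
    proof
      fix t assume t: "t \<in> {0..T}"
      show "snd (S t \<omega>) = exp (- k * t) * (snd (S 0 \<omega>) - \<theta>) + \<theta>"
        by (rule linear_ode_path(1)[OF T k0 D(6)[OF elim(2)] e t])
    qed
    moreover have "(LINT s:{0..T}|lborel. snd (S s \<omega>)) = I (snd (S 0 \<omega>))"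
      unfolding I_def by (rule linear_ode_path(2)[OF T k0 D(6)[OF elim(2)] e])
    ultimately show ?case using elim(2) by blast
  qed
  have Tin: "T \<in> {0..T}" using T by simp
  show "AE \<omega> in M. snd (S T \<omega>) = exp (- k * T) * (snd (S 0 \<omega>) - \<theta>) + \<theta>"
    using path by eventually_elim (use Tin in blast)
  assume G: "G \<in> borel_measurable (F 0)" "\<And>\<omega>. \<omega> \<in> space M \<Longrightarrow> norm (G \<omega>) \<le> 1"
  from J[OF Tin] obtain J where J1: "has_ito_integral M F (\<lambda>s \<omega>. snd (B s \<omega>)) H T J"
    and J2: "AE \<omega> in M. fst (S T \<omega>) = fst (S 0 \<omega>) + (LINT s:{0..T}|lborel. r - snd (S s \<omega>) / 2) + J \<omega> \<and>
        snd (S T \<omega>) = snd (S 0 \<omega>) + (LINT s:{0..T}|lborel. k * (\<theta> - snd (S s \<omega>)))" by (elim exE conjE)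
  have ia: "ito_approx M F (\<lambda>s \<omega>. snd (B s \<omega>)) H T J"
    by (rule B2.has_ito_integral_imp_approx[OF J1 less_imp_le[OF T]])
  define q where "q \<omega> = (1 - \<rho>\<^sup>2) * I (snd (S 0 \<omega>))" for \<omega>
  have zin: "0 \<in> {0..T}" using T by simp
  have I_meas: "(\<lambda>\<omega>. I (snd (S 0 \<omega>))) \<in> borel_measurable (F 0)"
    unfolding I_def using D(4)[OF zin] by simp
  have qm: "q \<in> borel_measurable (F 0)" unfolding q_def[abs_def] using I_meas by simp
  have Hm: "set_borel_measurable borel {0..T} (\<lambda>s. H s \<omega>)" if "\<omega> \<in> space M" for \<omega>
    unfolding H_def by (rule set_borel_measurable_continuous_on) (auto intro!: continuous_intros D(6)[OF that])
  have qe: "AE \<omega> in M. 0 \<le> q \<omega> \<and> (\<integral>\<^sup>+ s\<in>{0..T}. ennreal ((H s \<omega>)\<^sup>2) \<partial>lborel) = ennreal (q \<omega>)"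
    using path
  proof eventually_elim
    case (elim \<omega>)
    note \<omega> = elim[THEN conjunct1] and Ieq = elim[THEN conjunct2, THEN conjunct2]
    have si: "set_integrable lborel {0..T} (\<lambda>s. snd (S s \<omega>))" by (rule borel_integrable_atLeastAtMost'[OF D(6)[OF \<omega>]])
    define f where "f s = (1 - \<rho>\<^sup>2) * (indicator {0..T} s *\<^sub>R snd (S s \<omega>))" for s
    have fi: "integrable lborel f" unfolding f_def[abs_def] using si by (simp add: set_integrable_def)
    have f0: "0 \<le> f s" for s unfolding f_def using \<rho>2 S2[OF \<omega>, of s] by (auto simp: indicator_def)
    have "integral\<^sup>L lborel f = (1 - \<rho>\<^sup>2) * (LINT s|lborel. indicator {0..T} s *\<^sub>R snd (S s \<omega>))"
      unfolding f_def[abs_def] by (rule integral_mult_right_zero)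
    then have fq: "integral\<^sup>L lborel f = q \<omega>" using Ieq by (simp add: q_def set_lebesgue_integral_def)
    have "(\<integral>\<^sup>+ s\<in>{0..T}. ennreal ((H s \<omega>)\<^sup>2) \<partial>lborel) = (\<integral>\<^sup>+ s. ennreal (f s) \<partial>lborel)"
    proof (rule nn_integral_cong)
      fix s
      show "ennreal ((H s \<omega>)\<^sup>2) * indicator {0..T} s = ennreal (f s)"
        using \<rho>2 S2[OF \<omega>, of s] by (cases "s \<in> {0..T}") (auto simp: H_def f_def power_mult_distrib)
    qed
    also have "\<dots> = ennreal (integral\<^sup>L lborel f)" by (rule nn_integral_eq_integral[OF fi]) (use f0 in simp)
    finally show ?case unfolding fq using f0 fq Bochner_Integration.integral_nonneg[of lborel f] by simp
  qed
  \<comment> \<open>All of the final log-price except the stochastic integral is determined at time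
    0 and joins the test variable.\<close>
  define G' where "G' \<omega> = G \<omega> * exp (\<i> * of_real (u * (fst (S 0 \<omega>) + r * T - I (snd (S 0 \<omega>)) / 2)))" for \<omega>
  have G'm: "G' \<in> borel_measurable (F 0)"
  proof -
    have e: "(\<lambda>x::real. exp (\<i> * complex_of_real x)) \<in> borel_measurable borel"
      by (intro borel_measurable_continuous_onI continuous_intros)
    have "(\<lambda>\<omega>. u * (fst (S 0 \<omega>) + r * T - I (snd (S 0 \<omega>)) / 2)) \<in> borel_measurable (F 0)"
      using D(3)[OF zin] I_meas by simp
    from borel_measurable_times[OF G(1) measurable_compose[OF this e]] show ?thesis by (simp add: G'_def[abs_def])
  qed
  have G'1: "norm (G' \<omega>) \<le> 1" if "\<omega> \<in> space M" for \<omega>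
    using G(2)[OF that] by (simp add: G'_def norm_mult)
  have main: "integral\<^sup>L M (\<lambda>\<omega>. G' \<omega> * exp (\<i> * of_real (u * J \<omega>))) = integral\<^sup>L M (\<lambda>\<omega>. G' \<omega> * of_real (exp (- (u\<^sup>2 * q \<omega> / 2))))"
    by (rule B2.expectation_iexp_ito[OF ia Hm qe qm G'm G'1])
  have "AE \<omega> in M. G \<omega> * exp (\<i> * of_real (u * fst (S T \<omega>))) = G' \<omega> * exp (\<i> * of_real (u * J \<omega>))"
    using path J2
  proof eventually_elim
    case (elim \<omega>)
    note \<omega> = elim(1)[THEN conjunct1] and Ieq = elim(1)[THEN conjunct2, THEN conjunct2]
      and X = elim(2)[THEN conjunct1]
    have si: "set_integrable lborel {0..T} (\<lambda>s. snd (S s \<omega>))" by (rule borel_integrable_atLeastAtMost'[OF D(6)[OF \<omega>]])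
    have ci: "set_integrable lborel {0..T} (\<lambda>_. r)" by (rule borel_integrable_atLeastAtMost') simp
    have "(LINT s:{0..T}|lborel. r - snd (S s \<omega>) / 2) = (LINT s:{0..T}|lborel. r) - (LINT s:{0..T}|lborel. snd (S s \<omega>) / 2)"
      using si by (intro set_integral_diff(2)[OF ci]) simp
    also have "(LINT s:{0..T}|lborel. r) = r * T" using T by (simp add: set_lebesgue_integral_def)
    also have "(LINT s:{0..T}|lborel. snd (S s \<omega>) / 2) = I (snd (S 0 \<omega>)) / 2" using Ieq by simp
    finally have "fst (S T \<omega>) = (fst (S 0 \<omega>) + r * T - I (snd (S 0 \<omega>)) / 2) + J \<omega>" using X by simp
    then have "\<i> * of_real (u * fst (S T \<omega>)) = \<i> * of_real (u * (fst (S 0 \<omega>) + r * T - I (snd (S 0 \<omega>)) / 2)) + \<i> * of_real (u * J \<omega>)"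
      by (simp only: of_real_add of_real_mult distrib_left)
    then show ?case unfolding G'_def by (simp only: exp_add mult.assoc)
  qed
  then have "integral\<^sup>L M (\<lambda>\<omega>. G \<omega> * exp (\<i> * of_real (u * fst (S T \<omega>)))) = integral\<^sup>L M (\<lambda>\<omega>. G' \<omega> * exp (\<i> * of_real (u * J \<omega>)))"
  proof (rule integral_cong_AE[rotated 2])
    have e: "(\<lambda>x::real. exp (\<i> * complex_of_real x)) \<in> borel_measurable borel"
      by (intro borel_measurable_continuous_onI continuous_intros)
    have XM: "(\<lambda>\<omega>. u * fst (S T \<omega>)) \<in> borel_measurable M" using B2.F_imp_M[OF D(3)[OF Tin]] by simp
    show "(\<lambda>\<omega>. G \<omega> * exp (\<i> * of_real (u * fst (S T \<omega>)))) \<in> borel_measurable M"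
      by (intro borel_measurable_times B2.F_imp_M[OF G(1)] measurable_compose[OF XM e])
    have JM: "(\<lambda>\<omega>. u * J \<omega>) \<in> borel_measurable M"
      by (rule borel_measurable_times[OF borel_measurable_const ia[unfolded ito_approx_def, THEN conjunct1]])
    show "(\<lambda>\<omega>. G' \<omega> * exp (\<i> * of_real (u * J \<omega>))) \<in> borel_measurable M"
      by (intro borel_measurable_times B2.F_imp_M[OF G'm] measurable_compose[OF JM e])
  qed
  then show "(LINT \<omega>|M. G \<omega> * exp (\<i> * of_real (u * fst (S T \<omega>)))) =
      (LINT \<omega>|M. G \<omega> * exp (\<i> * of_real (u * (fst (S 0 \<omega>) + r * T - I (snd (S 0 \<omega>)) / 2)))
         * of_real (exp (- (u\<^sup>2 * ((1 - \<rho>\<^sup>2) * I (snd (S 0 \<omega>))) / 2))))"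
    using main by (simp only: G'_def q_def)
qed

section \<open>Conditioning on events and equality of joint laws\<close>

context prob_space
begin

text \<open>Conditioning on an event of positive probability, realised as a measure on the same
  space, so that uniqueness theorems for laws on the line apply to conditional laws.\<close>

definition conditioned :: "'a set \<Rightarrow> 'a measure" where
  "conditioned S = density M (\<lambda>\<omega>. ennreal (indicator S \<omega> / prob S))"

lemma conditioned_simps [simp]: "space (conditioned S) = space M" "sets (conditioned S) = sets M"
  "measurable (conditioned S) N = measurable M N"
  unfolding conditioned_def by (simp_all add: measurable_density_eq1 cong: measurable_cong_sets)

lemma integral_indicator_complex:
  assumes [measurable]: "Y \<in> measurable M N" "A \<in> sets N"
  shows "(LINT \<omega>|M. indicator A (Y \<omega>) *\<^sub>R (1::complex)) = of_real (prob (Y -` A \<inter> space M))"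
proof -
  have "(LINT \<omega>|M. indicator A (Y \<omega>) *\<^sub>R (1::complex)) = (LINT \<omega>|M. of_real (indicator (Y -` A \<inter> space M) \<omega>))"
    by (intro Bochner_Integration.integral_cong) (auto simp: indicator_def)
  also have "\<dots> = of_real (LINT \<omega>|M. indicator (Y -` A \<inter> space M) \<omega>)" by (rule integral_complex_of_real)
  also have "(LINT \<omega>|M. indicator (Y -` A \<inter> space M) \<omega>) = prob (Y -` A \<inter> space M)"
    by (simp add: Int_absorb2)
  finally show ?thesis .
qed

lemma integral_conditioned:
  fixes g :: "'a \<Rightarrow> 'b::{banach, second_countable_topology}"
  assumes [measurable]: "S \<in> events" "g \<in> borel_measurable M"
  shows "(LINT \<omega>|conditioned S. g \<omega>) = (1 / prob S) *\<^sub>R (LINT \<omega>|M. indicator S \<omega> *\<^sub>R g \<omega>)"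
proof -
  have "(LINT \<omega>|conditioned S. g \<omega>) = (LINT \<omega>|M. (indicator S \<omega> / prob S) *\<^sub>R g \<omega>)"
    unfolding conditioned_def by (rule integral_density) (auto simp: indicator_def)
  also have "\<dots> = (LINT \<omega>|M. (1 / prob S) *\<^sub>R (indicator S \<omega> *\<^sub>R g \<omega>))" by simp
  also have "\<dots> = (1 / prob S) *\<^sub>R (LINT \<omega>|M. indicator S \<omega> *\<^sub>R g \<omega>)"
    by (rule integral_scaleR_right)
  finally show ?thesis .
qed

lemma prob_space_conditioned:
  assumes [measurable]: "S \<in> events" and S: "prob S > 0"
  shows "prob_space (conditioned S)"
proof
  have "emeasure (conditioned S) (space (conditioned S)) = (\<integral>\<^sup>+\<omega>. ennreal (indicator S \<omega> / prob S) \<partial>M)"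
    unfolding conditioned_def by (subst emeasure_density) (auto intro!: nn_integral_cong)
  also have "\<dots> = (\<integral>\<^sup>+\<omega>. ennreal (1 / prob S) * indicator S \<omega> \<partial>M)"
    by (intro nn_integral_cong) (auto simp: indicator_def)
  also have "\<dots> = ennreal (1 / prob S) * ennreal (prob S)"
    by (simp add: nn_integral_cmult_indicator emeasure_eq_measure)
  also have "\<dots> = 1" using S by (simp add: ennreal_mult[symmetric])
  finally show "emeasure (conditioned S) (space (conditioned S)) = 1" .
qed

lemma measure_distr_conditioned:
  fixes X :: "'a \<Rightarrow> real"
  assumes [measurable]: "S \<in> events" "X \<in> borel_measurable M" "B \<in> sets borel" and S: "prob S > 0"
  shows "measure (distr (conditioned S) borel X) B = prob (S \<inter> (X -` B \<inter> space M)) / prob S"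
proof -
  interpret C: prob_space "conditioned S" by (rule prob_space_conditioned[OF assms(1) S])
  have XB: "X -` B \<inter> space M \<in> events" by measurable
  have "measure (distr (conditioned S) borel X) B = measure (conditioned S) (X -` B \<inter> space M)"
    by (subst measure_distr) auto
  also have "\<dots> = (LINT \<omega>|conditioned S. indicator (X -` B \<inter> space M) \<omega>)"
    by (simp add: Int_absorb2)
  also have "\<dots> = (1 / prob S) *\<^sub>R (LINT \<omega>|M. indicator S \<omega> *\<^sub>R (indicator (X -` B \<inter> space M) \<omega> :: real))"
    by (rule integral_conditioned) (use XB in auto)
  also have "(LINT \<omega>|M. indicator S \<omega> *\<^sub>R (indicator (X -` B \<inter> space M) \<omega> :: real)) = (LINT \<omega>|M. indicator (S \<inter> (X -` B \<inter> space M)) \<omega>)"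
    by (intro Bochner_Integration.integral_cong) (auto simp: indicator_def)
  also have "\<dots> = prob (S \<inter> (X -` B \<inter> space M))"
    by (simp add: Int_absorb2 Int_assoc)
  finally show ?thesis by simp
qed

end

text \<open>Divided by its value at \<open>u = 0\<close>, the mixed transform is the characteristic
  function of the first variable conditioned on the second lying in \<open>A\<close>. Levy's theorem
  on the line then settles all rectangles, which generate the Borel sets of the plane.\<close>

lemma distr_pair_eqI:
  fixes X Y :: "'a \<Rightarrow> real" and X' Y' :: "'b \<Rightarrow> real"
  assumes M: "prob_space M" and N: "prob_space N"
    and m[measurable]: "X \<in> borel_measurable M" "Y \<in> borel_measurable M" "X' \<in> borel_measurable N" "Y' \<in> borel_measurable N"
    and eq: "\<And>A u. A \<in> sets borel \<Longrightarrow>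
      (LINT \<omega>|M. indicator A (Y \<omega>) *\<^sub>R exp (\<i> * of_real (u * X \<omega>))) =
      (LINT \<omega>|N. indicator A (Y' \<omega>) *\<^sub>R exp (\<i> * of_real (u * X' \<omega>)))"
  shows "distr M borel (\<lambda>\<omega>. (X \<omega>, Y \<omega>)) = distr N borel (\<lambda>\<omega>. (X' \<omega>, Y' \<omega>))"
proof -
  interpret M: prob_space M by (rule M)
  interpret N: prob_space N by (rule N)
  \<comment> \<open>At \<open>u = 0\<close> the exponential is 1, which gives the second marginal;
    it supplies the normalising constants of both conditional laws.\<close>
  have PY: "M.prob (Y -` A \<inter> space M) = N.prob (Y' -` A \<inter> space N)" if A: "A \<in> sets borel" for A
    using eq[OF A, of 0] M.integral_indicator_complex[OF m(2) A] N.integral_indicator_complex[OF m(4) A] by simp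
  have rect: "M.prob ((Y -` A \<inter> space M) \<inter> (X -` B \<inter> space M)) = N.prob ((Y' -` A \<inter> space N) \<inter> (X' -` B \<inter> space N))"
    if A[measurable]: "A \<in> sets borel" and B[measurable]: "B \<in> sets borel" for A B
  proof (cases "M.prob (Y -` A \<inter> space M) = 0")
    case True
    have "M.prob ((Y -` A \<inter> space M) \<inter> (X -` B \<inter> space M)) \<le> M.prob (Y -` A \<inter> space M)"
      by (rule M.finite_measure_mono) auto
    moreover have "N.prob ((Y' -` A \<inter> space N) \<inter> (X' -` B \<inter> space N)) \<le> N.prob (Y' -` A \<inter> space N)"
      by (rule N.finite_measure_mono) auto
    ultimately show ?thesis using True PY[OF A] by (simp add: measure_le_0_iff)
  next
    case False
    let ?S = "Y -` A \<inter> space M" and ?S' = "Y' -` A \<inter> space N"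
    have S: "?S \<in> M.events" and S': "?S' \<in> N.events" by measurable
    have pS: "M.prob ?S > 0" using False by (simp add: zero_less_measure_iff)
    then have pS': "N.prob ?S' > 0" using PY[OF A] by simp
    interpret C: prob_space "M.conditioned ?S" by (rule M.prob_space_conditioned[OF S pS])
    interpret C': prob_space "N.conditioned ?S'" by (rule N.prob_space_conditioned[OF S' pS'])
    have "char (distr (M.conditioned ?S) borel X) = char (distr (N.conditioned ?S') borel X')"
    proof
      fix u
      have e: "(\<lambda>x::real. exp (\<i> * complex_of_real (u * x))) \<in> borel_measurable borel"
        by (intro borel_measurable_continuous_onI continuous_intros)
      have "char (distr (M.conditioned ?S) borel X) u = (LINT \<omega>|M.conditioned ?S. exp (\<i> * of_real (u * X \<omega>)))"
        unfolding char_def by (subst integral_distr) (use m e in auto)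
      also have "\<dots> = (1 / M.prob ?S) *\<^sub>R (LINT \<omega>|M. indicator ?S \<omega> *\<^sub>R exp (\<i> * of_real (u * X \<omega>)))"
        by (rule M.integral_conditioned[OF S measurable_compose[OF m(1) e]])
      also have "(LINT \<omega>|M. indicator ?S \<omega> *\<^sub>R exp (\<i> * of_real (u * X \<omega>))) = (LINT \<omega>|M. indicator A (Y \<omega>) *\<^sub>R exp (\<i> * of_real (u * X \<omega>)))"
        by (intro Bochner_Integration.integral_cong) (auto simp: indicator_def)
      also have "\<dots> = (LINT \<omega>|N. indicator A (Y' \<omega>) *\<^sub>R exp (\<i> * of_real (u * X' \<omega>)))" by (rule eq[OF A])
      also have "\<dots> = (LINT \<omega>|N. indicator ?S' \<omega> *\<^sub>R exp (\<i> * of_real (u * X' \<omega>)))"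
        by (intro Bochner_Integration.integral_cong) (auto simp: indicator_def)
      also have "(1 / M.prob ?S) *\<^sub>R \<dots> = (LINT \<omega>|N.conditioned ?S'. exp (\<i> * of_real (u * X' \<omega>)))"
        unfolding PY[OF A] by (rule N.integral_conditioned[OF S' measurable_compose[OF m(3) e], symmetric])
      also have "\<dots> = char (distr (N.conditioned ?S') borel X') u"
        unfolding char_def by (subst integral_distr) (use m e in auto)
      finally show "char (distr (M.conditioned ?S) borel X) u = char (distr (N.conditioned ?S') borel X') u" .
    qed
    then have "distr (M.conditioned ?S) borel X = distr (N.conditioned ?S') borel X'"
      by (intro Levy_uniqueness C.real_distribution_distr C'.real_distribution_distr) (use m in auto)
    then have "M.prob (?S \<inter> (X -` B \<inter> space M)) / M.prob ?S = N.prob (?S' \<inter> (X' -` B \<inter> space N)) / N.prob ?S'"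
      unfolding M.measure_distr_conditioned[OF S m(1) B pS, symmetric] N.measure_distr_conditioned[OF S' m(3) B pS', symmetric] by simp
    then show ?thesis using PY[OF A] False by simp
  qed
  have sb: "sets (borel :: (real \<times> real) measure) = sets ((borel :: real measure) \<Otimes>\<^sub>M (borel :: real measure))"
    by (simp only: borel_prod)
  have XY: "(\<lambda>\<omega>. (X \<omega>, Y \<omega>)) \<in> borel_measurable M" "(\<lambda>\<omega>. (X' \<omega>, Y' \<omega>)) \<in> borel_measurable N" using m by auto
  let ?E = "{a \<times> b |a b. a \<in> sets (borel :: real measure) \<and> b \<in> sets (borel :: real measure)}"
  show ?thesis
  proof (rule measure_eqI_generator_eq[where E = ?E and \<Omega> = UNIV and A = "\<lambda>_. UNIV"])
    show "Int_stable ?E" by (rule Int_stable_pair_measure_generator)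
    show "?E \<subseteq> Pow UNIV" by simp
    show "sets (distr M borel (\<lambda>\<omega>. (X \<omega>, Y \<omega>))) = sigma_sets UNIV ?E"
      unfolding sets_distr sb sets_pair_measure by simp
    show "sets (distr N borel (\<lambda>\<omega>. (X' \<omega>, Y' \<omega>))) = sigma_sets UNIV ?E"
      unfolding sets_distr sb sets_pair_measure by simp
    show "range (\<lambda>_::nat. UNIV :: (real \<times> real) set) \<subseteq> ?E"
      by (auto intro!: exI[of _ UNIV])
    show "(\<Union>i::nat. UNIV :: (real \<times> real) set) = UNIV" by simp
    show "emeasure (distr M borel (\<lambda>\<omega>. (X \<omega>, Y \<omega>))) UNIV \<noteq> \<infinity>"
      using XY(1) by (subst emeasure_distr) (auto simp: M.emeasure_eq_measure)
    fix R assume "R \<in> ?E"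
    then obtain B A where R: "R = B \<times> A" and B: "B \<in> sets borel" and A: "A \<in> sets borel" by blast
    have Rb: "R \<in> sets borel" unfolding R sb using A B by simp
    have "(\<lambda>\<omega>. (X \<omega>, Y \<omega>)) -` R \<inter> space M = (Y -` A \<inter> space M) \<inter> (X -` B \<inter> space M)"
      "(\<lambda>\<omega>. (X' \<omega>, Y' \<omega>)) -` R \<inter> space N = (Y' -` A \<inter> space N) \<inter> (X' -` B \<inter> space N)" by (auto simp: R)
    then show "emeasure (distr M borel (\<lambda>\<omega>. (X \<omega>, Y \<omega>))) R = emeasure (distr N borel (\<lambda>\<omega>. (X' \<omega>, Y' \<omega>))) R"
      using rect[OF A B] by (simp add: emeasure_distr[OF XY(1) Rb] emeasure_distr[OF XY(2) Rb] M.emeasure_eq_measure N.emeasure_eq_measure)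
  qed
qed

section \<open>Normal mixtures with random variance\<close>

lemma centred_normal_eq_distr:
  "centred_normal c = distr std_normal_distribution borel (\<lambda>z. sqrt (max 0 c) * z)"
proof (cases "c > 0")
  case True
  then show ?thesis using density_normal_eq_distr[of "sqrt c"] by (simp add: centred_normal_def)
next
  case False
  interpret S: prob_space std_normal_distribution by (rule prob_space_normal_density) simp
  have "max 0 c = 0" using False by simp
  then show ?thesis using False by (simp add: centred_normal_def S.distr_const)
qed

text \<open>Both branches of \<open>centred_normal\<close> are images of one standard normal
  variable under scaling by \<open>sqrt (max 0 c)\<close>. The kernel then depends measurably on
  \<open>y\<close>, and the mixture becomes the law of a function on a product space, where Fubini's
  theorem computes transforms.\<close>

lemma bind_centred_normal:
  fixes m c \<phi> :: "real \<Rightarrow> real"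
  assumes P: "prob_space P" and sP: "sets P = sets borel"
    and [measurable]: "m \<in> borel_measurable borel" "c \<in> borel_measurable borel" "\<phi> \<in> borel_measurable borel"
  shows "P \<bind> (\<lambda>y. centred_normal (c y) \<bind> (\<lambda>z. return borel (m y + z, \<phi> y)))
    = distr (P \<Otimes>\<^sub>M std_normal_distribution) borel (\<lambda>(y, z). (m y + sqrt (max 0 (c y)) * z, \<phi> y))"
proof -
  interpret P: prob_space P by (rule P)
  interpret S: prob_space std_normal_distribution by (rule prob_space_normal_density) simp
  interpret PS: pair_prob_space P std_normal_distribution ..
  note [measurable_cong] = sP
  define \<Psi> where "\<Psi> y z = (m y + sqrt (max 0 (c y)) * z, \<phi> y)" for y z :: real
  have \<Psi>m: "case_prod \<Psi> \<in> borel_measurable (P \<Otimes>\<^sub>M borel)" unfolding \<Psi>_def split_beta by measurable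
  have \<Psi>m': "case_prod \<Psi> \<in> borel_measurable (P \<Otimes>\<^sub>M std_normal_distribution)"
    unfolding \<Psi>_def split_beta by measurable
  have \<Psi>y: "\<Psi> y \<in> borel_measurable borel" for y unfolding \<Psi>_def by measurable
  have inner: "centred_normal (c y) \<bind> (\<lambda>z. return borel (m y + z, \<phi> y)) = distr std_normal_distribution borel (\<Psi> y)" for y
  proof -
    have g: "(\<lambda>z. (m y + z, \<phi> y)) \<in> borel_measurable borel" by measurable
    have "centred_normal (c y) \<bind> (\<lambda>z. return borel (m y + z, \<phi> y)) = distr (centred_normal (c y)) borel (\<lambda>z. (m y + z, \<phi> y))"
      unfolding centred_normal_eq_distr by (rule bind_return_distr') (use g in auto)
    also have "\<dots> = distr std_normal_distribution borel (\<Psi> y)"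
      unfolding centred_normal_eq_distr by (subst distr_distr) (use g in \<open>auto simp: comp_def \<Psi>_def[abs_def]\<close>)
    finally show ?thesis .
  qed
  have K: "(\<lambda>y. distr std_normal_distribution borel (\<Psi> y)) \<in> measurable P (subprob_algebra borel)"
    by (rule measurable_distr2[OF \<Psi>m measurable_const])
       (simp add: space_subprob_algebra prob_space_imp_subprob_space[OF S.prob_space_axioms])
  have "P \<bind> (\<lambda>y. distr std_normal_distribution borel (\<Psi> y)) = distr (P \<Otimes>\<^sub>M std_normal_distribution) borel (case_prod \<Psi>)"
  proof (rule measure_eqI)
    show "sets (P \<bind> (\<lambda>y. distr std_normal_distribution borel (\<Psi> y))) = sets (distr (P \<Otimes>\<^sub>M std_normal_distribution) borel (case_prod \<Psi>))"
      by (simp add: sets_bind[OF sets_kernel[OF K] P.not_empty])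
    fix A assume "A \<in> sets (P \<bind> (\<lambda>y. distr std_normal_distribution borel (\<Psi> y)))"
    then have A: "A \<in> sets borel" by (simp add: sets_bind[OF sets_kernel[OF K] P.not_empty])
    have "emeasure (P \<bind> (\<lambda>y. distr std_normal_distribution borel (\<Psi> y))) A = (\<integral>\<^sup>+y. emeasure (distr std_normal_distribution borel (\<Psi> y)) A \<partial>P)"
      by (rule emeasure_bind[OF P.not_empty K A])
    also have "\<dots> = (\<integral>\<^sup>+y. emeasure std_normal_distribution (Pair y -` (case_prod \<Psi> -` A \<inter> space (P \<Otimes>\<^sub>M std_normal_distribution))) \<partial>P)"
    proof (rule nn_integral_cong)
      fix y assume y: "y \<in> space P"
      have "\<Psi> y -` A \<inter> space std_normal_distribution = Pair y -` (case_prod \<Psi> -` A \<inter> space (P \<Otimes>\<^sub>M std_normal_distribution))"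
        using y by (auto simp: space_pair_measure)
      moreover have "\<Psi> y \<in> borel_measurable std_normal_distribution" using \<Psi>y by simp
      ultimately show "emeasure (distr std_normal_distribution borel (\<Psi> y)) A = emeasure std_normal_distribution (Pair y -` (case_prod \<Psi> -` A \<inter> space (P \<Otimes>\<^sub>M std_normal_distribution)))"
        using A by (simp only: emeasure_distr)
    qed
    also have "\<dots> = emeasure (P \<Otimes>\<^sub>M std_normal_distribution) (case_prod \<Psi> -` A \<inter> space (P \<Otimes>\<^sub>M std_normal_distribution))"
      by (rule S.emeasure_pair_measure_alt[symmetric]) (rule measurable_sets[OF \<Psi>m' A])
    also have "\<dots> = emeasure (distr (P \<Otimes>\<^sub>M std_normal_distribution) borel (case_prod \<Psi>)) A"
      by (rule emeasure_distr[OF \<Psi>m' A, symmetric])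
    finally show "emeasure (P \<bind> (\<lambda>y. distr std_normal_distribution borel (\<Psi> y))) A = emeasure (distr (P \<Otimes>\<^sub>M std_normal_distribution) borel (case_prod \<Psi>)) A" .
  qed
  then show ?thesis unfolding inner by (simp add: \<Psi>_def[abs_def])
qed

text \<open>Integrating the normal coordinate first produces its characteristic function at the
  random scale; boundedness of \<open>g\<close> justifies Fubini's theorem.\<close>

lemma char_mixture_normal:
  fixes g :: "real \<Rightarrow> complex" and c :: "real \<Rightarrow> real"
  assumes P: "prob_space P" and sP: "sets P = sets borel"
    and [measurable]: "g \<in> borel_measurable borel" "c \<in> borel_measurable borel" and g: "\<And>y. norm (g y) \<le> 1"
  shows "(LINT p|(P \<Otimes>\<^sub>M std_normal_distribution). g (fst p) * exp (\<i> * of_real (u * (sqrt (max 0 (c (fst p))) * snd p))))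
    = (LINT y|P. g y * of_real (exp (- (u\<^sup>2 * max 0 (c y) / 2))))"
proof -
  interpret P: prob_space P by (rule P)
  interpret S: prob_space std_normal_distribution by (rule prob_space_normal_density) simp
  interpret PS: pair_prob_space P std_normal_distribution ..
  note [measurable_cong] = sP
  define f where "f = (\<lambda>p. g (fst p) * exp (\<i> * of_real (u * (sqrt (max 0 (c (fst p))) * snd p))))"
  have e: "(\<lambda>x::real. exp (\<i> * complex_of_real x)) \<in> borel_measurable borel"
    by (intro borel_measurable_continuous_onI continuous_intros)
  have "(\<lambda>p. u * (sqrt (max 0 (c (fst p))) * snd p)) \<in> borel_measurable (P \<Otimes>\<^sub>M std_normal_distribution)" by measurable
  from measurable_compose[OF this e]
  have fm: "f \<in> borel_measurable (P \<Otimes>\<^sub>M std_normal_distribution)" unfolding f_def by measurable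
  have fi: "integrable (P \<Otimes>\<^sub>M std_normal_distribution) f"
    by (rule PS.P.integrable_const_bound[where B = 1]) (use g fm in \<open>auto simp: f_def norm_mult\<close>)
  have "(LINT p|(P \<Otimes>\<^sub>M std_normal_distribution). f p) = (LINT y|P. (LINT z|std_normal_distribution. f (y, z)))"
    by (rule PS.integral_fst'[OF fi, symmetric])
  also have "\<dots> = (LINT y|P. g y * of_real (exp (- (u\<^sup>2 * max 0 (c y) / 2))))"
  proof (rule Bochner_Integration.integral_cong[OF refl])
    fix y
    have "(LINT z|std_normal_distribution. f (y, z)) = g y * char std_normal_distribution (u * sqrt (max 0 (c y)))"
      unfolding f_def char_def by (simp add: mult.assoc)
    also have "char std_normal_distribution (u * sqrt (max 0 (c y))) = of_real (exp (- (u\<^sup>2 * max 0 (c y) / 2)))"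
      unfolding char_std_normal_distribution by (simp add: power_mult_distrib)
    finally show "(LINT z|std_normal_distribution. f (y, z)) = g y * of_real (exp (- (u\<^sup>2 * max 0 (c y) / 2)))" .
  qed
  finally show ?thesis by (simp add: f_def)
qed

section \<open>The law of one step\<close>

lemma (in prob_space) integral_AE_const:
  fixes f :: "'a \<Rightarrow> 'b::{banach, second_countable_topology}"
  assumes "f \<in> borel_measurable M" "AE \<omega> in M. f \<omega> = c"
  shows "(LINT \<omega>|M. f \<omega>) = c"
proof -
  have "(LINT \<omega>|M. f \<omega>) = (LINT \<omega>|M. c)" by (rule integral_cong_AE) (use assms in auto)
  then show ?thesis by (simp add: prob_space)
qed

context feller_diffusion
begin

text \<open>For a constant initial value the right-hand side of \<open>laplace\<close> factorises.
  Both later facts come from this formula: the independence of \<open>V h\<close> from time 0, and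
  the dependence of its law on \<open>\<sigma>\<close>, \<open>h\<close> and \<open>v0\<close>
  only.\<close>

lemma laplace_start:
  assumes v0: "AE \<omega> in M. V 0 \<omega> = v0" and S: "S \<in> sets (F 0)" and \<mu>: "\<mu> > 0"
  shows "expectation (\<lambda>\<omega>. indicator S \<omega> * exp (- \<mu> * V h \<omega>)) = prob S * exp (- riccati \<sigma> \<mu> h 0 * v0)"
proof -
  have SM: "S \<in> events" using S subalg by (auto simp: subalgebra_def)
  have V0m: "V 0 \<in> borel_measurable M" using h by (intro V_measurable) simp
  have "expectation (\<lambda>\<omega>. indicator S \<omega> * exp (- \<mu> * V h \<omega>)) = expectation (\<lambda>\<omega>. indicator S \<omega> * exp (- riccati \<sigma> \<mu> h 0 * V 0 \<omega>))"
    by (rule laplace[OF \<mu>]) (use S in \<open>auto simp: indicator_def\<close>)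
  also have "\<dots> = expectation (\<lambda>\<omega>. indicator S \<omega> * exp (- riccati \<sigma> \<mu> h 0 * v0))"
  proof (rule integral_cong_AE)
    show "(\<lambda>\<omega>. indicator S \<omega> * exp (- riccati \<sigma> \<mu> h 0 * V 0 \<omega>)) \<in> borel_measurable M"
      using SM V0m by measurable
    show "(\<lambda>\<omega>. indicator S \<omega> * exp (- riccati \<sigma> \<mu> h 0 * v0)) \<in> borel_measurable M"
      using SM by measurable
    show "AE \<omega> in M. indicator S \<omega> * exp (- riccati \<sigma> \<mu> h 0 * V 0 \<omega>) = indicator S \<omega> * exp (- riccati \<sigma> \<mu> h 0 * v0)"
      using v0 by eventually_elim simp
  qed
  also have "\<dots> = expectation (indicator S) * exp (- riccati \<sigma> \<mu> h 0 * v0)"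
    by (rule integral_mult_left_zero)
  also have "expectation (indicator S) = prob S"
    using sets.sets_into_space[OF SM] by (simp add: Int_absorb2)
  finally show ?thesis .
qed

text \<open>By \<open>laplace_start\<close>, conditioning on an event of \<open>F 0\<close> with
  positive probability leaves the Laplace transform of \<open>V h\<close> unchanged, hence also its
  law. Null events are trivial.\<close>

lemma indep_terminal_value:
  assumes v0: "AE \<omega> in M. V 0 \<omega> = v0" and X: "X \<in> borel_measurable (F 0)"
  shows "indep_var borel X borel (V h)"
proof -
  note XM[measurable] = F_imp_M[OF X]
  have Vm[measurable]: "V h \<in> borel_measurable M" using h by (intro V_measurable) simp
  interpret P: prob_space "distr M borel X" by (rule prob_space_distr) measurable
  interpret Q: prob_space "distr M borel (V h)" by (rule prob_space_distr) measurable
  have "distr M borel X \<Otimes>\<^sub>M distr M borel (V h) = distr M (borel \<Otimes>\<^sub>M borel) (\<lambda>\<omega>. (X \<omega>, V h \<omega>))"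
  proof (rule pair_measure_eqI)
    show "sigma_finite_measure (distr M borel X)" "sigma_finite_measure (distr M borel (V h))" by unfold_locales
    show "sets (distr M borel X \<Otimes>\<^sub>M distr M borel (V h)) = sets (distr M (borel \<Otimes>\<^sub>M borel) (\<lambda>\<omega>. (X \<omega>, V h \<omega>)))"
      by (simp cong: sets_pair_measure_cong)
    fix A B assume "A \<in> sets (distr M borel X)" "B \<in> sets (distr M borel (V h))"
    then have A[measurable]: "A \<in> sets borel" and B[measurable]: "B \<in> sets borel" by simp_all
    let ?S = "X -` A \<inter> space M"
    have SF: "?S \<in> sets (F 0)" using measurable_sets[OF X A] by simp
    have S: "?S \<in> events" by measurable
    have "prob (?S \<inter> (V h -` B \<inter> space M)) = prob ?S * prob (V h -` B \<inter> space M)"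
    proof (cases "prob ?S = 0")
      case True
      have "prob (?S \<inter> (V h -` B \<inter> space M)) \<le> prob ?S" by (rule finite_measure_mono) (use S in auto)
      then show ?thesis using True by (simp add: measure_le_0_iff)
    next
      case False
      then have pS: "prob ?S > 0" by (simp add: zero_less_measure_iff)
      have "distr (conditioned ?S) borel (V h) = distr M borel (V h)"
      proof (rule laplace_determines_distr)
        show "prob_space (conditioned ?S)" by (rule prob_space_conditioned[OF S pS])
        show "prob_space M" by unfold_locales
        show "V h \<in> borel_measurable (conditioned ?S)" "V h \<in> borel_measurable M" by simp_all
        have nn: "0 \<le> V h \<omega>" if "\<omega> \<in> space M" for \<omega> using nonneg[OF that] h by simp
        show "AE \<omega> in conditioned ?S. 0 \<le> V h \<omega>" by (rule AE_I2) (simp add: nn)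
        show "AE \<omega> in M. 0 \<le> V h \<omega>" by (rule AE_I2) (rule nn)
        fix \<mu> :: real assume \<mu>: "\<mu> > 0"
        have top: "space M \<in> sets (F 0)" using sets.top[of "F 0"] by simp
        have "(LINT \<omega>|conditioned ?S. exp (- \<mu> * V h \<omega>)) = (1 / prob ?S) *\<^sub>R (LINT \<omega>|M. indicator ?S \<omega> *\<^sub>R exp (- \<mu> * V h \<omega>))"
          by (rule integral_conditioned[OF S]) measurable
        also have "\<dots> = exp (- riccati \<sigma> \<mu> h 0 * v0)"
          using laplace_start[OF v0 SF \<mu>] pS by simp
        also have "\<dots> = (LINT \<omega>|M. indicator (space M) \<omega> * exp (- \<mu> * V h \<omega>))"
          using laplace_start[OF v0 top \<mu>] by (simp add: prob_space)
        also have "\<dots> = (LINT \<omega>|M. exp (- \<mu> * V h \<omega>))"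
          by (intro Bochner_Integration.integral_cong) auto
        finally show "(LINT \<omega>|conditioned ?S. exp (- \<mu> * V h \<omega>)) = (LINT \<omega>|M. exp (- \<mu> * V h \<omega>))" .
      qed
      then have "prob (?S \<inter> (V h -` B \<inter> space M)) / prob ?S = measure (distr M borel (V h)) B"
        using measure_distr_conditioned[OF S Vm B pS] by simp
      also have "\<dots> = prob (V h -` B \<inter> space M)" by (rule measure_distr[OF Vm B])
      finally show ?thesis using pS by (simp add: field_simps)
    qed
    moreover have "?S \<inter> (V h -` B \<inter> space M) = (\<lambda>\<omega>. (X \<omega>, V h \<omega>)) -` (A \<times> B) \<inter> space M" by auto
    ultimately show "emeasure (distr M borel X) A * emeasure (distr M borel (V h)) B
        = emeasure (distr M (borel \<Otimes>\<^sub>M borel) (\<lambda>\<omega>. (X \<omega>, V h \<omega>))) (A \<times> B)"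
      by (simp add: emeasure_distr emeasure_eq_measure ennreal_mult')
  qed
  then show ?thesis unfolding indep_var_distribution_eq using XM Vm by simp
qed

end

text \<open>The transform does not depend on the space or on the solution that realises the law.
  This is the uniqueness in law needed to compare variables on \<open>M\<close> and on
  \<open>N\<close>.\<close>

lemma is_CIR_law:
  assumes cir: "is_CIR M 0 0 \<sigma> h v0 Y" and h: "h > 0" and \<sigma>: "\<sigma> > 0"
  shows "prob_space M" "Y \<in> borel_measurable M" "AE \<omega> in M. 0 \<le> Y \<omega>"
    and "\<And>\<mu>. \<mu> > 0 \<Longrightarrow> (LINT \<omega>|M. exp (- \<mu> * Y \<omega>)) = exp (- riccati \<sigma> \<mu> h 0 * v0)"
proof -
  obtain F and W :: "real \<Rightarrow> 'a \<Rightarrow> real" and V where sol: "sde_solution M F W {0..} (\<lambda>y. 0 - 0 * y) (\<lambda>y w. \<sigma> * sqrt y * w) h V"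
    and v0: "AE \<omega> in M. V 0 \<omega> = v0" and d: "distr M borel Y = distr M borel (V h)" and Ym: "Y \<in> borel_measurable M"
    using cir unfolding is_CIR_def by blast
  interpret feller_diffusion M F W \<sigma> h V by (rule feller_diffusion_of_sde[OF sol h \<sigma>])
  have Vm: "V h \<in> borel_measurable M" using h by (intro V_measurable) simp
  show "prob_space M" by unfold_locales
  show "Y \<in> borel_measurable M" by (rule Ym)
  have nn: "0 \<le> V h \<omega>" if "\<omega> \<in> space M" for \<omega> using nonneg[OF that] h by simp
  have "AE y in distr M borel (V h). 0 \<le> y" using nn by (subst AE_distr_iff[OF Vm]) auto
  then have "AE y in distr M borel Y. 0 \<le> y" unfolding d .
  then show "AE \<omega> in M. 0 \<le> Y \<omega>" by (subst (asm) AE_distr_iff[OF Ym]) auto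
  fix \<mu> :: real assume \<mu>: "\<mu> > 0"
  have top: "space M \<in> sets (F 0)" using sets.top[of "F 0"] by simp
  have em: "(\<lambda>y. exp (- \<mu> * y)) \<in> borel_measurable borel" by measurable
  have "(LINT \<omega>|M. exp (- \<mu> * Y \<omega>)) = (LINT y|distr M borel Y. exp (- \<mu> * y))" by (rule integral_distr[OF Ym em, symmetric])
  also have "\<dots> = (LINT \<omega>|M. exp (- \<mu> * V h \<omega>))" unfolding d by (rule integral_distr[OF Vm em])
  also have "\<dots> = (LINT \<omega>|M. indicator (space M) \<omega> * exp (- \<mu> * V h \<omega>))"
    by (intro Bochner_Integration.integral_cong) auto
  also have "\<dots> = exp (- riccati \<sigma> \<mu> h 0 * v0)" using laplace_start[OF v0 top \<mu>] by (simp add: prob_space)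
  finally show "(LINT \<omega>|M. exp (- \<mu> * Y \<omega>)) = exp (- riccati \<sigma> \<mu> h 0 * v0)" .
qed

text \<open>The first conjunct shows that the CIR law in question is realised, the variable at the
  end of the second stage being a witness. As only a law is claimed, the normal term of random
  variance appears as a probability kernel composed with the law of that variable.\<close>

theorem proposition1:
  fixes M :: "'a measure" and N :: "'b measure"
    and k \<theta> \<sigma> r \<rho> h x v :: real and Xs Vs :: "'a \<Rightarrow> real"
  assumes "k > 0" and "\<theta> > 0" and "\<sigma> > 0" and "\<rho> \<in> {-1..1}" and "h > 0" and "v \<ge> 0"
    and "strang_step M heston_domain (system1_drift r k \<theta>) (system1_diffusion \<rho>)
           system2_drift (system2_diffusion \<rho> \<sigma>) h (x, v) (\<lambda>\<omega>. (Xs \<omega>, Vs \<omega>))"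
  defines "Vt \<equiv> exp (- k * h / 2) * (v - \<theta>) + \<theta>"
    and "I \<equiv> \<lambda>y. \<theta> * h + (v + y - 2 * \<theta>) / k * (1 - exp (- k * h / 2))"
  shows "(\<exists>Vhat. is_CIR M 0 0 \<sigma> h Vt Vhat) \<and>
    (\<forall>Vhat. is_CIR N 0 0 \<sigma> h Vt Vhat \<longrightarrow>
      distr M borel (\<lambda>\<omega>. (Xs \<omega>, Vs \<omega>)) =
        distr N borel Vhat \<bind> (\<lambda>y.
          centred_normal ((1 - \<rho>\<^sup>2) * I y) \<bind> (\<lambda>z.
            return borel
              (x + r * h - 1 / 2 * I y + \<rho> / \<sigma> * (y - Vt) + z,
               exp (- k * h / 2) * (y - \<theta>) + \<theta>))))"
proof -
  note k = \<open>k > 0\<close> and \<theta> = \<open>\<theta> > 0\<close> and \<sigma> = \<open>\<sigma> > 0\<close> and \<rho> = \<open>\<rho> \<in> {-1..1}\<close> and h = \<open>h > 0\<close> and v = \<open>v \<ge> 0\<close>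
  obtain F1 B1 S1 F2 B2 S2 F3 B3 S3 where
    sol1: "sde_solution M F1 B1 heston_domain (system1_drift r k \<theta>) (system1_diffusion \<rho>) (h/2) S1"
    and i1: "AE \<omega> in M. S1 0 \<omega> = (x, v)" and F12: "sets (F1 (h/2)) \<subseteq> sets (F2 0)"
    and sol2: "sde_solution M F2 B2 heston_domain system2_drift (system2_diffusion \<rho> \<sigma>) h S2"
    and i2: "AE \<omega> in M. S2 0 \<omega> = S1 (h/2) \<omega>" and F23: "sets (F2 h) \<subseteq> sets (F3 0)"
    and sol3: "sde_solution M F3 B3 heston_domain (system1_drift r k \<theta>) (system1_diffusion \<rho>) (h/2) S3"
    and i3: "AE \<omega> in M. S3 0 \<omega> = S2 h \<omega>" and Y: "\<forall>\<omega>\<in>space M. (Xs \<omega>, Vs \<omega>) = S3 (h/2) \<omega>"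
    using assms(7) unfolding strang_step_def by (elim exE conjE)
  have h2: "h / 2 > 0" using h by simp
  have hin: "h / 2 \<in> {0..h / 2}" "0 \<in> {0..h / 2}" "h \<in> {0..h}" "0 \<in> {0..h}" using h by simp_all
  note D1 = sde_solution_pairD[OF sol1] and D2 = sde_solution_pairD[OF sol2] and D3 = sde_solution_pairD[OF sol3]
  interpret E1: brownian M F1 "\<lambda>t \<omega>. fst (B1 t \<omega>)" by (rule D1(1))
  interpret E2: brownian M F2 "\<lambda>t \<omega>. fst (B2 t \<omega>)" by (rule D2(1))
  interpret E3: brownian M F3 "\<lambda>t \<omega>. fst (B3 t \<omega>)" by (rule D3(1))
  define X1 where "X1 \<omega> = fst (S1 (h/2) \<omega>)" for \<omega>
  define V2 where "V2 \<omega> = snd (S2 h \<omega>)" for \<omega>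
  define b where "b = exp (- k * (h / 2))"
  have b': "exp (- k * h / 2) = b" by (simp add: b_def)
  define I1 where "I1 y = \<theta> * (h / 2) + (y - \<theta>) * (1 - b) / k" for y
  \<comment> \<open>Only the two half steps of the first system accumulate integrated variance: one
    starts from \<open>v\<close>, the other from the terminal value \<open>y\<close> of the second
    stage.\<close>
  have I_eq: "I y = I1 v + I1 y" for y
    using k unfolding I_def I1_def b' by (simp add: field_simps)
  define \<phi> where "\<phi> y = b * (y - \<theta>) + \<theta>" for y
  define m where "m y = x + r * h - 1 / 2 * I y + \<rho> / \<sigma> * (y - Vt)" for y
  define c where "c y = (1 - \<rho>\<^sup>2) * I y" for y
  have \<rho>2: "0 \<le> 1 - \<rho>\<^sup>2" using \<rho> by (simp add: abs_square_le_1 abs_le_iff)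
  \<comment> \<open>The explicit formula does not show its sign; it follows from
    \<open>1 - exp (- t) \<le> t\<close>. Nonnegativity makes the Gaussian factors bounded by 1 and
    later removes the maximum with 0 in the variance.\<close>
  have I1_nonneg: "0 \<le> I1 y" if "0 \<le> y" for y
  proof -
    have "1 + - k * (h / 2) \<le> b" unfolding b_def by (rule exp_ge_add_one_self)
    then have "1 - b \<le> k * (h / 2)" by simp
    then have "(1 - b) / k \<le> h / 2" using k by (simp add: pos_divide_le_eq mult.commute)
    then have "0 \<le> \<theta> * (h / 2 - (1 - b) / k)" using \<theta> by simp
    moreover have "0 \<le> 1 - b" unfolding b_def using k h by simp
    then have "0 \<le> y * ((1 - b) / k)" using that k by simp
    moreover have "I1 y = \<theta> * (h / 2 - (1 - b) / k) + y * ((1 - b) / k)"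
      using k by (simp add: I1_def field_simps)
    ultimately show ?thesis by linarith
  qed
  have [measurable]: "I1 \<in> borel_measurable borel" "I \<in> borel_measurable borel" "\<phi> \<in> borel_measurable borel"
    "m \<in> borel_measurable borel" "c \<in> borel_measurable borel"
    unfolding I1_def[abs_def] I_def \<phi>_def[abs_def] m_def[abs_def] c_def[abs_def] by measurable
  have X1F: "X1 \<in> borel_measurable (F1 (h/2))" unfolding X1_def[abs_def] by (rule D1(3)[OF hin(1)])
  have X1F2: "X1 \<in> borel_measurable (F2 0)"
    by (rule measurable_from_subalg[OF _ X1F]) (use F12 in \<open>simp add: subalgebra_def\<close>)
  have V2F: "V2 \<in> borel_measurable (F2 h)" unfolding V2_def[abs_def] by (rule D2(4)[OF hin(3)])
  have V2F3: "V2 \<in> borel_measurable (F3 0)"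
    by (rule measurable_from_subalg[OF _ V2F]) (use F23 in \<open>simp add: subalgebra_def\<close>)
  note [measurable] = E1.F_imp_M[OF X1F] E2.F_imp_M[OF V2F]
  have V2_nonneg: "0 \<le> V2 \<omega>" if "\<omega> \<in> space M" for \<omega>
    using D2(7)[OF that hin(3)] by (auto simp: V2_def heston_domain_def)

  \<comment> \<open>The deterministic first stage makes the second one start from a constant, the
    hypothesis of \<open>indep_terminal_value\<close> and of \<open>is_CIR\<close>.\<close>
  have V1: "AE \<omega> in M. snd (S2 0 \<omega>) = Vt"
    using system1_solution(1)[OF sol1 h2 k \<rho>] i1 i2
    by eventually_elim (simp add: Vt_def)
  note feller_sol = system2_solution(1)[OF sol2 h \<sigma>]
  interpret feller_diffusion M F2 "\<lambda>t \<omega>. fst (B2 t \<omega>)" \<sigma> h "\<lambda>t \<omega>. snd (S2 t \<omega>)"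
    by (rule feller_diffusion_of_sde[OF feller_sol h \<sigma>])
  have cirM: "is_CIR M 0 0 \<sigma> h Vt V2"
    unfolding is_CIR_def
  proof (intro conjI exI)
    show "V2 \<in> borel_measurable M" by measurable
    show "sde_solution M F2 (\<lambda>t \<omega>. fst (B2 t \<omega>)) {0..} (\<lambda>y. 0 - 0 * y) (\<lambda>y w. \<sigma> * sqrt y * w) h (\<lambda>t \<omega>. snd (S2 t \<omega>))"
      by (rule feller_sol)
    show "AE \<omega> in M. snd (S2 0 \<omega>) = Vt" by (rule V1)
    show "distr M borel V2 = distr M borel (\<lambda>\<omega>. snd (S2 h \<omega>))" by (simp add: V2_def[abs_def])
  qed
  have indep: "E1.indep_var borel X1 borel V2"
    using indep_terminal_value[OF V1 X1F2] by (simp add: V2_def[abs_def])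
  have X2: "AE \<omega> in M. fst (S2 h \<omega>) = X1 \<omega> + \<rho> / \<sigma> * (V2 \<omega> - Vt)"
    using system2_solution(2)[OF sol2 h \<sigma>] V1 i2
    by eventually_elim (simp add: X1_def V2_def)
  have Vs: "AE \<omega> in M. Vs \<omega> = \<phi> (V2 \<omega>)"
    using system1_solution(1)[OF sol3 h2 k \<rho>] i3 AE_space
  proof eventually_elim
    case (elim \<omega>)
    have "Vs \<omega> = snd (S3 (h/2) \<omega>)" using Y elim(3) by (metis snd_conv)
    then show ?case using elim by (simp add: \<phi>_def b_def V2_def)
  qed
  have Xs: "Xs \<omega> = fst (S3 (h/2) \<omega>)" "Vs \<omega> = snd (S3 (h/2) \<omega>)" if "\<omega> \<in> space M" for \<omega>
    using Y that by (metis fst_conv, metis snd_conv)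
  have XsM[measurable]: "Xs \<in> borel_measurable M" and VsM[measurable]: "Vs \<in> borel_measurable M"
    using E3.F_imp_M[OF D3(3)[OF hin(1)]] E3.F_imp_M[OF D3(4)[OF hin(1)]]
    by (simp_all add: Xs cong: measurable_cong)
  have [measurable]: "(\<lambda>\<omega>. fst (S1 0 \<omega>)) \<in> borel_measurable M" "(\<lambda>\<omega>. snd (S1 0 \<omega>)) \<in> borel_measurable M"
    "(\<lambda>\<omega>. fst (S3 0 \<omega>)) \<in> borel_measurable M" "(\<lambda>\<omega>. snd (S3 0 \<omega>)) \<in> borel_measurable M"
    "(\<lambda>\<omega>. fst (S3 (h/2) \<omega>)) \<in> borel_measurable M"
    using E1.F_imp_M[OF D1(3)[OF hin(2)]] E1.F_imp_M[OF D1(4)[OF hin(2)]]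
      E3.F_imp_M[OF D3(3)[OF hin(2)]] E3.F_imp_M[OF D3(4)[OF hin(2)]] E3.F_imp_M[OF D3(3)[OF hin(1)]] by simp_all

  \<comment> \<open>With trivial test variable and constant start, the first half step gives an
    unconditional normal law.\<close>
  have char_X1: "(LINT \<omega>|M. exp (\<i> * of_real (u * X1 \<omega>)))
      = exp (\<i> * of_real (u * (x + r * (h / 2) - I1 v / 2))) * of_real (exp (- (u\<^sup>2 * ((1 - \<rho>\<^sup>2) * I1 v) / 2)))" for u
  proof -
    have "(LINT \<omega>|M. 1 * exp (\<i> * of_real (u * fst (S1 (h/2) \<omega>)))) =
      (LINT \<omega>|M. 1 * exp (\<i> * of_real (u * (fst (S1 0 \<omega>) + r * (h/2) - I1 (snd (S1 0 \<omega>)) / 2)))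
         * of_real (exp (- (u\<^sup>2 * ((1 - \<rho>\<^sup>2) * I1 (snd (S1 0 \<omega>))) / 2))))"
      using system1_solution(2)[OF sol1 h2 k \<rho>, of "\<lambda>_. 1" u] by (simp only: I1_def b_def) simp
    also have "\<dots> = exp (\<i> * of_real (u * (x + r * (h / 2) - I1 v / 2))) * of_real (exp (- (u\<^sup>2 * ((1 - \<rho>\<^sup>2) * I1 v) / 2)))"
    proof (rule E1.integral_AE_const)
      show "(\<lambda>\<omega>. 1 * exp (\<i> * of_real (u * (fst (S1 0 \<omega>) + r * (h/2) - I1 (snd (S1 0 \<omega>)) / 2)))
         * of_real (exp (- (u\<^sup>2 * ((1 - \<rho>\<^sup>2) * I1 (snd (S1 0 \<omega>))) / 2)))) \<in> borel_measurable M"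
        by measurable
      show "AE \<omega> in M. 1 * exp (\<i> * of_real (u * (fst (S1 0 \<omega>) + r * (h/2) - I1 (snd (S1 0 \<omega>)) / 2)))
         * of_real (exp (- (u\<^sup>2 * ((1 - \<rho>\<^sup>2) * I1 (snd (S1 0 \<omega>))) / 2)))
         = exp (\<i> * of_real (u * (x + r * (h / 2) - I1 v / 2))) * of_real (exp (- (u\<^sup>2 * ((1 - \<rho>\<^sup>2) * I1 v) / 2)))"
        using i1 by eventually_elim simp
    qed
    finally show ?thesis by (simp add: X1_def)
  qed

  have char_split: "(LINT \<omega>|M. indicator A (Vs \<omega>) *\<^sub>R exp (\<i> * of_real (u * Xs \<omega>)))
    = (LINT \<omega>|M. indicator A (\<phi> (V2 \<omega>)) * exp (\<i> * of_real (u * m (V2 \<omega>))) * of_real (exp (- (u\<^sup>2 * c (V2 \<omega>) / 2))))"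
    if A[measurable]: "A \<in> sets borel" for A u
  proof -
    \<comment> \<open>The final variance is a function of \<open>V2\<close>, so its indicator is
      known when the third stage starts and may serve as test variable for it.\<close>
    define G where "G \<omega> = (indicator A (\<phi> (V2 \<omega>)) :: complex)" for \<omega>
    have GF: "G \<in> borel_measurable (F3 0)"
    proof -
      have "(\<lambda>y. indicator A (\<phi> y) :: complex) \<in> borel_measurable borel" by measurable
      from measurable_compose[OF V2F3 this] show ?thesis by (simp add: G_def[abs_def])
    qed
    note [measurable] = E3.F_imp_M[OF GF]
    define w where "w = (\<lambda>y. \<rho> / \<sigma> * (y - Vt) + r * (h / 2) - I1 y / 2)"
    define g where "g = (\<lambda>y. indicator A (\<phi> y) * exp (\<i> * of_real (u * w y)) * of_real (exp (- (u\<^sup>2 * ((1 - \<rho>\<^sup>2) * I1 y) / 2))))"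
    have wm[measurable]: "w \<in> borel_measurable borel" unfolding w_def by measurable
    have gm[measurable]: "g \<in> borel_measurable borel" unfolding g_def by measurable
    have em[measurable]: "(\<lambda>y. exp (\<i> * complex_of_real (u * y))) \<in> borel_measurable borel" by measurable
    have "(LINT \<omega>|M. indicator A (Vs \<omega>) *\<^sub>R exp (\<i> * of_real (u * Xs \<omega>))) = (LINT \<omega>|M. G \<omega> * exp (\<i> * of_real (u * fst (S3 (h/2) \<omega>))))"
    proof (rule integral_cong_AE)
      show "AE \<omega> in M. indicator A (Vs \<omega>) *\<^sub>R exp (\<i> * of_real (u * Xs \<omega>)) = G \<omega> * exp (\<i> * of_real (u * fst (S3 (h/2) \<omega>)))"
        using Vs AE_space by eventually_elim (simp add: Xs(1) G_def indicator_def)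
    qed measurable
    also have "\<dots> = (LINT \<omega>|M. G \<omega> * exp (\<i> * of_real (u * (fst (S3 0 \<omega>) + r * (h/2) - I1 (snd (S3 0 \<omega>)) / 2)))
         * of_real (exp (- (u\<^sup>2 * ((1 - \<rho>\<^sup>2) * I1 (snd (S3 0 \<omega>))) / 2))))"
      unfolding I1_def b_def by (rule system1_solution(2)[OF sol3 h2 k \<rho> GF]) (simp add: G_def indicator_def)
    also have "\<dots> = (LINT \<omega>|M. exp (\<i> * of_real (u * X1 \<omega>)) * g (V2 \<omega>))"
    proof (rule integral_cong_AE)
      show "AE \<omega> in M. G \<omega> * exp (\<i> * of_real (u * (fst (S3 0 \<omega>) + r * (h/2) - I1 (snd (S3 0 \<omega>)) / 2)))
         * of_real (exp (- (u\<^sup>2 * ((1 - \<rho>\<^sup>2) * I1 (snd (S3 0 \<omega>))) / 2))) = exp (\<i> * of_real (u * X1 \<omega>)) * g (V2 \<omega>)"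
        using i3 X2
      proof eventually_elim
        case (elim \<omega>)
        have s: "snd (S3 0 \<omega>) = V2 \<omega>" using elim by (simp add: V2_def)
        have "fst (S3 0 \<omega>) + r * (h/2) - I1 (V2 \<omega>) / 2 = X1 \<omega> + w (V2 \<omega>)"
          using elim by (simp add: w_def)
        then have e: "exp (\<i> * of_real (u * (fst (S3 0 \<omega>) + r * (h/2) - I1 (V2 \<omega>) / 2)))
            = exp (\<i> * of_real (u * X1 \<omega>)) * exp (\<i> * of_real (u * w (V2 \<omega>)))"
          by (simp only: distrib_left of_real_add exp_add)
        show ?case unfolding s e g_def G_def by (simp only: mult_ac)
      qed
    qed measurable
    \<comment> \<open>After the third stage has been integrated out, the remaining integrand is a
      function of \<open>X1\<close> times a function of \<open>V2\<close>; independence splits the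
      expectation.\<close>
    also have "\<dots> = (LINT \<omega>|M. exp (\<i> * of_real (u * X1 \<omega>))) * (LINT \<omega>|M. g (V2 \<omega>))"
    proof (rule E1.indep_var_lebesgue_integral)
      have "E1.indep_var borel ((\<lambda>y. exp (\<i> * complex_of_real (u * y))) \<circ> X1) borel (g \<circ> V2)"
        by (rule E1.indep_var_compose[OF indep em gm])
      then show "E1.indep_var borel (\<lambda>\<omega>. exp (\<i> * of_real (u * X1 \<omega>))) borel (\<lambda>\<omega>. g (V2 \<omega>))" by (simp add: comp_def)
      show "integrable M (\<lambda>\<omega>. exp (\<i> * of_real (u * X1 \<omega>)))"
        by (rule E1.integrable_const_bound[where B = 1]) auto
      show "integrable M (\<lambda>\<omega>. g (V2 \<omega>))"
      proof (rule E1.integrable_const_bound[where B = 1])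
        show "AE \<omega> in M. norm (g (V2 \<omega>)) \<le> 1"
        proof (rule AE_I2)
          fix \<omega> assume "\<omega> \<in> space M"
          then have "0 \<le> u\<^sup>2 * ((1 - \<rho>\<^sup>2) * I1 (V2 \<omega>)) / 2" using \<rho>2 I1_nonneg[OF V2_nonneg] by simp
          then show "norm (g (V2 \<omega>)) \<le> 1" by (simp add: g_def norm_mult indicator_def)
        qed
      qed measurable
    qed
    also have "\<dots> = (LINT \<omega>|M. (LINT \<omega>|M. exp (\<i> * of_real (u * X1 \<omega>))) * g (V2 \<omega>))"
      by (rule integral_mult_right_zero[symmetric])
    \<comment> \<open>The transform of the first half step is a constant; multiplying it back in
      adds up the two means and the two variances through \<open>I_eq\<close>.\<close>
    also have "\<dots> = (LINT \<omega>|M. indicator A (\<phi> (V2 \<omega>)) * exp (\<i> * of_real (u * m (V2 \<omega>))) * of_real (exp (- (u\<^sup>2 * c (V2 \<omega>) / 2))))"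
    proof (rule Bochner_Integration.integral_cong[OF refl])
      fix \<omega>
      let ?y = "V2 \<omega>"
      have "x + r * h - 1 / 2 * (a + b) + z = (x + r * (h / 2) - a / 2) + (z + r * (h / 2) - b / 2)" for a b z :: real
        by (simp add: field_simps)
      then have "m ?y = (x + r * (h / 2) - I1 v / 2) + w ?y" unfolding m_def w_def I_eq .
      then have e1: "exp (\<i> * of_real (u * m ?y)) = exp (\<i> * of_real (u * (x + r * (h / 2) - I1 v / 2))) * exp (\<i> * of_real (u * w ?y))"
        by (simp only: distrib_left of_real_add exp_add)
      have "- (u\<^sup>2 * c ?y / 2) = - (u\<^sup>2 * ((1 - \<rho>\<^sup>2) * I1 v) / 2) + - (u\<^sup>2 * ((1 - \<rho>\<^sup>2) * I1 ?y) / 2)"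
        by (simp only: c_def I_eq distrib_left add_divide_distrib minus_add_distrib)
      then have e2: "complex_of_real (exp (- (u\<^sup>2 * c ?y / 2)))
        = of_real (exp (- (u\<^sup>2 * ((1 - \<rho>\<^sup>2) * I1 v) / 2))) * of_real (exp (- (u\<^sup>2 * ((1 - \<rho>\<^sup>2) * I1 ?y) / 2)))"
        by (simp only: exp_add of_real_mult)
      show "(LINT \<omega>|M. exp (\<i> * of_real (u * X1 \<omega>))) * g ?y
        = indicator A (\<phi> ?y) * exp (\<i> * of_real (u * m ?y)) * of_real (exp (- (u\<^sup>2 * c ?y / 2)))"
        unfolding char_X1 e1 e2 g_def by (simp only: mult_ac)
    qed
    finally show ?thesis .
  qed

  have "distr M borel (\<lambda>\<omega>. (Xs \<omega>, Vs \<omega>)) =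
        distr N borel Vhat \<bind> (\<lambda>y.
          centred_normal (c y) \<bind> (\<lambda>z. return borel (m y + z, \<phi> y)))" if cirN: "is_CIR N 0 0 \<sigma> h Vt Vhat" for Vhat
  proof -
    note LM = is_CIR_law[OF cirM h \<sigma>] and LN = is_CIR_law[OF cirN h \<sigma>]
    define P where "P = distr M borel V2"
    \<comment> \<open>An arbitrary realisation of the CIR law on \<open>N\<close> is replaced here
      by \<open>V2\<close>, after which both sides refer to \<open>M\<close>.\<close>
    have PN: "distr N borel Vhat = P"
      unfolding P_def by (rule laplace_determines_distr[OF LN(1) LM(1) LN(2) LM(2) LN(3) LM(3)]) (simp only: LM(4) LN(4))
    interpret P: prob_space P unfolding P_def by (rule E1.prob_space_distr) measurable
    interpret S: prob_space std_normal_distribution by (rule prob_space_normal_density) simp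
    interpret PS: pair_prob_space P std_normal_distribution ..
    have sP: "sets P = sets borel" by (simp add: P_def)
    note [measurable_cong] = sP
    have P_nonneg: "AE y in P. 0 \<le> y"
      unfolding P_def using V2_nonneg by (subst AE_distr_iff) auto
    have "distr M borel (\<lambda>\<omega>. (Xs \<omega>, Vs \<omega>)) = distr (P \<Otimes>\<^sub>M std_normal_distribution) borel
       (\<lambda>p. (m (fst p) + sqrt (max 0 (c (fst p))) * snd p, \<phi> (fst p)))"
    proof (rule distr_pair_eqI)
      show "prob_space M" "prob_space (P \<Otimes>\<^sub>M std_normal_distribution)" by unfold_locales
      show "Xs \<in> borel_measurable M" "Vs \<in> borel_measurable M" by measurable
      show "(\<lambda>p. m (fst p) + sqrt (max 0 (c (fst p))) * snd p) \<in> borel_measurable (P \<Otimes>\<^sub>M std_normal_distribution)"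
        "(\<lambda>p. \<phi> (fst p)) \<in> borel_measurable (P \<Otimes>\<^sub>M std_normal_distribution)" by measurable
      fix A :: "real set" and u :: real assume A[measurable]: "A \<in> sets borel"
      define g where "g = (\<lambda>y. indicator A (\<phi> y) * exp (\<i> * complex_of_real (u * m y)))"
      have gm[measurable]: "g \<in> borel_measurable borel" unfolding g_def by measurable
      have g1: "norm (g y) \<le> 1" for y by (simp add: g_def norm_mult indicator_def)
      have "(LINT p|(P \<Otimes>\<^sub>M std_normal_distribution). indicator A (\<phi> (fst p)) *\<^sub>R exp (\<i> * of_real (u * (m (fst p) + sqrt (max 0 (c (fst p))) * snd p))))
        = (LINT p|(P \<Otimes>\<^sub>M std_normal_distribution). g (fst p) * exp (\<i> * of_real (u * (sqrt (max 0 (c (fst p))) * snd p))))"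
      proof (rule Bochner_Integration.integral_cong[OF refl])
        fix p :: "real \<times> real"
        have "exp (\<i> * of_real (u * (m (fst p) + sqrt (max 0 (c (fst p))) * snd p)))
          = exp (\<i> * complex_of_real (u * m (fst p))) * exp (\<i> * of_real (u * (sqrt (max 0 (c (fst p))) * snd p)))"
          by (simp only: distrib_left of_real_add exp_add)
        then show "indicator A (\<phi> (fst p)) *\<^sub>R exp (\<i> * of_real (u * (m (fst p) + sqrt (max 0 (c (fst p))) * snd p)))
          = g (fst p) * exp (\<i> * of_real (u * (sqrt (max 0 (c (fst p))) * snd p)))"
          by (simp add: g_def indicator_def)
      qed
      also have "\<dots> = (LINT y|P. g y * of_real (exp (- (u\<^sup>2 * max 0 (c y) / 2))))"
        by (rule char_mixture_normal[OF P.prob_space_axioms sP gm _ g1]) measurable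
      also have "\<dots> = (LINT y|P. g y * of_real (exp (- (u\<^sup>2 * c y / 2))))"
      proof (rule integral_cong_AE)
        show "AE y in P. g y * of_real (exp (- (u\<^sup>2 * max 0 (c y) / 2))) = g y * of_real (exp (- (u\<^sup>2 * c y / 2)))"
          using P_nonneg
        proof eventually_elim
          case (elim y)
          have "0 \<le> c y" unfolding c_def I_eq using \<rho>2 I1_nonneg[OF v] I1_nonneg[OF elim] by simp
          then show ?case by (simp add: max_absorb2)
        qed
      qed measurable
      also have "\<dots> = (LINT \<omega>|M. g (V2 \<omega>) * of_real (exp (- (u\<^sup>2 * c (V2 \<omega>) / 2))))"
        unfolding P_def by (rule integral_distr) measurable
      finally show "(LINT \<omega>|M. indicator A (Vs \<omega>) *\<^sub>R exp (\<i> * of_real (u * Xs \<omega>)))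
        = (LINT p|(P \<Otimes>\<^sub>M std_normal_distribution). indicator A (\<phi> (fst p)) *\<^sub>R exp (\<i> * of_real (u * (m (fst p) + sqrt (max 0 (c (fst p))) * snd p))))"
        unfolding char_split[OF A] g_def by simp
    qed
    also have "\<dots> = P \<bind> (\<lambda>y. centred_normal (c y) \<bind> (\<lambda>z. return borel (m y + z, \<phi> y)))"
      by (subst bind_centred_normal[OF P.prob_space_axioms sP]) (simp_all add: case_prod_beta')
    finally show ?thesis unfolding PN .
  qed
  then show ?thesis unfolding b' c_def m_def \<phi>_def using cirM by blast
qed

end
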